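(* Let $n\ge 1$ and $\mu=(\mu_1,\ldots,\mu_n)\in[-1/2,\infty)^n$. Let $P[x]=\sum_{|\alpha|\le N}a_\alpha x^\alpha$ be a polynomial in $n$ variables with real coefficients such that $\sum_{|\alpha|\le N}a_\alpha x^\alpha\neq 0$ for all $x\in\mathbb{R}^n\setminus\{0\}$ and all of whose coefficients have the same sign. Let $L$ be the operator on $\mathcal{H}'_\mu$ given by $L=\sum_{|\alpha|\le N}(-1)^{|\alpha|}a_\alpha S^\alpha$. If $f\in\mathcal{H}'_\mu$ and $Lf=0$, then there exists a polynomial $Q$ in $n$ variables such that $f(x)=x^{\mu+1/2}\,Q[x_1^2,\ldots,x_n^2]$ (equality in $\mathcal{H}'_\mu$).
   Context: Multi-indices are elements $k=(k_1,\ldots,k_n)\in\mathbb{N}_0^n$, with $|k|=k_1+\cdots+k_n$; $\|x\|=(x_1^2+\cdots+x_n^2)^{1/2}$; $x^{m}=x_1^{m_1}\cdots x_n^{m_n}$. For $\mu\in\mathbb{R}^n$, $\mu+1/2=(\mu_1+1/2,\ldots,\mu_n+1/2)$ and $-\mu-1/2=(-\mu_1-1/2,\ldots,-\mu_n-1/2)$. "All coefficients have the same sign" means that either $a_\alpha\ge 0$ for all $\alpha$ or $a_\alpha\le 0$ for all $\alpha$ (zero coefficients are allowed). Let $T_i=x_i^{-1}\frac{\partial}{\partial x_i}$ and $T^k=T_n^{k_n}\circ\cdots\circ T_1^{k_1}$. The space $\mathcal{H}_\mu$ consists of all (complex-valued) $\phi\in C^\infty((0,\infty)^n)$ such that for all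 $m\in\mathbb{N}_0$, $k\in\mathbb{N}_0^n$, $$\gamma^\mu_{m,k}(\phi)=\sup_{x\in(0,\infty)^n}\left|(1+\|x\|^2)^m\,T^k\{x^{-\mu-1/2}\phi(x)\}\right|<\infty,$$ and it is a Fréchet space with the topology generated by the seminorms $\gamma^\mu_{m,k}$. $\mathcal{H}'_\mu$ is its dual (continuous linear functionals), with pairing $(f,\phi)$. A function $g$ on $(0,\infty)^n$ such as $x^{\mu+1/2}Q[x_1^2,\ldots,x_n^2]$ is identified with the functional $\phi\mapsto\int_{(0,\infty)^n}g(x)\phi(x)\,dx$. For $i=1,\ldots,n$ let $S_{\mu_i}=\frac{\partial^2}{\partial x_i^2}-\frac{4\mu_i^2-1}{4x_i^2}$ and, for a multi-index $k$, $S^k=S_{\mu_1}^{k_1}\circ\cdots\circ S_{\mu_n}^{k_n}$. These operators map $\mathcal{H}_\mu$ continuously into itself, and are extended to $\mathcal{H}'_\mu$ by $(S_{\mu_i}f,\phi)=(f,S_{\mu_i}\phi)$ and $(S^kf,\phi)=(f,S^k\phi)$ for $f\in\mathcal{H}'_\mu$, $\phi\in\mathcal{H}_\mu$. *)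

theory Defs
  imports "HOL-Analysis.Analysis"
begin

text \<open>
  The coordinates \<open>x\<^sub>1, \<dots>, x\<^sub>n\<close> are indexed by a finite linearly ordered type \<open>'n\<close>, so
  \<open>n = CARD('n)\<close> is an arbitrary positive integer. The linear order is used only to fix the
  order of composition in the operators \<open>T\<^sup>k\<close> and \<open>S\<^sup>k\<close>.
  Functions on the open orthant are represented by functions on the whole space that vanish
  outside it, and functionals on \<open>Hmu \<mu>\<close> by functions that vanish outside \<open>Hmu \<mu>\<close>. In this
  way equality in HOL is equality of functions on the orthant, respectively of functionals.
\<close>

type_synonym 'n multi_index = "'n \<Rightarrow> nat"
type_synonym 'n cfun = "(real, 'n) vec \<Rightarrow> complex"
type_synonym 'n functional = "'n cfun \<Rightarrow> complex"

definition mi_abs :: "'n::finite multi_index \<Rightarrow> nat" where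
  "mi_abs k = (\<Sum>i\<in>UNIV. k i)"

definition mpoly_eval ::
  "nat \<Rightarrow> ('n::finite multi_index \<Rightarrow> 'a::comm_semiring_1) \<Rightarrow> 'a ^ 'n \<Rightarrow> 'a" where
  "mpoly_eval N a x = (\<Sum>\<alpha> | mi_abs \<alpha> \<le> N. a \<alpha> * (\<Prod>i\<in>UNIV. (x $ i) ^ \<alpha> i))"

definition orthant :: "(real ^ 'n) set" where
  "orthant = {x. \<forall>i. 0 < x $ i}"

definition vpowr ::
  "(real, 'n::finite) vec \<Rightarrow> (real, 'n) vec \<Rightarrow> real" where
  "vpowr x \<nu> = (\<Prod>i\<in>UNIV. (x $ i) powr (\<nu> $ i))"

definition partial :: "'n::finite \<Rightarrow> 'n cfun \<Rightarrow> 'n cfun" where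
  "partial i \<phi> x = vector_derivative (\<lambda>t. \<phi> (x + t *\<^sub>R axis i 1)) (at 0)"

primrec Ck_on :: "nat \<Rightarrow> (real, 'n::finite) vec set \<Rightarrow> 'n cfun \<Rightarrow> bool" where
  "Ck_on 0 U \<phi> \<longleftrightarrow> continuous_on U \<phi>"
| "Ck_on (Suc k) U \<phi> \<longleftrightarrow> continuous_on U \<phi> \<and>
     (\<forall>i. (\<forall>x\<in>U. (\<lambda>t. \<phi> (x + t *\<^sub>R axis i 1)) differentiable (at 0)) \<and>
          Ck_on k U (partial i \<phi>))"

definition Cinf_on ::
  "(real, 'n::finite) vec set \<Rightarrow> 'n cfun \<Rightarrow> bool" where
  "Cinf_on U \<phi> \<longleftrightarrow> (\<forall>k. Ck_on k U \<phi>)"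

definition T_op :: "'n::finite \<Rightarrow> 'n cfun \<Rightarrow> 'n cfun" where
  "T_op i \<phi> x = complex_of_real (inverse (x $ i)) * partial i \<phi> x"

text \<open>\<open>fold\<close> applies the operator of the smallest index first.\<close>

definition T_pow ::
  "'n::{finite,linorder} multi_index \<Rightarrow> 'n cfun \<Rightarrow> 'n cfun" where
  "T_pow k \<phi> = fold (\<lambda>i. T_op i ^^ k i) (sorted_list_of_set UNIV) \<phi>"

definition gamma_seminorm ::
  "(real, 'n::{finite,linorder}) vec \<Rightarrow> nat \<Rightarrow> 'n multi_index \<Rightarrow> 'n cfun \<Rightarrow> ennreal" where
  "gamma_seminorm \<mu> m k \<phi> =
     (SUP x\<in>orthant. ennreal (cmod (complex_of_real ((1 + (norm x)\<^sup>2) ^ m) *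
        T_pow k (\<lambda>y. complex_of_real (vpowr y (\<chi> i. - (\<mu> $ i) - 1/2)) * \<phi> y) x)))"

definition Hmu :: "(real, 'n::{finite,linorder}) vec \<Rightarrow> 'n cfun set" where
  "Hmu \<mu> = {\<phi>. Cinf_on orthant \<phi> \<and> (\<forall>x. x \<notin> orthant \<longrightarrow> \<phi> x = 0) \<and>
                (\<forall>m k. gamma_seminorm \<mu> m k \<phi> < \<infinity>)}"

definition Hmu_topology ::
  "(real, 'n::{finite,linorder}) vec \<Rightarrow> 'n cfun topology" where
  "Hmu_topology \<mu> = topology_generated_by
     {{\<psi> \<in> Hmu \<mu>. gamma_seminorm \<mu> m k (\<lambda>x. \<psi> x - \<phi> x) < ennreal \<epsilon>} | m k \<phi> \<epsilon>.
        \<phi> \<in> Hmu \<mu> \<and> 0 < \<epsilon>}"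

definition Hmu_dual ::
  "(real, 'n::{finite,linorder}) vec \<Rightarrow> 'n functional set" where
  "Hmu_dual \<mu> = {f.
     (\<forall>\<phi>\<in>Hmu \<mu>. \<forall>\<psi>\<in>Hmu \<mu>. f (\<lambda>x. \<phi> x + \<psi> x) = f \<phi> + f \<psi>) \<and>
     (\<forall>c. \<forall>\<phi>\<in>Hmu \<mu>. f (\<lambda>x. c * \<phi> x) = c * f \<phi>) \<and>
     continuous_map (Hmu_topology \<mu>) euclidean f \<and>
     (\<forall>\<phi>. \<phi> \<notin> Hmu \<mu> \<longrightarrow> f \<phi> = 0)}"

definition regular_functional ::
  "(real, 'n::{finite,linorder}) vec \<Rightarrow> 'n cfun \<Rightarrow> 'n functional" where
  "regular_functional \<mu> g \<phi> =
     (if \<phi> \<in> Hmu \<mu> then (LINT x:orthant|lborel. g x * \<phi> x) else 0)"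

definition S_op ::
  "(real, 'n::finite) vec \<Rightarrow> 'n \<Rightarrow> 'n cfun \<Rightarrow> 'n cfun" where
  "S_op \<mu> i \<phi> x = (if x \<in> orthant
     then partial i (partial i \<phi>) x
          - complex_of_real ((4 * (\<mu> $ i)\<^sup>2 - 1) / (4 * (x $ i)\<^sup>2)) * \<phi> x
     else 0)"

text \<open>\<open>foldr\<close> applies the operator of the largest index first.\<close>

definition S_pow ::
  "(real, 'n::{finite,linorder}) vec \<Rightarrow> 'n multi_index \<Rightarrow> 'n cfun \<Rightarrow> 'n cfun" where
  "S_pow \<mu> k \<phi> = foldr (\<lambda>i. S_op \<mu> i ^^ k i) (sorted_list_of_set UNIV) \<phi>"

definition S_pow_dual ::
  "(real, 'n::{finite,linorder}) vec \<Rightarrow> 'n multi_index \<Rightarrow> 'n functional \<Rightarrow> 'n functional" where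
  "S_pow_dual \<mu> k f \<phi> = (if \<phi> \<in> Hmu \<mu> then f (S_pow \<mu> k \<phi>) else 0)"

definition L_op ::
  "(real, 'n::{finite,linorder}) vec \<Rightarrow> nat \<Rightarrow> ('n multi_index \<Rightarrow> real) \<Rightarrow>
     'n functional \<Rightarrow> 'n functional" where
  "L_op \<mu> N a f \<phi> =
     (\<Sum>\<alpha> | mi_abs \<alpha> \<le> N. complex_of_real ((-1) ^ mi_abs \<alpha> * a \<alpha>) * S_pow_dual \<mu> \<alpha> f \<phi>)"

end

theory Submission imports Defs begin

text \<open>
  In the variables \<open>u\<^sub>i = x\<^sub>i\<^sup>2\<close> the operators \<open>T\<^sub>i\<close> are partial derivatives. For \<open>\<theta>\<close> in the span
  of the functions \<open>v\<^sup>k e\<^bsup>-t\<cdot>v\<^esup>\<close>, \<open>t\<^sub>i > 0\<close>, let \<open>synth \<mu> \<theta>\<close> be \<open>x\<^bsup>\<mu>+1/2\<^esup>\<close> times the Hankel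
  transform of \<open>\<theta>\<close>; it lies in \<open>Hmu \<mu>\<close>, and \<open>L\<close> acts on it as multiplication of \<open>\<theta>\<close> by
  \<open>p(v) = \<Sum> a\<^sub>\<alpha> 4\<^bsup>|\<alpha>|\<^esup> v\<^sup>\<alpha>\<close>. Nonvanishing of \<open>P\<close> on the coordinate axes and the sign condition give
  \<open>p \<ge> b v\<^sub>i\<^sup>d\<close> with \<open>b > 0\<close> on the orthant, for each \<open>i\<close>.

  Since \<open>L f = 0\<close>, the functional \<open>\<Lambda> \<theta> = f (synth \<mu> \<theta>)\<close> vanishes on multiples of \<open>p\<close>, so
  \<open>\<Lambda> \<theta> = \<Lambda> (\<theta> (1 - H)\<^sup>M)\<close> for all \<open>M\<close>, where \<open>H\<close> is \<open>p\<close> times a decaying exponential, scaled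
  into \<open>[0, 1]\<close>. If \<open>\<theta>\<close> vanishes to high order on \<open>v\<^sub>i = 0\<close>, the seminorms of
  \<open>synth \<mu> (\<theta> (1 - H)\<^sup>M)\<close> tend to \<open>0\<close>, whence \<open>\<Lambda> \<theta> = 0\<close>. Taylor expansion in each \<open>v\<^sub>i\<close> now shows that
  \<open>\<Lambda> (e\<^bsup>-t\<cdot>v\<^esup>)\<close> is a polynomial in \<open>t\<close>. The functionals \<open>\<phi> \<mapsto> \<integral> x\<^bsup>\<mu>+1/2\<^esup> x\<^bsup>2\<beta>\<^esup> \<phi>\<close> take at
  \<open>synth \<mu> e\<^bsup>-t\<cdot>v\<^esup>\<close>, which is a multiple of \<open>x\<^bsup>\<mu>+1/2\<^esup> exp (- \<Sum> x\<^sub>i\<^sup>2 / t\<^sub>i)\<close>, nonzero multiples of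
  \<open>t\<^sup>\<beta>\<close> as values. So some linear combination of them agrees with \<open>f\<close> on these Gaussians, and the
  Gaussians span a dense subspace of \<open>Hmu \<mu>\<close>.
\<close>

subsection \<open>Smooth functions and the operators \<open>T\<^sub>i\<close>\<close>

text \<open>The natural route, to transform \<open>f\<close> and show that the result lives at the
  origin, would need a transform of functionals; testing \<open>f\<close> on explicitly
  transformable functions avoids it. The obstacle is that \<open>(1 - H)^M\<close> does not tend to
  0 uniformly: \<open>H\<close> is small near \<open>v = 0\<close>, where \<open>p\<close> may
  vanish, and at infinity, where its exponential factor decays. Derivatives make this worse, since r
  of them produce a factor \<open>M^r\<close>. Both difficulties are met by
  \<open>M^r (1 - H)^(M - r) <= C / (M H^(r + 1))\<close>: the zeros of \<theta> on
  \<open>v_i = 0\<close> and its exponential decay pay for the negative power of \<open>H\<close>,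
  and a factor \<open>1 / M\<close> survives. The number of zeros required depends on the finitely
  many seminorms that control \<open>f\<close> and on the power of \<open>v_i\<close> below
  \<open>p\<close>, but not on t. That is why the expansion in t stops at a fixed degree. Since
  \<open>p\<close> dominates a power of each single \<open>v_i\<close>, zeros in one coordinate
  suffice, and the coordinates can be expanded one after the other.\<close>

definition has_partial :: "'n::finite \<Rightarrow> 'n cfun \<Rightarrow> complex \<Rightarrow> real ^ 'n \<Rightarrow> bool" where
  "has_partial i \<phi> d x \<longleftrightarrow> ((\<lambda>t. \<phi> (x + t *\<^sub>R axis i 1)) has_vector_derivative d) (at 0)"

lemma has_partial_imp_partial: "has_partial i \<phi> d x \<Longrightarrow> partial i \<phi> x = d"
  unfolding has_partial_def partial_def by (rule vector_derivative_at)

lemma open_orthant [simp]: "open (orthant :: (real ^ 'n) set)"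
proof -
  have "orthant = (\<Inter>i\<in>UNIV. {x :: real ^ 'n. 0 < x $ i})"
    by (auto simp: orthant_def)
  moreover have "open {x :: real ^ 'n. 0 < x $ i}" for i
    by (intro open_Collect_less continuous_intros)
  ultimately show ?thesis by (metis open_INT finite)
qed

lemma eventually_line_in_open:
  assumes "open U" "x \<in> U"
  shows "\<forall>\<^sub>F t in nhds 0. x + t *\<^sub>R v \<in> (U :: 'a::real_normed_vector set)"
proof -
  have "((\<lambda>t::real. x + t *\<^sub>R v) \<longlongrightarrow> x + 0 *\<^sub>R v) (nhds 0)"
    by (intro tendsto_intros filterlim_ident)
  then show ?thesis
    using assms by (auto simp: topological_tendstoD)
qed

lemma has_partial_cong:
  assumes "open U" "x \<in> U" "\<And>y. y \<in> U \<Longrightarrow> \<phi> y = \<psi> y"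
  shows "has_partial i \<phi> d x \<longleftrightarrow> has_partial i \<psi> d x"
proof -
  have ev: "\<forall>\<^sub>F t in nhds 0. \<phi> (x + t *\<^sub>R axis i 1) = \<psi> (x + t *\<^sub>R axis i 1)"
    using eventually_line_in_open[OF assms(1,2), of "axis i 1"]
    by eventually_elim (use assms(3) in auto)
  then have "\<forall>\<^sub>F t in at 0. \<phi> (x + t *\<^sub>R axis i 1) = \<psi> (x + t *\<^sub>R axis i 1)"
    "\<forall>\<^sub>F t in at 0. \<psi> (x + t *\<^sub>R axis i 1) = \<phi> (x + t *\<^sub>R axis i 1)"
    by (auto simp: eventually_at_filter elim: eventually_mono)
  then show ?thesis
    unfolding has_partial_def has_vector_derivative_def
    using assms(2,3)
    by (intro iffI) (erule has_derivative_transform_eventually; simp)+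
qed

lemma partial_cong:
  assumes "open U" "x \<in> U" "\<And>y. y \<in> U \<Longrightarrow> \<phi> y = \<psi> y"
  shows "partial i \<phi> x = partial i \<psi> x"
proof -

  have "(\<lambda>d. has_partial i \<phi> d x) = (\<lambda>d. has_partial i \<psi> d x)"
    using has_partial_cong[of U x \<phi> \<psi> i] assms by blast
  then show ?thesis
    unfolding partial_def vector_derivative_def has_partial_def by simp
qed

lemma differentiable_iff_has_partial:
  "(\<lambda>t. \<phi> (x + t *\<^sub>R axis i 1)) differentiable (at 0) \<longleftrightarrow> (\<exists>d. has_partial i \<phi> d x)"
  unfolding has_partial_def
  by (metis differentiableI_vector vector_derivative_works)

lemma Ck_on_cong:
  assumes "open U" "\<And>y. y \<in> U \<Longrightarrow> \<phi> y = \<psi> y"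
  shows "Ck_on k U \<phi> \<longleftrightarrow> Ck_on k U \<psi>"
  using assms(2)
proof (induction k arbitrary: \<phi> \<psi>)
  case 0
  then show ?case by (auto cong: continuous_on_cong)
next
  case (Suc k)
  have "Ck_on k U (partial i \<phi>) \<longleftrightarrow> Ck_on k U (partial i \<psi>)" for i
    by (rule Suc.IH) (use partial_cong[OF assms(1) _ Suc.prems] in auto)
  moreover have "continuous_on U \<phi> \<longleftrightarrow> continuous_on U \<psi>"
    by (rule continuous_on_cong) (use Suc.prems in auto)
  ultimately show ?case
    by (auto simp: Ck_on.simps(2) differentiable_iff_has_partial has_partial_cong[OF assms(1) _ Suc.prems])
qed

lemma Ck_on_SucI:
  assumes "open U" "continuous_on U \<phi>"
    and "\<And>i x. x \<in> U \<Longrightarrow> has_partial i \<phi> (\<phi>' i x) x"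
    and "\<And>i. Ck_on k U (\<phi>' i)"
  shows "Ck_on (Suc k) U \<phi>"
proof -
  have "Ck_on k U (partial i \<phi>) \<longleftrightarrow> Ck_on k U (\<phi>' i)" for i
    by (rule Ck_on_cong[OF assms(1)]) (use assms(3) has_partial_imp_partial in blast)
  then show ?thesis using assms by (auto simp: differentiable_iff_has_partial Ck_on.simps(2))
qed

lemma Ck_on_SucD:
  assumes "Ck_on (Suc k) U \<phi>"
  shows "continuous_on U \<phi>" "x \<in> U \<Longrightarrow> has_partial i \<phi> (partial i \<phi> x) x" "Ck_on k U (partial i \<phi>)"
  using assms by (auto simp: Ck_on.simps(2) has_partial_def partial_def vector_derivative_works)

declare Ck_on.simps(2) [simp del]

lemma Ck_on_continuous: "Ck_on k U \<phi> \<Longrightarrow> continuous_on U \<phi>"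
  by (cases k) (auto simp: Ck_on.simps(2))

lemma Ck_on_Suc_imp: "Ck_on (Suc k) U \<phi> \<Longrightarrow> Ck_on k U \<phi>"
  by (induction k arbitrary: \<phi>) (auto simp: Ck_on.simps)

lemma has_partial_add:
  "has_partial i \<phi> d x \<Longrightarrow> has_partial i \<psi> e x \<Longrightarrow> has_partial i (\<lambda>y. \<phi> y + \<psi> y) (d + e) x"
  unfolding has_partial_def by (rule has_vector_derivative_add)

lemma has_partial_mult:
  "has_partial i \<phi> d x \<Longrightarrow> has_partial i \<psi> e x \<Longrightarrow>
    has_partial i (\<lambda>y. \<phi> y * \<psi> y) (\<phi> x * e + d * \<psi> x) x"
  unfolding has_partial_def
  using has_vector_derivative_mult[of "\<lambda>t. \<phi> (x + t *\<^sub>R axis i 1)" d 0 UNIV "\<lambda>t. \<psi> (x + t *\<^sub>R axis i 1)" e]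
  by simp

lemma has_partial_const: "has_partial i (\<lambda>y. c) 0 x"
  unfolding has_partial_def by simp

lemma has_partial_cmult: "has_partial i \<phi> d x \<Longrightarrow> has_partial i (\<lambda>y. c * \<phi> y) (c * d) x"
  using has_partial_mult[OF has_partial_const] by fastforce

lemma Ck_on_const: "open U \<Longrightarrow> Ck_on k U (\<lambda>y. c)"
proof (induction k arbitrary: c)
  case (Suc k)
  show ?case by (rule Ck_on_SucI[where \<phi>'="\<lambda>_ _. 0"]) (use Suc has_partial_const in auto)
qed auto

lemma Ck_on_add:
  assumes "open U"
  shows "Ck_on k U \<phi> \<Longrightarrow> Ck_on k U \<psi> \<Longrightarrow> Ck_on k U (\<lambda>y. \<phi> y + \<psi> y)"
proof (induction k arbitrary: \<phi> \<psi>)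
  case (Suc k)
  show ?case
  proof (rule Ck_on_SucI[where \<phi>'="\<lambda>i x. partial i \<phi> x + partial i \<psi> x"])
    show "Ck_on k U (\<lambda>x. partial i \<phi> x + partial i \<psi> x)" for i
      by (intro Suc.IH Ck_on_SucD(3) Suc.prems)
  qed (use assms Suc.prems Ck_on_SucD in \<open>auto intro!: has_partial_add continuous_intros\<close>)
qed (auto intro!: continuous_intros)

lemma Ck_on_mult:
  assumes "open U"
  shows "Ck_on k U \<phi> \<Longrightarrow> Ck_on k U \<psi> \<Longrightarrow> Ck_on k U (\<lambda>y. \<phi> y * \<psi> y)"
proof (induction k arbitrary: \<phi> \<psi>)
  case (Suc k)
  show ?case
  proof (rule Ck_on_SucI[where \<phi>'="\<lambda>i x. \<phi> x * partial i \<psi> x + partial i \<phi> x * \<psi> x"])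
    show "Ck_on k U (\<lambda>x. \<phi> x * partial i \<psi> x + partial i \<phi> x * \<psi> x)" for i
      by (intro Ck_on_add assms Suc.IH Ck_on_SucD(3) Suc.prems Ck_on_Suc_imp[OF Suc.prems(1)]
          Ck_on_Suc_imp[OF Suc.prems(2)])
  qed (use assms Suc.prems Ck_on_SucD in \<open>auto intro!: has_partial_mult continuous_intros\<close>)
qed (auto intro!: continuous_intros)

lemma Cinf_on_const: "open U \<Longrightarrow> Cinf_on U (\<lambda>y. c)"
  by (simp add: Cinf_on_def Ck_on_const)

lemma Cinf_on_add: "open U \<Longrightarrow> Cinf_on U \<phi> \<Longrightarrow> Cinf_on U \<psi> \<Longrightarrow> Cinf_on U (\<lambda>y. \<phi> y + \<psi> y)"
  by (simp add: Cinf_on_def Ck_on_add)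

lemma Cinf_on_mult: "open U \<Longrightarrow> Cinf_on U \<phi> \<Longrightarrow> Cinf_on U \<psi> \<Longrightarrow> Cinf_on U (\<lambda>y. \<phi> y * \<psi> y)"
  by (simp add: Cinf_on_def Ck_on_mult)

lemma Cinf_on_cmult: "open U \<Longrightarrow> Cinf_on U \<phi> \<Longrightarrow> Cinf_on U (\<lambda>y. c * \<phi> y)"
  by (intro Cinf_on_mult Cinf_on_const)

lemma Cinf_on_transform:
  "Cinf_on U \<psi> \<Longrightarrow> open U \<Longrightarrow> (\<And>y. y \<in> U \<Longrightarrow> \<phi> y = \<psi> y) \<Longrightarrow> Cinf_on U \<phi>"
  unfolding Cinf_on_def by (metis Ck_on_cong)

lemma Cinf_on_partial: "Cinf_on U \<phi> \<Longrightarrow> Cinf_on U (partial i \<phi>)"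
  unfolding Cinf_on_def by (metis Ck_on_SucD(3))

lemma Cinf_on_has_partial: "Cinf_on U \<phi> \<Longrightarrow> x \<in> U \<Longrightarrow> has_partial i \<phi> (partial i \<phi> x) x"
  unfolding Cinf_on_def by (metis Ck_on_SucD(2))

lemma Cinf_on_continuous: "Cinf_on U \<phi> \<Longrightarrow> continuous_on U \<phi>"
  unfolding Cinf_on_def using Ck_on_continuous by blast

text \<open>\<open>Ck_on\<close> recurses through partial derivatives, so it suffices to exhibit a
  class of continuous functions that is closed under them. \<open>C\<close> is such an invariant;
  the typical instance consists of the multiples of \<open>vpowr y \<nu>\<close> for all
  \<open>\<nu>\<close> at once.\<close>

lemma Cinf_on_coinduct:
  assumes "open U" "C \<phi>"
    and "\<And>\<phi>. C \<phi> \<Longrightarrow> continuous_on U \<phi>"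
    and "\<And>\<phi> i. C \<phi> \<Longrightarrow> \<exists>\<phi>'. C \<phi>' \<and> (\<forall>x\<in>U. has_partial i \<phi> (\<phi>' x) x)"
  shows "Cinf_on U \<phi>"
proof -
  have "Ck_on k U \<phi>" for k
    using assms(2)
  proof (induction k arbitrary: \<phi>)
    case 0
    then show ?case using assms(3) by auto
  next
    case (Suc k)
    from assms(4)[OF Suc.prems] obtain \<phi>' where
      "\<And>i. C (\<phi>' i) \<and> (\<forall>x\<in>U. has_partial i \<phi> (\<phi>' i x) x)" by metis
    then show ?case
      by (intro Ck_on_SucI[where \<phi>'=\<phi>']) (use Suc assms in auto)
  qed
  then show ?thesis by (simp add: Cinf_on_def)
qed

section \<open>Coordinates and real powers of coordinates as smooth functions\<close>

lemma axis_nth: "(x + t *\<^sub>R axis i (1::real)) $ j = x $ j + (if j = i then t else 0)"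
  by (simp add: axis_def)

lemma has_partial_component:
  assumes "(f has_vector_derivative d) (at (x $ i))"
  shows "has_partial i (\<lambda>y. f (y $ i)) d x" and "j \<noteq> i \<Longrightarrow> has_partial j (\<lambda>y. f (y $ i)) 0 x"
proof -
  show "has_partial i (\<lambda>y. f (y $ i)) d x"
    unfolding has_partial_def axis_nth
  proof -
    have "((\<lambda>t. x $ i + t) has_vector_derivative 1) (at 0)"
      by (auto intro!: derivative_eq_intros)
    from vector_diff_chain_at[OF this, of f d] assms show "((\<lambda>t. f (x $ i + (if i = i then t else 0))) has_vector_derivative d) (at 0)"
      by (simp add: o_def)
  qed
  show "j \<noteq> i \<Longrightarrow> has_partial j (\<lambda>y. f (y $ i)) 0 x"
    unfolding has_partial_def axis_nth by simp
qed

lemma Cinf_on_coord: "open U \<Longrightarrow> Cinf_on U (\<lambda>y. complex_of_real (y $ i))"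
proof (rule Cinf_on_coinduct[where C="\<lambda>\<phi>. \<phi> = (\<lambda>y. complex_of_real (y $ i)) \<or> (\<exists>c. \<phi> = (\<lambda>y. c))"])
  fix \<phi> j assume "\<phi> = (\<lambda>y. complex_of_real (y $ i)) \<or> (\<exists>c. \<phi> = (\<lambda>y. c))"
  then show "\<exists>\<phi>'. (\<phi>' = (\<lambda>y. complex_of_real (y $ i)) \<or> (\<exists>c. \<phi>' = (\<lambda>y. c))) \<and>
    (\<forall>x\<in>U. has_partial j \<phi> (\<phi>' x) x)"
  proof
    assume "\<phi> = (\<lambda>y. complex_of_real (y $ i))"
    moreover have "(complex_of_real has_vector_derivative 1) (at z)" for z
      using has_vector_derivative_of_real[of "\<lambda>x. x" 1 "at z"] by simp
    ultimately have "has_partial j \<phi> (if j = i then 1 else 0) x" for x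
      using has_partial_component[of complex_of_real 1 x i] by auto
    then show ?thesis by blast
  qed (use has_partial_const in blast)
qed (auto intro!: continuous_intros)

lemma vpowr_axis:
  assumes "x \<in> orthant"
  shows "vpowr x (\<nu> + c *\<^sub>R axis i 1) = x $ i powr c * vpowr x \<nu>"
proof -
  have "vpowr x (\<nu> + c *\<^sub>R axis i 1) = (\<Prod>j\<in>UNIV. (if j = i then x $ i powr c else 1) * x $ j powr \<nu> $ j)"
    unfolding vpowr_def axis_nth by (rule prod.cong) (auto simp: powr_add)
  then show ?thesis by (simp add: prod.distrib vpowr_def)
qed

lemma vpowr_uminus: "vpowr x (- \<nu>) = inverse (vpowr x \<nu>)"
  by (simp add: vpowr_def powr_minus prod_inversef[symmetric])

lemma vpowr_pos: "x \<in> orthant \<Longrightarrow> vpowr x \<nu> > 0"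
  by (auto simp: vpowr_def orthant_def less_imp_neq[symmetric] intro!: prod_pos)

lemma continuous_on_vpowr: "continuous_on orthant (\<lambda>x. vpowr x \<nu>)"
  unfolding vpowr_def by (intro continuous_intros) (auto simp: orthant_def less_imp_neq[symmetric])

lemma has_partial_vpowr:
  assumes "x \<in> orthant"
  shows "has_partial i (\<lambda>y. complex_of_real (vpowr y \<nu>))
    (complex_of_real (\<nu> $ i * vpowr x (\<nu> + (-1) *\<^sub>R axis i 1))) x"
proof -
  let ?R = "\<Prod>j\<in>UNIV - {i}. x $ j powr \<nu> $ j"
  have pos: "x $ i > 0" using assms by (simp add: orthant_def)
  have split: "vpowr (x + t *\<^sub>R axis i 1) \<nu> = (x $ i + t) powr \<nu> $ i * ?R" for t
  proof -
    have "(\<Prod>j\<in>UNIV - {i}. (x $ j + (if j = i then t else 0)) powr \<nu> $ j) = ?R"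
      by (rule prod.cong) auto
    then show ?thesis unfolding vpowr_def axis_nth by (subst prod.remove[of _ i]) auto
  qed
  have "((\<lambda>t. (x $ i + t) powr \<nu> $ i * ?R) has_real_derivative
      (\<nu> $ i * (x $ i) powr (\<nu> $ i - 1)) * ?R) (at 0)"
    using pos by (auto intro!: derivative_eq_intros simp: field_simps powr_diff)
  moreover have "(\<nu> $ i * (x $ i) powr (\<nu> $ i - 1)) * ?R = \<nu> $ i * vpowr x (\<nu> + (-1) *\<^sub>R axis i 1)"
    using split[of 0] pos unfolding vpowr_axis[OF assms] by (simp add: powr_diff powr_minus field_simps)
  ultimately show ?thesis
    unfolding has_partial_def split
    by (intro has_vector_derivative_of_real) (simp add: has_real_derivative_iff_has_vector_derivative)
qed

lemma Cinf_on_vpowr: "Cinf_on orthant (\<lambda>y. complex_of_real (vpowr y \<nu>))"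
proof (rule Cinf_on_coinduct[where C="\<lambda>\<phi>. \<exists>c \<nu>. \<phi> = (\<lambda>y. c * complex_of_real (vpowr y \<nu>))"])
  show "\<exists>c \<nu>'. (\<lambda>y. complex_of_real (vpowr y \<nu>)) = (\<lambda>y. c * complex_of_real (vpowr y \<nu>'))"
    by (intro exI[of _ 1] exI[of _ \<nu>]) simp
next
  fix \<phi> :: "'a cfun" and i assume "\<exists>c \<nu>. \<phi> = (\<lambda>y. c * complex_of_real (vpowr y \<nu>))"
  then obtain c \<nu> where p: "\<phi> = (\<lambda>y. c * complex_of_real (vpowr y \<nu>))" by blast
  have "has_partial i \<phi> (c * \<nu> $ i * complex_of_real (vpowr x (\<nu> + (-1) *\<^sub>R axis i 1))) x"
    if "x \<in> orthant" for x
    using has_partial_cmult[OF has_partial_vpowr[OF that], of i c \<nu>] unfolding p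
    by (simp only: mult.assoc of_real_mult)
  then show "\<exists>\<phi>'. (\<exists>c \<nu>. \<phi>' = (\<lambda>y. c * complex_of_real (vpowr y \<nu>))) \<and> (\<forall>x\<in>orthant. has_partial i \<phi> (\<phi>' x) x)"
    by blast
qed (auto intro!: continuous_intros continuous_on_vpowr)

lemma Cinf_on_inverse_coord: "Cinf_on orthant (\<lambda>y. complex_of_real (inverse (y $ i)))"
proof -
  have *: "complex_of_real (inverse (y $ i)) = complex_of_real (vpowr y (0 + (-1) *\<^sub>R axis i 1))"
    if y: "y \<in> orthant" for y
  proof -
    have pos: "y $ j > 0" for j using y by (simp add: orthant_def)
    then have "y $ j \<noteq> 0" for j by (metis less_irrefl)
    then show ?thesis
      unfolding vpowr_axis[OF y] using pos[of i] by (simp add: vpowr_def powr_minus)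
  qed
  show ?thesis by (rule Cinf_on_transform[OF Cinf_on_vpowr open_orthant]) (fact *)
qed

section \<open>Compositions of the operators \<open>T_op\<close> and their independence of the
  order\<close>

lemma T_op_cong:
  "(\<And>y. y \<in> orthant \<Longrightarrow> \<phi> y = \<psi> y) \<Longrightarrow> x \<in> orthant \<Longrightarrow> T_op i \<phi> x = T_op i \<psi> x"
  unfolding T_op_def using partial_cong[OF open_orthant, of x \<phi> \<psi> i] by auto

lemma Cinf_on_T_op: "Cinf_on orthant \<phi> \<Longrightarrow> Cinf_on orthant (T_op i \<phi>)"
  unfolding T_op_def by (intro Cinf_on_mult Cinf_on_inverse_coord Cinf_on_partial) auto

lemma T_op_has_partial: "has_partial i \<phi> d x \<Longrightarrow> T_op i \<phi> x = complex_of_real (inverse (x $ i)) * d"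
  by (simp add: T_op_def has_partial_imp_partial)

text \<open>Lists of indices replace multi-indices in inductions, because they can be extended at
  the head, split and concatenated. The head is applied last. \<open>T_list_eq_T_pow\<close> returns
  to multi-indices.\<close>

definition T_list :: "'n::finite list \<Rightarrow> 'n cfun \<Rightarrow> 'n cfun" where
  "T_list l \<phi> = foldr T_op l \<phi>"

lemma T_list_simps [simp]: "T_list [] \<phi> = \<phi>" "T_list (i # l) \<phi> = T_op i (T_list l \<phi>)"
  "T_list (l @ l') \<phi> = T_list l (T_list l' \<phi>)"
  by (auto simp: T_list_def)

lemma Cinf_on_T_list: "Cinf_on orthant \<phi> \<Longrightarrow> Cinf_on orthant (T_list l \<phi>)"
  by (induction l) (auto intro: Cinf_on_T_op)

lemma T_list_cong:
  "(\<And>y. y \<in> orthant \<Longrightarrow> \<phi> y = \<psi> y) \<Longrightarrow> x \<in> orthant \<Longrightarrow> T_list l \<phi> x = T_list l \<psi> x"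
  by (induction l arbitrary: x) (auto intro: T_op_cong)

lemma T_list_lincomb:
  assumes "Cinf_on orthant \<phi>" "Cinf_on orthant \<psi>" "x \<in> orthant"
  shows "T_list l (\<lambda>y. a * \<phi> y + b * \<psi> y) x = a * T_list l \<phi> x + b * T_list l \<psi> x"
  using assms(3)
proof (induction l arbitrary: x)
  case (Cons i l)
  have hp0: "T_op i (T_list l (\<lambda>y. a * \<phi> y + b * \<psi> y)) x =
      T_op i (\<lambda>x. a * T_list l \<phi> x + b * T_list l \<psi> x) x"
    by (rule T_op_cong) (use Cons in auto)
  have hp: "has_partial i (\<lambda>x. a * T_list l \<phi> x + b * T_list l \<psi> x)
    (a * partial i (T_list l \<phi>) x + b * partial i (T_list l \<psi>) x) x"
    by (intro has_partial_add has_partial_cmult Cinf_on_has_partial[OF Cinf_on_T_list] assms Cons)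
  have "T_op i (\<lambda>x. a * T_list l \<phi> x + b * T_list l \<psi> x) x =
      a * T_op i (T_list l \<phi>) x + b * T_op i (T_list l \<psi>) x"
    unfolding T_op_has_partial[OF hp] by (simp add: T_op_def algebra_simps)
  with hp0 show ?case by simp
qed auto

text \<open>Both mixed derivatives are limits of the second difference over a square of side
  \<open>h\<close>, divided by \<open>h^2\<close>: the mean value theorem, applied twice in either
  order, gives their values at intermediate points of the square. The mean value theorem forces real
  values here.\<close>

lemma mixed_derivative_eq_real:
  fixes f :: "real \<Rightarrow> real \<Rightarrow> real"
  assumes \<delta>: "\<delta> > 0"
    and fs: "\<And>s t. \<bar>s\<bar> < \<delta> \<Longrightarrow> \<bar>t\<bar> < \<delta> \<Longrightarrow> ((\<lambda>s. f s t) has_real_derivative fs s t) (at s)"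
    and dst: "\<And>s t. \<bar>s\<bar> < \<delta> \<Longrightarrow> \<bar>t\<bar> < \<delta> \<Longrightarrow> ((\<lambda>t. fs s t) has_real_derivative dst s t) (at t)"
    and ft: "\<And>s t. \<bar>s\<bar> < \<delta> \<Longrightarrow> \<bar>t\<bar> < \<delta> \<Longrightarrow> ((\<lambda>t. f s t) has_real_derivative ft s t) (at t)"
    and fts: "\<And>s t. \<bar>s\<bar> < \<delta> \<Longrightarrow> \<bar>t\<bar> < \<delta> \<Longrightarrow> ((\<lambda>s. ft s t) has_real_derivative fts s t) (at s)"
    and c1: "isCont (\<lambda>p. dst (fst p) (snd p)) (0, 0)"
    and c2: "isCont (\<lambda>p. fts (fst p) (snd p)) (0, 0)"
  shows "dst 0 0 = fts 0 0"
proof -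
  have *: "\<exists>a b. 0 < a \<and> a < h \<and> 0 < b \<and> b < h \<and> f h h - f h 0 - f 0 h + f 0 0 = h * h * dst a b"
    if h: "0 < h" "h < \<delta>"
      and fs: "\<And>s t. \<bar>s\<bar> < \<delta> \<Longrightarrow> \<bar>t\<bar> < \<delta> \<Longrightarrow> ((\<lambda>s. f s t) has_real_derivative fs s t) (at s)"
      and dst: "\<And>s t. \<bar>s\<bar> < \<delta> \<Longrightarrow> \<bar>t\<bar> < \<delta> \<Longrightarrow> ((\<lambda>t. fs s t) has_real_derivative dst s t) (at t)"
    for h and f fs dst :: "real \<Rightarrow> real \<Rightarrow> real"
  proof -
    have "\<exists>a. 0 < a \<and> a < h \<and> (f h h - f h 0) - (f 0 h - f 0 0) = (h - 0) * (fs a h - fs a 0)"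
      by (rule MVT2) (use h in \<open>auto intro!: derivative_eq_intros fs\<close>)
    then obtain a where a: "0 < a" "a < h" "(f h h - f h 0) - (f 0 h - f 0 0) = h * (fs a h - fs a 0)"
      by auto
    have "\<exists>b. 0 < b \<and> b < h \<and> fs a h - fs a 0 = (h - 0) * dst a b"
      by (rule MVT2) (use h a in \<open>auto intro!: derivative_eq_intros dst\<close>)
    then obtain b where b: "0 < b" "b < h" "fs a h - fs a 0 = h * dst a b" by auto
    have "f h h - f h 0 - f 0 h + f 0 0 = h * h * dst a b"
      using a(3) unfolding b(3) by (simp add: algebra_simps)
    then show ?thesis using a(1,2) b(1,2) by metis
  qed
  \<comment> \<open>The offset 2 keeps \<open>h n\<close> strictly below \<open>\<delta>\<close>
    already for \<open>n = 0\<close>.\<close>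
  define h where "h n = \<delta> / real (n + 2)" for n
  have h: "0 < h n" "h n < \<delta>" for n
    using \<delta> by (auto simp: h_def field_simps intro!: add_pos_nonneg)
  have hlim: "h \<longlonglongrightarrow> 0"
    unfolding h_def using LIMSEQ_ignore_initial_segment[OF lim_const_over_n[of \<delta>], of 2] by simp
  have "\<forall>n. \<exists>a b. 0 < a \<and> a < h n \<and> 0 < b \<and> b < h n \<and> f (h n) (h n) - f (h n) 0 - f 0 (h n) + f 0 0 = h n * h n * dst a b"
    using *[OF h fs dst] by simp
  then obtain a b where ab: "\<And>n. 0 < a n" "\<And>n. a n < h n" "\<And>n. 0 < b n" "\<And>n. b n < h n"
    "\<And>n. f (h n) (h n) - f (h n) 0 - f 0 (h n) + f 0 0 = h n * h n * dst (a n) (b n)" by metis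
  have "\<forall>n. \<exists>a b. 0 < a \<and> a < h n \<and> 0 < b \<and> b < h n \<and> f (h n) (h n) - f 0 (h n) - f (h n) 0 + f 0 0 = h n * h n * fts b a"
    using *[OF h, of "\<lambda>s t. f t s" "\<lambda>s t. ft t s" "\<lambda>s t. fts t s"] ft fts by simp
  then obtain a' b' where ab': "\<And>n. 0 < a' n" "\<And>n. a' n < h n" "\<And>n. 0 < b' n" "\<And>n. b' n < h n"
    "\<And>n. f (h n) (h n) - f 0 (h n) - f (h n) 0 + f 0 0 = h n * h n * fts (b' n) (a' n)" by metis
  have eq: "dst (a n) (b n) = fts (b' n) (a' n)" for n
  proof -
    have "h n * h n * dst (a n) (b n) = h n * h n * fts (b' n) (a' n)"
      using ab(5)[of n] ab'(5)[of n] by linarith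
    then show ?thesis using h(1)[of n] by simp
  qed
  have sq: "u \<longlonglongrightarrow> 0" if "\<And>n. 0 < u n" "\<And>n. u n < h n" for u :: "nat \<Rightarrow> real"
    by (rule tendsto_sandwich[OF _ _ tendsto_const hlim]) (use that in \<open>auto intro!: always_eventually less_imp_le\<close>)
  have "(\<lambda>n. (a n, b n)) \<longlonglongrightarrow> (0, 0)" "(\<lambda>n. (b' n, a' n)) \<longlonglongrightarrow> (0, 0)"
    by (intro tendsto_Pair sq ab ab')+
  then have "(\<lambda>n. dst (a n) (b n)) \<longlonglongrightarrow> dst 0 0" "(\<lambda>n. fts (b' n) (a' n)) \<longlonglongrightarrow> fts 0 0"
    using isCont_tendsto_compose[OF c1] isCont_tendsto_compose[OF c2] by fastforce+
  then show ?thesis unfolding eq using LIMSEQ_unique by blast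
qed

lemma line_derivative:
  fixes g :: "'n::finite cfun"
  assumes "\<And>y. y \<in> U \<Longrightarrow> has_partial i g (g' y) y" "z + s *\<^sub>R axis i 1 \<in> U"
  shows "((\<lambda>s. g (z + s *\<^sub>R axis i 1)) has_vector_derivative g' (z + s *\<^sub>R axis i 1)) (at s)"
proof -
  have "((\<lambda>t. g (z + s *\<^sub>R axis i 1 + t *\<^sub>R axis i 1)) has_vector_derivative g' (z + s *\<^sub>R axis i 1)) (at (s - s))"
    using assms(1)[OF assms(2)] unfolding has_partial_def by simp
  moreover have "((\<lambda>s'. s' - s) has_vector_derivative 1) (at s)"
    by (auto intro!: derivative_eq_intros)
  ultimately have "((\<lambda>t. g (z + s *\<^sub>R axis i 1 + t *\<^sub>R axis i 1)) \<circ> (\<lambda>s'. s' - s) has_vector_derivative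
      1 *\<^sub>R g' (z + s *\<^sub>R axis i 1)) (at s)"
    by (intro vector_diff_chain_at)
  then show ?thesis by (simp add: o_def scaleR_diff_left algebra_simps)
qed

text \<open>The real statement is applied to the real and the imaginary part on the plane through
  \<open>x\<close> spanned by the two axes. The square of half-side \<open>e / 2\<close> stays
  inside the ball of radius \<open>e\<close>, by the triangle inequality.\<close>

lemma partial_commute:
  assumes U: "open U" and \<phi>: "Cinf_on U \<phi>" and x: "x \<in> U"
  shows "partial i (partial j \<phi>) x = partial j (partial i \<phi>) x"
proof -
  have key: "p (partial i (partial j \<phi>) x) = p (partial j (partial i \<phi>) x)"
    if p: "bounded_linear p" for p :: "complex \<Rightarrow> real"
  proof -
    obtain e where e: "e > 0" "ball x e \<subseteq> U" using U x by (auto simp: open_contains_ball)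
    define \<delta> where "\<delta> = e / 2"
    have \<delta>: "\<delta> > 0" using e by (simp add: \<delta>_def)
    let ?q = "\<lambda>s t. x + s *\<^sub>R axis i 1 + t *\<^sub>R axis j 1"
    have inU: "?q s t \<in> U" if "\<bar>s\<bar> < \<delta>" "\<bar>t\<bar> < \<delta>" for s t
    proof -
      have "dist x (?q s t) = norm (s *\<^sub>R axis i (1::real) + t *\<^sub>R axis j 1)"
        by (subst dist_commute) (simp only: dist_norm add.assoc add_diff_cancel_left')
      also have "\<dots> \<le> \<bar>s\<bar> + \<bar>t\<bar>"
        by (rule order_trans[OF norm_triangle_ineq]) (simp add: norm_axis_1)
      finally have "dist x (?q s t) < e" using that by (simp add: \<delta>_def)
      then show ?thesis using e(2) by (simp add: subset_iff)
    qed
    have d1: "((\<lambda>s. p (g (?q s t))) has_real_derivative p (partial i g (?q s t))) (at s)"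
      if "Cinf_on U g" "\<bar>s\<bar> < \<delta>" "\<bar>t\<bar> < \<delta>" for g s t
    proof -
      have sw: "(x + t *\<^sub>R axis j 1) + s *\<^sub>R axis i 1 = ?q s t" for s
        by (simp only: add.assoc add.commute[of "t *\<^sub>R axis j 1"])
      have "((\<lambda>s. g ((x + t *\<^sub>R axis j 1) + s *\<^sub>R axis i 1)) has_vector_derivative partial i g ((x + t *\<^sub>R axis j 1) + s *\<^sub>R axis i 1)) (at s)"
      proof (rule line_derivative[where U=U and g=g and g'="partial i g" and z="x + t *\<^sub>R axis j 1"])
        show "x + t *\<^sub>R axis j 1 + s *\<^sub>R axis i 1 \<in> U"
          unfolding sw by (rule inU[OF that(2,3)])
      qed (rule Cinf_on_has_partial[OF that(1)])
      from bounded_linear.has_vector_derivative[OF p this] show ?thesis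
        unfolding sw has_real_derivative_iff_has_vector_derivative .
    qed
    have d2: "((\<lambda>t. p (g (?q s t))) has_real_derivative p (partial j g (?q s t))) (at t)"
      if "Cinf_on U g" "\<bar>s\<bar> < \<delta>" "\<bar>t\<bar> < \<delta>" for g s t
    proof -
      have "((\<lambda>t. g ((x + s *\<^sub>R axis i 1) + t *\<^sub>R axis j 1)) has_vector_derivative partial j g ((x + s *\<^sub>R axis i 1) + t *\<^sub>R axis j 1)) (at t)"
        by (rule line_derivative[where U=U and g=g and g'="partial j g" and z="x + s *\<^sub>R axis i 1",
              OF Cinf_on_has_partial[OF that(1)] inU[OF that(2,3)]])
      from bounded_linear.has_vector_derivative[OF p this] show ?thesis
        unfolding has_real_derivative_iff_has_vector_derivative .
    qed
    have c: "isCont (\<lambda>z. p (g (?q (fst z) (snd z)))) (0, 0)" if "Cinf_on U g" for g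
    proof -
      have "isCont g x"
        using Cinf_on_continuous[OF that] x U continuous_on_eq_continuous_at by blast
      then have "isCont (\<lambda>z. g (?q (fst z) (snd z))) (0, 0)"
        by (intro isCont_o2[where f="\<lambda>z. ?q (fst z) (snd z)" and g=g]) (simp_all add: continuous_intros)
      then show ?thesis
        by (rule bounded_linear.isCont[OF p, where g="\<lambda>z. g (?q (fst z) (snd z))"])
    qed
    note C = Cinf_on_partial[OF \<phi>] Cinf_on_partial[OF Cinf_on_partial[OF \<phi>]]
    have "p (partial j (partial i \<phi>) (?q 0 0)) = p (partial i (partial j \<phi>) (?q 0 0))"
      by (rule mixed_derivative_eq_real[where f="\<lambda>s t. p (\<phi> (?q s t))" and fs="\<lambda>s t. p (partial i \<phi> (?q s t))"
          and ft="\<lambda>s t. p (partial j \<phi> (?q s t))" and dst="\<lambda>s t. p (partial j (partial i \<phi>) (?q s t))"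
          and fts="\<lambda>s t. p (partial i (partial j \<phi>) (?q s t))", OF \<delta>])
         (fact d1[OF \<phi>] d2[OF C(1)] d2[OF \<phi>] d1[OF C(1)] c[OF C(2)])+
    then show ?thesis by simp
  qed
  show ?thesis
    using key[OF bounded_linear_Re] key[OF bounded_linear_Im] by (simp add: complex_eq_iff)
qed

text \<open>For \<open>i \<noteq> j\<close> the factor \<open>1 / x_j\<close> is constant in
  direction \<open>i\<close> and can be pulled out of the derivative, so only the mixed partial
  derivatives have to be exchanged.\<close>

lemma T_op_commute:
  assumes \<phi>: "Cinf_on orthant \<phi>" and x: "x \<in> orthant"
  shows "T_op i (T_op j \<phi>) x = T_op j (T_op i \<phi>) x"
proof (cases "i = j")
  case False
  have "T_op i (T_op j \<phi>) x = complex_of_real (inverse (x $ i)) * complex_of_real (inverse (x $ j)) * partial i (partial j \<phi>) x"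
    if "i \<noteq> j" for i j
  proof -
    have "x $ j > 0" using x by (simp add: orthant_def)
    then have "(inverse has_real_derivative - (inverse (x $ j) ^ Suc (Suc 0))) (at (x $ j))"
      by (intro DERIV_inverse) simp
    then have "((\<lambda>y. complex_of_real (inverse y)) has_vector_derivative
        complex_of_real (- (inverse (x $ j) ^ Suc (Suc 0)))) (at (x $ j))"
      by (rule has_vector_derivative_of_real)
    from has_partial_component(2)[OF this that]
    have "has_partial i (\<lambda>y. complex_of_real (inverse (y $ j))) 0 x" .
    from has_partial_mult[OF this Cinf_on_has_partial[OF Cinf_on_partial[OF \<phi>] x, of i j]]
    have hp: "has_partial i (\<lambda>y. complex_of_real (inverse (y $ j)) * partial j \<phi> y)
        (complex_of_real (inverse (x $ j)) * partial i (partial j \<phi>) x) x"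
      by simp
    have "T_op j \<phi> = (\<lambda>y. complex_of_real (inverse (y $ j)) * partial j \<phi> y)"
      by (simp add: T_op_def fun_eq_iff)
    then show ?thesis using T_op_has_partial[OF hp] by (simp only: mult.assoc)
  qed
  from this[OF False] this[OF False[symmetric]] show ?thesis
    using partial_commute[OF open_orthant \<phi> x, of i j] by (simp add: mult_ac)
qed auto

lemma T_list_move:
  assumes \<phi>: "Cinf_on orthant \<phi>" and x: "x \<in> orthant"
  shows "T_list (l @ i # l') \<phi> x = T_list (i # l @ l') \<phi> x"
  using x
proof (induction l arbitrary: x)
  case (Cons j l)
  have "T_list ((j # l) @ i # l') \<phi> x = T_op j (T_list (i # l @ l') \<phi>) x"
    unfolding append_Cons T_list_simps(2) by (rule T_op_cong) (use Cons in auto)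
  also have "\<dots> = T_list (i # (j # l) @ l') \<phi> x"
    using T_op_commute[OF Cinf_on_T_list[OF Cinf_on_T_list[OF \<phi>]] Cons.prems, of j i l l'] by simp
  finally show ?case .
qed auto

text \<open>The seminorms fix one order of composition, whereas estimates produce the operators in
  any order. Matching heads one by one, each moved to the front by \<open>T_list_move\<close>,
  identifies the two.\<close>

lemma T_list_perm:
  assumes \<phi>: "Cinf_on orthant \<phi>" and "mset l = mset l'" "x \<in> orthant"
  shows "T_list l \<phi> x = T_list l' \<phi> x"
  using assms(2,3)
proof (induction l arbitrary: l' x)
  case (Cons i l)
  have "i \<in> set l'" using Cons.prems(1) by (metis list.set_intros(1) mset_eq_setD)
  then obtain p q where l': "l' = p @ i # q" by (meson split_list)
  have "T_list (i # l) \<phi> x = T_op i (T_list (p @ q) \<phi>) x"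
    unfolding T_list_simps(2)
  proof (rule T_op_cong)
    show "T_list l \<phi> y = T_list (p @ q) \<phi> y" if "y \<in> orthant" for y
      by (rule Cons.IH) (use Cons.prems l' that in auto)
  qed (use Cons.prems in auto)
  also have "\<dots> = T_list l' \<phi> x"
    using T_list_move[OF \<phi> Cons.prems(2), of p i q] by (simp add: l')
  finally show ?case .
qed auto

text \<open>\<open>T_pow\<close> uses \<open>fold\<close>, which applies the head first;
  \<open>T_list\<close> uses \<open>foldr\<close>, which applies it last. Hence the
  reversal.\<close>

definition mi_list :: "'n::{finite,linorder} multi_index \<Rightarrow> 'n list" where
  "mi_list k = concat (map (\<lambda>i. replicate (k i) i) (rev (sorted_list_of_set UNIV)))"

lemma foldr_replicate_concat:
  "foldr (\<lambda>i. f i ^^ k i) xs = foldr f (concat (map (\<lambda>i. replicate (k i) i) xs))"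
proof (induction xs)
  case (Cons i xs)
  have "foldr f (replicate n i @ ys) z = (f i ^^ n) (foldr f ys z)" for n ys z
    by (induction n) auto
  with Cons show ?case by (auto simp: fun_eq_iff)
qed auto

lemma T_pow_eq_T_list: "T_pow k \<phi> = T_list (mi_list k) \<phi>"
  by (simp add: T_pow_def T_list_def mi_list_def foldr_conv_fold[of _ "rev _", simplified, symmetric]
      foldr_replicate_concat)

lemma count_mi_list: "count (mset (mi_list k)) i = k i"
proof -
  have "count (mset (concat (map (\<lambda>i. replicate (k i) i) xs))) j = (if j \<in> set xs then k j else 0)"
    if "distinct xs" for k :: "'a \<Rightarrow> nat" and xs j
    using that by (induction xs) auto
  then show ?thesis by (simp add: mi_list_def)
qed

lemma T_list_eq_T_pow:
  "Cinf_on orthant \<phi> \<Longrightarrow> x \<in> orthant \<Longrightarrow> T_list l \<phi> x = T_pow (\<lambda>i. count (mset l) i) \<phi> x"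
  unfolding T_pow_eq_T_list by (rule T_list_perm) (auto simp: count_mi_list intro!: multiset_eqI)

subsection \<open>The space \<open>Hmu \<mu>\<close> and its dual\<close>

text \<open>The function to which the seminorms apply \<open>T_pow\<close>. All estimates are made
  for it, and \<open>reduced_cancel\<close> recovers \<open>\<phi>\<close> on the orthant.\<close>

definition reduced :: "(real, 'n::finite) vec \<Rightarrow> 'n cfun \<Rightarrow> 'n cfun" where
  "reduced \<mu> \<phi> = (\<lambda>y. complex_of_real (vpowr y (\<chi> i. - (\<mu> $ i) - 1/2)) * \<phi> y)"

lemma Cinf_on_reduced: "Cinf_on orthant \<phi> \<Longrightarrow> Cinf_on orthant (reduced \<mu> \<phi>)"
  unfolding reduced_def by (intro Cinf_on_mult Cinf_on_vpowr) auto

lemma vpowr_reduced_eq: "(\<chi> i. - (\<mu> $ i) - 1/2) = - (\<chi> i. (\<mu> $ i :: real) + 1/2)"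
  by (simp add: vec_eq_iff)

lemma reduced_cancel:
  "x \<in> orthant \<Longrightarrow> complex_of_real (vpowr x (\<chi> i. \<mu> $ i + 1/2)) * reduced \<mu> \<phi> x = \<phi> x"
  using vpowr_pos[of x "\<chi> i. \<mu> $ i + 1/2"] unfolding reduced_def vpowr_reduced_eq vpowr_uminus by simp

lemma gamma_seminorm_le_iff:
  "0 \<le> C \<Longrightarrow> gamma_seminorm \<mu> m k \<phi> \<le> ennreal C \<longleftrightarrow>
    (\<forall>x\<in>orthant. (1 + (norm x)\<^sup>2) ^ m * cmod (T_list (mi_list k) (reduced \<mu> \<phi>) x) \<le> C)"
  unfolding gamma_seminorm_def SUP_le_iff T_pow_eq_T_list reduced_def[symmetric]
  by (simp add: norm_mult norm_power abs_of_nonneg del: of_real_add)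

lemma gamma_seminorm_finite_iff:
  "gamma_seminorm \<mu> m k \<phi> < \<infinity> \<longleftrightarrow>
    (\<exists>C. \<forall>x\<in>orthant. (1 + (norm x)\<^sup>2) ^ m * cmod (T_list (mi_list k) (reduced \<mu> \<phi>) x) \<le> C)"
proof
  assume "gamma_seminorm \<mu> m k \<phi> < \<infinity>"
  then obtain C where "0 \<le> C" "gamma_seminorm \<mu> m k \<phi> = ennreal C"
    by (cases "gamma_seminorm \<mu> m k \<phi>") auto
  then show "\<exists>C. \<forall>x\<in>orthant. (1 + (norm x)\<^sup>2) ^ m * cmod (T_list (mi_list k) (reduced \<mu> \<phi>) x) \<le> C"
    using gamma_seminorm_le_iff[of C \<mu> m k \<phi>] by auto
next
  assume "\<exists>C. \<forall>x\<in>orthant. (1 + (norm x)\<^sup>2) ^ m * cmod (T_list (mi_list k) (reduced \<mu> \<phi>) x) \<le> C"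
  then obtain C where "\<forall>x\<in>orthant. (1 + (norm x)\<^sup>2) ^ m * cmod (T_list (mi_list k) (reduced \<mu> \<phi>) x) \<le> C" by blast
  then have "gamma_seminorm \<mu> m k \<phi> \<le> ennreal (max 0 C)"
    by (subst gamma_seminorm_le_iff) (auto simp: le_max_iff_disj)
  then show "gamma_seminorm \<mu> m k \<phi> < \<infinity>" by (simp add: le_less_trans)
qed

lemma HmuI:
  assumes "Cinf_on orthant \<phi>" "\<And>x. x \<notin> orthant \<Longrightarrow> \<phi> x = 0"
    and "\<And>m l. \<exists>C. \<forall>x\<in>orthant. (1 + (norm x)\<^sup>2) ^ m * cmod (T_list l (reduced \<mu> \<phi>) x) \<le> C"
  shows "\<phi> \<in> Hmu \<mu>"
  using assms unfolding Hmu_def gamma_seminorm_finite_iff by auto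

text \<open>The bound is available for every list, not only for sorted ones, because on smooth
  functions a list of operators acts through its multiset.\<close>

lemma HmuD:
  assumes "\<phi> \<in> Hmu \<mu>"
  shows "Cinf_on orthant \<phi>" "x \<notin> orthant \<Longrightarrow> \<phi> x = 0"
    and "\<exists>C. \<forall>x\<in>orthant. (1 + (norm x)\<^sup>2) ^ m * cmod (T_list l (reduced \<mu> \<phi>) x) \<le> C"
proof -
  show c: "Cinf_on orthant \<phi>" and "x \<notin> orthant \<Longrightarrow> \<phi> x = 0" using assms by (auto simp: Hmu_def)
  have "\<exists>C. \<forall>x\<in>orthant. (1 + (norm x)\<^sup>2) ^ m * cmod (T_pow (\<lambda>i. count (mset l) i) (reduced \<mu> \<phi>) x) \<le> C"
    using assms unfolding Hmu_def gamma_seminorm_finite_iff T_pow_eq_T_list by blast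
  then show "\<exists>C. \<forall>x\<in>orthant. (1 + (norm x)\<^sup>2) ^ m * cmod (T_list l (reduced \<mu> \<phi>) x) \<le> C"
    using T_list_eq_T_pow[OF Cinf_on_reduced[OF c]] by auto
qed

lemma reduced_lincomb:
  "reduced \<mu> (\<lambda>x. a * \<phi> x + b * \<psi> x) = (\<lambda>x. a * reduced \<mu> \<phi> x + b * reduced \<mu> \<psi> x)"
  by (auto simp: reduced_def algebra_simps)

lemma Hmu_lincomb:
  assumes "\<phi> \<in> Hmu \<mu>" "\<psi> \<in> Hmu \<mu>"
  shows "(\<lambda>x. a * \<phi> x + b * \<psi> x) \<in> Hmu \<mu>"
proof (rule HmuI)
  fix m l
  obtain C where C: "\<And>x. x \<in> orthant \<Longrightarrow> (1 + (norm x)\<^sup>2) ^ m * cmod (T_list l (reduced \<mu> \<phi>) x) \<le> C"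
    using HmuD(3)[OF assms(1)] by blast
  obtain D where D: "\<And>x. x \<in> orthant \<Longrightarrow> (1 + (norm x)\<^sup>2) ^ m * cmod (T_list l (reduced \<mu> \<psi>) x) \<le> D"
    using HmuD(3)[OF assms(2)] by blast
  have "(1 + (norm x)\<^sup>2) ^ m * cmod (T_list l (reduced \<mu> (\<lambda>x. a * \<phi> x + b * \<psi> x)) x) \<le> cmod a * C + cmod b * D"
    if x: "x \<in> orthant" for x
  proof -
    let ?w = "(1 + (norm x)\<^sup>2) ^ m" and ?p = "T_list l (reduced \<mu> \<phi>) x" and ?q = "T_list l (reduced \<mu> \<psi>) x"
    have "T_list l (reduced \<mu> (\<lambda>x. a * \<phi> x + b * \<psi> x)) x = a * ?p + b * ?q"
      unfolding reduced_lincomb using HmuD(1)[OF assms(1)] HmuD(1)[OF assms(2)] x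
      by (intro T_list_lincomb Cinf_on_reduced)
    then have "cmod (T_list l (reduced \<mu> (\<lambda>x. a * \<phi> x + b * \<psi> x)) x) \<le> cmod a * cmod ?p + cmod b * cmod ?q"
      by (metis norm_mult norm_triangle_ineq)
    then have "?w * cmod (T_list l (reduced \<mu> (\<lambda>x. a * \<phi> x + b * \<psi> x)) x) \<le> ?w * (cmod a * cmod ?p + cmod b * cmod ?q)"
      by (rule mult_left_mono) auto
    also have "\<dots> = cmod a * (?w * cmod ?p) + cmod b * (?w * cmod ?q)" by (simp add: algebra_simps)
    also have "\<dots> \<le> cmod a * C + cmod b * D"
      by (intro add_mono mult_left_mono C D x) auto
    finally show ?thesis .
  qed
  then show "\<exists>C. \<forall>x\<in>orthant. (1 + (norm x)\<^sup>2) ^ m * cmod (T_list l (reduced \<mu> (\<lambda>x. a * \<phi> x + b * \<psi> x)) x) \<le> C"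
    by blast
qed (use HmuD(1,2)[OF assms(1)] HmuD(1,2)[OF assms(2)] in \<open>auto intro!: Cinf_on_add Cinf_on_cmult\<close>)

lemma T_list_zero: "x \<in> orthant \<Longrightarrow> T_list l (\<lambda>x. 0) x = 0"
  using T_list_lincomb[of "\<lambda>x. 0" "\<lambda>x. 0" x l 0 0] Cinf_on_const[OF open_orthant] by auto

lemma Hmu_zero: "(\<lambda>x. 0) \<in> Hmu \<mu>"
  by (rule HmuI) (auto simp: Cinf_on_const reduced_def T_list_zero)

lemma Hmu_cmult: "\<phi> \<in> Hmu \<mu> \<Longrightarrow> (\<lambda>x. c * \<phi> x) \<in> Hmu \<mu>"
  using Hmu_lincomb[OF _ Hmu_zero, of \<phi> \<mu> c 0] by simp

lemma Hmu_sum: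
  "finite A \<Longrightarrow> (\<And>a. a \<in> A \<Longrightarrow> \<phi> a \<in> Hmu \<mu>) \<Longrightarrow> (\<lambda>x. \<Sum>a\<in>A. \<phi> a x) \<in> Hmu \<mu>"
proof (induction rule: finite_induct)
  case (insert a A)
  then show ?case using Hmu_lincomb[of "\<phi> a" \<mu> "\<lambda>x. \<Sum>a\<in>A. \<phi> a x" 1 1] by simp
qed (simp add: Hmu_zero)

text \<open>The algebraic half of membership in the dual. The functional built from moments that is
  compared with \<open>f\<close> is used through its linearity and explicit bounds, without its
  continuity as a map of topological spaces.\<close>

definition Hmu_linear :: "(real, 'n::{finite,linorder}) vec \<Rightarrow> 'n functional \<Rightarrow> bool" where
  "Hmu_linear \<mu> f \<longleftrightarrow> (\<forall>\<phi>\<in>Hmu \<mu>. \<forall>\<psi>\<in>Hmu \<mu>. f (\<lambda>x. \<phi> x + \<psi> x) = f \<phi> + f \<psi>) \<and>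
     (\<forall>c. \<forall>\<phi>\<in>Hmu \<mu>. f (\<lambda>x. c * \<phi> x) = c * f \<phi>)"

lemma Hmu_linear_lincomb:
  assumes "Hmu_linear \<mu> f" "\<phi> \<in> Hmu \<mu>" "\<psi> \<in> Hmu \<mu>"
  shows "f (\<lambda>x. a * \<phi> x + b * \<psi> x) = a * f \<phi> + b * f \<psi>"
  using assms Hmu_cmult[OF assms(2), of a] Hmu_cmult[OF assms(3), of b] unfolding Hmu_linear_def by simp

lemma Hmu_linear_zero: "Hmu_linear \<mu> f \<Longrightarrow> f (\<lambda>x. 0) = 0"
  using Hmu_linear_lincomb[OF _ Hmu_zero Hmu_zero, of \<mu> f 0 0] by simp

lemma Hmu_linear_sum:
  assumes "Hmu_linear \<mu> f"
  shows "finite A \<Longrightarrow> (\<And>a. a \<in> A \<Longrightarrow> \<phi> a \<in> Hmu \<mu>) \<Longrightarrow>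
    f (\<lambda>x. \<Sum>a\<in>A. c a * \<phi> a x) = (\<Sum>a\<in>A. c a * f (\<phi> a))"
proof (induction rule: finite_induct)
  case (insert a A)
  have "(\<lambda>x. \<Sum>a\<in>A. c a * \<phi> a x) \<in> Hmu \<mu>"
    using insert by (intro Hmu_sum Hmu_cmult) auto
  then show ?case
    using insert Hmu_linear_lincomb[OF assms, of "\<phi> a" "\<lambda>x. \<Sum>a\<in>A. c a * \<phi> a x" "c a" 1] by simp
qed (simp add: Hmu_linear_zero[OF assms])

section \<open>Continuity of functionals in terms of finitely many seminorms\<close>

lemma gamma_seminorm_triangle:
  assumes "\<phi> \<in> Hmu \<mu>" "\<psi> \<in> Hmu \<mu>"
  shows "gamma_seminorm \<mu> m k (\<lambda>x. \<phi> x + \<psi> x) \<le> gamma_seminorm \<mu> m k \<phi> + gamma_seminorm \<mu> m k \<psi>"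
proof -
  have "gamma_seminorm \<mu> m k \<phi> < \<infinity>" "gamma_seminorm \<mu> m k \<psi> < \<infinity>" using assms by (auto simp: Hmu_def)
  then obtain A B where A: "0 \<le> A" "gamma_seminorm \<mu> m k \<phi> = ennreal A"
    and B: "0 \<le> B" "gamma_seminorm \<mu> m k \<psi> = ennreal B"
    by (cases "gamma_seminorm \<mu> m k \<phi>"; cases "gamma_seminorm \<mu> m k \<psi>") auto
  have a: "\<And>x. x \<in> orthant \<Longrightarrow> (1 + (norm x)\<^sup>2) ^ m * cmod (T_list (mi_list k) (reduced \<mu> \<phi>) x) \<le> A"
    using gamma_seminorm_le_iff[OF A(1), of \<mu> m k \<phi>] A(2) by simp
  have b: "\<And>x. x \<in> orthant \<Longrightarrow> (1 + (norm x)\<^sup>2) ^ m * cmod (T_list (mi_list k) (reduced \<mu> \<psi>) x) \<le> B"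
    using gamma_seminorm_le_iff[OF B(1), of \<mu> m k \<psi>] B(2) by simp
  have "gamma_seminorm \<mu> m k (\<lambda>x. \<phi> x + \<psi> x) \<le> ennreal (A + B)"
  proof (subst gamma_seminorm_le_iff, goal_cases)
    case 2
    show ?case
    proof (rule ballI, goal_cases)
      case (1 x)
      note x = 1
      let ?w = "(1 + (norm x)\<^sup>2) ^ m" and ?p = "T_list (mi_list k) (reduced \<mu> \<phi>) x" and ?q = "T_list (mi_list k) (reduced \<mu> \<psi>) x"
      have "T_list (mi_list k) (reduced \<mu> (\<lambda>x. \<phi> x + \<psi> x)) x = ?p + ?q"
        using T_list_lincomb[OF Cinf_on_reduced[OF HmuD(1)[OF assms(1)], of \<mu>]
            Cinf_on_reduced[OF HmuD(1)[OF assms(2)], of \<mu>] x, of "mi_list k" 1 1]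
          reduced_lincomb[of \<mu> 1 \<phi> 1 \<psi>] by simp
      then have "?w * cmod (T_list (mi_list k) (reduced \<mu> (\<lambda>x. \<phi> x + \<psi> x)) x) \<le> ?w * (cmod ?p + cmod ?q)"
        by (simp add: norm_triangle_ineq mult_left_mono)
      also have "\<dots> \<le> A + B" using a[OF x] b[OF x] by (simp add: algebra_simps)
      finally show ?case .
    qed
  qed (use A B in auto)
  then show ?thesis using A B by (simp add: ennreal_plus)
qed

text \<open>The generating sets are balls of single seminorms around arbitrary centres. By induction
  over the generation of the topology, every open set around \<open>\<phi>0\<close> contains a
  finite intersection of balls centred at \<open>\<phi>0\<close> itself; the triangle inequality
  moves the centre.\<close>

lemma Hmu_topology_neighbourhood:
  assumes "generate_topology_on {{\<psi> \<in> Hmu \<mu>. gamma_seminorm \<mu> m k (\<lambda>x. \<psi> x - \<phi> x) < ennreal \<epsilon>} | m k \<phi> \<epsilon>.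
        \<phi> \<in> Hmu \<mu> \<and> 0 < \<epsilon>} U" (is "generate_topology_on ?S U")
    and "\<phi>0 \<in> U" "\<phi>0 \<in> Hmu \<mu>"
  shows "\<exists>F \<delta>. finite F \<and> 0 < \<delta> \<and>
    (\<forall>\<psi>\<in>Hmu \<mu>. (\<forall>(m,k)\<in>F. gamma_seminorm \<mu> m k (\<lambda>x. \<psi> x - \<phi>0 x) \<le> ennreal \<delta>) \<longrightarrow> \<psi> \<in> U)"
  using assms
proof (induction rule: generate_topology_on.induct)
  case (Int a b)
  then have "\<phi>0 \<in> a" "\<phi>0 \<in> b" by auto
  from Int.IH(1)[OF this(1) Int.prems(2)] obtain F \<delta> where F: "finite F" "0 < \<delta>"
    "\<And>\<psi>. \<psi> \<in> Hmu \<mu> \<Longrightarrow> (\<forall>(m,k)\<in>F. gamma_seminorm \<mu> m k (\<lambda>x. \<psi> x - \<phi>0 x) \<le> ennreal \<delta>) \<Longrightarrow> \<psi> \<in> a"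
    by blast
  from Int.IH(2)[OF \<open>\<phi>0 \<in> b\<close> Int.prems(2)] obtain G \<epsilon> where G: "finite G" "0 < \<epsilon>"
    "\<And>\<psi>. \<psi> \<in> Hmu \<mu> \<Longrightarrow> (\<forall>(m,k)\<in>G. gamma_seminorm \<mu> m k (\<lambda>x. \<psi> x - \<phi>0 x) \<le> ennreal \<epsilon>) \<Longrightarrow> \<psi> \<in> b"
    by blast
  have le: "ennreal (min \<delta> \<epsilon>) \<le> ennreal \<delta>" "ennreal (min \<delta> \<epsilon>) \<le> ennreal \<epsilon>"
    by (auto intro: ennreal_leI)
  show ?case
  proof (intro exI[of _ "F \<union> G"] exI[of _ "min \<delta> \<epsilon>"] conjI ballI impI IntI)
    fix \<psi> assume \<psi>: "\<psi> \<in> Hmu \<mu>" "\<forall>(m,k)\<in>F \<union> G. gamma_seminorm \<mu> m k (\<lambda>x. \<psi> x - \<phi>0 x) \<le> ennreal (min \<delta> \<epsilon>)"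
    have "gamma_seminorm \<mu> m k (\<lambda>x. \<psi> x - \<phi>0 x) \<le> ennreal (min \<delta> \<epsilon>)" if "(m, k) \<in> F \<union> G" for m k
      using \<psi>(2) that by blast
    note le' = order_trans[OF this le(1)] order_trans[OF this le(2)]
    show "\<psi> \<in> a" by (rule F(3)[OF \<psi>(1)]) (use le'(1) in blast)
    show "\<psi> \<in> b" by (rule G(3)[OF \<psi>(1)]) (use le'(2) in blast)
  qed (use F G in auto)
next
  case (UN K)
  then obtain V where V: "V \<in> K" "\<phi>0 \<in> V" by blast
  from UN.IH[OF V UN.prems(2)] obtain F \<delta> where F: "finite F" "0 < \<delta>"
    "\<And>\<psi>. \<psi> \<in> Hmu \<mu> \<Longrightarrow> (\<forall>(m,k)\<in>F. gamma_seminorm \<mu> m k (\<lambda>x. \<psi> x - \<phi>0 x) \<le> ennreal \<delta>) \<Longrightarrow> \<psi> \<in> V"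
    by blast
  show ?case by (rule exI[of _ F], rule exI[of _ \<delta>]) (use F V(1) in blast)
next
  case (Basis s)
  then obtain m k \<phi> \<epsilon> where s: "s = {\<psi> \<in> Hmu \<mu>. gamma_seminorm \<mu> m k (\<lambda>x. \<psi> x - \<phi> x) < ennreal \<epsilon>}"
    "\<phi> \<in> Hmu \<mu>" "0 < \<epsilon>" by blast
  then have lt: "gamma_seminorm \<mu> m k (\<lambda>x. \<phi>0 x - \<phi> x) < ennreal \<epsilon>" using Basis by blast
  then obtain A where A: "0 \<le> A" "gamma_seminorm \<mu> m k (\<lambda>x. \<phi>0 x - \<phi> x) = ennreal A"
    by (cases "gamma_seminorm \<mu> m k (\<lambda>x. \<phi>0 x - \<phi> x)") auto
  then have "A < \<epsilon>" using lt by (simp add: ennreal_less_iff)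
  \<comment> \<open>Only half of the slack is used, since \<open>\<le> \<delta>\<close> is allowed
    for \<open>\<psi>\<close> while the generating set demands a strict inequality.\<close>
  define \<delta> where "\<delta> = (\<epsilon> - A) / 2"
  have \<delta>: "0 < \<delta>" "A + \<delta> < \<epsilon>" using \<open>A < \<epsilon>\<close> by (auto simp: \<delta>_def field_simps)
  have diff: "(\<lambda>x. \<phi>1 x - \<phi>2 x) \<in> Hmu \<mu>" if "\<phi>1 \<in> Hmu \<mu>" "\<phi>2 \<in> Hmu \<mu>" for \<phi>1 \<phi>2
    using Hmu_lincomb[OF that, of 1 "-1"] by simp
  have "\<psi> \<in> s" if \<psi>: "\<psi> \<in> Hmu \<mu>" "gamma_seminorm \<mu> m k (\<lambda>x. \<psi> x - \<phi>0 x) \<le> ennreal \<delta>" for \<psi>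
  proof -
    have "gamma_seminorm \<mu> m k (\<lambda>x. (\<psi> x - \<phi>0 x) + (\<phi>0 x - \<phi> x)) \<le>
        gamma_seminorm \<mu> m k (\<lambda>x. \<psi> x - \<phi>0 x) + gamma_seminorm \<mu> m k (\<lambda>x. \<phi>0 x - \<phi> x)"
      by (intro gamma_seminorm_triangle diff \<psi>(1) Basis.prems(2) s(2))
    also have "\<dots> \<le> ennreal \<delta> + ennreal A" using \<psi>(2) A(2) by (intro add_mono) auto
    also have "\<dots> = ennreal (\<delta> + A)" using \<delta> A by (simp add: ennreal_plus)
    also have "\<dots> < ennreal \<epsilon>" using \<delta> A(1) by (intro ennreal_lessI) auto
    finally show ?thesis using \<psi> s by simp
  qed
  then show ?case using \<delta>(1) by (intro exI[of _ "{(m,k)}"] exI[of _ \<delta>]) auto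
qed auto

text \<open>The preimage of the unit ball is a neighbourhood of 0. This is the only form in which
  continuity of \<open>f\<close> enters, and the finite set \<open>F\<close> later determines how
  many zeros and how many derivatives have to be controlled.\<close>

lemma Hmu_dual_bound:
  assumes "f \<in> Hmu_dual \<mu>"
  obtains F \<delta> where "finite F" "0 < \<delta>"
    "\<And>\<psi>. \<psi> \<in> Hmu \<mu> \<Longrightarrow> (\<forall>(m,k)\<in>F. gamma_seminorm \<mu> m k \<psi> \<le> ennreal \<delta>) \<Longrightarrow> cmod (f \<psi>) < 1"
proof -
  have lin: "Hmu_linear \<mu> f" using assms by (auto simp: Hmu_dual_def Hmu_linear_def)
  have "continuous_map (Hmu_topology \<mu>) euclidean f" using assms by (auto simp: Hmu_dual_def)
  then have op: "openin (Hmu_topology \<mu>) {x \<in> topspace (Hmu_topology \<mu>). f x \<in> ball 0 1}" (is "openin _ ?U")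
    by (rule openin_continuous_map_preimage) simp
  have z: "(\<lambda>x. 0) \<in> topspace (Hmu_topology \<mu>)"
  proof -
    have "(\<lambda>x. 0) \<in> {\<psi> \<in> Hmu \<mu>. gamma_seminorm \<mu> 0 (\<lambda>_. 0) (\<lambda>x. \<psi> x - 0) < ennreal 1}"
      using Hmu_zero[of \<mu>] gamma_seminorm_le_iff[of 0 \<mu> 0 "\<lambda>_. 0" "\<lambda>x. 0"]
      by (auto simp: reduced_def T_list_zero)
    then show ?thesis
      unfolding Hmu_topology_def topology_generated_by_topspace
      using Hmu_zero[of \<mu>] zero_less_one by blast
  qed
  have "\<exists>F \<delta>. finite F \<and> 0 < \<delta> \<and>
    (\<forall>\<psi>\<in>Hmu \<mu>. (\<forall>(m,k)\<in>F. gamma_seminorm \<mu> m k (\<lambda>x. \<psi> x - 0) \<le> ennreal \<delta>) \<longrightarrow> \<psi> \<in> ?U)"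
    by (rule Hmu_topology_neighbourhood)
       (use op z Hmu_zero Hmu_linear_zero[OF lin] in \<open>auto simp: Hmu_topology_def openin_topology_generated_by_iff\<close>)
  then obtain F \<delta> where F: "finite F" "0 < \<delta>"
    "\<forall>\<psi>\<in>Hmu \<mu>. (\<forall>(m,k)\<in>F. gamma_seminorm \<mu> m k (\<lambda>x. \<psi> x - 0) \<le> ennreal \<delta>) \<longrightarrow> \<psi> \<in> ?U" by blast
  show ?thesis
    by (rule that[OF F(1,2)]) (use F(3) in auto)
qed

subsection \<open>The Hankel kernel\<close>

lemma powr_mult_power:
  fixes t :: real
  shows "t > 0 \<Longrightarrow> t ^ j * t powr a = t powr (a + real j)" and "t > 0 \<Longrightarrow> t * t powr a = t powr (a + 1)"
  by (simp_all add: powr_add powr_realpow)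

text \<open>A ratio bound of order \<open>1 / (j + 1)\<close> compares the series with the
  exponential series. It covers the Bessel series as well as the series of
  \<open>lag\<close>.\<close>

lemma factorial_decay:
  fixes c :: "nat \<Rightarrow> real"
  assumes "\<And>j. \<bar>c (Suc j)\<bar> \<le> K / real (Suc j) * \<bar>c j\<bar>" "0 \<le> K"
  shows "\<bar>c j\<bar> \<le> \<bar>c 0\<bar> * (K ^ j / fact j)"
proof (induction j)
  case (Suc j)
  have "\<bar>c (Suc j)\<bar> \<le> K / real (Suc j) * (\<bar>c 0\<bar> * (K ^ j / fact j))"
    by (rule order_trans[OF assms(1) mult_left_mono[OF Suc]]) (use assms(2) in auto)
  then show ?case by (simp add: field_simps)
qed simp

lemma summable_factorial_decay:
  fixes c :: "nat \<Rightarrow> real"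
  assumes "\<And>j. \<bar>c (Suc j)\<bar> \<le> K / real (Suc j) * \<bar>c j\<bar>" "0 \<le> K"
  shows "summable (\<lambda>j. \<bar>c j * x ^ j\<bar>)" "summable (\<lambda>j. c j * x ^ j)"
proof -
  have "summable (\<lambda>j. \<bar>c 0\<bar> * ((K * \<bar>x\<bar>) ^ j / fact j))"
    using summable_exp[of "K * \<bar>x\<bar>"] by (intro summable_mult) (simp add: field_simps)
  moreover have "norm (\<bar>c j * x ^ j\<bar>) \<le> \<bar>c 0\<bar> * ((K * \<bar>x\<bar>) ^ j / fact j)" for j
    using mult_right_mono[OF factorial_decay[OF assms], of "\<bar>x\<bar> ^ j" j]
    by (simp add: abs_mult power_abs power_mult_distrib)
  ultimately show *: "summable (\<lambda>j. \<bar>c j * x ^ j\<bar>)"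
    by (rule summable_comparison_test'[where N=0])
  show "summable (\<lambda>j. c j * x ^ j)" using summable_norm_cancel[of "\<lambda>j. c j * x ^ j"] * by simp
qed

text \<open>With \<open>u = x\<^sup>2\<close> and \<open>v = y\<^sup>2 / 4\<close> the Hankel kernel \<open>(xy)\<^bsup>-\<nu>\<^esup> J\<^sub>\<nu>(xy)\<close> is, up to a constant,
  the value of the following entire function at \<open>uv\<close>.\<close>

definition bessel_coeff :: "real \<Rightarrow> nat \<Rightarrow> real" where
  "bessel_coeff \<nu> j = (-1) ^ j / (fact j * Gamma (\<nu> + real j + 1))"

definition bessel :: "real \<Rightarrow> real \<Rightarrow> real" where
  "bessel \<nu> w = (\<Sum>j. bessel_coeff \<nu> j * w ^ j)"

lemma bessel_coeff_shift:
  assumes "-1/2 \<le> \<nu>"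
  shows "bessel_coeff \<nu> j = (\<nu> + real j + 1) * bessel_coeff (\<nu> + 1) j"
proof -
  have "\<nu> + real j + 1 > 0" using assms by simp
  then have "Gamma (\<nu> + real j + 1 + 1) = (\<nu> + real j + 1) * Gamma (\<nu> + real j + 1)"
    by (intro Gamma_plus1) (metis less_irrefl nonpos_Ints_nonpos not_le)
  moreover have "Gamma (\<nu> + 1 + real j + 1) = Gamma (\<nu> + real j + 1 + 1)" by (simp add: algebra_simps)
  ultimately have "Gamma (\<nu> + 1 + real j + 1) = (\<nu> + real j + 1) * Gamma (\<nu> + real j + 1)" by simp
  then show ?thesis using \<open>\<nu> + real j + 1 > 0\<close>
    unfolding bessel_coeff_def by simp
qed

lemma bessel_coeff_diffs: "diffs (bessel_coeff \<nu>) j = - bessel_coeff (\<nu> + 1) j"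
proof -
  have "real (Suc j) * ((-1) ^ Suc j / fact (Suc j)) = - ((-1) ^ j / fact j :: real)"
    by (simp del: of_nat_Suc)
  moreover have "\<nu> + real (Suc j) + 1 = \<nu> + 1 + real j + 1" by simp
  moreover have "bessel_coeff \<nu> j = (-1) ^ j / fact j * (1 / Gamma (\<nu> + real j + 1))" for \<nu> j
    by (simp add: bessel_coeff_def)
  ultimately show ?thesis unfolding diffs_def by (simp only: mult.assoc[symmetric] mult_minus_left)
qed

text \<open>The ratio constant 2 reflects \<open>\<nu> + j + 1 \<ge> 1/2\<close>.\<close>

lemma bessel_summable:
  assumes "-1/2 \<le> \<nu>"
  shows "summable (\<lambda>j. \<bar>bessel_coeff \<nu> j * w ^ j\<bar>)" "summable (\<lambda>j. bessel_coeff \<nu> j * w ^ j)"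
proof -
  have "\<bar>bessel_coeff \<nu> (Suc j)\<bar> \<le> 2 / real (Suc j) * \<bar>bessel_coeff \<nu> j\<bar>" for j
  proof -
    have p: "\<nu> + real j + 1 \<ge> 1/2" using assms by simp
    have "real (Suc j) * bessel_coeff \<nu> (Suc j) = - bessel_coeff (\<nu> + 1) j"
      using bessel_coeff_diffs[of \<nu> j] by (simp add: diffs_def)
    then have "\<bar>bessel_coeff (\<nu> + 1) j\<bar> = real (Suc j) * \<bar>bessel_coeff \<nu> (Suc j)\<bar>"
      by (metis abs_minus_cancel abs_mult abs_of_nat)
    moreover have "\<bar>bessel_coeff (\<nu> + 1) j\<bar> \<le> 2 * \<bar>bessel_coeff \<nu> j\<bar>"
    proof -
      have "\<bar>bessel_coeff \<nu> j\<bar> = (\<nu> + real j + 1) * \<bar>bessel_coeff (\<nu> + 1) j\<bar>"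
        using p by (simp add: bessel_coeff_shift[OF assms] abs_mult)
      moreover have "1/2 * \<bar>bessel_coeff (\<nu> + 1) j\<bar> \<le> (\<nu> + real j + 1) * \<bar>bessel_coeff (\<nu> + 1) j\<bar>"
        by (rule mult_right_mono[OF p]) simp
      ultimately show ?thesis by linarith
    qed
    ultimately show ?thesis by (simp add: field_simps)
  qed
  from summable_factorial_decay[OF this] show "summable (\<lambda>j. \<bar>bessel_coeff \<nu> j * w ^ j\<bar>)"
    "summable (\<lambda>j. bessel_coeff \<nu> j * w ^ j)" by auto
qed

lemma bessel_deriv:
  assumes "-1/2 \<le> \<nu>"
  shows "(bessel \<nu> has_real_derivative - bessel (\<nu> + 1) w) (at w)"
proof -
  have "((\<lambda>x. \<Sum>n. bessel_coeff \<nu> n * x^n) has_real_derivative (\<Sum>n. diffs (bessel_coeff \<nu>) n * w^n)) (at w)"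
    by (rule termdiffs_strong_converges_everywhere) (rule bessel_summable[OF assms])
  moreover have "(\<Sum>n. diffs (bessel_coeff \<nu>) n * w^n) = - bessel (\<nu> + 1) w"
    unfolding bessel_coeff_diffs bessel_def using bessel_summable(2)[of "\<nu> + 1" w] assms
    by (simp add: suminf_minus)
  ultimately show ?thesis unfolding bessel_def[abs_def] by simp
qed

text \<open>Split the factor in \<open>bessel_coeff_shift\<close>: the part \<open>\<nu> + 1\<close>
  gives the first term, and the part \<open>j\<close> gives \<open>w\<close> times the derivative of
  \<open>bessel (\<nu> + 1)\<close>. This is the three-term recurrence of Bessel functions in the
  variable \<open>w\<close>.\<close>

lemma bessel_recurrence:
  assumes "-1/2 \<le> \<nu>"
  shows "bessel \<nu> w = (\<nu> + 1) * bessel (\<nu> + 1) w - w * bessel (\<nu> + 2) w"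
proof -
  have \<nu>1: "-1/2 \<le> \<nu> + 1" "-1/2 \<le> \<nu> + 1 + 1" using assms by auto
  let ?c = "bessel_coeff (\<nu> + 1)"
  have d: "(\<lambda>n. diffs ?c n * w ^ n) sums (- bessel (\<nu> + 2) w)"
    unfolding bessel_coeff_diffs bessel_def
    using sums_minus[OF summable_sums[OF bessel_summable(2)[OF \<nu>1(2), of w]]] by (simp add: add.assoc)
  have "(\<lambda>n. of_nat n * ?c n * w ^ (n - Suc 0)) sums (\<Sum>n. diffs ?c n * w ^ n)"
    by (rule diffs_equiv) (use d sums_summable in blast)
  then have "(\<lambda>n. of_nat n * ?c n * w ^ (n - Suc 0)) sums (- bessel (\<nu> + 2) w)"
    using sums_unique[OF d] by simp
  from sums_mult[OF this, of w]
  have "(\<lambda>n. w * (of_nat n * ?c n * w ^ (n - Suc 0))) sums (- (w * bessel (\<nu> + 2) w))" by simp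
  moreover have "w * (of_nat n * ?c n * w ^ (n - Suc 0)) = of_nat n * ?c n * w ^ n" for n
    by (cases n) auto
  ultimately have "(\<lambda>n. of_nat n * ?c n * w ^ n) sums (- (w * bessel (\<nu> + 2) w))" by simp
  moreover have "(\<lambda>n. (\<nu> + 1) * (?c n * w ^ n)) sums ((\<nu> + 1) * bessel (\<nu> + 1) w)"
    unfolding bessel_def by (intro sums_mult summable_sums bessel_summable \<nu>1)
  ultimately have "(\<lambda>n. (\<nu> + 1) * (?c n * w ^ n) + of_nat n * ?c n * w ^ n) sums
      ((\<nu> + 1) * bessel (\<nu> + 1) w + - (w * bessel (\<nu> + 2) w))"
    using sums_add by blast
  moreover have "(\<nu> + 1) * (?c n * w ^ n) + of_nat n * ?c n * w ^ n = bessel_coeff \<nu> n * w ^ n" for n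
    unfolding bessel_coeff_shift[OF assms] by (simp add: algebra_simps)
  ultimately show ?thesis unfolding bessel_def[of \<nu>] using sums_unique by fastforce
qed

lemma bessel_0: "bessel \<nu> 0 = 1 / Gamma (\<nu> + 1)"
proof -
  have "(\<lambda>j. bessel_coeff \<nu> j * 0 ^ j) sums (bessel_coeff \<nu> 0)"
    using sums_If_finite_set[of "{0}" "\<lambda>j. bessel_coeff \<nu> j"]
    by (simp add: power_0_left if_distrib cong: if_cong)
  then show ?thesis unfolding bessel_def using sums_unique by (fastforce simp: bessel_coeff_def)
qed

text \<open>The energy \<open>(bessel \<nu> w)\<^sup>2 + w (bessel (\<nu> + 1) w)\<^sup>2\<close> has derivative
  \<open>- (2\<nu> + 1) (bessel (\<nu> + 1) w)\<^sup>2\<close>.\<close>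

lemma bessel_bounded:
  assumes "-1/2 \<le> \<nu>" "0 \<le> w"
  shows "\<bar>bessel \<nu> w\<bar> \<le> 1 / Gamma (\<nu> + 1)"
proof -
  have \<nu>1: "-1/2 \<le> \<nu> + 1" using assms by auto
  define E where "E = (\<lambda>w. (bessel \<nu> w)\<^sup>2 + w * (bessel (\<nu> + 1) w)\<^sup>2)"
  have "E w \<le> E 0"
  proof (rule DERIV_nonpos_imp_nonincreasing[OF assms(2)])
    fix x :: real
    let ?P = "bessel \<nu> x" and ?Q = "bessel (\<nu> + 1) x" and ?R = "bessel (\<nu> + 2) x"
    have "(bessel (\<nu> + 1) has_real_derivative - ?R) (at x)"
      using bessel_deriv[OF \<nu>1, of x] by (simp add: add.assoc)
    then have "(E has_real_derivative 2 * ?P * (- ?Q) + (?Q\<^sup>2 + x * (2 * ?Q * (- ?R)))) (at x)"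
      unfolding E_def by (auto intro!: derivative_eq_intros bessel_deriv[OF assms(1)] simp: power2_eq_square)
    moreover have "2 * ?P * (- ?Q) + (?Q\<^sup>2 + x * (2 * ?Q * (- ?R))) = - (2 * \<nu> + 1) * ?Q\<^sup>2"
      unfolding bessel_recurrence[OF assms(1)] by (simp add: algebra_simps power2_eq_square)
    \<comment> \<open>The monotonicity of the energy rests on
      \<open>-1/2 \<le> \<nu>\<close>.\<close>
    moreover have "- (2 * \<nu> + 1) * ?Q\<^sup>2 \<le> 0"
      by (rule mult_nonpos_nonneg) (use assms(1) in auto)
    ultimately show "\<exists>y. (E has_real_derivative y) (at x) \<and> y \<le> 0" by metis
  qed
  moreover have "(bessel \<nu> w)\<^sup>2 \<le> E w" unfolding E_def using assms(2) by simp
  ultimately have "(bessel \<nu> w)\<^sup>2 \<le> (1 / Gamma (\<nu> + 1))\<^sup>2" by (simp add: E_def bessel_0)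
  moreover have "1 / Gamma (\<nu> + 1) \<ge> 0" using Gamma_real_pos[of "\<nu> + 1"] assms by simp
  ultimately show ?thesis by (metis abs_le_square_iff abs_of_nonneg)
qed

section \<open>Gamma integrals and the one-dimensional transform of
  \<open>v^k exp (- t v)\<close>\<close>

lemma Gamma_has_bochner_integral:
  fixes a t :: real
  assumes "a > -1" "t > 0"
  shows "has_bochner_integral lborel (\<lambda>v. indicator {0<..} v * (v powr a * exp (- (t * v))))
    (Gamma (a + 1) * t powr - (a + 1))"
proof -
  let ?f = "\<lambda>v. indicator {0<..} v * (v powr a * exp (- v)) :: real"
  have "?f v = indicator {0..} v * v powr (a + 1 - 1) / exp v" for v
    by (auto simp: indicator_def exp_minus field_simps)
  then have "(\<integral>\<^sup>+v. ennreal (?f v) \<partial>lborel) = ennreal (Gamma (a + 1))"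
    using Gamma_conv_nn_integral_real[of "a + 1"] assms by simp
  then have 1: "has_bochner_integral lborel ?f (Gamma (a + 1))"
    by (intro has_bochner_integral_nn_integral) (use assms Gamma_real_pos[of "a + 1"] in \<open>auto intro!: less_imp_le\<close>)
  have "has_bochner_integral lborel (\<lambda>v. ?f (0 + t * v)) (Gamma (a + 1) /\<^sub>R \<bar>t\<bar>)"
    using assms 1 by (subst lborel_has_bochner_integral_real_affine_iff[symmetric]) auto
  from has_bochner_integral_mult_right[OF this, of "t powr - a"]
  have "has_bochner_integral lborel (\<lambda>v. t powr - a * ?f (0 + t * v)) (t powr - a * (Gamma (a + 1) /\<^sub>R \<bar>t\<bar>))" .
  moreover have "t powr - a * ?f (0 + t * v) = indicator {0<..} v * (v powr a * exp (- (t * v)))" for v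
    using assms by (auto simp: indicator_def powr_mult powr_minus zero_less_mult_iff field_simps)
  moreover have "t powr - a * (Gamma (a + 1) /\<^sub>R \<bar>t\<bar>) = Gamma (a + 1) * t powr - (a + 1)"
    using assms powr_mult_power(2)[of t "- (a + 1)"] by (simp add: field_simps)
  ultimately show ?thesis by (simp only:)
qed

text \<open>\<open>lag \<nu> k t\<close> is the one-dimensional Hankel transform of \<open>v\<^sup>k e\<^bsup>-tv\<^esup>\<close>, expanded termwise.\<close>

definition lag_coeff :: "real \<Rightarrow> nat \<Rightarrow> real \<Rightarrow> nat \<Rightarrow> real" where
  "lag_coeff \<nu> k t j = (-1) ^ j / fact j * pochhammer (\<nu> + real j + 1) k * t powr - (\<nu> + real k + real j + 1)"

definition lag :: "real \<Rightarrow> nat \<Rightarrow> real \<Rightarrow> real \<Rightarrow> real" where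
  "lag \<nu> k t u = (\<Sum>j. lag_coeff \<nu> k t j * u ^ j)"

lemma lag_coeff_diffs: "diffs (lag_coeff \<nu> k t) j = - lag_coeff (\<nu> + 1) k t j"
proof -
  have "real (Suc j) * ((-1) ^ Suc j / fact (Suc j)) = - ((-1) ^ j / fact j :: real)"
    by (simp del: of_nat_Suc)
  moreover have "\<nu> + real (Suc j) + 1 = \<nu> + 1 + real j + 1"
    "\<nu> + real k + real (Suc j) + 1 = \<nu> + 1 + real k + real j + 1" by simp_all
  ultimately show ?thesis unfolding diffs_def lag_coeff_def by (simp only: mult.assoc[symmetric] mult_minus_left)
qed

lemma lag_summable:
  assumes "-1/2 \<le> \<nu>" "t > 0"
  shows "summable (\<lambda>j. \<bar>lag_coeff \<nu> k t j * w ^ j\<bar>)" "summable (\<lambda>j. lag_coeff \<nu> k t j * w ^ j)"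
proof -
  \<comment> \<open>The factor \<open>1 + 2 k\<close> bounds the quotient
    \<open>(?a + k) / ?a\<close> of consecutive Pochhammer symbols, because
    \<open>?a \<ge> 1/2\<close>; the factor \<open>1 / t\<close> comes from the power of
    \<open>t\<close>.\<close>
  let ?K = "(1 + 2 * real k) / t"
  have "\<bar>lag_coeff \<nu> k t (Suc j)\<bar> \<le> ?K / real (Suc j) * \<bar>lag_coeff \<nu> k t j\<bar>" for j
  proof -
    let ?a = "\<nu> + real j + 1"
    have p: "?a \<ge> 1/2" using assms by simp
    have pp: "pochhammer ?a k > 0" "pochhammer (?a + 1) k > 0" using p by (auto intro!: pochhammer_pos)
    have "?a * pochhammer (?a + 1) k = (?a + real k) * pochhammer ?a k"
      using pochhammer_rec[of ?a k] pochhammer_rec'[of ?a k] by (simp add: mult_ac)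
    moreover have "?a + real k \<le> (1 + 2 * real k) * ?a"
      using mult_left_mono[OF p, of "2 * real k"] by (simp add: algebra_simps)
    ultimately have "?a * pochhammer (?a + 1) k \<le> ?a * ((1 + 2 * real k) * pochhammer ?a k)"
      using pp mult_right_mono[of "?a + real k" "(1 + 2 * real k) * ?a" "pochhammer ?a k"] by (simp add: mult_ac)
    then have poch: "pochhammer (?a + 1) k \<le> (1 + 2 * real k) * pochhammer ?a k"
      using p by (subst (asm) mult_le_cancel_left_pos) auto
    have pw: "t powr - (\<nu> + real k + real (Suc j) + 1) = t powr - (\<nu> + real k + real j + 1) / t"
      using assms(2) powr_mult_power(2)[of t "- (\<nu> + real k + real (Suc j) + 1)"] by (simp add: field_simps)
    have "\<bar>lag_coeff \<nu> k t (Suc j)\<bar> = pochhammer (?a + 1) k * (t powr - (\<nu> + real k + real j + 1) / t / fact (Suc j))"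
      unfolding lag_coeff_def pw using pp assms(2) by (simp add: abs_mult power_abs add_ac)
    also have "\<dots> \<le> (1 + 2 * real k) * pochhammer ?a k * (t powr - (\<nu> + real k + real j + 1) / t / fact (Suc j))"
      by (rule mult_right_mono[OF poch]) (use assms in auto)
    also have "\<dots> = ?K / real (Suc j) * \<bar>lag_coeff \<nu> k t j\<bar>"
      unfolding lag_coeff_def using pp assms(2) by (simp add: abs_mult power_abs field_simps)
    finally show ?thesis .
  qed
  from summable_factorial_decay[OF this] show "summable (\<lambda>j. \<bar>lag_coeff \<nu> k t j * w ^ j\<bar>)"
    "summable (\<lambda>j. lag_coeff \<nu> k t j * w ^ j)" using assms by auto
qed

lemma lag_deriv:
  assumes "-1/2 \<le> \<nu>" "t > 0"
  shows "(lag \<nu> k t has_real_derivative - lag (\<nu> + 1) k t u) (at u)"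
proof -
  have "((\<lambda>x. \<Sum>n. lag_coeff \<nu> k t n * x^n) has_real_derivative (\<Sum>n. diffs (lag_coeff \<nu> k t) n * u^n)) (at u)"
    by (rule termdiffs_strong_converges_everywhere) (rule lag_summable[OF assms])
  moreover have "(\<Sum>n. diffs (lag_coeff \<nu> k t) n * u^n) = - lag (\<nu> + 1) k t u"
    unfolding lag_coeff_diffs lag_def using lag_summable(2)[of "\<nu> + 1" t k u] assms
    by (simp add: suminf_minus)
  ultimately show ?thesis unfolding lag_def[abs_def] by simp
qed

lemma lag_0:
  assumes "t > 0"
  shows "lag \<nu> 0 t u = t powr - (\<nu> + 1) * exp (- (u / t))"
proof -
  have "lag_coeff \<nu> 0 t j * u ^ j = t powr - (\<nu> + 1) * ((- (u / t)) ^ j / fact j)" for j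
  proof -
    have "t powr - (\<nu> + 0 + real j + 1) = t powr - (\<nu> + 1) / t ^ j"
      using assms powr_mult_power(1)[of t j "- (\<nu> + 0 + real j + 1)"] by (simp add: field_simps)
    moreover have "(- (u / t)) ^ j = (-1) ^ j * (u ^ j / t ^ j)"
      by (simp add: power_minus[of "u / t"] power_divide)
    ultimately show ?thesis by (simp add: lag_coeff_def mult_ac)
  qed
  moreover have "(\<lambda>j. t powr - (\<nu> + 1) * ((- (u / t)) ^ j / fact j)) sums (t powr - (\<nu> + 1) * exp (- (u / t)))"
    using exp_converges[of "- (u / t)"] by (intro sums_mult) (simp add: field_simps)
  ultimately show ?thesis unfolding lag_def using sums_unique by fastforce
qed

text \<open>A three-term recurrence of Laguerre type, checked on coefficients. The combination
  \<open>d j\<close> of the three coefficients on the right collapses to a multiple of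
  \<open>j * pochhammer (\<nu> + j) k\<close>. Hence \<open>d 0 = 0\<close> and
  \<open>d (Suc j)\<close> is the \<open>j\<close>-th coefficient of \<open>lag \<nu> k t\<close>,
  which is the index shift caused by the factor \<open>u\<close>.\<close>

lemma lag_mult:
  assumes "-1/2 \<le> \<nu>" "t > 0"
  shows "u * lag \<nu> k t u = - (real k * (real k + \<nu>)) * lag \<nu> (k - 1) t u
    + (2 * real k + \<nu> + 1) * t * lag \<nu> k t u - t\<^sup>2 * lag \<nu> (k + 1) t u"
proof -
  define d where "d j = - (real k * (real k + \<nu>)) * lag_coeff \<nu> (k - 1) t j
    + (2 * real k + \<nu> + 1) * t * lag_coeff \<nu> k t j - t\<^sup>2 * lag_coeff \<nu> (k + 1) t j" for j
  have dk: "d j = (-1) ^ j / fact j * t powr - (\<nu> + real k + real j) * (- (real j * pochhammer (\<nu> + real j) k))" for j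
  proof -
    let ?a = "\<nu> + real j + 1" and ?T = "t powr - (\<nu> + real k + real j)"
    have t1: "t * t powr - (\<nu> + real k + real j + 1) = ?T"
      "t\<^sup>2 * t powr - (\<nu> + real (k + 1) + real j + 1) = ?T"
      using assms(2) powr_mult_power(1)[of t 2 "- (\<nu> + real (k + 1) + real j + 1)"]
      by (simp_all add: powr_mult_power(2) algebra_simps)
    have t2: "t * lag_coeff \<nu> k t j = (-1) ^ j / fact j * ?T * pochhammer ?a k"
      unfolding lag_coeff_def t1(1)[symmetric] by simp
    have t3: "t\<^sup>2 * lag_coeff \<nu> (k + 1) t j = (-1) ^ j / fact j * ?T * (pochhammer ?a k * (?a + real k))"
      unfolding lag_coeff_def t1(2)[symmetric] by (simp add: pochhammer_rec' mult_ac)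
    have d: "d j = - (real k * (real k + \<nu>)) * lag_coeff \<nu> (k - 1) t j
      + (2 * real k + \<nu> + 1) * ((-1) ^ j / fact j * ?T * pochhammer ?a k)
      - (-1) ^ j / fact j * ?T * (pochhammer ?a k * (?a + real k))"
      unfolding d_def t3[symmetric] t2[symmetric] by simp
    show ?thesis
    \<comment> \<open>For \<open>k = 0\<close> the term with the truncated \<open>k - 1\<close>
      carries the factor \<open>real k = 0\<close>.\<close>
    proof (cases k)
      case 0
      have "- (real k * (real k + \<nu>)) * A + (2 * real k + \<nu> + 1) * (B * pochhammer ?a k)
          - B * (pochhammer ?a k * (?a + real k)) = B * (- (real j * pochhammer (\<nu> + real j) k))" for A B
        by (simp add: 0 algebra_simps)
      then show ?thesis unfolding d .
    next
      case (Suc k')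
      have t4: "lag_coeff \<nu> (k - 1) t j = (-1) ^ j / fact j * ?T * pochhammer ?a k'"
        unfolding lag_coeff_def Suc by (simp add: add_ac)
      have t5: "pochhammer ?a k = pochhammer ?a k' * (?a + real k')"
        unfolding Suc by (simp add: pochhammer_rec' mult_ac)
      have t6: "pochhammer (\<nu> + real j) k = (\<nu> + real j) * pochhammer ?a k'"
        unfolding Suc by (rule pochhammer_rec)
      have "- (real k * (real k + \<nu>)) + (2 * real k + \<nu> + 1) * (?a + real k') - (?a + real k') * (?a + real k)
          = - (real j * (\<nu> + real j))"
        unfolding Suc by (simp add: algebra_simps)
      note eq = this
      have gen: "c1 * (B * P) + c2 * (B * (P * x)) - B * (P * x * y) = B * P * (c1 + c2 * x - x * y)"
        for c1 c2 B P x y :: real by (simp add: algebra_simps)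
      have "- (real k * (real k + \<nu>)) * (B * P) + (2 * real k + \<nu> + 1) * (B * (P * (?a + real k')))
          - B * (P * (?a + real k') * (?a + real k)) = B * (- (real j * ((\<nu> + real j) * P)))" for B P :: real
        unfolding gen eq by simp
      then show ?thesis unfolding d t4 t5 t6 .
    qed
  qed
  have "d (Suc j) = lag_coeff \<nu> k t j" for j
  proof -
    have "(-1) ^ Suc j / fact (Suc j) * (- real (Suc j)) = ((-1) ^ j / fact j :: real)"
      by (simp del: of_nat_Suc)
    moreover have "\<nu> + real (Suc j) = \<nu> + real j + 1" "\<nu> + real k + real (Suc j) = \<nu> + real k + real j + 1"
      by simp_all
    moreover have "A * T * (- (B * P)) = (A * (- B)) * P * T" for A T B P :: real by simp
    ultimately show ?thesis unfolding dk lag_coeff_def by (simp only:)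
  qed
  then have "d (Suc j) * u ^ Suc j = u * (lag_coeff \<nu> k t j * u ^ j)" for j by simp
  moreover have "(\<lambda>j. u * (lag_coeff \<nu> k t j * u ^ j)) sums (u * lag \<nu> k t u)"
    unfolding lag_def by (intro sums_mult summable_sums lag_summable assms)
  ultimately have "(\<lambda>j. d (Suc j) * u ^ Suc j) sums (u * lag \<nu> k t u)" by (simp only:)
  moreover have "d 0 = 0" unfolding dk by simp
  ultimately have "(\<lambda>j. d j * u ^ j) sums (u * lag \<nu> k t u)"
    using sums_Suc[of "\<lambda>j. d j * u ^ j"] by fastforce
  moreover have "(\<lambda>j. - (real k * (real k + \<nu>)) * (lag_coeff \<nu> (k - 1) t j * u ^ j)
    + (2 * real k + \<nu> + 1) * t * (lag_coeff \<nu> k t j * u ^ j) - t\<^sup>2 * (lag_coeff \<nu> (k + 1) t j * u ^ j)) sums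
    (- (real k * (real k + \<nu>)) * lag \<nu> (k - 1) t u
    + (2 * real k + \<nu> + 1) * t * lag \<nu> k t u - t\<^sup>2 * lag \<nu> (k + 1) t u)"
    unfolding lag_def by (intro sums_add sums_diff sums_mult summable_sums lag_summable assms)
  then have "(\<lambda>j. d j * u ^ j) sums (- (real k * (real k + \<nu>)) * lag \<nu> (k - 1) t u
    + (2 * real k + \<nu> + 1) * t * lag \<nu> k t u - t\<^sup>2 * lag \<nu> (k + 1) t u)"
    unfolding d_def by (simp only: algebra_simps)
  ultimately show ?thesis using sums_unique2 by blast
qed

text \<open>Integrating the Bessel series term by term gives Gamma integrals; the quotient of the
  Gamma value by that in \<open>bessel_coeff\<close> is the Pochhammer symbol in
  \<open>lag_coeff\<close>. The exchange is justified because the integrals of the absolute values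
  are the absolute values of the summable terms of \<open>lag\<close>.\<close>

lemma lag_has_bochner_integral:
  assumes \<nu>: "-1/2 \<le> \<nu>" and t: "t > 0"
  shows "has_bochner_integral lborel
    (\<lambda>v. indicator {0<..} v * (v ^ k * exp (- (t * v)) * (bessel \<nu> (u * v) * v powr \<nu>))) (lag \<nu> k t u)"
proof -
  define f where "f j v = bessel_coeff \<nu> j * u ^ j * (indicator {0<..} v * (v powr (\<nu> + real k + real j) * exp (- (t * v))))" for j v
  define G where "G j = Gamma (\<nu> + real k + real j + 1) * t powr - (\<nu> + real k + real j + 1)" for j
  have hbi: "has_bochner_integral lborel (f j) (bessel_coeff \<nu> j * u ^ j * G j)" for j
    unfolding f_def G_def using \<nu> t by (intro has_bochner_integral_mult_right Gamma_has_bochner_integral) auto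
  have hbin: "has_bochner_integral lborel (\<lambda>v. norm (f j v)) (\<bar>bessel_coeff \<nu> j * u ^ j\<bar> * G j)" for j
  proof -
    have "norm (f j v) = \<bar>bessel_coeff \<nu> j * u ^ j\<bar> * (indicator {0<..} v * (v powr (\<nu> + real k + real j) * exp (- (t * v))))" for v
      by (simp add: f_def abs_mult indicator_def)
    then show ?thesis unfolding G_def
      using \<nu> t by (simp only:) (intro has_bochner_integral_mult_right Gamma_has_bochner_integral; simp)
  qed
  have coeff: "bessel_coeff \<nu> j * G j = lag_coeff \<nu> k t j" for j
  proof -
    have p: "\<nu> + real j + 1 > 0" using \<nu> by simp
    then have "\<nu> + real j + 1 \<notin> \<int>\<^sub>\<le>\<^sub>0" by (metis nonpos_Ints_nonpos not_le)
    then have "pochhammer (\<nu> + real j + 1) k = Gamma (\<nu> + real j + 1 + real k) / Gamma (\<nu> + real j + 1)"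
      by (rule pochhammer_Gamma)
    then have "lag_coeff \<nu> k t j = (-1) ^ j / fact j * (Gamma (\<nu> + real j + 1 + real k) / Gamma (\<nu> + real j + 1)) * t powr - (\<nu> + real k + real j + 1)"
      unfolding lag_coeff_def by simp
    also have "\<nu> + real j + 1 + real k = \<nu> + real k + real j + 1" by simp
    finally show ?thesis by (simp add: bessel_coeff_def G_def)
  qed
  have G: "G j \<ge> 0" for j
    unfolding G_def using \<nu> by (intro mult_nonneg_nonneg Gamma_real_nonneg less_imp_le[OF Gamma_real_pos]) auto
  have sm: "summable (\<lambda>j. norm (f j v))" for v
  proof (cases "v > 0")
    case True
    have "norm (f j v) = \<bar>bessel_coeff \<nu> j * (u * v) ^ j\<bar> * (v powr (\<nu> + real k) * exp (- (t * v)))" for j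
      using True by (simp add: f_def abs_mult powr_add powr_realpow power_mult_distrib)
    then show ?thesis using bessel_summable(1)[OF \<nu>, of "u * v"] by (simp add: summable_mult2)
  qed (simp add: f_def)
  have sm2: "summable (\<lambda>j. \<integral>v. norm (f j v) \<partial>lborel)"
  proof -
    have "(\<integral>v. norm (f j v) \<partial>lborel) = \<bar>lag_coeff \<nu> k t j * u ^ j\<bar>" for j
      using has_bochner_integral_integral_eq[OF hbin, of j] G[of j]
      unfolding coeff[symmetric] by (simp add: abs_mult mult_ac)
    then show ?thesis using lag_summable(1)[OF assms] by simp
  qed
  have int: "integrable lborel (f j)" for j using hbi by (rule has_bochner_integral_iff[THEN iffD1, THEN conjunct1])
  have "(\<lambda>j. \<integral>v. f j v \<partial>lborel) sums (\<integral>v. (\<Sum>j. f j v) \<partial>lborel)"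
    by (rule sums_integral[OF int _ sm2]) (use sm in simp)
  moreover have "(\<integral>v. f j v \<partial>lborel) = lag_coeff \<nu> k t j * u ^ j" for j
    using has_bochner_integral_integral_eq[OF hbi, of j] coeff[of j] by (simp add: mult_ac)
  ultimately have 1: "(\<integral>v. (\<Sum>j. f j v) \<partial>lborel) = lag \<nu> k t u"
    unfolding lag_def by (simp add: sums_iff)
  have "integrable lborel (\<lambda>v. \<Sum>j. f j v)"
    by (rule integrable_suminf[OF int _ sm2]) (use sm in simp)
  with 1 have "has_bochner_integral lborel (\<lambda>v. \<Sum>j. f j v) (lag \<nu> k t u)"
    by (simp add: has_bochner_integral_iff)
  moreover have "(\<Sum>j. f j v) = indicator {0<..} v * (v ^ k * exp (- (t * v)) * (bessel \<nu> (u * v) * v powr \<nu>))" for v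
  proof (cases "v > 0")
    case True
    have "f j v = bessel_coeff \<nu> j * (u * v) ^ j * (v ^ k * exp (- (t * v)) * v powr \<nu>)" for j
      using True by (simp add: f_def powr_add powr_realpow power_mult_distrib)
    then have "(\<Sum>j. f j v) = bessel \<nu> (u * v) * (v ^ k * exp (- (t * v)) * v powr \<nu>)"
      unfolding bessel_def using bessel_summable(2)[OF \<nu>] by (simp add: suminf_mult2)
    then show ?thesis using True by simp
  qed (simp add: f_def)
  ultimately show ?thesis by simp
qed

text \<open>Lebesgue measure on the vector type is the image of a product measure indexed by the
  basis vectors. Reindexing these by coordinates reduces the claim to Fubini for products of
  functions of one variable.\<close>

lemma has_bochner_integral_prod_vec:
  fixes f :: "'n::finite \<Rightarrow> real \<Rightarrow> real"
  assumes "\<And>i. has_bochner_integral lborel (f i) (I i)"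
  shows "has_bochner_integral lborel (\<lambda>x :: real ^ 'n. \<Prod>i\<in>UNIV. f i (x $ i)) (\<Prod>i\<in>UNIV. I i)"
proof -
  interpret product_sigma_finite "\<lambda>_ :: real ^ 'n. lborel :: real measure" by standard
  let ?P = "\<Pi>\<^sub>M b\<in>(Basis :: (real ^ 'n) set). (lborel :: real measure)"
  let ?g = "\<lambda>w. \<Sum>b\<in>Basis. w b *\<^sub>R b :: real ^ 'n"
  let ?F = "\<lambda>x :: real ^ 'n. \<Prod>i\<in>UNIV. f i (x $ i)"
  have Basis: "Basis = (\<lambda>i. axis i (1::real) :: real ^ 'n) ` UNIV" by (auto simp: Basis_vec_def)
  have inj: "inj (\<lambda>i. axis i (1::real) :: real ^ 'n)" by (auto simp: inj_on_def axis_eq_axis)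
  have int: "integrable lborel (f i)" and I: "integral\<^sup>L lborel (f i) = I i" for i
    using assms[of i] by (auto simp: has_bochner_integral_iff)
  have [measurable]: "f i \<in> borel_measurable borel" for i
    using borel_measurable_integrable[OF int] by simp
  have F: "?F \<in> borel_measurable borel" by measurable
  have g: "?g \<in> measurable ?P borel" by measurable
  have comp: "?F (?g w) = (\<Prod>b\<in>Basis. f (axis_index b) (w b))" for w
  proof -
    have "(?g w) $ i = w (axis i 1)" for i
    proof -
      have "(?g w) $ i = (\<Sum>b\<in>Basis. w b * b $ i)" by simp
      also have "\<dots> = (\<Sum>j\<in>UNIV. w (axis j 1) * (axis j 1 :: real ^ 'n) $ i)"
        unfolding Basis by (rule sum.reindex[OF inj, unfolded o_def])
      also have "\<dots> = (\<Sum>j\<in>UNIV. if j = i then w (axis i 1) else 0)"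
        by (rule sum.cong) (auto simp: axis_def)
      finally show ?thesis by simp
    qed
    then have "?F (?g w) = (\<Prod>i\<in>UNIV. f i (w (axis i 1)))" by simp
    also have "\<dots> = (\<Prod>b\<in>Basis. f (axis_index b) (w b))"
      unfolding Basis by (subst prod.reindex[OF inj]) (simp add: axis_index_axis)
    finally show ?thesis .
  qed
  have "integrable ?P (\<lambda>w. \<Prod>b\<in>Basis. f (axis_index b) (w b))"
    by (rule product_integrable_prod) (auto intro: int)
  moreover have "integral\<^sup>L ?P (\<lambda>w. \<Prod>b\<in>Basis. f (axis_index b) (w b)) = (\<Prod>b\<in>(Basis :: (real ^ 'n) set). I (axis_index b))"
    by (subst product_integral_prod) (auto intro: int simp: I)
  moreover have "(\<Prod>b\<in>(Basis :: (real ^ 'n) set). I (axis_index b)) = (\<Prod>i\<in>UNIV. I i)"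
    unfolding Basis by (subst prod.reindex[OF inj]) (simp add: axis_index_axis)
  ultimately show ?thesis
    unfolding has_bochner_integral_iff lborel_eq[where 'a="real ^ 'n"]
    unfolding integrable_distr_eq[OF g F] integral_distr[OF g F] comp by simp
qed

lemma indicator_orthant: "indicator orthant v = (\<Prod>i\<in>UNIV. indicator {0<..} (v $ i) :: real)"
proof (cases "v \<in> orthant")
  case False
  then obtain i where "\<not> 0 < v $ i" by (auto simp: orthant_def)
  then have "(\<Prod>i\<in>UNIV. indicator {0<..} (v $ i) :: real) = 0" by (auto simp: indicator_def intro!: prod_zero)
  with False show ?thesis by simp
qed (auto simp: orthant_def)

lemma sets_orthant [measurable]: "orthant \<in> sets borel"
  by (rule borel_open) simp

subsection \<open>Hankel transforms of exponential polynomials\<close>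

definition monexp :: "'n::finite multi_index \<Rightarrow> ('n \<Rightarrow> real) \<Rightarrow> real ^ 'n \<Rightarrow> real" where
  "monexp k t v = (\<Prod>i\<in>UNIV. (v $ i) ^ k i * exp (- (t i * v $ i)))"

text \<open>The parameter \<open>\<tau>\<close> is a lower bound for the rates \<open>t\<close>.
  Products add the bounds, rate 0 still admits polynomials and constants as multipliers, and
  strictly positive rates make the transform converge. The inductive form turns every linear
  statement into one about a single \<open>monexp\<close>.\<close>

inductive_set expoly :: "('n::finite \<Rightarrow> real) \<Rightarrow> 'n cfun set" for \<tau> where
  monexp: "(\<And>i. \<tau> i \<le> t i) \<Longrightarrow> (\<lambda>v. complex_of_real (monexp k t v)) \<in> expoly \<tau>"
| add: "\<theta> \<in> expoly \<tau> \<Longrightarrow> \<eta> \<in> expoly \<tau> \<Longrightarrow> (\<lambda>v. \<theta> v + \<eta> v) \<in> expoly \<tau>"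
| cmult: "\<theta> \<in> expoly \<tau> \<Longrightarrow> (\<lambda>v. c * \<theta> v) \<in> expoly \<tau>"

lemma monexp_split: "monexp k t v = ((v $ i) ^ k i * exp (- (t i * v $ i))) * (\<Prod>j\<in>UNIV - {i}. (v $ j) ^ k j * exp (- (t j * v $ j)))"
  unfolding monexp_def by (rule prod.remove) auto

lemma monexp_upd: "monexp (k(i := m)) t v = ((v $ i) ^ m * exp (- (t i * v $ i))) * (\<Prod>j\<in>UNIV - {i}. (v $ j) ^ k j * exp (- (t j * v $ j)))"
proof -
  have "(\<Prod>j\<in>UNIV - {i}. (v $ j) ^ (k(i := m)) j * exp (- (t j * v $ j))) = (\<Prod>j\<in>UNIV - {i}. (v $ j) ^ k j * exp (- (t j * v $ j)))"
    by (rule prod.cong) auto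
  then show ?thesis unfolding monexp_split[of _ _ _ i] by simp
qed

lemma monexp_mult: "monexp k t v * monexp k' t' v = monexp (\<lambda>i. k i + k' i) (\<lambda>i. t i + t' i) v"
  unfolding monexp_def prod.distrib[symmetric]
  by (rule prod.cong) (auto simp: power_add exp_add[symmetric] algebra_simps)

lemma expoly_mult:
  assumes "\<theta> \<in> expoly \<sigma>" "\<eta> \<in> expoly \<tau>"
  shows "(\<lambda>v. \<theta> v * \<eta> v) \<in> expoly (\<lambda>i. \<sigma> i + \<tau> i)"
  using assms(1)
proof induction
  case (monexp t k)
  show ?case using assms(2)
  proof induction
    case (monexp t' k')
    have "(\<lambda>v. complex_of_real (monexp (\<lambda>i. k i + k' i) (\<lambda>i. t i + t' i) v)) \<in> expoly (\<lambda>i. \<sigma> i + \<tau> i)"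
      by (rule expoly.monexp) (use \<open>\<And>i. \<sigma> i \<le> t i\<close> monexp in \<open>auto intro: add_mono\<close>)
    then show ?case by (simp add: monexp_mult[symmetric])
  next
    case (add \<theta> \<eta>)
    then show ?case using expoly.add[OF add.IH] by (simp add: algebra_simps)
  next
    case (cmult \<theta> c)
    then show ?case using expoly.cmult[OF cmult.IH, of c] by (simp add: algebra_simps)
  qed
next
  case (add \<theta> \<eta>)
  then show ?case using expoly.add[OF add.IH] by (simp add: algebra_simps)
next
  case (cmult \<theta> c)
  then show ?case using expoly.cmult[OF cmult.IH, of c] by (simp add: algebra_simps)
qed

lemma expoly_antimono: "\<theta> \<in> expoly \<tau> \<Longrightarrow> (\<And>i. \<sigma> i \<le> \<tau> i) \<Longrightarrow> \<theta> \<in> expoly \<sigma>"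
  by (induction rule: expoly.induct) (auto intro!: expoly.intros intro: order_trans)

lemma expoly_mult': "\<theta> \<in> expoly (\<lambda>_. 0) \<Longrightarrow> \<eta> \<in> expoly \<tau> \<Longrightarrow> (\<lambda>v. \<theta> v * \<eta> v) \<in> expoly \<tau>"
  using expoly_mult[of \<theta> "\<lambda>_. 0" \<eta> \<tau>] by simp

lemma expoly_const: "(\<lambda>v. c) \<in> expoly (\<lambda>_. 0)"
  using expoly.cmult[OF expoly.monexp[of "\<lambda>_. 0" "\<lambda>_. 0" "\<lambda>_. 0"], of c] by (simp add: monexp_def)

lemma expoly_zero: "(\<lambda>v. 0) \<in> expoly \<tau>"
  using expoly.cmult[OF expoly.monexp[of \<tau> \<tau> "\<lambda>_. 0"], of 0] by simp

lemma expoly_diff: "\<theta> \<in> expoly \<tau> \<Longrightarrow> \<eta> \<in> expoly \<tau> \<Longrightarrow> (\<lambda>v. \<theta> v - \<eta> v) \<in> expoly \<tau>"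
  using expoly.add[OF _ expoly.cmult[of \<eta> \<tau> "-1"], of \<theta>] by simp

lemma expoly_sum: "finite A \<Longrightarrow> (\<And>a. a \<in> A \<Longrightarrow> \<theta> a \<in> expoly \<tau>) \<Longrightarrow> (\<lambda>v. \<Sum>a\<in>A. \<theta> a v) \<in> expoly \<tau>"
  by (induction rule: finite_induct) (auto intro: expoly_zero expoly.add)

lemma expoly_coord: "(\<lambda>v. complex_of_real (v $ i)) \<in> expoly (\<lambda>_. 0)"
proof -
  have "monexp ((\<lambda>_. 0)(i := 1)) (\<lambda>_. 0) v = v $ i" for v unfolding monexp_upd by simp
  then show ?thesis using expoly.monexp[of "\<lambda>_. 0" "\<lambda>_. 0" "(\<lambda>_. 0)(i := 1)"] by simp
qed

lemma expoly_coord_mult: "\<theta> \<in> expoly \<tau> \<Longrightarrow> (\<lambda>v. complex_of_real (v $ i) * \<theta> v) \<in> expoly \<tau>"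
  by (rule expoly_mult'[OF expoly_coord])

lemma has_partial_monexp:
  "has_partial i (\<lambda>v. complex_of_real (monexp k t v))
    (complex_of_real (real (k i) * monexp (k(i := k i - 1)) t v - t i * monexp k t v)) v"
proof -
  let ?R = "\<Prod>j\<in>UNIV - {i}. (v $ j) ^ k j * exp (- (t j * v $ j))"
  have split: "monexp k t (v + s *\<^sub>R axis i 1) = ((v $ i + s) ^ k i * exp (- (t i * (v $ i + s)))) * ?R" for s
  proof -
    have "(\<Prod>j\<in>UNIV - {i}. ((v + s *\<^sub>R axis i 1) $ j) ^ k j * exp (- (t j * (v + s *\<^sub>R axis i 1) $ j))) = ?R"
      by (rule prod.cong) (auto simp: axis_def)
    then show ?thesis unfolding monexp_split[of _ _ _ i] by (simp add: axis_def)
  qed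
  have "((\<lambda>s. ((v $ i + s) ^ k i * exp (- (t i * (v $ i + s)))) * ?R) has_real_derivative
      (real (k i) * (v $ i) ^ (k i - 1) * exp (- (t i * v $ i)) - t i * ((v $ i) ^ k i * exp (- (t i * v $ i)))) * ?R) (at 0)"
    by (auto intro!: derivative_eq_intros simp: algebra_simps)
  then show ?thesis
    unfolding has_partial_def split monexp_upd monexp_split[of k t v i]
    by (intro has_vector_derivative_of_real) (simp add: algebra_simps)
qed

lemma expoly_has_partial:
  "\<theta> \<in> expoly \<tau> \<Longrightarrow> partial i \<theta> \<in> expoly \<tau> \<and> (\<forall>v. has_partial i \<theta> (partial i \<theta> v) v)"
proof (induction rule: expoly.induct)
  case (monexp t k)
  let ?d = "\<lambda>v. complex_of_real (real (k i) * monexp (k(i := k i - 1)) t v - t i * monexp k t v)"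
  have eq: "partial i (\<lambda>v. complex_of_real (monexp k t v)) = ?d"
    using has_partial_imp_partial[OF has_partial_monexp] by blast
  have "(\<lambda>v. complex_of_real (real (k i)) * complex_of_real (monexp (k(i := k i - 1)) t v) - complex_of_real (t i) * complex_of_real (monexp k t v)) \<in> expoly \<tau>"
    by (intro expoly_diff expoly.cmult expoly.monexp monexp)
  then show ?case unfolding eq using has_partial_monexp by auto
next
  case (add \<theta> \<eta>)
  then have "has_partial i (\<lambda>v. \<theta> v + \<eta> v) (partial i \<theta> v + partial i \<eta> v) v" for v
    by (intro has_partial_add) auto
  moreover from this have "partial i (\<lambda>v. \<theta> v + \<eta> v) = (\<lambda>v. partial i \<theta> v + partial i \<eta> v)"
    using has_partial_imp_partial by blast
  ultimately show ?case using add expoly.add by auto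
next
  case (cmult \<theta> c)
  then have "has_partial i (\<lambda>v. c * \<theta> v) (c * partial i \<theta> v) v" for v
    by (intro has_partial_cmult) auto
  moreover from this have "partial i (\<lambda>v. c * \<theta> v) = (\<lambda>v. c * partial i \<theta> v)"
    using has_partial_imp_partial by blast
  ultimately show ?case using cmult expoly.cmult by auto
qed

lemma expoly_partial: "\<theta> \<in> expoly \<tau> \<Longrightarrow> partial i \<theta> \<in> expoly \<tau>"
  and expoly_partial': "\<theta> \<in> expoly \<tau> \<Longrightarrow> has_partial i \<theta> (partial i \<theta> v) v"
  using expoly_has_partial by blast+

lemma expoly_continuous: "\<theta> \<in> expoly \<tau> \<Longrightarrow> continuous_on UNIV \<theta>"
  by (induction rule: expoly.induct) (auto simp: monexp_def intro!: continuous_intros)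

lemma expoly_measurable: "\<theta> \<in> expoly \<tau> \<Longrightarrow> \<theta> \<in> borel_measurable borel"
  by (rule borel_measurable_continuous_onI) (rule expoly_continuous)

section \<open>The transform in several variables: derivatives and multiplication rules\<close>

definition hkernel :: "real ^ 'n::finite \<Rightarrow> real ^ 'n \<Rightarrow> real ^ 'n \<Rightarrow> real" where
  "hkernel \<nu> u v = (\<Prod>i\<in>UNIV. bessel (\<nu> $ i) (u $ i * v $ i) * (v $ i) powr (\<nu> $ i))"

definition hankel :: "real ^ 'n::finite \<Rightarrow> 'n cfun \<Rightarrow> 'n cfun" where
  "hankel \<nu> \<theta> u = (LINT v:orthant|lborel. \<theta> v * complex_of_real (hkernel \<nu> u v))"

lemma hankel_monexp:
  assumes "\<And>i. -1/2 \<le> \<nu> $ i" "\<And>i. 0 < t i"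
  shows "set_integrable lborel orthant (\<lambda>v. complex_of_real (monexp k t v) * complex_of_real (hkernel \<nu> u v))"
    and "hankel \<nu> (\<lambda>v. complex_of_real (monexp k t v)) u = complex_of_real (\<Prod>i\<in>UNIV. lag (\<nu> $ i) (k i) (t i) (u $ i))"
proof -
  let ?f = "\<lambda>v :: real ^ 'a. \<Prod>i\<in>UNIV. indicator {0<..} (v $ i) * ((v $ i) ^ k i * exp (- (t i * v $ i)) * (bessel (\<nu> $ i) (u $ i * v $ i) * v $ i powr \<nu> $ i))"
  have 1: "has_bochner_integral lborel ?f (\<Prod>i\<in>UNIV. lag (\<nu> $ i) (k i) (t i) (u $ i))"
    by (intro has_bochner_integral_prod_vec lag_has_bochner_integral assms)
  have "?f v = indicator orthant v * (monexp k t v * hkernel \<nu> u v)" for v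
    unfolding indicator_orthant monexp_def hkernel_def prod.distrib[symmetric] by simp
  then have "complex_of_real (?f v) = indicator orthant v *\<^sub>R (complex_of_real (monexp k t v) * complex_of_real (hkernel \<nu> u v))" for v
    by (simp add: scaleR_conv_of_real)
  then have 2: "has_bochner_integral lborel (\<lambda>v. indicator orthant v *\<^sub>R (complex_of_real (monexp k t v) * complex_of_real (hkernel \<nu> u v)))
      (complex_of_real (\<Prod>i\<in>UNIV. lag (\<nu> $ i) (k i) (t i) (u $ i)))"
    using has_bochner_integral_of_real[OF 1, where 'a=complex] by (simp only:)
  from 2 show "set_integrable lborel orthant (\<lambda>v. complex_of_real (monexp k t v) * complex_of_real (hkernel \<nu> u v))"
    unfolding set_integrable_def has_bochner_integral_iff by blast
  from 2 show "hankel \<nu> (\<lambda>v. complex_of_real (monexp k t v)) u = complex_of_real (\<Prod>i\<in>UNIV. lag (\<nu> $ i) (k i) (t i) (u $ i))"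
    unfolding hankel_def set_lebesgue_integral_def has_bochner_integral_iff by blast
qed

lemma hankel_integrable:
  assumes "\<theta> \<in> expoly \<tau>" "\<And>i. 0 < \<tau> i" "\<And>i. -1/2 \<le> \<nu> $ i"
  shows "set_integrable lborel orthant (\<lambda>v. \<theta> v * complex_of_real (hkernel \<nu> u v))"
  using assms(1)
proof induction
  case (monexp t k)
  show ?case by (rule hankel_monexp) (use assms monexp in \<open>auto intro: less_le_trans\<close>)
next
  case (add \<theta> \<eta>)
  then show ?case using set_integral_add(1)[OF add.IH] by (simp add: algebra_simps)
next
  case (cmult \<theta> c)
  then show ?case using set_integrable_mult_right[of c, OF cmult.IH] by (simp add: mult.assoc)
qed

lemma hankel_add:
  assumes "\<theta> \<in> expoly \<tau>" "\<eta> \<in> expoly \<tau>" "\<And>i. 0 < \<tau> i" "\<And>i. -1/2 \<le> \<nu> $ i"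
  shows "hankel \<nu> (\<lambda>v. \<theta> v + \<eta> v) u = hankel \<nu> \<theta> u + hankel \<nu> \<eta> u"
  unfolding hankel_def
  using set_integral_add(2)[OF hankel_integrable[OF assms(1,3,4)] hankel_integrable[OF assms(2,3,4)]]
  by (simp add: algebra_simps)

lemma hankel_cmult: "hankel \<nu> (\<lambda>v. c * \<theta> v) u = c * hankel \<nu> \<theta> u"
  unfolding hankel_def mult.assoc by (rule set_integral_mult_right)

definition vsq :: "real ^ 'n \<Rightarrow> real ^ 'n" where
  "vsq x = (\<chi> i. (x $ i)\<^sup>2)"

lemma vsq_nth [simp]: "vsq x $ i = (x $ i)\<^sup>2"
  by (simp add: vsq_def)

lemma norm_power2_vec: "(norm x)\<^sup>2 = (\<Sum>i\<in>UNIV. (x $ i)\<^sup>2)" for x :: "real ^ 'n::finite"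
  unfolding power2_norm_eq_inner inner_vec_def by (simp add: power2_eq_square)

lemma shift_ge: "(\<And>i. -1/2 \<le> \<nu> $ i) \<Longrightarrow> -1/2 \<le> (\<nu> + axis j 1) $ i" for \<nu> :: "real ^ 'n::finite"
proof -
  assume "\<And>i. -1/2 \<le> \<nu> $ i"
  from this[of i] show ?thesis by (auto simp: axis_def)
qed

text \<open>The weight \<open>v^\<nu>\<close> is part of \<open>hkernel\<close> for this formula:
  differentiating the Bessel factor in \<open>u_i\<close> raises its index and releases a factor
  \<open>v_i\<close>, which raises the weight to match. Thus the derivative in \<open>u_i\<close> is
  minus the transform of raised index, and \<open>u_i = x_i^2\<close> adds \<open>2 x_i\<close>.
  Working on generators replaces differentiation under the integral by
  \<open>lag_deriv\<close>.\<close>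

lemma hankel_has_partial:
  assumes "\<theta> \<in> expoly \<tau>" "\<And>i. 0 < \<tau> i" "\<And>i. -1/2 \<le> \<nu> $ i"
  shows "has_partial i (\<lambda>x. hankel \<nu> \<theta> (vsq x)) (complex_of_real (-2 * x $ i) * hankel (\<nu> + axis i 1) \<theta> (vsq x)) x"
  using assms(1)
proof induction
  case (monexp t k)
  have t: "0 < t i" for i using assms(2)[of i] monexp[of i] by simp
  let ?l = "\<lambda>i u. lag (\<nu> $ i) (k i) (t i) u"
  let ?R = "\<Prod>j\<in>UNIV - {i}. ?l j ((x $ j)\<^sup>2)"
  have h1: "hankel \<nu> (\<lambda>v. complex_of_real (monexp k t v)) (vsq (x + s *\<^sub>R axis i 1)) =
      complex_of_real (?l i ((x $ i + s)\<^sup>2) * ?R)" for s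
  proof -
    have "(\<Prod>j\<in>UNIV - {i}. ?l j (((x + s *\<^sub>R axis i 1) $ j)\<^sup>2)) = ?R"
      by (rule prod.cong) (auto simp: axis_def)
    then have "(\<Prod>j\<in>UNIV. ?l j (vsq (x + s *\<^sub>R axis i 1) $ j)) = ?l i ((x $ i + s)\<^sup>2) * ?R"
      by (subst prod.remove[of _ i]) (auto simp: axis_def)
    then show ?thesis using hankel_monexp(2)[of \<nu> t, OF assms(3) t] by (simp only:)
  qed
  have h2: "hankel (\<nu> + axis i 1) (\<lambda>v. complex_of_real (monexp k t v)) (vsq x) =
      complex_of_real (lag (\<nu> $ i + 1) (k i) (t i) ((x $ i)\<^sup>2) * ?R)"
  proof -
    have "(\<Prod>j\<in>UNIV - {i}. lag ((\<nu> + axis i 1) $ j) (k j) (t j) ((x $ j)\<^sup>2)) = ?R"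
      by (rule prod.cong) (auto simp: axis_def)
    then have "(\<Prod>j\<in>UNIV. lag ((\<nu> + axis i 1) $ j) (k j) (t j) (vsq x $ j)) = lag (\<nu> $ i + 1) (k i) (t i) ((x $ i)\<^sup>2) * ?R"
      by (subst prod.remove[of _ i]) (auto simp: axis_def)
    then show ?thesis using hankel_monexp(2)[of "\<nu> + axis i 1" t, OF shift_ge[OF assms(3)] t] by (simp only:)
  qed
  have "((\<lambda>s. ?l i ((x $ i + s)\<^sup>2)) has_real_derivative - lag (\<nu> $ i + 1) (k i) (t i) ((x $ i + 0)\<^sup>2) * (2 * x $ i)) (at 0)"
    by (rule DERIV_chain2[OF lag_deriv[OF assms(3) t]]) (auto intro!: derivative_eq_intros)
  then have "((\<lambda>s. ?l i ((x $ i + s)\<^sup>2) * ?R) has_real_derivative - lag (\<nu> $ i + 1) (k i) (t i) ((x $ i + 0)\<^sup>2) * (2 * x $ i) * ?R) (at 0)"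
    by (rule DERIV_cmult_right)
  from has_vector_derivative_of_real[OF this, where 'a=complex] show ?case
    unfolding has_partial_def h1 h2 by (simp add: algebra_simps)
next
  case (add \<theta> \<eta>)
  note h = hankel_add[OF add.hyps assms(2,3)] hankel_add[OF add.hyps assms(2) shift_ge[OF assms(3)]]
  show ?case unfolding h using has_partial_add[OF add.IH] by (simp add: algebra_simps)
next
  case (cmult \<theta> c)
  show ?case unfolding hankel_cmult using has_partial_cmult[OF cmult.IH, of c] by (simp add: algebra_simps)
qed

lemma hankel_continuous:
  assumes "\<theta> \<in> expoly \<tau>" "\<And>i. 0 < \<tau> i" "\<And>i. -1/2 \<le> \<nu> $ i"
  shows "continuous_on U (\<lambda>x. hankel \<nu> \<theta> (vsq x))"
  using assms(1)
proof induction
  case (monexp t k)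
  have t: "0 < t i" for i using assms(2)[of i] monexp[of i] by simp
  have c: "continuous_on UNIV (lag (\<nu> $ i) (k i) (t i))" for i
    using lag_deriv[OF assms(3) t] DERIV_isCont by (intro continuous_at_imp_continuous_on) blast
  show ?case unfolding hankel_monexp(2)[of \<nu> t, OF assms(3) t] vsq_nth
    by (intro continuous_intros continuous_on_compose2[OF c]) auto
next
  case (add \<theta> \<eta>)
  show ?case unfolding hankel_add[OF add.hyps assms(2,3)] using add by (intro continuous_intros)
next
  case (cmult \<theta> c)
  show ?case unfolding hankel_cmult using cmult by (intro continuous_intros)
qed

text \<open>The induction on the order has to vary \<open>\<nu>\<close>, because each derivative
  raises a component of the index.\<close>

lemma Cinf_on_hankel:
  assumes "\<theta> \<in> expoly \<tau>" "\<And>i. 0 < \<tau> i" "\<And>i. -1/2 \<le> \<nu> $ i" "open U"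
  shows "Cinf_on U (\<lambda>x. hankel \<nu> \<theta> (vsq x))"
proof -
  have "Ck_on k U (\<lambda>x. hankel \<nu> \<theta> (vsq x))" for k
    using assms(3)
  proof (induction k arbitrary: \<nu>)
    case 0
    then show ?case using hankel_continuous[OF assms(1,2)] by simp
  next
    case (Suc k)
    show ?case
    proof (rule Ck_on_SucI[OF assms(4), where \<phi>'="\<lambda>i x. complex_of_real (-2 * x $ i) * hankel (\<nu> + axis i 1) \<theta> (vsq x)"])
      show "Ck_on k U (\<lambda>x. complex_of_real (-2 * x $ i) * hankel (\<nu> + axis i 1) \<theta> (vsq x))" for i
      proof (rule Ck_on_mult[OF assms(4) _ Suc.IH[OF shift_ge[OF Suc.prems]]])
        have "Cinf_on U (\<lambda>x. -2 * complex_of_real (x $ i))"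
          by (intro Cinf_on_cmult Cinf_on_coord assms)
        then show "Ck_on k U (\<lambda>x. complex_of_real (-2 * x $ i))" by (simp add: Cinf_on_def)
      qed
    qed (use hankel_continuous[OF assms(1,2)] hankel_has_partial[OF assms(1,2)] Suc.prems in auto)
  qed
  then show ?thesis by (simp add: Cinf_on_def)
qed

lemma hkernel_recurrence:
  assumes "\<And>i. -1/2 \<le> \<nu> $ i" "v \<in> orthant"
  shows "v $ i * hkernel \<nu> u v = (\<nu> $ i + 1) * hkernel (\<nu> + axis i 1) u v
    - u $ i * hkernel (\<nu> + axis i 1 + axis i 1) u v"
proof -
  let ?R = "\<Prod>j\<in>UNIV - {i}. bessel (\<nu> $ j) (u $ j * v $ j) * (v $ j) powr (\<nu> $ j)"
  have h: "hkernel \<rho> u v = bessel (\<rho> $ i) (u $ i * v $ i) * (v $ i) powr (\<rho> $ i) * ?R"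
    if "\<And>j. j \<noteq> i \<Longrightarrow> \<rho> $ j = \<nu> $ j" for \<rho>
  proof -
    have "(\<Prod>j\<in>UNIV - {i}. bessel (\<rho> $ j) (u $ j * v $ j) * (v $ j) powr (\<rho> $ j)) = ?R"
      by (rule prod.cong) (use that in auto)
    then show ?thesis unfolding hkernel_def by (subst prod.remove[of _ i]) auto
  qed
  have v: "v $ i > 0" using assms(2) by (simp add: orthant_def)
  have p: "(v $ i) powr (\<nu> $ i + 1) = v $ i * (v $ i) powr (\<nu> $ i)" "(v $ i) powr (\<nu> $ i + 2) = v $ i * (v $ i * (v $ i) powr (\<nu> $ i))"
    using v powr_mult_power(2)[of "v $ i" "\<nu> $ i"] powr_mult_power(2)[of "v $ i" "\<nu> $ i + 1"] by (simp_all add: add.assoc)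
  have a: "(\<nu> + axis i 1) $ i = \<nu> $ i + 1" "(\<nu> + axis i 1 + axis i 1) $ i = \<nu> $ i + 2" by (simp_all add: axis_def)
  have "hkernel \<nu> u v = bessel (\<nu> $ i) (u $ i * v $ i) * (v $ i) powr (\<nu> $ i) * ?R" by (rule h) simp
  moreover have "hkernel (\<nu> + axis i 1) u v = bessel (\<nu> $ i + 1) (u $ i * v $ i) * (v $ i) powr (\<nu> $ i + 1) * ?R"
    by (subst h) (auto simp: axis_def)
  moreover have "hkernel (\<nu> + axis i 1 + axis i 1) u v = bessel (\<nu> $ i + 2) (u $ i * v $ i) * (v $ i) powr (\<nu> $ i + 2) * ?R"
    unfolding a(2)[symmetric] by (rule h) (auto simp: axis_def)
  moreover note bessel_recurrence[OF assms(1)[of i], of "u $ i * v $ i"]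
  moreover have "V * (B * P * R) = (n + 1) * (B1 * (V * P) * R) - U * (B2 * (V * (V * P)) * R)"
    if "B = (n + 1) * B1 - U * V * B2" for V B P R n B1 B2 U :: real
    unfolding that by (simp add: algebra_simps)
  ultimately show ?thesis unfolding p by (simp only:)
qed

text \<open>Raising the index once or twice amounts to one or two derivatives in \<open>u_i\<close>,
  up to sign. So multiplication by \<open>v_i\<close> becomes minus the operator
  \<open>u_i \<partial>^2 + (\<nu>_i + 1) \<partial>\<close> on the transform; pointwise this is the
  Bessel recurrence of the kernel.\<close>

lemma hankel_coord_mult:
  assumes "\<theta> \<in> expoly \<tau>" "\<And>i. 0 < \<tau> i" "\<And>i. -1/2 \<le> \<nu> $ i"
  shows "hankel \<nu> (\<lambda>v. complex_of_real (v $ i) * \<theta> v) u = complex_of_real (\<nu> $ i + 1) * hankel (\<nu> + axis i 1) \<theta> u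
    - complex_of_real (u $ i) * hankel (\<nu> + axis i 1 + axis i 1) \<theta> u"
proof -
  note int = hankel_integrable[OF assms(1,2), where u=u]
  note i1 = int[OF shift_ge[OF assms(3)], of i] and i2 = int[OF shift_ge[OF shift_ge[OF assms(3)]], of i i]
  have "hankel \<nu> (\<lambda>v. complex_of_real (v $ i) * \<theta> v) u =
    (LINT v:orthant|lborel. complex_of_real (\<nu> $ i + 1) * (\<theta> v * complex_of_real (hkernel (\<nu> + axis i 1) u v))
      - complex_of_real (u $ i) * (\<theta> v * complex_of_real (hkernel (\<nu> + axis i 1 + axis i 1) u v)))"
    unfolding hankel_def
  proof (rule set_lebesgue_integral_cong)
    show "\<forall>v. v \<in> orthant \<longrightarrow> complex_of_real (v $ i) * \<theta> v * complex_of_real (hkernel \<nu> u v) =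
      complex_of_real (\<nu> $ i + 1) * (\<theta> v * complex_of_real (hkernel (\<nu> + axis i 1) u v))
      - complex_of_real (u $ i) * (\<theta> v * complex_of_real (hkernel (\<nu> + axis i 1 + axis i 1) u v))"
    proof (intro allI impI)
      fix v :: "real ^ 'a" assume v: "v \<in> orthant"
      have "complex_of_real (v $ i * hkernel \<nu> u v) = complex_of_real ((\<nu> $ i + 1) * hkernel (\<nu> + axis i 1) u v
        - u $ i * hkernel (\<nu> + axis i 1 + axis i 1) u v)"
        using hkernel_recurrence[OF assms(3) v] by simp
      then have "\<theta> v * (complex_of_real (v $ i) * complex_of_real (hkernel \<nu> u v)) = \<theta> v * (complex_of_real (\<nu> $ i + 1) * complex_of_real (hkernel (\<nu> + axis i 1) u v)
        - complex_of_real (u $ i) * complex_of_real (hkernel (\<nu> + axis i 1 + axis i 1) u v))"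
        by simp
      then show "complex_of_real (v $ i) * \<theta> v * complex_of_real (hkernel \<nu> u v) =
        complex_of_real (\<nu> $ i + 1) * (\<theta> v * complex_of_real (hkernel (\<nu> + axis i 1) u v))
        - complex_of_real (u $ i) * (\<theta> v * complex_of_real (hkernel (\<nu> + axis i 1 + axis i 1) u v))"
        by (simp add: algebra_simps)
    qed
  qed simp
  also have "\<dots> = complex_of_real (\<nu> $ i + 1) * hankel (\<nu> + axis i 1) \<theta> u
    - complex_of_real (u $ i) * hankel (\<nu> + axis i 1 + axis i 1) \<theta> u"
    unfolding hankel_def using i1 i2
    by (subst set_integral_diff) (auto simp: set_integral_mult_right intro: set_integrable_mult_right)
  finally show ?thesis .
qed

text \<open>The radial Bessel operator in the variable \<open>v_i\<close>, formally symmetric for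
  the weight \<open>v^\<nu>\<close>. It is the counterpart, on the side of \<open>\<theta>\<close>,
  of multiplying the transform by \<open>u_i\<close>.\<close>

definition bessel_op :: "real ^ 'n::finite \<Rightarrow> 'n \<Rightarrow> 'n cfun \<Rightarrow> 'n cfun" where
  "bessel_op \<nu> i \<theta> v = complex_of_real (v $ i) * partial i (partial i \<theta>) v + complex_of_real (\<nu> $ i + 1) * partial i \<theta> v"

lemma expoly_bessel_op: "\<theta> \<in> expoly \<tau> \<Longrightarrow> bessel_op \<nu> i \<theta> \<in> expoly \<tau>"
  unfolding bessel_op_def[abs_def] by (intro expoly.add expoly_coord_mult expoly.cmult expoly_partial)

lemma partial_add_expoly: "\<theta> \<in> expoly \<tau> \<Longrightarrow> \<eta> \<in> expoly \<tau> \<Longrightarrow> partial i (\<lambda>v. \<theta> v + \<eta> v) = (\<lambda>v. partial i \<theta> v + partial i \<eta> v)"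
  by (rule ext) (intro has_partial_imp_partial has_partial_add expoly_partial')

lemma partial_cmult_expoly: "\<theta> \<in> expoly \<tau> \<Longrightarrow> partial i (\<lambda>v. c * \<theta> v) = (\<lambda>v. c * partial i \<theta> v)"
  by (rule ext) (intro has_partial_imp_partial has_partial_cmult expoly_partial')

lemma bessel_op_add:
  "\<theta> \<in> expoly \<tau> \<Longrightarrow> \<eta> \<in> expoly \<tau> \<Longrightarrow> bessel_op \<nu> i (\<lambda>v. \<theta> v + \<eta> v) = (\<lambda>v. bessel_op \<nu> i \<theta> v + bessel_op \<nu> i \<eta> v)"
  by (simp add: bessel_op_def fun_eq_iff partial_add_expoly
      partial_add_expoly[OF expoly_partial expoly_partial] distrib_left)

lemma bessel_op_cmult:
  "\<theta> \<in> expoly \<tau> \<Longrightarrow> bessel_op \<nu> i (\<lambda>v. c * \<theta> v) = (\<lambda>v. c * bessel_op \<nu> i \<theta> v)"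
  by (simp add: bessel_op_def fun_eq_iff partial_cmult_expoly partial_cmult_expoly[OF expoly_partial] algebra_simps)

lemma bessel_op_monexp:
  "bessel_op \<nu> i (\<lambda>v. complex_of_real (monexp k t v)) v = complex_of_real
    (real (k i) * (real (k i) + \<nu> $ i) * monexp (k(i := k i - 1)) t v
     - (2 * real (k i) + \<nu> $ i + 1) * t i * monexp k t v + (t i)\<^sup>2 * monexp (k(i := k i + 1)) t v)"
proof -
  let ?m = "\<lambda>n v. monexp (k(i := n)) t v" and ?k = "k i"
  have p: "partial i (\<lambda>v. complex_of_real (?m n v)) v = complex_of_real (real n * ?m (n - 1) v - t i * ?m n v)" for n v
    using has_partial_imp_partial[OF has_partial_monexp, of i "k(i := n)" t v] by simp
  have e: "(\<lambda>v. complex_of_real (?m n v)) \<in> expoly t" for n by (rule expoly.monexp) simp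
  have p1: "partial i (\<lambda>v. complex_of_real (?m ?k v)) = (\<lambda>v. complex_of_real (real ?k) * complex_of_real (?m (?k - 1) v) + complex_of_real (- t i) * complex_of_real (?m ?k v))"
    by (simp add: fun_eq_iff p[of ?k, simplified])
  have p2: "partial i (partial i (\<lambda>v. complex_of_real (?m ?k v))) v =
     complex_of_real (real ?k) * complex_of_real (real (?k - 1) * ?m (?k - 1 - 1) v - t i * ?m (?k - 1) v)
     + complex_of_real (- t i) * complex_of_real (real ?k * ?m (?k - 1) v - t i * ?m ?k v)"
    by (subst p1) (simp only: partial_add_expoly[OF expoly.cmult[OF e] expoly.cmult[OF e]] partial_cmult_expoly[OF e] p)
  have m: "v $ i * ?m n v = ?m (n + 1) v" for n unfolding monexp_upd by simp
  have m': "v $ i * (real ?k * ?m (?k - 1) v) = real ?k * ?m ?k v"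
    using m[of "?k - 1"] by (cases ?k) auto
  have m'': "v $ i * (real ?k * (real (?k - 1) * ?m (?k - 1 - 1) v)) = real ?k * (real (?k - 1) * ?m (?k - 1) v)"
  proof (cases "?k - 1")
    case (Suc n)
    then show ?thesis using m[of n] by simp
  qed simp
  have k1: "real ?k * (real (?k - 1) * z) = real ?k * ((real ?k - 1) * z)" for z by (cases ?k) auto
  have "bessel_op \<nu> i (\<lambda>v. complex_of_real (?m ?k v)) v = complex_of_real
    (v $ i * (real ?k * (real (?k - 1) * ?m (?k - 1 - 1) v - t i * ?m (?k - 1) v) - t i * (real ?k * ?m (?k - 1) v - t i * ?m ?k v))
      + (\<nu> $ i + 1) * (real ?k * ?m (?k - 1) v - t i * ?m ?k v))"
    unfolding bessel_op_def p2 unfolding p1 by simp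
  also have "v $ i * (real ?k * (real (?k - 1) * ?m (?k - 1 - 1) v - t i * ?m (?k - 1) v) - t i * (real ?k * ?m (?k - 1) v - t i * ?m ?k v))
    = v $ i * (real ?k * (real (?k - 1) * ?m (?k - 1 - 1) v)) - 2 * t i * (v $ i * (real ?k * ?m (?k - 1) v)) + (t i)\<^sup>2 * (v $ i * ?m ?k v)"
    by (simp add: algebra_simps power2_eq_square)
  also have "\<dots> = real ?k * ((real ?k - 1) * ?m (?k - 1) v) - 2 * t i * (real ?k * ?m ?k v) + (t i)\<^sup>2 * ?m (?k + 1) v"
    unfolding m m' m'' by (simp only: k1)
  finally have "bessel_op \<nu> i (\<lambda>v. complex_of_real (?m ?k v)) v = complex_of_real
    (real ?k * ((real ?k - 1) * ?m (?k - 1) v) - 2 * t i * (real ?k * ?m ?k v) + (t i)\<^sup>2 * ?m (?k + 1) v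
      + (\<nu> $ i + 1) * (real ?k * ?m (?k - 1) v - t i * ?m ?k v))" .
  moreover have "A * ((A - 1) * x) - 2 * T * (A * y) + T\<^sup>2 * z + (n + 1) * (A * x - T * y)
      = A * (A + n) * x - (2 * A + n + 1) * T * y + T\<^sup>2 * z" for A T n x y z :: real
    by (simp add: algebra_simps)
  ultimately show ?thesis by (simp only: fun_upd_triv)
qed

text \<open>Proved without integration by parts, hence without boundary terms: on a generator
  \<open>bessel_op_monexp\<close> yields three neighbouring powers of \<open>v_i\<close>, whose
  coefficients are those of \<open>lag_mult\<close> with opposite sign.\<close>

lemma hankel_bessel_op:
  assumes "\<theta> \<in> expoly \<tau>" "\<And>i. 0 < \<tau> i" "\<And>i. -1/2 \<le> \<nu> $ i"
  shows "complex_of_real (u $ i) * hankel \<nu> \<theta> u = - hankel \<nu> (bessel_op \<nu> i \<theta>) u"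
  using assms(1)
proof induction
  case (monexp t k)
  have t: "0 < t i" for i using assms(2)[of i] monexp[of i] by simp
  let ?m = "\<lambda>n v. complex_of_real (monexp (k(i := n)) t v)" and ?k = "k i"
  let ?R = "\<Prod>j\<in>UNIV - {i}. lag (\<nu> $ j) (k j) (t j) (u $ j)"
  have e: "?m n \<in> expoly t" for n by (rule expoly.monexp) simp
  have h: "hankel \<nu> (?m n) u = complex_of_real (lag (\<nu> $ i) n (t i) (u $ i) * ?R)" for n
  proof -
    have "(\<Prod>j\<in>UNIV - {i}. lag (\<nu> $ j) ((k(i := n)) j) (t j) (u $ j)) = ?R"
      by (rule prod.cong) auto
    then show ?thesis unfolding hankel_monexp(2)[of \<nu> t, OF assms(3) t] by (subst prod.remove[of _ i]) auto
  qed
  let ?A = "real ?k * (real ?k + \<nu> $ i)" and ?B = "(2 * real ?k + \<nu> $ i + 1) * t i"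
  have "bessel_op \<nu> i (?m ?k) = (\<lambda>v. (complex_of_real ?A * ?m (?k - 1) v + complex_of_real (- ?B) * ?m ?k v)
      + complex_of_real ((t i)\<^sup>2) * ?m (?k + 1) v)"
    by (rule ext) (simp add: bessel_op_monexp algebra_simps)
  then have "hankel \<nu> (bessel_op \<nu> i (?m ?k)) u = complex_of_real ?A * hankel \<nu> (?m (?k - 1)) u
      + complex_of_real (- ?B) * hankel \<nu> (?m ?k) u + complex_of_real ((t i)\<^sup>2) * hankel \<nu> (?m (?k + 1)) u"
    by (simp only: hankel_add[OF expoly.add[OF expoly.cmult[OF e] expoly.cmult[OF e]] expoly.cmult[OF e] t assms(3)]
        hankel_add[OF expoly.cmult[OF e] expoly.cmult[OF e] t assms(3)] hankel_cmult)
  also have "\<dots> = complex_of_real ((?A * lag (\<nu> $ i) (?k - 1) (t i) (u $ i) - ?B * lag (\<nu> $ i) ?k (t i) (u $ i)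
      + (t i)\<^sup>2 * lag (\<nu> $ i) (?k + 1) (t i) (u $ i)) * ?R)"
    unfolding h by (simp add: algebra_simps)
  also have "?A * lag (\<nu> $ i) (?k - 1) (t i) (u $ i) - ?B * lag (\<nu> $ i) ?k (t i) (u $ i)
      + (t i)\<^sup>2 * lag (\<nu> $ i) (?k + 1) (t i) (u $ i) = - (u $ i * lag (\<nu> $ i) ?k (t i) (u $ i))"
    unfolding lag_mult[OF assms(3) t] by simp
  finally have "hankel \<nu> (bessel_op \<nu> i (?m ?k)) u = - (complex_of_real (u $ i) * hankel \<nu> (?m ?k) u)"
    unfolding h by simp
  then show ?case by simp
next
  case (add \<theta> \<eta>)
  show ?case
    unfolding bessel_op_add[OF add.hyps] hankel_add[OF add.hyps assms(2,3)]
      hankel_add[OF expoly_bessel_op[OF add.hyps(1)] expoly_bessel_op[OF add.hyps(2)] assms(2,3)]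
    using add.IH by (simp add: algebra_simps)
next
  case (cmult \<theta> c)
  show ?case
    unfolding bessel_op_cmult[OF cmult.hyps] hankel_cmult using cmult.IH by (simp add: algebra_simps)
qed

text \<open>On the orthant the Bessel factors are bounded by their values at 0, by
  \<open>bessel_bounded\<close>. The transform is therefore bounded uniformly in \<open>u\<close> by
  a weighted L1 norm of \<open>\<theta>\<close>.\<close>

lemma hankel_bound:
  assumes \<nu>: "\<And>i. -1/2 \<le> \<nu> $ i" and u: "\<And>i. 0 \<le> u $ i"
    and int: "set_integrable lborel orthant (\<lambda>v. \<theta> v * complex_of_real (hkernel \<nu> u v))"
    and int': "set_integrable lborel orthant (\<lambda>v. cmod (\<theta> v) * vpowr v \<nu>)"
  shows "cmod (hankel \<nu> \<theta> u) \<le> (\<Prod>i\<in>UNIV. 1 / Gamma (\<nu> $ i + 1)) * (LINT v:orthant|lborel. cmod (\<theta> v) * vpowr v \<nu>)"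
proof -
  let ?C = "\<Prod>i\<in>UNIV. 1 / Gamma (\<nu> $ i + 1)"
  have K: "\<bar>hkernel \<nu> u v\<bar> \<le> ?C * vpowr v \<nu>" if v: "v \<in> orthant" for v
  proof -
    have v0: "0 \<le> v $ i" for i using v by (simp add: orthant_def less_imp_le)
    have "\<bar>hkernel \<nu> u v\<bar> = (\<Prod>i\<in>UNIV. \<bar>bessel (\<nu> $ i) (u $ i * v $ i)\<bar> * (v $ i) powr (\<nu> $ i))"
      unfolding hkernel_def abs_prod by (simp add: abs_mult)
    also have "\<dots> \<le> (\<Prod>i\<in>UNIV. 1 / Gamma (\<nu> $ i + 1) * (v $ i) powr (\<nu> $ i))"
      by (intro prod_mono conjI mult_right_mono bessel_bounded \<nu> mult_nonneg_nonneg u v0) auto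
    finally show ?thesis by (simp only: prod.distrib vpowr_def)
  qed
  have "norm (LINT v|lborel. indicator orthant v *\<^sub>R (\<theta> v * complex_of_real (hkernel \<nu> u v))) \<le>
     (LINT v|lborel. ?C * (indicator orthant v *\<^sub>R (cmod (\<theta> v) * vpowr v \<nu>)))"
  proof (rule Bochner_Integration.integral_norm_bound_integral)
    show "integrable lborel (\<lambda>v. indicator orthant v *\<^sub>R (\<theta> v * complex_of_real (hkernel \<nu> u v)))"
      using int unfolding set_integrable_def .
    show "integrable lborel (\<lambda>v. ?C * (indicat_real orthant v *\<^sub>R (cmod (\<theta> v) * vpowr v \<nu>)))"
      using int' unfolding set_integrable_def by (rule integrable_mult_right)
    fix v :: "real ^ 'a"
    show "norm (indicator orthant v *\<^sub>R (\<theta> v * complex_of_real (hkernel \<nu> u v))) \<le>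
      ?C * (indicat_real orthant v *\<^sub>R (cmod (\<theta> v) * vpowr v \<nu>))"
    proof (cases "v \<in> orthant")
      case True
      have "cmod (\<theta> v) * \<bar>hkernel \<nu> u v\<bar> \<le> cmod (\<theta> v) * (?C * vpowr v \<nu>)"
        by (rule mult_left_mono[OF K[OF True]]) simp
      then show ?thesis using True by (simp only: indicator_simps scaleR_one norm_mult norm_of_real mult_ac)
    qed simp
  qed
  then show ?thesis unfolding hankel_def set_lebesgue_integral_def by simp
qed

lemma finite_mi_abs_le: "finite {\<alpha> :: 'n::finite multi_index. mi_abs \<alpha> \<le> N}"
proof (rule finite_subset)
  show "{\<alpha> :: 'n multi_index. mi_abs \<alpha> \<le> N} \<subseteq> PiE UNIV (\<lambda>_. {..N})"
  proof
    fix \<alpha> :: "'n multi_index" assume "\<alpha> \<in> {\<alpha>. mi_abs \<alpha> \<le> N}"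
    moreover have "\<alpha> i \<le> mi_abs \<alpha>" for i
      unfolding mi_abs_def by (rule member_le_sum) auto
    ultimately show "\<alpha> \<in> PiE UNIV (\<lambda>_. {..N})" by (auto intro: order_trans)
  qed
  show "finite (PiE (UNIV :: 'n set) (\<lambda>_. {..N}))" by (intro finite_PiE) auto
qed

section \<open>Exponential decay and integrability\<close>

lemma exp_lower_sum:
  fixes x :: real
  assumes "0 \<le> x"
  shows "(\<Sum>j\<le>k. x ^ j / fact j) \<le> exp x"
proof -
  have "(\<Sum>j\<in>{..k}. x ^ j / fact j) \<le> (\<Sum>j. x ^ j / fact j)"
    using summable_exp[of x] assms by (intro sum_le_suminf) (auto simp: field_simps)
  also have "(\<Sum>j. x ^ j / fact j) = exp x"
    using exp_converges[of x] by (simp add: sums_iff field_simps)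
  finally show ?thesis .
qed

lemma power_exp_bounded:
  fixes v d :: real
  assumes "0 \<le> v" "0 < d"
  shows "v ^ k * exp (- (d * v)) \<le> fact k / d ^ k"
proof -
  have "(d * v) ^ k / fact k \<le> exp (d * v)"
    using assms member_le_sum[of k "{..k}" "\<lambda>j. (d * v) ^ j / fact j"] exp_lower_sum[of "d * v" k] by simp
  then have "(d * v) ^ k * exp (- (d * v)) \<le> fact k"
    by (simp add: exp_minus field_simps)
  then show ?thesis using assms by (simp add: power_mult_distrib field_simps)
qed

definition expw :: "('n::finite \<Rightarrow> real) \<Rightarrow> real ^ 'n \<Rightarrow> real" where
  "expw \<sigma> v = exp (- (\<Sum>i\<in>UNIV. \<sigma> i * v $ i))"

lemma expw_prod: "expw \<sigma> v = (\<Prod>i\<in>UNIV. exp (- (\<sigma> i * v $ i)))"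
  unfolding expw_def by (simp add: exp_sum sum_negf[symmetric])

text \<open>The strict gap between \<open>\<sigma>\<close> and \<open>\<tau>\<close> absorbs the
  polynomial factors.\<close>

lemma expoly_decay:
  assumes "\<theta> \<in> expoly \<tau>" "\<And>i. \<sigma> i < \<tau> i"
  shows "\<exists>C\<ge>0. \<forall>v\<in>orthant. cmod (\<theta> v) \<le> C * expw \<sigma> v"
  using assms(1)
proof induction
  case (monexp t k)
  let ?C = "\<Prod>i\<in>UNIV. fact (k i) / (t i - \<sigma> i) ^ k i"
  have p: "0 < t i - \<sigma> i" for i using monexp[of i] assms(2)[of i] by simp
  have "cmod (complex_of_real (monexp k t v)) \<le> ?C * expw \<sigma> v" if v: "v \<in> orthant" for v
  proof -
    have v0: "0 \<le> v $ i" for i using v by (simp add: orthant_def less_imp_le)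
    have "monexp k t v \<le> (\<Prod>i\<in>UNIV. fact (k i) / (t i - \<sigma> i) ^ k i * exp (- (\<sigma> i * v $ i)))"
      unfolding monexp_def
    proof (intro prod_mono conjI)
      fix i
      have "(v $ i) ^ k i * exp (- (t i * v $ i)) = (v $ i) ^ k i * exp (- ((t i - \<sigma> i) * v $ i)) * exp (- (\<sigma> i * v $ i))"
        by (simp add: exp_add[symmetric] algebra_simps)
      also have "\<dots> \<le> fact (k i) / (t i - \<sigma> i) ^ k i * exp (- (\<sigma> i * v $ i))"
        by (intro mult_right_mono power_exp_bounded v0 p) simp
      finally show "(v $ i) ^ k i * exp (- (t i * v $ i)) \<le> fact (k i) / (t i - \<sigma> i) ^ k i * exp (- (\<sigma> i * v $ i))" .
    qed (use v0 in auto)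
    moreover have "monexp k t v \<ge> 0" unfolding monexp_def by (intro prod_nonneg) (use v0 in auto)
    ultimately show ?thesis by (simp only: norm_of_real abs_of_nonneg prod.distrib expw_prod)
  qed
  moreover have "?C \<ge> 0" by (intro prod_nonneg) (use p in \<open>auto simp: less_imp_le\<close>)
  ultimately show ?case by blast
next
  case (add \<theta> \<eta>)
  then obtain C D where C: "C \<ge> 0" "\<And>v. v \<in> orthant \<Longrightarrow> cmod (\<theta> v) \<le> C * expw \<sigma> v"
    and D: "D \<ge> 0" "\<And>v. v \<in> orthant \<Longrightarrow> cmod (\<eta> v) \<le> D * expw \<sigma> v" by blast
  have "cmod (\<theta> v + \<eta> v) \<le> (C + D) * expw \<sigma> v" if "v \<in> orthant" for v
    using norm_triangle_ineq[of "\<theta> v" "\<eta> v"] C(2)[OF that] D(2)[OF that] by (simp add: algebra_simps)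
  then show ?case using C(1) D(1) by (intro exI[of _ "C + D"]) auto
next
  case (cmult \<theta> c)
  then obtain C where C: "C \<ge> 0" "\<And>v. v \<in> orthant \<Longrightarrow> cmod (\<theta> v) \<le> C * expw \<sigma> v" by blast
  have "cmod (c * \<theta> v) \<le> (cmod c * C) * expw \<sigma> v" if "v \<in> orthant" for v
    using mult_left_mono[OF C(2)[OF that], of "cmod c"] by (simp add: norm_mult mult.assoc)
  then show ?case using C(1) by (intro exI[of _ "cmod c * C"]) auto
qed

lemma expw_integrable:
  assumes "\<And>i. 0 < \<sigma> i" "\<And>i. -1/2 \<le> \<nu> $ i"
  shows "set_integrable lborel orthant (\<lambda>v. expw \<sigma> v * vpowr v \<nu>)"
proof -
  have "has_bochner_integral lborel (\<lambda>v. \<Prod>i\<in>UNIV. indicator {0<..} (v $ i) * ((v $ i) powr (\<nu> $ i) * exp (- (\<sigma> i * v $ i))))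
    (\<Prod>i\<in>UNIV. Gamma (\<nu> $ i + 1) * \<sigma> i powr - (\<nu> $ i + 1))"
    by (intro has_bochner_integral_prod_vec Gamma_has_bochner_integral assms less_le_trans[OF _ assms(2)]) simp
  moreover have "(\<Prod>i\<in>UNIV. indicator {0<..} (v $ i) * ((v $ i) powr (\<nu> $ i) * exp (- (\<sigma> i * v $ i))))
    = indicator orthant v *\<^sub>R (expw \<sigma> v * vpowr v \<nu>)" for v
    unfolding indicator_orthant expw_prod vpowr_def prod.distrib by simp
  ultimately show ?thesis unfolding set_integrable_def has_bochner_integral_iff by simp
qed

lemma vpowr_measurable [measurable]: "(\<lambda>v :: real ^ 'n::finite. vpowr v \<nu>) \<in> borel_measurable borel"
  unfolding vpowr_def by measurable

lemma vpowr_nonneg: "0 \<le> vpowr v \<nu>"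
  unfolding vpowr_def by (intro prod_nonneg) auto

lemma decay_integrable:
  assumes "\<And>i. 0 < \<sigma> i" "\<And>i. -1/2 \<le> \<nu> $ i" "\<theta> \<in> borel_measurable borel"
    and "\<And>v. v \<in> orthant \<Longrightarrow> cmod (\<theta> v) \<le> C * expw \<sigma> v"
  shows "set_integrable lborel orthant (\<lambda>v. cmod (\<theta> v) * vpowr v \<nu>)"
    and "(LINT v:orthant|lborel. cmod (\<theta> v) * vpowr v \<nu>) \<le> C * (LINT v:orthant|lborel. expw \<sigma> v * vpowr v \<nu>)"
proof -
  have i: "set_integrable lborel orthant (\<lambda>v. C * (expw \<sigma> v * vpowr v \<nu>))"
    by (intro set_integrable_mult_right expw_integrable assms)
  have le: "cmod (\<theta> v) * vpowr v \<nu> \<le> C * (expw \<sigma> v * vpowr v \<nu>)" if "v \<in> orthant" for v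
    using mult_right_mono[OF assms(4)[OF that] vpowr_nonneg, of v \<nu>] by (simp add: mult.assoc)
  show 1: "set_integrable lborel orthant (\<lambda>v. cmod (\<theta> v) * vpowr v \<nu>)"
    using i unfolding set_integrable_def
  proof (rule Bochner_Integration.integrable_bound)
    show "(\<lambda>v. indicat_real orthant v *\<^sub>R (cmod (\<theta> v) * vpowr v \<nu>)) \<in> borel_measurable lborel"
      using assms(3) by measurable
    show "AE v in lborel. norm (indicat_real orthant v *\<^sub>R (cmod (\<theta> v) * vpowr v \<nu>))
        \<le> norm (indicat_real orthant v *\<^sub>R (C * (expw \<sigma> v * vpowr v \<nu>)))"
    proof (intro AE_I2)
      fix v :: "real ^ 'a"
      show "norm (indicat_real orthant v *\<^sub>R (cmod (\<theta> v) * vpowr v \<nu>))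
        \<le> norm (indicat_real orthant v *\<^sub>R (C * (expw \<sigma> v * vpowr v \<nu>)))"
      proof (cases "v \<in> orthant")
        case True
        have "\<bar>cmod (\<theta> v) * vpowr v \<nu>\<bar> = cmod (\<theta> v) * vpowr v \<nu>"
          using vpowr_nonneg[of v \<nu>] by (intro abs_of_nonneg) simp
        then show ?thesis using le[OF True] True by simp
      qed simp
    qed
  qed
  have "(LINT v:orthant|lborel. cmod (\<theta> v) * vpowr v \<nu>) \<le> (LINT v:orthant|lborel. C * (expw \<sigma> v * vpowr v \<nu>))"
    by (rule set_integral_mono[OF 1 i le])
  then show "(LINT v:orthant|lborel. cmod (\<theta> v) * vpowr v \<nu>) \<le> C * (LINT v:orthant|lborel. expw \<sigma> v * vpowr v \<nu>)"
    by simp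
qed

lemma hankel_sum:
  assumes "finite A" "\<And>a. a \<in> A \<Longrightarrow> \<theta> a \<in> expoly \<tau>" "\<And>i. 0 < \<tau> i" "\<And>i. -1/2 \<le> \<nu> $ i"
  shows "hankel \<nu> (\<lambda>v. \<Sum>a\<in>A. \<theta> a v) u = (\<Sum>a\<in>A. hankel \<nu> (\<theta> a) u)"
  using assms(1,2)
proof (induction rule: finite_induct)
  case empty
  then show ?case by (simp add: hankel_def)
next
  case (insert a A)
  then have "hankel \<nu> (\<lambda>v. \<theta> a v + (\<Sum>a\<in>A. \<theta> a v)) u = hankel \<nu> (\<theta> a) u + hankel \<nu> (\<lambda>v. \<Sum>a\<in>A. \<theta> a v) u"
    by (intro hankel_add[of _ \<tau>] expoly_sum assms(3,4)) auto
  then show ?case using insert by simp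
qed

text \<open>Chosen so that the transform turns it into multiplication by
  \<open>1 + (norm x)^2\<close>. Its powers convert the weights of the seminorms into derivatives of
  \<open>\<theta>\<close>.\<close>

definition laguerre_op :: "real ^ 'n::finite \<Rightarrow> 'n cfun \<Rightarrow> 'n cfun" where
  "laguerre_op \<nu> \<theta> v = \<theta> v - (\<Sum>i\<in>UNIV. bessel_op \<nu> i \<theta> v)"

lemma expoly_laguerre_op: "\<theta> \<in> expoly \<tau> \<Longrightarrow> laguerre_op \<nu> \<theta> \<in> expoly \<tau>"
  unfolding laguerre_op_def[abs_def] by (intro expoly_diff expoly_sum expoly_bessel_op) auto

lemma expoly_laguerre_op_funpow: "\<theta> \<in> expoly \<tau> \<Longrightarrow> (laguerre_op \<nu> ^^ m) \<theta> \<in> expoly \<tau>"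
  by (induction m) (auto intro: expoly_laguerre_op)

lemma hankel_laguerre_op:
  assumes "\<theta> \<in> expoly \<tau>" "\<And>i. 0 < \<tau> i" "\<And>i. -1/2 \<le> \<nu> $ i"
  shows "hankel \<nu> (laguerre_op \<nu> \<theta>) (vsq x) = complex_of_real (1 + (norm x)\<^sup>2) * hankel \<nu> \<theta> (vsq x)"
proof -
  note e = expoly_bessel_op[OF assms(1)]
  have "laguerre_op \<nu> \<theta> = (\<lambda>v. \<theta> v + (-1) * (\<Sum>i\<in>UNIV. bessel_op \<nu> i \<theta> v))"
    by (simp add: laguerre_op_def fun_eq_iff)
  then have "hankel \<nu> (laguerre_op \<nu> \<theta>) (vsq x) = hankel \<nu> \<theta> (vsq x) + (-1) * (\<Sum>i\<in>UNIV. hankel \<nu> (bessel_op \<nu> i \<theta>) (vsq x))"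
    using hankel_add[OF assms(1) expoly.cmult[OF expoly_sum[of UNIV "\<lambda>i. bessel_op \<nu> i \<theta>" \<tau>, OF finite e]] assms(2,3), of "-1" "vsq x"]
      hankel_sum[of UNIV "\<lambda>i. bessel_op \<nu> i \<theta>" \<tau> \<nu> "vsq x", OF finite e assms(2,3)]
    by (simp only: hankel_cmult)
  also have "\<dots> = hankel \<nu> \<theta> (vsq x) + (\<Sum>i\<in>UNIV. complex_of_real (vsq x $ i) * hankel \<nu> \<theta> (vsq x))"
    unfolding hankel_bessel_op[OF assms] by (simp add: sum_negf)
  also have "\<dots> = complex_of_real (1 + (norm x)\<^sup>2) * hankel \<nu> \<theta> (vsq x)"
    unfolding norm_power2_vec by (simp add: sum_distrib_right[symmetric] distrib_right)
  finally show ?thesis .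
qed

lemma hankel_laguerre_op_funpow:
  assumes "\<theta> \<in> expoly \<tau>" "\<And>i. 0 < \<tau> i" "\<And>i. -1/2 \<le> \<nu> $ i"
  shows "hankel \<nu> ((laguerre_op \<nu> ^^ m) \<theta>) (vsq x) = complex_of_real (1 + (norm x)\<^sup>2) ^ m * hankel \<nu> \<theta> (vsq x)"
  by (induction m) (simp_all add: hankel_laguerre_op[OF expoly_laguerre_op_funpow[OF assms(1)] assms(2,3)] del: of_real_add)

definition shift_index :: "'n::finite list \<Rightarrow> real ^ 'n \<Rightarrow> real ^ 'n" where
  "shift_index l \<nu> = foldr (\<lambda>i \<nu>. \<nu> + axis i 1) l \<nu>"

lemma shift_index_ge: "(\<And>i. -1/2 \<le> \<nu> $ i) \<Longrightarrow> -1/2 \<le> shift_index l \<nu> $ i"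
proof (induction l arbitrary: i)
  case (Cons j l)
  show ?case using shift_ge[of "shift_index l \<nu>"] Cons by (simp add: shift_index_def)
qed (simp add: shift_index_def)

text \<open>In \<open>u_i = x_i^2\<close> the operator \<open>T_op i\<close> is twice the partial
  derivative, and that derivative is minus a raised index: a factor \<open>-2\<close> per
  operator.\<close>

lemma T_list_hankel:
  assumes "\<theta> \<in> expoly \<tau>" "\<And>i. 0 < \<tau> i" "\<And>i. -1/2 \<le> \<nu> $ i" "x \<in> orthant"
  shows "T_list l (\<lambda>x. hankel \<nu> \<theta> (vsq x)) x = (-2) ^ length l * hankel (shift_index l \<nu>) \<theta> (vsq x)"
  using assms(4)
proof (induction l arbitrary: x)
  case (Cons i l)
  let ?\<rho> = "shift_index l \<nu>"
  have "T_list (i # l) (\<lambda>x. hankel \<nu> \<theta> (vsq x)) x = T_op i (\<lambda>x. (-2) ^ length l * hankel ?\<rho> \<theta> (vsq x)) x"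
    unfolding T_list_simps by (rule T_op_cong) (use Cons in auto)
  also have "\<dots> = complex_of_real (inverse (x $ i)) * ((-2) ^ length l * (complex_of_real (-2 * x $ i) * hankel (?\<rho> + axis i 1) \<theta> (vsq x)))"
    by (rule T_op_has_partial)
       (rule has_partial_cmult[OF hankel_has_partial[OF assms(1,2) shift_index_ge[OF assms(3)]]])
  also have "\<dots> = (-2) ^ length (i # l) * hankel (shift_index (i # l) \<nu>) \<theta> (vsq x)"
    using Cons.prems by (auto simp: shift_index_def orthant_def field_simps) (metis less_irrefl)
  finally show ?case .
qed (simp add: shift_index_def)

section \<open>The resulting elements of \<open>Hmu\<close> and the action of \<open>S_op\<close>
  and \<open>L_op\<close> on them\<close>

definition synth :: "real ^ 'n::{finite,linorder} \<Rightarrow> 'n cfun \<Rightarrow> 'n cfun" where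
  "synth \<mu> \<theta> x = (if x \<in> orthant then complex_of_real (vpowr x (\<chi> i. \<mu> $ i + 1/2)) * hankel \<mu> \<theta> (vsq x) else 0)"

lemma reduced_synth: "x \<in> orthant \<Longrightarrow> reduced \<mu> (synth \<mu> \<theta>) x = hankel \<mu> \<theta> (vsq x)"
  using vpowr_pos[of x "\<chi> i. \<mu> $ i + 1/2"] unfolding reduced_def vpowr_reduced_eq vpowr_uminus
  by (simp add: synth_def)

text \<open>The seminorms of \<open>synth \<mu> \<theta>\<close> become L1 norms on the side of
  \<open>\<theta>\<close>: the operators in \<open>l\<close> shift the index to
  \<open>\<nu>\<close>, the weight is traded for \<open>m\<close> applications of
  \<open>laguerre_op \<nu>\<close>, and the kernel of index \<open>\<nu>\<close> is bounded. To make
  \<open>synth \<mu> \<theta>\<close> small it is enough to control finitely many derivatives of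
  \<open>\<theta>\<close>.\<close>

lemma synth_seminorm_bound:
  assumes "\<theta> \<in> expoly \<tau>" "\<And>i. 0 < \<tau> i" "\<And>i. -1/2 \<le> \<mu> $ i" "x \<in> orthant"
    and \<nu>: "\<nu> = shift_index l \<mu>"
  shows "(1 + (norm x)\<^sup>2) ^ m * cmod (T_list l (reduced \<mu> (synth \<mu> \<theta>)) x) \<le>
    2 ^ length l * (\<Prod>i\<in>UNIV. 1 / Gamma (\<nu> $ i + 1)) * (LINT v:orthant|lborel. cmod ((laguerre_op \<nu> ^^ m) \<theta> v) * vpowr v \<nu>)"
proof -
  have nu: "-1/2 \<le> \<nu> $ i" for i unfolding \<nu> by (rule shift_index_ge[OF assms(3)])
  let ?\<eta> = "(laguerre_op \<nu> ^^ m) \<theta>"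
  have e: "?\<eta> \<in> expoly \<tau>" by (rule expoly_laguerre_op_funpow[OF assms(1)])
  have t2: "\<tau> i / 2 < \<tau> i" "0 < \<tau> i / 2" for i using assms(2)[of i] by auto
  obtain C where C: "\<And>v. v \<in> orthant \<Longrightarrow> cmod (?\<eta> v) \<le> C * expw (\<lambda>i. \<tau> i / 2) v"
    using expoly_decay[OF e t2(1)] by blast
  have "T_list l (reduced \<mu> (synth \<mu> \<theta>)) x = T_list l (\<lambda>x. hankel \<mu> \<theta> (vsq x)) x"
    by (rule T_list_cong) (use reduced_synth assms(4) in auto)
  also have "\<dots> = (-2) ^ length l * hankel \<nu> \<theta> (vsq x)" unfolding \<nu> by (rule T_list_hankel[OF assms(1-4)])
  finally have "(1 + (norm x)\<^sup>2) ^ m * cmod (T_list l (reduced \<mu> (synth \<mu> \<theta>)) x) =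
      2 ^ length l * ((1 + (norm x)\<^sup>2) ^ m * cmod (hankel \<nu> \<theta> (vsq x)))"
    by (simp add: norm_mult norm_power)
  also have "(1 + (norm x)\<^sup>2) ^ m * cmod (hankel \<nu> \<theta> (vsq x)) = cmod (hankel \<nu> ?\<eta> (vsq x))"
    unfolding hankel_laguerre_op_funpow[OF assms(1,2) nu] norm_mult norm_power norm_of_real by simp
  also have "\<dots> \<le> (\<Prod>i\<in>UNIV. 1 / Gamma (\<nu> $ i + 1)) * (LINT v:orthant|lborel. cmod (?\<eta> v) * vpowr v \<nu>)"
    by (rule hankel_bound[OF nu _ hankel_integrable[OF e assms(2) nu] decay_integrable(1)[OF t2(2) nu expoly_measurable[OF e] C]]) simp_all
  finally show ?thesis by (simp add: mult.assoc)
qed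

lemma Cinf_on_synth:
  assumes "\<theta> \<in> expoly \<tau>" "\<And>i. 0 < \<tau> i" "\<And>i. -1/2 \<le> \<mu> $ i"
  shows "Cinf_on orthant (synth \<mu> \<theta>)"
  by (rule Cinf_on_transform[OF Cinf_on_mult[OF _ Cinf_on_vpowr Cinf_on_hankel[OF assms]]])
     (auto simp: synth_def)

lemma synth_in_Hmu:
  assumes "\<theta> \<in> expoly \<tau>" "\<And>i. 0 < \<tau> i" "\<And>i. -1/2 \<le> \<mu> $ i"
  shows "synth \<mu> \<theta> \<in> Hmu \<mu>"
proof (rule HmuI)
  show "\<exists>C. \<forall>x\<in>orthant. (1 + (norm x)\<^sup>2) ^ m * cmod (T_list l (reduced \<mu> (synth \<mu> \<theta>)) x) \<le> C" for m l
    using synth_seminorm_bound[OF assms _ refl] by blast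
qed (auto simp: synth_def intro: Cinf_on_synth[OF assms])

lemma synth_add:
  assumes "\<theta> \<in> expoly \<tau>" "\<eta> \<in> expoly \<tau>" "\<And>i. 0 < \<tau> i" "\<And>i. -1/2 \<le> \<mu> $ i"
  shows "synth \<mu> (\<lambda>v. \<theta> v + \<eta> v) = (\<lambda>x. synth \<mu> \<theta> x + synth \<mu> \<eta> x)"
  by (auto simp: synth_def fun_eq_iff hankel_add[OF assms] distrib_left)

lemma synth_cmult: "synth \<mu> (\<lambda>v. c * \<theta> v) = (\<lambda>x. c * synth \<mu> \<theta> x)"
  by (auto simp: synth_def fun_eq_iff hankel_cmult)

lemma synth_sum:
  assumes "finite A" "\<And>a. a \<in> A \<Longrightarrow> \<theta> a \<in> expoly \<tau>" "\<And>i. 0 < \<tau> i" "\<And>i. -1/2 \<le> \<mu> $ i"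
  shows "synth \<mu> (\<lambda>v. \<Sum>a\<in>A. \<theta> a v) = (\<lambda>x. \<Sum>a\<in>A. synth \<mu> (\<theta> a) x)"
  by (auto simp: synth_def fun_eq_iff hankel_sum[of A \<theta> \<tau>, OF assms] sum_distrib_left)

lemma has_partial_coord: "has_partial i (\<lambda>y. complex_of_real (y $ i)) 1 x"
proof -
  have "(complex_of_real has_vector_derivative complex_of_real 1) (at (x $ i))"
    by (rule has_vector_derivative_of_real) simp
  then show ?thesis using has_partial_component(1) by fastforce
qed

text \<open>With \<open>a = \<mu>_i + 1/2\<close> the potential is \<open>a (a - 1) / x_i^2\<close>,
  which cancels the second derivative of the factor \<open>x_i^a\<close>. The rest is
  \<open>x_i^a\<close> times \<open>\<partial>^2 + (2 a / x_i) \<partial>\<close> applied to the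
  transform. In \<open>u_i = x_i^2\<close> this operator is
  \<open>4 (u_i \<partial>^2 + (\<mu>_i + 1) \<partial>)\<close>, and by
  \<open>hankel_coord_mult\<close> it acts as \<open>- 4 v_i\<close>.\<close>

lemma S_op_synth:
  assumes "\<theta> \<in> expoly \<tau>" "\<And>i. 0 < \<tau> i" "\<And>i. -1/2 \<le> \<mu> $ i"
  shows "S_op \<mu> i (synth \<mu> \<theta>) = synth \<mu> (\<lambda>v. - 4 * (complex_of_real (v $ i) * \<theta> v))"
proof
  fix x
  show "S_op \<mu> i (synth \<mu> \<theta>) x = synth \<mu> (\<lambda>v. - 4 * (complex_of_real (v $ i) * \<theta> v)) x"
  proof (cases "x \<in> orthant")
    case True
    let ?a = "\<chi> i. \<mu> $ i + 1/2" and ?e = "axis i (1::real)"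
    let ?h = "\<lambda>\<nu> x. hankel \<nu> \<theta> (vsq x)"
    let ?P = "\<lambda>\<nu> y. complex_of_real (vpowr y \<nu>)"
    define ai where "ai = complex_of_real (?a $ i)"
    have hp: "has_partial i (?h \<mu>) (complex_of_real (-2 * x $ i) * ?h (\<mu> + ?e) x) x"
      and hp1: "has_partial i (?h (\<mu> + ?e)) (complex_of_real (-2 * x $ i) * ?h (\<mu> + ?e + ?e) x) x" for x
      by (rule hankel_has_partial[OF assms(1,2)]; (intro shift_ge assms(3)))+
    have vp: "has_partial i (?P (\<nu> + c *\<^sub>R ?e)) (complex_of_real (\<nu> $ i + c) * ?P (\<nu> + (c - 1) *\<^sub>R ?e) y) y" if "y \<in> orthant" for \<nu> c y
      using has_partial_vpowr[OF that, of i "\<nu> + c *\<^sub>R ?e"] by (simp add: axis_def algebra_simps)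
    have eqs: "synth \<mu> \<theta> y = ?P ?a y * ?h \<mu> y" if "y \<in> orthant" for y
      using that by (simp add: synth_def)
    let ?D = "\<lambda>y. ?P ?a y * (complex_of_real (-2 * y $ i) * ?h (\<mu> + ?e) y) + (ai * ?P (?a + (-1) *\<^sub>R ?e) y) * ?h \<mu> y"
    have D: "partial i (synth \<mu> \<theta>) y = ?D y" if y: "y \<in> orthant" for y
    proof -
      have "has_partial i (\<lambda>y. ?P ?a y * ?h \<mu> y) (?D y) y"
        using has_partial_mult[OF vp[OF y, of ?a 0] hp[of y]] by (simp add: ai_def)
      then have "partial i (\<lambda>y. ?P ?a y * ?h \<mu> y) y = ?D y" by (rule has_partial_imp_partial)
      then show ?thesis using partial_cong[OF open_orthant y eqs] by simp
    qed
    have lin: "has_partial i (\<lambda>y. complex_of_real (-2 * y $ i)) (-2) x"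
      using has_partial_cmult[OF has_partial_coord, of i "-2" x] by simp
    let ?h0 = "?h \<mu> x" and ?h1 = "?h (\<mu> + ?e) x" and ?h2 = "?h (\<mu> + ?e + ?e) x" and ?X = "complex_of_real (-2 * x $ i)"
    have "has_partial i ?D
      ((?P ?a x * (?X * (?X * ?h2) + (-2) * ?h1) + (ai * ?P (?a + (-1) *\<^sub>R ?e) x) * (?X * ?h1))
       + ((ai * ?P (?a + (-1) *\<^sub>R ?e) x) * (?X * ?h1) + (ai * ((ai - 1) * ?P (?a + (-2) *\<^sub>R ?e) x)) * ?h0)) x"

    proof -
      have p0: "has_partial i (?P ?a) (ai * ?P (?a + (-1) *\<^sub>R ?e) x) x"
        using vp[OF True, of ?a 0] by (simp add: ai_def)
      have p1: "has_partial i (?P (?a + (-1) *\<^sub>R ?e)) ((ai - 1) * ?P (?a + (-2) *\<^sub>R ?e) x) x"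
        using vp[OF True, of ?a "-1"] by (simp add: ai_def)
      show ?thesis
        by (rule has_partial_add[OF has_partial_mult[OF p0 has_partial_mult[OF lin hp1[of x]]]
            has_partial_mult[OF has_partial_cmult[OF p1, of ai] hp[of x]]])
    qed
    from trans[OF partial_cong[OF open_orthant True D] has_partial_imp_partial[OF this]]
    have D2: "partial i (partial i (synth \<mu> \<theta>)) x =
       ((?P ?a x * (?X * (?X * ?h2) + (-2) * ?h1) + (ai * ?P (?a + (-1) *\<^sub>R ?e) x) * (?X * ?h1))
       + ((ai * ?P (?a + (-1) *\<^sub>R ?e) x) * (?X * ?h1) + (ai * ((ai - 1) * ?P (?a + (-2) *\<^sub>R ?e) x)) * ?h0))"
      .
    have x: "x $ i > 0" using True by (simp add: orthant_def)
    define z where "z = complex_of_real (x $ i)"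
    have z: "z \<noteq> 0" using x by (simp add: z_def)
    have v1: "?P (?a + (-1) *\<^sub>R ?e) x = ?P ?a x / z" "?P (?a + (-2) *\<^sub>R ?e) x = ?P ?a x / z\<^sup>2"
    proof -
      have "x $ i powr (-1) = inverse (x $ i)" "x $ i powr (-2) = inverse ((x $ i)\<^sup>2)"
        using x by (simp_all add: powr_minus)
      then show "?P (?a + (-1) *\<^sub>R ?e) x = ?P ?a x / z" "?P (?a + (-2) *\<^sub>R ?e) x = ?P ?a x / z\<^sup>2"
        unfolding vpowr_axis[OF True] z_def of_real_mult divide_inverse
        by (simp_all only: of_real_inverse of_real_power mult.commute)
    qed
    have X: "?X = - 2 * z" by (simp add: z_def)
    have c: "complex_of_real ((4 * (\<mu> $ i)\<^sup>2 - 1) / (4 * (x $ i)\<^sup>2)) = ai * (ai - 1) / z\<^sup>2"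
      unfolding ai_def z_def by (simp add: field_simps power2_eq_square)
    have ai: "complex_of_real (\<mu> $ i + 1) = ai + 1/2" by (simp add: ai_def)
    have "S_op \<mu> i (synth \<mu> \<theta>) x = ?P ?a x * (- 4 * ((ai + 1/2) * ?h1 - z\<^sup>2 * ?h2))"
    proof -
      have g: "((P * (- 2 * z * (- 2 * z * h2) + (-2) * h1) + (A * (P / z)) * (- 2 * z * h1))
        + ((A * (P / z)) * (- 2 * z * h1) + (A * ((A - 1) * (P / z\<^sup>2))) * h0)) - A * (A - 1) / z\<^sup>2 * (P * h0)
        = P * (- 4 * ((A + 1/2) * h1 - z\<^sup>2 * h2))" for P A h0 h1 h2
      proof -
        have g1: "(A * (P / z)) * (- 2 * z * h1) = - 2 * A * P * h1" using z by simp
        have g2: "(A * ((A - 1) * (P / z\<^sup>2))) * h0 = A * (A - 1) / z\<^sup>2 * (P * h0)" by simp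
        show ?thesis unfolding g1 g2 by (simp add: algebra_simps power2_eq_square)
      qed
      show ?thesis unfolding S_op_def D2 c eqs[OF True] v1 X using True by (simp only: g if_True)
    qed
    also have "\<dots> = synth \<mu> (\<lambda>v. - 4 * (complex_of_real (v $ i) * \<theta> v)) x"
      unfolding synth_def hankel_cmult hankel_coord_mult[OF assms] ai
      using True by (simp add: z_def)
    finally show ?thesis .
  qed (simp add: S_op_def synth_def)
qed

lemma S_pow_synth:
  assumes "\<theta> \<in> expoly \<tau>" "\<And>i. 0 < \<tau> i" "\<And>i. -1/2 \<le> \<mu> $ i"
  shows "S_pow \<mu> \<alpha> (synth \<mu> \<theta>) = synth \<mu> (\<lambda>v. (-4) ^ mi_abs \<alpha> * ((\<Prod>i\<in>UNIV. complex_of_real (v $ i) ^ \<alpha> i) * \<theta> v))"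
proof -
  have *: "foldr (\<lambda>i. S_op \<mu> i ^^ \<alpha> i) xs (synth \<mu> \<theta>) =
      synth \<mu> (\<lambda>v. (-4) ^ (\<Sum>i\<in>set xs. \<alpha> i) * ((\<Prod>i\<in>set xs. complex_of_real (v $ i) ^ \<alpha> i) * \<theta> v))
    \<and> (\<lambda>v. (-4) ^ (\<Sum>i\<in>set xs. \<alpha> i) * ((\<Prod>i\<in>set xs. complex_of_real (v $ i) ^ \<alpha> i) * \<theta> v)) \<in> expoly \<tau>"
    if "distinct xs" for xs
    using that
  proof (induction xs)
    case (Cons i xs)
    have **: "(S_op \<mu> i ^^ k) (synth \<mu> \<eta>) = synth \<mu> (\<lambda>v. (-4) ^ k * (complex_of_real (v $ i) ^ k * \<eta> v))
      \<and> (\<lambda>v. (-4) ^ k * (complex_of_real (v $ i) ^ k * \<eta> v)) \<in> expoly \<tau>"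
      if \<eta>: "\<eta> \<in> expoly \<tau>" for \<eta> k
    proof (induction k)
      case (Suc k)
      let ?\<zeta> = "\<lambda>v. (-4) ^ k * (complex_of_real (v $ i) ^ k * \<eta> v)"
      have "(S_op \<mu> i ^^ Suc k) (synth \<mu> \<eta>) = S_op \<mu> i (synth \<mu> ?\<zeta>)" using Suc by simp
      also have "\<dots> = synth \<mu> (\<lambda>v. - 4 * (complex_of_real (v $ i) * ?\<zeta> v))"
        by (rule S_op_synth[OF conjunct2[OF Suc] assms(2,3)])
      finally have 1: "(S_op \<mu> i ^^ Suc k) (synth \<mu> \<eta>) = synth \<mu> (\<lambda>v. - 4 * (complex_of_real (v $ i) * ?\<zeta> v))" .
      have 2: "(\<lambda>v. - 4 * (complex_of_real (v $ i) * ?\<zeta> v)) \<in> expoly \<tau>"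
        by (intro expoly.cmult expoly_coord_mult conjunct2[OF Suc])
      have 3: "(\<lambda>v. - 4 * (complex_of_real (v $ i) * ?\<zeta> v)) = (\<lambda>v. (-4) ^ Suc k * (complex_of_real (v $ i) ^ Suc k * \<eta> v))"
        by (simp add: fun_eq_iff mult_ac)
      from 1 2 show ?case unfolding 3 by simp
    qed (use \<eta> in simp)
    let ?\<eta> = "\<lambda>v. (-4) ^ (\<Sum>i\<in>set xs. \<alpha> i) * ((\<Prod>i\<in>set xs. complex_of_real (v $ i) ^ \<alpha> i) * \<theta> v)"
    have \<eta>: "?\<eta> \<in> expoly \<tau>" using Cons by simp
    have eq: "(\<lambda>v. (-4) ^ \<alpha> i * (complex_of_real (v $ i) ^ \<alpha> i * ?\<eta> v)) =
       (\<lambda>v. (-4) ^ (\<Sum>i\<in>set (i # xs). \<alpha> i) * ((\<Prod>i\<in>set (i # xs). complex_of_real (v $ i) ^ \<alpha> i) * \<theta> v))"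
      using Cons.prems by (simp add: fun_eq_iff power_add mult_ac)
    show ?case using **[OF \<eta>, of "\<alpha> i"] Cons unfolding eq by simp
  qed (use assms in simp)
  show ?thesis
    unfolding S_pow_def using *[of "sorted_list_of_set UNIV"] by (simp add: mi_abs_def)
qed

definition symbol :: "nat \<Rightarrow> ('n::finite multi_index \<Rightarrow> real) \<Rightarrow> real ^ 'n \<Rightarrow> real" where
  "symbol N a v = (\<Sum>\<alpha> | mi_abs \<alpha> \<le> N. a \<alpha> * 4 ^ mi_abs \<alpha> * (\<Prod>i\<in>UNIV. (v $ i) ^ \<alpha> i))"

lemma expoly_monomial: "(\<lambda>v. \<Prod>i\<in>UNIV. complex_of_real (v $ i) ^ \<alpha> i) \<in> expoly (\<lambda>_. 0)"
  using expoly.monexp[of "\<lambda>_. 0" "\<lambda>_. 0" \<alpha>] by (simp add: monexp_def)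

lemma expoly_symbol: "(\<lambda>v. complex_of_real (symbol N a v)) \<in> expoly (\<lambda>_. 0)"
proof -
  have "(\<lambda>v. \<Sum>\<alpha> | mi_abs \<alpha> \<le> N. complex_of_real (a \<alpha> * 4 ^ mi_abs \<alpha>) * (\<Prod>i\<in>UNIV. complex_of_real (v $ i) ^ \<alpha> i)) \<in> expoly (\<lambda>_. 0)"
    by (intro expoly_sum finite_mi_abs_le expoly.cmult expoly_monomial)
  then show ?thesis by (simp add: symbol_def)
qed

text \<open>The signs \<open>(-1)^|\<alpha>|\<close> in \<open>L\<close> cancel those of
  \<open>(-4)^|\<alpha>|\<close>, so the coefficients of the symbol inherit the signs of the
  \<open>a \<alpha>\<close>.\<close>

lemma L_op_synth:
  assumes "\<theta> \<in> expoly \<tau>" "\<And>i. 0 < \<tau> i" "\<And>i. -1/2 \<le> \<mu> $ i" "Hmu_linear \<mu> f"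
  shows "L_op \<mu> N a f (synth \<mu> \<theta>) = f (synth \<mu> (\<lambda>v. complex_of_real (symbol N a v) * \<theta> v))"
proof -
  let ?A = "{\<alpha>. mi_abs \<alpha> \<le> N}"
  let ?m = "\<lambda>\<alpha> v. (\<Prod>i\<in>UNIV. complex_of_real (v $ i) ^ \<alpha> i) * \<theta> v"
  have e: "?m \<alpha> \<in> expoly \<tau>" for \<alpha>
    by (rule expoly_mult'[OF expoly_monomial assms(1)])
  have "L_op \<mu> N a f (synth \<mu> \<theta>) = (\<Sum>\<alpha>\<in>?A. complex_of_real ((-1) ^ mi_abs \<alpha> * a \<alpha>) * f (synth \<mu> (\<lambda>v. (-4) ^ mi_abs \<alpha> * ?m \<alpha> v)))"
    unfolding L_op_def S_pow_dual_def using synth_in_Hmu[OF assms(1-3)] by (simp add: S_pow_synth[OF assms(1-3)])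
  also have "\<dots> = f (\<lambda>x. \<Sum>\<alpha>\<in>?A. complex_of_real ((-1) ^ mi_abs \<alpha> * a \<alpha>) * synth \<mu> (\<lambda>v. (-4) ^ mi_abs \<alpha> * ?m \<alpha> v) x)"
    by (rule Hmu_linear_sum[OF assms(4) finite_mi_abs_le, symmetric]) (intro synth_in_Hmu[OF expoly.cmult[OF e] assms(2,3)])
  also have "(\<lambda>x. \<Sum>\<alpha>\<in>?A. complex_of_real ((-1) ^ mi_abs \<alpha> * a \<alpha>) * synth \<mu> (\<lambda>v. (-4) ^ mi_abs \<alpha> * ?m \<alpha> v) x)
    = (\<lambda>x. \<Sum>\<alpha>\<in>?A. synth \<mu> (\<lambda>v. complex_of_real (a \<alpha> * 4 ^ mi_abs \<alpha>) * ?m \<alpha> v) x)"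
  proof (intro ext sum.cong refl)
    fix x and \<alpha> :: "'a multi_index"
    have "(-1) ^ mi_abs \<alpha> * (-4) ^ mi_abs \<alpha> = (4 :: complex) ^ mi_abs \<alpha>"
      by (simp add: power_mult_distrib[symmetric])
    then have "complex_of_real ((-1) ^ mi_abs \<alpha> * a \<alpha>) * (-4) ^ mi_abs \<alpha> = complex_of_real (a \<alpha> * 4 ^ mi_abs \<alpha>)"
      by (simp add: mult_ac)
    then show "complex_of_real ((-1) ^ mi_abs \<alpha> * a \<alpha>) * synth \<mu> (\<lambda>v. (-4) ^ mi_abs \<alpha> * ?m \<alpha> v) x
      = synth \<mu> (\<lambda>v. complex_of_real (a \<alpha> * 4 ^ mi_abs \<alpha>) * ?m \<alpha> v) x"
      using synth_cmult[of \<mu> "(-4) ^ mi_abs \<alpha>" "?m \<alpha>"] synth_cmult[of \<mu> "complex_of_real (a \<alpha> * 4 ^ mi_abs \<alpha>)" "?m \<alpha>"]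
      by (simp only: mult.assoc[symmetric])
  qed
  also have "\<dots> = synth \<mu> (\<lambda>v. \<Sum>\<alpha>\<in>?A. complex_of_real (a \<alpha> * 4 ^ mi_abs \<alpha>) * ?m \<alpha> v)"
    by (rule synth_sum[symmetric, OF finite_mi_abs_le expoly.cmult[OF e] assms(2,3)])
  also have "(\<lambda>v. \<Sum>\<alpha>\<in>?A. complex_of_real (a \<alpha> * 4 ^ mi_abs \<alpha>) * ?m \<alpha> v) = (\<lambda>v. complex_of_real (symbol N a v) * \<theta> v)"
    by (simp add: symbol_def sum_distrib_right mult.assoc)
  finally show ?thesis .
qed

text \<open>Homogeneity: \<open>\<psi>\<close> scaled by \<open>\<delta> / e\<close> lies in the
  neighbourhood on which \<open>f\<close> is less than 1 in modulus.\<close>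

lemma Hmu_dual_scaled:
  assumes lin: "Hmu_linear \<mu> f" and \<delta>: "0 < \<delta>"
    and bd: "\<And>\<psi>. \<psi> \<in> Hmu \<mu> \<Longrightarrow> (\<forall>(m,k)\<in>F. gamma_seminorm \<mu> m k \<psi> \<le> ennreal \<delta>) \<Longrightarrow> cmod (f \<psi>) < 1"
    and \<psi>: "\<psi> \<in> Hmu \<mu>" and e: "0 < e"
    and small: "\<And>m k x. (m,k) \<in> F \<Longrightarrow> x \<in> orthant \<Longrightarrow>
      (1 + (norm x)\<^sup>2) ^ m * cmod (T_list (mi_list k) (reduced \<mu> \<psi>) x) \<le> e"
  shows "cmod (f \<psi>) \<le> e / \<delta>"
proof -
  define c where "c = complex_of_real (\<delta> / e)"
  have c: "cmod c = \<delta> / e" using \<delta> e by (simp add: c_def norm_divide)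
  have "gamma_seminorm \<mu> m k (\<lambda>x. c * \<psi> x) \<le> ennreal \<delta>" if mk: "(m,k) \<in> F" for m k
  proof (subst gamma_seminorm_le_iff, use \<delta> in simp, rule ballI, goal_cases)
    case (1 x)
    note x = 1
    have "T_list (mi_list k) (reduced \<mu> (\<lambda>x. c * \<psi> x)) x = c * T_list (mi_list k) (reduced \<mu> \<psi>) x"
      using T_list_lincomb[OF Cinf_on_reduced[OF HmuD(1)[OF \<psi>], of \<mu>] Cinf_on_const[OF open_orthant, of 0] x, of "mi_list k" c 0]
        reduced_lincomb[of \<mu> c \<psi> 0 "\<lambda>x. 0"] by (simp add: reduced_def)
    then have "(1 + (norm x)\<^sup>2) ^ m * cmod (T_list (mi_list k) (reduced \<mu> (\<lambda>x. c * \<psi> x)) x)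
      = cmod c * ((1 + (norm x)\<^sup>2) ^ m * cmod (T_list (mi_list k) (reduced \<mu> \<psi>) x))"
      by (simp add: norm_mult)
    also have "\<dots> \<le> cmod c * e" by (rule mult_left_mono[OF small[OF mk x]]) simp
    also have "\<dots> = \<delta>" using e by (simp add: c)
    finally show ?case .
  qed
  then have "cmod (f (\<lambda>x. c * \<psi> x)) < 1" by (intro bd Hmu_cmult \<psi>) auto
  moreover have "f (\<lambda>x. c * \<psi> x) = c * f \<psi>" using lin \<psi> unfolding Hmu_linear_def by blast
  ultimately show ?thesis using \<delta> e by (simp add: norm_mult c field_simps)
qed

subsection \<open>Cutoff by the symbol of \<open>L\<close>\<close>

text \<open>A smooth substitute for the factor \<open>v^q\<close>, and a regularised incomplete
  Gamma function: it vanishes to order \<open>q\<close> at 0. Its advantage over a power is that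
  \<open>exp (- t v) (1 - taylor_gap (1 - t) q v)\<close> equals \<open>exp (- v)\<close> times a
  Taylor polynomial in \<open>(1 - t) v\<close>, so that discarding the gap leaves exactly a finite
  expansion.\<close>

definition taylor_gap :: "real \<Rightarrow> nat \<Rightarrow> real \<Rightarrow> real" where
  "taylor_gap a q v = 1 - exp (- (a * v)) * (\<Sum>j<q. (a * v) ^ j / fact j)"

lemma taylor_gap_bound:
  assumes "0 \<le> a" "0 \<le> v"
  shows "\<bar>taylor_gap a q v\<bar> \<le> (a * v) ^ q"
proof -
  let ?x = "a * v"
  have x: "0 \<le> ?x" using assms by simp
  obtain t where t: "\<bar>t\<bar> \<le> \<bar>?x\<bar>" "exp ?x = (\<Sum>m<q. ?x ^ m / fact m) + exp t / fact q * ?x ^ q"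
    using Maclaurin_exp_le by blast
  have "exp (- ?x) * (\<Sum>m<q. ?x ^ m / fact m) = exp (- ?x) * (exp ?x - exp t / fact q * ?x ^ q)"
    using t(2) by simp
  also have "\<dots> = 1 - exp (t - ?x) / fact q * ?x ^ q"
    by (simp add: right_diff_distrib exp_add[symmetric] exp_diff exp_minus field_simps)
  finally have "taylor_gap a q v = exp (t - ?x) / fact q * ?x ^ q" by (simp add: taylor_gap_def)
  moreover have "exp (t - ?x) / fact q \<le> 1"
  proof -
    have "exp (t - ?x) \<le> 1" using t(1) x by simp
    moreover have "(1::real) \<le> fact q" by (rule fact_ge_1)
    ultimately have "exp (t - ?x) \<le> fact q" by (rule order_trans)
    then show ?thesis by (simp add: divide_le_eq)
  qed
  ultimately show ?thesis
    using mult_right_mono[of "exp (t - ?x) / fact q" 1 "?x ^ q"] x by (simp add: abs_mult)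
qed

lemma taylor_sum_deriv:
  "((\<lambda>v. \<Sum>j<q. (a * v) ^ j / fact j) has_real_derivative a * (\<Sum>j<q - 1. (a * v) ^ j / fact j)) (at v)"
proof (induction q)
  case (Suc q)
  have "((\<lambda>v. (a * v) ^ q / fact q) has_real_derivative (if q = 0 then 0 else a * ((a * v) ^ (q - 1) / fact (q - 1)))) (at v)"
  proof (cases q)
    case (Suc p)
    have "((\<lambda>v. (a * v) ^ Suc p / fact (Suc p)) has_real_derivative (real (Suc p) * (a * v) ^ p * a) / fact (Suc p)) (at v)"
      by (auto intro!: derivative_eq_intros simp del: of_nat_Suc power_Suc fact_Suc)
    moreover have "(real (Suc p) * (a * v) ^ p * a) / fact (Suc p) = a * ((a * v) ^ p / fact p)"
      by (simp del: of_nat_Suc)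
    ultimately show ?thesis unfolding Suc by (simp only: nat.simps if_False diff_Suc_1)
  qed simp
  from DERIV_add[OF Suc this] show ?case
    by (cases q) (simp_all add: distrib_left)
qed simp

text \<open>The family is closed under differentiation, and each derivative loses one order of
  vanishing. At \<open>q = 0\<close> the gap is the constant 1, in accordance with the truncated
  \<open>q - 1\<close>.\<close>

lemma taylor_gap_deriv:
  "(taylor_gap a q has_real_derivative a * (taylor_gap a (q - 1) v - taylor_gap a q v)) (at v)"
proof -
  have "((\<lambda>v. exp (- (a * v))) has_real_derivative - a * exp (- (a * v))) (at v)"
    by (auto intro!: derivative_eq_intros)
  from DERIV_diff[OF DERIV_const[of 1] DERIV_mult[OF this taylor_sum_deriv[of a q v]]]
  show ?thesis unfolding taylor_gap_def[abs_def] by (simp add: algebra_simps)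
qed

lemma expoly_exp_coord:
  "(\<lambda>v. complex_of_real (exp (- (a * v $ i)))) \<in> expoly (\<lambda>j. if j = i then a else 0)"
proof -
  have "monexp (\<lambda>_. 0) (\<lambda>j. if j = i then a else 0) v = exp (- (a * v $ i))" for v
    unfolding monexp_split[of _ _ _ i] by simp
  then show ?thesis
    using expoly.monexp[of "\<lambda>j. if j = i then a else 0" "\<lambda>j. if j = i then a else 0" "\<lambda>_. 0"] by simp
qed

lemma expoly_coord_power: "(\<lambda>v. complex_of_real (v $ i) ^ n) \<in> expoly (\<lambda>_. 0)"
  by (induction n) (auto intro: expoly_const expoly_coord_mult)

lemma expoly_taylor_gap:
  assumes "0 \<le> a"
  shows "(\<lambda>v. complex_of_real (taylor_gap a q (v $ i))) \<in> expoly (\<lambda>_. 0)"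
proof -
  have e: "(\<lambda>v. complex_of_real (exp (- (a * v $ i)))) \<in> expoly (\<lambda>_. 0)"
    by (rule expoly_antimono[OF expoly_exp_coord]) (use assms in auto)
  have "(\<lambda>v. 1 - complex_of_real (exp (- (a * v $ i))) * (\<Sum>j<q. (complex_of_real a ^ j / fact j) * complex_of_real (v $ i) ^ j)) \<in> expoly (\<lambda>_. 0)"
    by (intro expoly_diff expoly_const expoly_mult'[OF e] expoly_sum expoly.cmult expoly_coord_power) simp
  then show ?thesis by (simp add: taylor_gap_def power_mult_distrib)
qed

text \<open>Derivatives of \<open>\<theta> (1 - H)\<^sup>M\<close>, where \<open>\<theta>\<close> vanishes to order \<open>R\<close> on \<open>v\<^sub>i = 0\<close>: after \<open>n\<close>
  differentiations at least \<open>R - n\<close> zeros are left, and at most \<open>n\<close> factors \<open>M\<close> have been produced.\<close>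

inductive_set cutoff_seq :: "'n::finite \<Rightarrow> real \<Rightarrow> ('n \<Rightarrow> real) \<Rightarrow> (real ^ 'n \<Rightarrow> real) \<Rightarrow> nat \<Rightarrow> nat \<Rightarrow> (nat \<Rightarrow> 'n cfun) set"
  for i a \<tau> H R n where
  base: "r \<le> n \<Longrightarrow> R \<le> q + n \<Longrightarrow> g \<in> expoly \<tau> \<Longrightarrow> (\<And>M. cmod (c M) \<le> K) \<Longrightarrow>
    (\<lambda>M v. c M * (complex_of_real (taylor_gap a q (v $ i)) * g v) * (of_nat M ^ r * complex_of_real (1 - H v) ^ (M - r)))
      \<in> cutoff_seq i a \<tau> H R n"
| add: "S \<in> cutoff_seq i a \<tau> H R n \<Longrightarrow> S' \<in> cutoff_seq i a \<tau> H R n \<Longrightarrow>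
    (\<lambda>M v. S M v + S' M v) \<in> cutoff_seq i a \<tau> H R n"

lemma cutoff_seq_mono: "S \<in> cutoff_seq i a \<tau> H R n \<Longrightarrow> n \<le> n' \<Longrightarrow> S \<in> cutoff_seq i a \<tau> H R n'"
proof (induction rule: cutoff_seq.induct)
  case (base r q g c K)
  show ?case by (rule cutoff_seq.base[where K=K]) (use base in auto)
qed (rule cutoff_seq.add)

lemma cutoff_seq_mult:
  assumes "\<zeta> \<in> expoly (\<lambda>_. 0)"
  shows "S \<in> cutoff_seq i a \<tau> H R n \<Longrightarrow> (\<lambda>M v. \<zeta> v * S M v) \<in> cutoff_seq i a \<tau> H R n"
proof (induction rule: cutoff_seq.induct)
  case (base r q g c K)
  have "(\<lambda>M v. c M * (complex_of_real (taylor_gap a q (v $ i)) * (\<zeta> v * g v)) * (of_nat M ^ r * complex_of_real (1 - H v) ^ (M - r)))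
      \<in> cutoff_seq i a \<tau> H R n"
    by (rule cutoff_seq.base[where K=K]) (use base expoly_mult'[OF assms] in auto)
  then show ?case by (simp only: mult_ac)
next
  case (add S S')
  from cutoff_seq.add[OF add.IH] show ?case by (simp add: distrib_left)
qed

text \<open>The product rule gives four terms of the base shape: two from
  \<open>taylor_gap_deriv\<close>, with order \<open>q - 1\<close> or \<open>q\<close>, one from
  \<open>g\<close>, and one from the power of \<open>1 - H\<close>. Only the first lowers the order,
  and only the last raises \<open>r\<close>.\<close>

lemma cutoff_seq_partial:
  assumes H: "(\<lambda>v. complex_of_real (H v)) \<in> expoly (\<lambda>_. 0)"
  shows "S \<in> cutoff_seq i a \<tau> H R n \<Longrightarrow>
    \<exists>S'\<in>cutoff_seq i a \<tau> H R (Suc n). \<forall>M v. has_partial j (S M) (S' M v) v"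
proof (induction rule: cutoff_seq.induct)
  case (base r q g c K)
  define dH where "dH = partial j (\<lambda>v. complex_of_real (H v))"
  have dH: "dH \<in> expoly (\<lambda>_. 0)" unfolding dH_def by (rule expoly_partial[OF H])
  let ?e = "\<lambda>q v. complex_of_real (taylor_gap a q (v $ i))"
  let ?w = "\<lambda>r M v. of_nat M ^ r * complex_of_real (1 - H v) ^ (M - r)"
  define a' where "a' = (if j = i then complex_of_real a else 0)"
  \<comment> \<open>The exponent yields the factor \<open>M - r\<close>, while the base shape wants
    a full factor \<open>M\<close>. The quotient has modulus at most 1 and joins the bounded
    coefficients. For \<open>M = 0\<close> it is 0, as is the derivative of the power with exponent
    0.\<close>
  define c' where "c' M = c M * (- (of_nat (M - r) / of_nat M))" for M
  have c': "cmod (c' M) \<le> K" for M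
  proof -
    have "cmod (of_nat (M - r) / of_nat M) \<le> 1" by (simp add: norm_divide divide_le_eq)
    then have "cmod (c' M) \<le> cmod (c M) * 1"
      unfolding c'_def norm_mult norm_minus_cancel by (intro mult_left_mono) auto
    then show ?thesis using base(4)[of M] by simp
  qed
  have ca: "cmod (c M * a') \<le> K * cmod a'" for M
    unfolding norm_mult by (rule mult_right_mono[OF base(4)]) simp
  have ca': "cmod (- (c M * a')) \<le> K * cmod a'" for M using ca[of M] by simp
  let ?S1 = "\<lambda>M v. (c M * a') * (?e (q - 1) v * g v) * ?w r M v"
  let ?S2 = "\<lambda>M v. (- (c M * a')) * (?e q v * g v) * ?w r M v"
  let ?S3 = "\<lambda>M v. c M * (?e q v * partial j g v) * ?w r M v"
  let ?S4 = "\<lambda>M v. c' M * (?e q v * (dH v * g v)) * ?w (Suc r) M v"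
  have 1: "?S1 \<in> cutoff_seq i a \<tau> H R (Suc n)"
    by (rule cutoff_seq.base[OF _ _ base(3) ca]) (use base(1,2) in auto)
  have 2: "?S2 \<in> cutoff_seq i a \<tau> H R (Suc n)"
    by (rule cutoff_seq.base[OF _ _ base(3) ca']) (use base(1,2) in auto)
  have 3: "?S3 \<in> cutoff_seq i a \<tau> H R (Suc n)"
    by (rule cutoff_seq.base[OF _ _ expoly_partial[OF base(3)] base(4)]) (use base(1,2) in auto)
  have 4: "?S4 \<in> cutoff_seq i a \<tau> H R (Suc n)"
    by (rule cutoff_seq.base[OF _ _ expoly_mult'[OF dH base(3)] c']) (use base(1,2) in auto)
  let ?S' = "\<lambda>M v. ((?S1 M v + ?S2 M v) + ?S3 M v) + ?S4 M v"
  have mem: "?S' \<in> cutoff_seq i a \<tau> H R (Suc n)"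
    using cutoff_seq.add[OF cutoff_seq.add[OF cutoff_seq.add[OF 1 2] 3] 4] .
  have hp: "has_partial j (\<lambda>v. c M * (?e q v * g v) * ?w r M v) (?S' M v) v" for M v
  proof -
    have he: "has_partial j (?e q) (a' * (?e (q - 1) v - ?e q v)) v"
    proof -
      have d: "((\<lambda>x. complex_of_real (taylor_gap a q x)) has_vector_derivative complex_of_real (a * (taylor_gap a (q - 1) (v $ i) - taylor_gap a q (v $ i)))) (at (v $ i))"
        by (rule has_vector_derivative_of_real[OF taylor_gap_deriv])
      show ?thesis
      proof (cases "j = i")
        case True
        then show ?thesis using has_partial_component(1)[OF d] by (simp add: a'_def)
      next
        case False
        then show ?thesis using has_partial_component(2)[OF d False] by (simp add: a'_def)
      qed
    qed
    have h1: "has_partial j (\<lambda>v. complex_of_real (1 - H v)) (- dH v) v"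
      using has_partial_add[OF has_partial_const[of j 1 v] has_partial_cmult[OF expoly_partial'[OF H, of j v], of "-1"]]
      by (simp add: dH_def)
    have hpow: "has_partial j (\<lambda>v. complex_of_real (1 - H v) ^ m) (of_nat m * complex_of_real (1 - H v) ^ (m - 1) * (- dH v)) v" for m
    proof (induction m)
      case 0
      show ?case using has_partial_const[of j 1 v] by simp
    next
      case (Suc m)
      have "has_partial j (\<lambda>v. complex_of_real (1 - H v) * complex_of_real (1 - H v) ^ m)
        (complex_of_real (1 - H v) * (of_nat m * complex_of_real (1 - H v) ^ (m - 1) * (- dH v)) + - dH v * complex_of_real (1 - H v) ^ m) v"
        by (rule has_partial_mult[OF h1 Suc])
      moreover have "complex_of_real (1 - H v) * (of_nat m * complex_of_real (1 - H v) ^ (m - 1) * (- dH v)) + - dH v * complex_of_real (1 - H v) ^ m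
        = of_nat (Suc m) * complex_of_real (1 - H v) ^ (Suc m - 1) * (- dH v)"
        by (cases m) (simp_all add: algebra_simps)
      ultimately show ?case by simp
    qed
    have "has_partial j (\<lambda>v. c M * (?e q v * g v) * ?w r M v)
      (c M * (?e q v * g v) * (of_nat M ^ r * (of_nat (M - r) * complex_of_real (1 - H v) ^ (M - r - 1) * (- dH v)))
       + (c M * (?e q v * partial j g v + a' * (?e (q - 1) v - ?e q v) * g v)) * ?w r M v) v"
      by (intro has_partial_mult has_partial_cmult he hpow expoly_partial'[OF base(3)])
    moreover have "c M * (?e q v * g v) * (of_nat M ^ r * (of_nat (M - r) * complex_of_real (1 - H v) ^ (M - r - 1) * (- dH v))) = ?S4 M v"
    proof (cases "M = 0")
      case False
      then have *: "of_nat M ^ r * of_nat (M - r) = (of_nat (M - r) / of_nat M) * (of_nat M ^ Suc r :: complex)" by simp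
      have gen: "C * (E * G) * ((X * Y) * W * (- D)) = C * (- Z) * (E * (D * G)) * (Xr * W)"
        if "X * Y = Z * Xr" for C E G X Y W D Z Xr :: complex
        unfolding that by simp
      from gen[OF *]
      have "c M * (?e q v * g v) * ((of_nat M ^ r * of_nat (M - r)) * complex_of_real (1 - H v) ^ (M - r - 1) * (- dH v)) = ?S4 M v"
        unfolding c'_def by (simp only: diff_diff_left Suc_eq_plus1)
      then show ?thesis by (simp only: mult.assoc)
    qed (simp add: c'_def)
    moreover have "(c M * (?e q v * partial j g v + a' * (?e (q - 1) v - ?e q v) * g v)) * ?w r M v = (?S1 M v + ?S2 M v) + ?S3 M v"
      by (simp add: algebra_simps)
    ultimately show ?thesis by (simp only: add.commute)
  qed
  show ?case by (rule bexI[OF _ mem]) (use hp in simp)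
next
  case (add S S')
  then obtain T T' where T: "T \<in> cutoff_seq i a \<tau> H R (Suc n)" "\<And>M v. has_partial j (S M) (T M v) v"
    and T': "T' \<in> cutoff_seq i a \<tau> H R (Suc n)" "\<And>M v. has_partial j (S' M) (T' M v) v" by blast
  show ?case
    by (rule bexI[OF _ cutoff_seq.add[OF T(1) T'(1)]]) (use has_partial_add[OF T(2) T'(2)] in simp)
qed

lemma cutoff_seq_sum:
  assumes "finite A" "A \<noteq> {}" "\<And>x. x \<in> A \<Longrightarrow> S x \<in> cutoff_seq i a \<tau> H R n"
  shows "(\<lambda>M v. \<Sum>x\<in>A. S x M v) \<in> cutoff_seq i a \<tau> H R n"
  using assms
proof (induction rule: finite_ne_induct)
  case (insert x A)
  then show ?case using cutoff_seq.add[of "S x" i a \<tau> H R n] by simp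
qed simp

lemma cutoff_seq_partial':
  assumes H: "(\<lambda>v. complex_of_real (H v)) \<in> expoly (\<lambda>_. 0)" and S: "S \<in> cutoff_seq i a \<tau> H R n"
  shows "(\<lambda>M. partial j (S M)) \<in> cutoff_seq i a \<tau> H R (Suc n)"
proof -
  obtain S' where S': "S' \<in> cutoff_seq i a \<tau> H R (Suc n)" "\<And>M v. has_partial j (S M) (S' M v) v"
    using cutoff_seq_partial[OF H S] by blast
  have "(\<lambda>M. partial j (S M)) = S'"
    by (intro ext has_partial_imp_partial S'(2))
  with S'(1) show ?thesis by simp
qed

lemma cutoff_seq_laguerre_op:
  assumes H: "(\<lambda>v. complex_of_real (H v)) \<in> expoly (\<lambda>_. 0)" and S: "S \<in> cutoff_seq i a \<tau> H R n"
  shows "(\<lambda>M. laguerre_op \<nu> (S M)) \<in> cutoff_seq i a \<tau> H R (Suc (Suc n))"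
proof -
  note m = cutoff_seq_mult[OF expoly_const]
  have "(\<lambda>M v. S M v + (-1) * (\<Sum>j\<in>UNIV. complex_of_real (v $ j) * partial j (partial j (S M)) v + complex_of_real (\<nu> $ j + 1) * partial j (S M) v))
    \<in> cutoff_seq i a \<tau> H R (Suc (Suc n))"
  proof (intro cutoff_seq.add m cutoff_seq_sum)
    show "S \<in> cutoff_seq i a \<tau> H R (Suc (Suc n))" by (rule cutoff_seq_mono[OF S]) simp
    fix j
    note p = cutoff_seq_partial'[OF H S, of j]
    show "(\<lambda>M v. complex_of_real (v $ j) * partial j (partial j (S M)) v) \<in> cutoff_seq i a \<tau> H R (Suc (Suc n))"
      by (rule cutoff_seq_mult[OF expoly_coord cutoff_seq_partial'[OF H p]])
    show "(\<lambda>M. partial j (S M)) \<in> cutoff_seq i a \<tau> H R (Suc (Suc n))"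
      by (rule cutoff_seq_mono[OF p]) simp
  qed auto
  then show ?thesis by (simp add: laguerre_op_def[abs_def] bessel_op_def)
qed

text \<open>\<open>laguerre_op\<close> is of second order, so every application costs two steps of
  the derivative count.\<close>

lemma cutoff_seq_laguerre_op_funpow:
  assumes H: "(\<lambda>v. complex_of_real (H v)) \<in> expoly (\<lambda>_. 0)" and S: "S \<in> cutoff_seq i a \<tau> H R 0"
  shows "(\<lambda>M. (laguerre_op \<nu> ^^ m) (S M)) \<in> cutoff_seq i a \<tau> H R (2 * m)"
  by (induction m) (use S cutoff_seq_laguerre_op[OF H] in auto)

section \<open>Quantitative estimates for the cutoff\<close>

lemma expw_add: "expw \<sigma> v * expw \<tau> v = expw (\<lambda>i. \<sigma> i + \<tau> i) v"
  by (simp add: expw_def exp_add[symmetric] sum.distrib distrib_right)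

lemma expw_const: "expw (\<lambda>_. c) v = exp (- (c * (\<Sum>i\<in>UNIV. v $ i)))"
  by (simp add: expw_def sum_distrib_left)

lemma expw_pos: "0 < expw \<sigma> v" by (simp add: expw_def)

lemma expw_antimono: "v \<in> orthant \<Longrightarrow> (\<And>i. \<sigma> i \<le> \<tau> i) \<Longrightarrow> expw \<tau> v \<le> expw \<sigma> v"
  by (auto simp: expw_def orthant_def less_imp_le intro!: sum_mono mult_right_mono)

text \<open>From \<open>1 - h \<le> exp (- h)\<close> and
  \<open>s^(r + 1) exp (- s) \<le> (r + 1)!\<close> at \<open>s = M h\<close>. One power of
  \<open>M\<close> more than the \<open>M^r\<close> to be compensated is gained, at the price of
  \<open>r + 1\<close> powers of \<open>1 / h\<close>.\<close>

lemma one_minus_power_bound: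
  fixes h :: real
  assumes "0 < h" "h \<le> 1" "r \<le> M" "1 \<le> M"
  shows "real M ^ r * (1 - h) ^ (M - r) \<le> exp (real r) * fact (Suc r) / (real M * h ^ Suc r)"
proof -
  have "(1 - h) ^ (M - r) \<le> exp (- h) ^ (M - r)"
    using assms exp_ge_add_one_self[of "- h"] by (intro power_mono) auto
  also have "\<dots> = exp (real r * h) * exp (- (real M * h))"
    using assms(3) by (simp add: exp_of_nat_mult[symmetric] of_nat_diff exp_add[symmetric] algebra_simps)
  also have "\<dots> \<le> exp (real r) * exp (- (real M * h))"
    using assms by (intro mult_right_mono) (auto simp: mult_left_le)
  finally have 1: "(1 - h) ^ (M - r) \<le> exp (real r) * exp (- (real M * h))" .
  have Mh: "0 < real M * h" using assms by simp
  have "(real M * h) ^ Suc r * exp (- (1 * (real M * h))) \<le> fact (Suc r) / 1 ^ Suc r"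
    by (rule power_exp_bounded) (use Mh in auto)
  then have 2: "exp (- (real M * h)) \<le> fact (Suc r) / (real M * h) ^ Suc r"
    using Mh by (simp add: pos_le_divide_eq mult.commute del: power_Suc fact_Suc)
  have "real M ^ r * (1 - h) ^ (M - r) \<le> real M ^ r * (exp (real r) * (fact (Suc r) / (real M * h) ^ Suc r))"
    by (intro mult_left_mono order_trans[OF 1] 2) auto
  also have "\<dots> = exp (real r) * fact (Suc r) / (real M * h ^ Suc r)"
    using assms by (simp add: power_mult_distrib field_simps)
  finally show ?thesis .
qed

lemma cutoff_seq_bound:
  assumes \<epsilon>: "0 < \<epsilon>" and a: "0 \<le> a" and \<kappa>: "0 \<le> \<kappa>" "\<kappa> * (real n0 + 1) \<le> \<epsilon> / 4" and c0: "0 < c0"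
    and H: "\<And>v. v \<in> orthant \<Longrightarrow> c0 * (v $ i) ^ d * expw (\<lambda>_. \<kappa>) v \<le> H v"
    and H1: "\<And>v. v \<in> orthant \<Longrightarrow> H v \<le> 1"
    and R: "n0 + d * (n0 + 1) \<le> R" and n: "n \<le> n0"
  shows "S \<in> cutoff_seq i a (\<lambda>_. \<epsilon>) H R n \<Longrightarrow>
    \<exists>C\<ge>0. \<forall>M>n0. \<forall>v\<in>orthant. cmod (S M v) \<le> C / real M * expw (\<lambda>_. \<epsilon> / 4) v"
proof (induction rule: cutoff_seq.induct)
  case (base r q g c K)
  \<comment> \<open>The decay rate \<open>\<epsilon>\<close> is spent in quarters: one for the
    polynomial factors of \<open>g\<close>, one for the exponential in \<open>1 / H\<close>, one for
    \<open>(v $ i)^p\<close>, and one is kept for integrability.\<close>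
  obtain D where D: "D \<ge> 0" "\<And>v. v \<in> orthant \<Longrightarrow> cmod (g v) \<le> D * expw (\<lambda>_. 3 * \<epsilon> / 4) v"
    using expoly_decay[OF base(3), of "\<lambda>_. 3 * \<epsilon> / 4"] \<epsilon> by auto
  define p where "p = q - d * Suc r"
  have "d * Suc r \<le> d * (n0 + 1)" using base(1) n by (intro mult_le_mono2) auto
  then have "d * Suc r \<le> q" using R base(2) n by linarith
  then have q: "q = p + d * Suc r" unfolding p_def by simp
  define B where "B = fact p / (\<epsilon> / 4) ^ p"
  have K: "0 \<le> K" using base(4)[of 0] norm_ge_zero order_trans by blast
  define C where "C = K * a ^ q * D * (exp (real r) * fact (Suc r) / c0 ^ Suc r) * B"
  have C: "C \<ge> 0" unfolding C_def B_def using K a D(1) c0 \<epsilon> by (intro mult_nonneg_nonneg) auto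
  have "cmod (c M * (complex_of_real (taylor_gap a q (v $ i)) * g v) * (of_nat M ^ r * complex_of_real (1 - H v) ^ (M - r)))
    \<le> C / real M * expw (\<lambda>_. \<epsilon> / 4) v" if M: "n0 < M" and v: "v \<in> orthant" for M v
  proof -
    have vi: "0 < v $ i" using v by (simp add: orthant_def)
    define b where "b = c0 * (v $ i) ^ d * expw (\<lambda>_. \<kappa>) v"
    have b: "0 < b" "b \<le> H v" unfolding b_def using c0 vi expw_pos[of "\<lambda>_. \<kappa>" v] H[OF v] by auto
    have Hv: "0 < H v" "H v \<le> 1" using b H1[OF v] by auto
    have M1: "r \<le> M" "1 \<le> M" "0 < real M" using M base(1) n by auto
    have "real M ^ r * (1 - H v) ^ (M - r) \<le> exp (real r) * fact (Suc r) / (real M * H v ^ Suc r)"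
      by (rule one_minus_power_bound[OF Hv M1(1,2)])
    also have "\<dots> \<le> exp (real r) * fact (Suc r) / (real M * b ^ Suc r)"
      using b M1 by (intro divide_left_mono mult_left_mono power_mono mult_pos_pos) auto
    finally have w: "real M ^ r * (1 - H v) ^ (M - r) \<le> exp (real r) * fact (Suc r) / (real M * b ^ Suc r)" .
    have e: "\<bar>taylor_gap a q (v $ i)\<bar> \<le> (a * v $ i) ^ q" by (rule taylor_gap_bound) (use a vi in auto)
    have "cmod (c M * (complex_of_real (taylor_gap a q (v $ i)) * g v) * (of_nat M ^ r * complex_of_real (1 - H v) ^ (M - r)))
      = cmod (c M) * (\<bar>taylor_gap a q (v $ i)\<bar> * cmod (g v)) * (real M ^ r * (1 - H v) ^ (M - r))"
      using Hv(2) by (simp add: norm_mult norm_power del: of_real_diff)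
    also have "\<dots> \<le> K * ((a * v $ i) ^ q * (D * expw (\<lambda>_. 3 * \<epsilon> / 4) v)) * (exp (real r) * fact (Suc r) / (real M * b ^ Suc r))"
      by (intro mult_mono base(4) e D(2) v w mult_nonneg_nonneg) (use K a vi D(1) Hv less_imp_le[OF expw_pos] in auto)
    also have "\<dots> = K * a ^ q * D * (exp (real r) * fact (Suc r) / c0 ^ Suc r) / real M *
       ((v $ i) ^ p * (expw (\<lambda>_. 3 * \<epsilon> / 4) v / expw (\<lambda>_. \<kappa>) v ^ Suc r))"
    proof -
      have "(v $ i) ^ q = (v $ i) ^ p * ((v $ i) ^ d) ^ Suc r"
        unfolding q power_add power_mult ..
      moreover have "b ^ Suc r = c0 ^ Suc r * ((v $ i) ^ d) ^ Suc r * expw (\<lambda>_. \<kappa>) v ^ Suc r"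
        unfolding b_def power_mult_distrib ..
      moreover have "((v $ i) ^ d) ^ Suc r \<noteq> 0" using vi by simp
      moreover have "K * ((A * (P * Y)) * (G * E)) * (X / (m * (C * Y * W))) = K * A * G * (X / C) / m * (P * (E / W))"
        if "Y \<noteq> 0" for K A P Y G E X m C W :: real
        using that by (simp add: divide_inverse)
      ultimately show ?thesis unfolding power_mult_distrib[of a] by (simp only:)
    qed
    also have "\<dots> \<le> K * a ^ q * D * (exp (real r) * fact (Suc r) / c0 ^ Suc r) / real M * (B * expw (\<lambda>_. \<epsilon> / 4) v)"
    proof (rule mult_left_mono)
      show "0 \<le> K * a ^ q * D * (exp (real r) * fact (Suc r) / c0 ^ Suc r) / real M"
        using K a D(1) c0 M1 by (intro mult_nonneg_nonneg divide_nonneg_nonneg) auto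
      have "expw (\<lambda>_. 3 * \<epsilon> / 4) v / expw (\<lambda>_. \<kappa>) v ^ Suc r = expw (\<lambda>_. 3 * \<epsilon> / 4 - \<kappa> * real (Suc r)) v"
        unfolding expw_const exp_of_nat_mult[symmetric] exp_diff[symmetric]
        by (simp add: algebra_simps del: of_nat_Suc)
      also have "\<dots> \<le> expw (\<lambda>_. \<epsilon> / 4 + \<epsilon> / 4) v"
      proof (rule expw_antimono[OF v])
        have "\<kappa> * real (Suc r) \<le> \<kappa> * (real n0 + 1)" using base(1) n \<kappa> by (intro mult_left_mono) auto
        then show "\<epsilon> / 4 + \<epsilon> / 4 \<le> 3 * \<epsilon> / 4 - \<kappa> * real (Suc r)" using \<kappa> by simp
      qed
      also have "\<dots> = expw (\<lambda>_. \<epsilon> / 4) v * expw (\<lambda>_. \<epsilon> / 4) v" by (simp add: expw_add)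
      finally have 1: "expw (\<lambda>_. 3 * \<epsilon> / 4) v / expw (\<lambda>_. \<kappa>) v ^ Suc r \<le> expw (\<lambda>_. \<epsilon> / 4) v * expw (\<lambda>_. \<epsilon> / 4) v" .
      have "expw (\<lambda>_. \<epsilon> / 4) v \<le> exp (- (\<epsilon> / 4 * v $ i))"
        unfolding expw_def using member_le_sum[of i UNIV "\<lambda>j. \<epsilon> / 4 * v $ j"] v \<epsilon>
        by (simp add: orthant_def less_imp_le)
      then have "(v $ i) ^ p * expw (\<lambda>_. \<epsilon> / 4) v \<le> (v $ i) ^ p * exp (- (\<epsilon> / 4 * v $ i))"
        using vi by (intro mult_left_mono) auto
      also have "\<dots> \<le> B" unfolding B_def by (rule power_exp_bounded) (use vi \<epsilon> in auto)
      finally have 2: "(v $ i) ^ p * expw (\<lambda>_. \<epsilon> / 4) v \<le> B" .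
      have "(v $ i) ^ p * (expw (\<lambda>_. 3 * \<epsilon> / 4) v / expw (\<lambda>_. \<kappa>) v ^ Suc r) \<le> (v $ i) ^ p * (expw (\<lambda>_. \<epsilon> / 4) v * expw (\<lambda>_. \<epsilon> / 4) v)"
        using 1 vi by (intro mult_left_mono) auto
      also have "\<dots> \<le> B * expw (\<lambda>_. \<epsilon> / 4) v"
        unfolding mult.assoc[symmetric] using 2 expw_pos[of "\<lambda>_. \<epsilon> / 4" v] by (intro mult_right_mono) auto
      finally show "(v $ i) ^ p * (expw (\<lambda>_. 3 * \<epsilon> / 4) v / expw (\<lambda>_. \<kappa>) v ^ Suc r) \<le> B * expw (\<lambda>_. \<epsilon> / 4) v" .
    qed
    also have "\<dots> = C / real M * expw (\<lambda>_. \<epsilon> / 4) v" by (simp add: C_def)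
    finally show ?thesis .
  qed
  then show ?case using C by blast
next
  case (add S S')
  then obtain C C' where C: "C \<ge> 0" "\<And>M v. n0 < M \<Longrightarrow> v \<in> orthant \<Longrightarrow> cmod (S M v) \<le> C / real M * expw (\<lambda>_. \<epsilon> / 4) v"
    and C': "C' \<ge> 0" "\<And>M v. n0 < M \<Longrightarrow> v \<in> orthant \<Longrightarrow> cmod (S' M v) \<le> C' / real M * expw (\<lambda>_. \<epsilon> / 4) v" by blast
  have "cmod (S M v + S' M v) \<le> (C + C') / real M * expw (\<lambda>_. \<epsilon> / 4) v" if "n0 < M" "v \<in> orthant" for M v
    using norm_triangle_ineq[of "S M v" "S' M v"] C(2)[OF that] C'(2)[OF that]
    by (simp add: add_divide_distrib distrib_right)
  then show ?case using C(1) C'(1) by (intro exI[of _ "C + C'"]) auto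
qed

lemma symbol_lower:
  fixes a :: "'n::finite multi_index \<Rightarrow> real"
  assumes nonneg: "\<And>\<alpha>. mi_abs \<alpha> \<le> N \<Longrightarrow> 0 \<le> a \<alpha>" and nz: "mpoly_eval N a (axis i 1) \<noteq> 0"
  shows "\<exists>d b. 0 < b \<and> (\<forall>v\<in>orthant. b * (v $ i) ^ d \<le> symbol N a v)"
proof -
  obtain \<alpha> where \<alpha>: "mi_abs \<alpha> \<le> N" "a \<alpha> * (\<Prod>j\<in>UNIV. (axis i 1 $ j :: real) ^ \<alpha> j) \<noteq> 0"
    using nz unfolding mpoly_eval_def by (metis (mono_tags, lifting) mem_Collect_eq sum.neutral)
  then have a: "0 < a \<alpha>" using nonneg[OF \<alpha>(1)] by (cases "a \<alpha> = 0") auto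
  have z: "\<alpha> j = 0" if "j \<noteq> i" for j
  proof (rule ccontr)
    assume "\<alpha> j \<noteq> 0"
    then have "(axis i 1 $ j :: real) ^ \<alpha> j = 0" using that by (simp add: axis_def)
    then have "(\<Prod>j\<in>UNIV. (axis i 1 $ j :: real) ^ \<alpha> j) = 0" by (intro prod_zero) auto
    with \<alpha>(2) show False by simp
  qed
  have "a \<alpha> * 4 ^ mi_abs \<alpha> * (v $ i) ^ \<alpha> i \<le> symbol N a v" if v: "v \<in> orthant" for v
  proof -
    have "(\<Prod>j\<in>UNIV. (v $ j) ^ \<alpha> j) = (v $ i) ^ \<alpha> i"
      by (subst prod.remove[of _ i]) (auto simp: z)
    moreover have "a \<alpha> * 4 ^ mi_abs \<alpha> * (\<Prod>j\<in>UNIV. (v $ j) ^ \<alpha> j) \<le> symbol N a v"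
      unfolding symbol_def
      by (rule member_le_sum[of \<alpha> _ "\<lambda>\<alpha>. a \<alpha> * 4 ^ mi_abs \<alpha> * (\<Prod>j\<in>UNIV. (v $ j) ^ \<alpha> j)"])
         (use \<alpha> v nonneg finite_mi_abs_le in \<open>auto simp: orthant_def less_imp_le intro!: mult_nonneg_nonneg prod_nonneg\<close>)
    ultimately show ?thesis by simp
  qed
  then show ?thesis using a by (intro exI[of _ "\<alpha> i"] exI[of _ "a \<alpha> * 4 ^ mi_abs \<alpha>"]) auto
qed

text \<open>The order of the quantifiers matters: \<open>R\<close> is fixed before
  \<open>a'\<close>, \<open>\<epsilon>\<close> and \<open>g\<close>, because these will depend on
  the exponents \<open>t\<close>. Allowing every \<open>R' \<ge> R\<close> lets a single order serve
  all coordinates.\<close>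

lemma synth_vanish:
  fixes \<mu> :: "real ^ 'n::{finite,linorder}"
  assumes \<mu>: "\<And>i. -1/2 \<le> \<mu> $ i" and f: "f \<in> Hmu_dual \<mu>" and L: "L_op \<mu> N a f = (\<lambda>\<phi>. 0)"
    and nonneg: "\<And>\<alpha>. mi_abs \<alpha> \<le> N \<Longrightarrow> 0 \<le> a \<alpha>" and nz: "mpoly_eval N a (axis i 1) \<noteq> 0"
  shows "\<exists>R. \<forall>a'\<ge>0. \<forall>\<epsilon>>0. \<forall>g\<in>expoly (\<lambda>_. \<epsilon>). \<forall>R'\<ge>R.
    f (synth \<mu> (\<lambda>v. complex_of_real (taylor_gap a' R' (v $ i)) * g v)) = 0"
proof -
  have lin: "Hmu_linear \<mu> f" using f by (auto simp: Hmu_dual_def Hmu_linear_def)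
  obtain F \<delta> where F: "finite F" "0 < \<delta>"
    "\<And>\<psi>. \<psi> \<in> Hmu \<mu> \<Longrightarrow> (\<forall>(m,k)\<in>F. gamma_seminorm \<mu> m k \<psi> \<le> ennreal \<delta>) \<Longrightarrow> cmod (f \<psi>) < 1"
    using Hmu_dual_bound[OF f] by blast
  obtain d b where b: "0 < b" "\<And>v. v \<in> orthant \<Longrightarrow> b * (v $ i) ^ d \<le> symbol N a v"
    using symbol_lower[OF nonneg nz] by blast
  \<comment> \<open>A common bound for the number of derivatives, \<open>2 m\<close>, caused by the
    weights of all seminorms in \<open>F\<close>.\<close>
  define n0 where "n0 = (\<Sum>(m,k)\<in>F. 2 * m)"
  have n0: "2 * m \<le> n0" if "(m, k) \<in> F" for m k
    using member_le_sum[of "(m,k)" F "\<lambda>(m,k). 2 * m"] that F(1) unfolding n0_def by auto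
  have "f (synth \<mu> (\<lambda>v. complex_of_real (taylor_gap a' R' (v $ i)) * g v)) = 0"
    if a': "0 \<le> a'" and \<epsilon>: "0 < \<epsilon>" and g: "g \<in> expoly (\<lambda>_. \<epsilon>)" and R': "n0 + d * (n0 + 1) \<le> R'" for a' \<epsilon> g R'
  proof -
    \<comment> \<open>So small that the \<open>n0 + 1\<close> possible factors \<open>1 / H\<close>
      together use at most a quarter of the decay rate.\<close>
    define \<kappa> where "\<kappa> = \<epsilon> / (4 * (real n0 + 1))"
    have \<kappa>: "0 < \<kappa>" "\<kappa> * (real n0 + 1) \<le> \<epsilon> / 4" using \<epsilon> by (auto simp: \<kappa>_def field_simps)
    have ex: "(\<lambda>v. complex_of_real (expw (\<lambda>_. \<kappa>) v)) \<in> expoly (\<lambda>_. \<kappa>)"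
      using expoly.monexp[of "\<lambda>_. \<kappa>" "\<lambda>_. \<kappa>" "\<lambda>_. 0"] by (simp add: monexp_def expw_prod)
    have sx: "(\<lambda>v. complex_of_real (symbol N a v) * complex_of_real (expw (\<lambda>_. \<kappa>) v)) \<in> expoly (\<lambda>_. \<kappa>)"
      by (rule expoly_mult'[OF expoly_symbol ex])
    obtain C where C: "C \<ge> 0" "\<And>v. v \<in> orthant \<Longrightarrow> cmod (complex_of_real (symbol N a v) * complex_of_real (expw (\<lambda>_. \<kappa>) v)) \<le> C * expw (\<lambda>_. 0) v"
      using expoly_decay[OF sx, of "\<lambda>_. 0"] \<kappa> by blast
    \<comment> \<open>Scales \<open>H\<close> below 1; adding 1 to \<open>C\<close> avoids a
      division by zero.\<close>
    define c1 where "c1 = 1 / (C + 1)"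
    have c1: "0 < c1" using C(1) by (simp add: c1_def)
    define H where "H v = c1 * symbol N a v * expw (\<lambda>_. \<kappa>) v" for v
    have sym_nonneg: "0 \<le> symbol N a v" if "v \<in> orthant" for v
    proof -
      have "0 \<le> b * (v $ i) ^ d" using b(1) that by (auto simp: orthant_def less_imp_le)
      then show ?thesis using b(2)[OF that] by linarith
    qed
    have H1: "H v \<le> 1" if v: "v \<in> orthant" for v
    proof -
      have "symbol N a v * expw (\<lambda>_. \<kappa>) v \<le> C"
        using C(2)[OF v] sym_nonneg[OF v] expw_pos[of "\<lambda>_. \<kappa>" v] by (simp add: norm_mult expw_def)
      then have "c1 * (symbol N a v * expw (\<lambda>_. \<kappa>) v) \<le> c1 * (C + 1)"
        using c1 by (intro mult_left_mono) auto
      then show ?thesis using C(1) by (simp add: H_def c1_def mult.assoc)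
    qed
    have H0: "c1 * b * (v $ i) ^ d * expw (\<lambda>_. \<kappa>) v \<le> H v" if v: "v \<in> orthant" for v
      unfolding H_def using b(2)[OF v] c1 expw_pos[of "\<lambda>_. \<kappa>" v]
      by (intro mult_right_mono) (simp_all add: mult.assoc)
    have He: "(\<lambda>v. complex_of_real (H v)) \<in> expoly (\<lambda>_. 0)"
    proof -
      have "(\<lambda>v. complex_of_real c1 * (complex_of_real (symbol N a v) * complex_of_real (expw (\<lambda>_. \<kappa>) v))) \<in> expoly (\<lambda>_. 0)"
        by (rule expoly_antimono[OF expoly.cmult[OF sx]]) (use \<kappa> in auto)
      then show ?thesis by (simp add: H_def mult.assoc)
    qed
    \<comment> \<open>The trivial factors match the base rule of \<open>cutoff_seq\<close> with
      coefficient 1 and \<open>r = 0\<close>; \<open>S 0\<close> is the function whose image is to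
      be annihilated.\<close>
    define S where "S = (\<lambda>M v. 1 * (complex_of_real (taylor_gap a' R' (v $ i)) * g v) * (of_nat M ^ 0 * complex_of_real (1 - H v) ^ (M - 0)))"
    have S: "S \<in> cutoff_seq i a' (\<lambda>_. \<epsilon>) H R' 0"
      unfolding S_def by (rule cutoff_seq.base[where K=1]) (use g in auto)
    have Hp: "(\<lambda>v. complex_of_real (1 - H v) ^ M) \<in> expoly (\<lambda>_. 0)" for M
    proof (induction M)
      case (Suc M)
      have "(\<lambda>v. 1 - complex_of_real (H v)) \<in> expoly (\<lambda>_. 0)" by (intro expoly_diff expoly_const He)
      from expoly_mult'[OF this Suc] show ?case by simp
    qed (simp add: expoly_const)
    have Se: "S M \<in> expoly (\<lambda>_. \<epsilon>)" for M
    proof -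
      have "(\<lambda>v. complex_of_real (1 - H v) ^ M * (complex_of_real (taylor_gap a' R' (v $ i)) * g v)) \<in> expoly (\<lambda>_. \<epsilon>)"
        by (intro expoly_mult' Hp expoly_taylor_gap a' g)
      then show ?thesis by (simp add: S_def mult.commute)
    qed
    \<comment> \<open>Consecutive members differ by the symbol times an element of
      \<open>expoly\<close>, and \<open>f\<close> annihilates the image of such a product because
      \<open>L f = 0\<close>.\<close>
    have fS: "f (synth \<mu> (S M)) = f (synth \<mu> (S 0))" for M
    proof (induction M)
      case (Suc M)
      define \<eta> where "\<eta> v = complex_of_real c1 * (complex_of_real (expw (\<lambda>_. \<kappa>) v) * S M v)" for v
      have \<eta>: "\<eta> \<in> expoly (\<lambda>_. \<epsilon>)" unfolding \<eta>_def[abs_def]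
        by (intro expoly.cmult expoly_mult' Se expoly_antimono[OF ex]) (use \<kappa> in auto)
      have "f (synth \<mu> (\<lambda>v. complex_of_real (symbol N a v) * \<eta> v)) = 0"
        using L_op_synth[OF \<eta> \<epsilon> \<mu> lin, of N a] L by simp
      moreover have "S (Suc M) = (\<lambda>v. S M v + (-1) * (complex_of_real (symbol N a v) * \<eta> v))"
        by (simp add: S_def \<eta>_def H_def fun_eq_iff algebra_simps)
      then have "synth \<mu> (S (Suc M)) = (\<lambda>x. 1 * synth \<mu> (S M) x + (-1) * synth \<mu> (\<lambda>v. complex_of_real (symbol N a v) * \<eta> v) x)"
        using synth_add[OF Se expoly.cmult[OF expoly_mult'[OF expoly_symbol \<eta>]] \<epsilon> \<mu>, of M "-1" N a]
        by (simp only: synth_cmult mult_1)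
      then have "f (synth \<mu> (S (Suc M))) = 1 * f (synth \<mu> (S M)) + (-1) * f (synth \<mu> (\<lambda>v. complex_of_real (symbol N a v) * \<eta> v))"
        using Hmu_linear_lincomb[OF lin synth_in_Hmu[OF Se \<epsilon> \<mu>] synth_in_Hmu[OF expoly_mult'[OF expoly_symbol \<eta>] \<epsilon> \<mu>]]
        by (simp only:)
      ultimately show ?case using Suc by simp
    qed simp
    have small: "cmod (f (synth \<mu> (S 0))) \<le> e / \<delta>" if e: "0 < e" for e
    proof -
      define \<nu> where "\<nu> k = shift_index (mi_list k) \<mu>" for k
      have \<nu>: "-1/2 \<le> \<nu> k $ j" for k j unfolding \<nu>_def by (rule shift_index_ge[OF \<mu>])
      have "\<exists>K\<ge>0. \<forall>M>n0. (LINT v:orthant|lborel. cmod ((laguerre_op (\<nu> k) ^^ m) (S M) v) * vpowr v (\<nu> k)) \<le> K / real M"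
        if mk: "(m, k) \<in> F" for m k
      proof -
        have "\<exists>C\<ge>0. \<forall>M>n0. \<forall>v\<in>orthant. cmod ((laguerre_op (\<nu> k) ^^ m) (S M) v) \<le> C / real M * expw (\<lambda>_. \<epsilon> / 4) v"
          by (rule cutoff_seq_bound[OF \<epsilon> a' less_imp_le[OF \<kappa>(1)] \<kappa>(2) mult_pos_pos[OF c1 b(1)] H0 H1 R' n0[OF mk]
              cutoff_seq_laguerre_op_funpow[OF He S]])
        then obtain C where C: "C \<ge> 0" "\<And>M v. n0 < M \<Longrightarrow> v \<in> orthant \<Longrightarrow> cmod ((laguerre_op (\<nu> k) ^^ m) (S M) v) \<le> C / real M * expw (\<lambda>_. \<epsilon> / 4) v"
          by blast
        define I where "I = (LINT v:orthant|lborel. expw (\<lambda>_. \<epsilon> / 4) v * vpowr v (\<nu> k))"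
        have I: "0 \<le> I" unfolding I_def set_lebesgue_integral_def
          by (intro Bochner_Integration.integral_nonneg) (auto simp: vpowr_nonneg less_imp_le[OF expw_pos])
        have "(LINT v:orthant|lborel. cmod ((laguerre_op (\<nu> k) ^^ m) (S M) v) * vpowr v (\<nu> k)) \<le> C * I / real M" if "n0 < M" for M
        proof -
          have "(LINT v:orthant|lborel. cmod ((laguerre_op (\<nu> k) ^^ m) (S M) v) * vpowr v (\<nu> k)) \<le> C / real M * I"
            unfolding I_def by (rule decay_integrable(2)[OF _ \<nu>[of k] expoly_measurable[OF expoly_laguerre_op_funpow[OF Se]] C(2)[OF that]])
              (use \<epsilon> in simp)
          then show ?thesis by simp
        qed
        then show ?thesis using C(1) I by (intro exI[of _ "C * I"]) auto
      qed
      then have "\<forall>p\<in>F. \<exists>K. 0 \<le> K \<and> (\<forall>M>n0. (LINT v:orthant|lborel. cmod ((laguerre_op (\<nu> (snd p)) ^^ fst p) (S M) v) * vpowr v (\<nu> (snd p))) \<le> K / real M)"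
        by auto
      from bchoice[OF this] obtain K0 where K0: "\<forall>p\<in>F. 0 \<le> K0 p \<and> (\<forall>M>n0. (LINT v:orthant|lborel. cmod ((laguerre_op (\<nu> (snd p)) ^^ fst p) (S M) v) * vpowr v (\<nu> (snd p))) \<le> K0 p / real M)" ..
      define K where "K m k = K0 (m, k)" for m k
      have K: "0 \<le> K m k \<and> (\<forall>M>n0. (LINT v:orthant|lborel. cmod ((laguerre_op (\<nu> k) ^^ m) (S M) v) * vpowr v (\<nu> k)) \<le> K m k / real M)"
        if "(m, k) \<in> F" for m k
        using bspec[OF K0 that] by (simp add: K_def)
      define B where "B k = 2 ^ length (mi_list k) * (\<Prod>i\<in>UNIV. 1 / Gamma (\<nu> k $ i + 1))" for k
      have B: "0 \<le> B k" for k
        unfolding B_def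
      proof (intro mult_nonneg_nonneg prod_nonneg)
        fix j show "0 \<le> 1 / Gamma (\<nu> k $ j + 1)"
          using Gamma_real_pos[of "\<nu> k $ j + 1"] \<nu>[of k j] by simp
      qed auto
      define T where "T = (\<Sum>(m,k)\<in>F. B k * K m k)"
      have T: "B k * K m k \<le> T" if "(m, k) \<in> F" for m k
        unfolding T_def using member_le_sum[of "(m,k)" F "\<lambda>(m,k). B k * K m k"] that F(1) K B by auto
      obtain M0 :: nat where M0: "T / e \<le> real M0" using real_arch_simple by blast
      define M where "M = Suc (max M0 n0)"
      have M: "n0 < M" "T / e \<le> real M" using M0 by (auto simp: M_def)
      have "(1 + (norm x)\<^sup>2) ^ m * cmod (T_list (mi_list k) (reduced \<mu> (synth \<mu> (S M))) x) \<le> e"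
        if mk: "(m, k) \<in> F" and x: "x \<in> orthant" for m k x
      proof -
        have "(1 + (norm x)\<^sup>2) ^ m * cmod (T_list (mi_list k) (reduced \<mu> (synth \<mu> (S M))) x) \<le>
          B k * (LINT v:orthant|lborel. cmod ((laguerre_op (\<nu> k) ^^ m) (S M) v) * vpowr v (\<nu> k))"
          unfolding B_def by (rule synth_seminorm_bound[OF Se \<epsilon> \<mu> x]) (simp add: \<nu>_def)
        also have "\<dots> \<le> B k * (K m k / real M)" using K[OF mk] M(1) B by (intro mult_left_mono) auto
        also have "\<dots> \<le> T / real M" using T[OF mk] by (simp add: divide_right_mono)
        also have "\<dots> \<le> e" using M e by (simp add: field_simps)
        finally show ?thesis .
      qed
      note sm = this
      have "cmod (f (synth \<mu> (S M))) \<le> e / \<delta>"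
        by (rule Hmu_dual_scaled[OF lin F(2) _ synth_in_Hmu[OF Se \<epsilon> \<mu>] e]) (rule F(3) sm; assumption)+
      then show ?thesis by (simp add: fS[of M])
    qed
    have "cmod (f (synth \<mu> (S 0))) \<le> 0 + e" if "0 < e" for e
      using small[of "e * \<delta>"] F(2) that by simp
    then have "cmod (f (synth \<mu> (S 0))) \<le> 0" by (rule field_le_epsilon)
    then show ?thesis by (simp add: S_def)
  qed
  then show ?thesis by (intro exI[of _ "n0 + d * (n0 + 1)"]) blast
qed

text \<open>The exponential is expanded around rate 1 in every coordinate. Multiplying by
  \<open>1 - taylor_gap\<close> in one coordinate after another does not change the value of
  \<open>f\<close>, by the vanishing hypothesis, and ends in a finite sum of
  \<open>v^\<alpha> exp (- \<Sum> v_i)\<close> with coefficients polynomial in \<open>t\<close>. The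
  condition \<open>t_i \<le> 1\<close> makes the gap parameter \<open>1 - t_i\<close>
  nonnegative.\<close>

lemma synth_exp_polynomial:
  fixes \<mu> :: "real ^ 'n::{finite,linorder}"
  assumes \<mu>: "\<And>i. -1/2 \<le> \<mu> $ i" and lin: "Hmu_linear \<mu> f"
    and van: "\<And>i a \<epsilon> g. 0 \<le> a \<Longrightarrow> 0 < \<epsilon> \<Longrightarrow> g \<in> expoly (\<lambda>_. \<epsilon>) \<Longrightarrow>
      f (synth \<mu> (\<lambda>v. complex_of_real (taylor_gap a R (v $ i)) * g v)) = 0"
  shows "\<exists>D. \<forall>t. (\<forall>i. 0 < t i \<and> t i \<le> 1) \<longrightarrow> f (synth \<mu> (\<lambda>v. complex_of_real (monexp (\<lambda>_. 0) t v))) =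
    (\<Sum>\<beta>\<in>PiE UNIV (\<lambda>_. {..<R}). D \<beta> * (\<Prod>i\<in>UNIV. complex_of_real (t i) ^ \<beta> i))"
proof -
  let ?A = "PiE (UNIV :: 'n set) (\<lambda>_. {..<R})"
  have finA: "finite ?A" by (intro finite_PiE) auto
  define \<Lambda> where "\<Lambda> \<alpha> = f (synth \<mu> (\<lambda>v. complex_of_real (monexp \<alpha> (\<lambda>_. 1) v)))" for \<alpha>
  \<comment> \<open>The coefficient of \<open>t^\<beta>\<close> after binomial expansion of the
    factors \<open>(1 - t_i)^\<alpha>_i / \<alpha>_i!\<close>.\<close>
  define D where "D \<beta> = (\<Sum>\<alpha>\<in>?A. (\<Prod>i\<in>UNIV. of_nat (\<alpha> i choose \<beta> i) * (-1) ^ \<beta> i / fact (\<alpha> i)) * \<Lambda> \<alpha>)" for \<beta>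
  have "f (synth \<mu> (\<lambda>v. complex_of_real (monexp (\<lambda>_. 0) t v))) =
    (\<Sum>\<beta>\<in>?A. D \<beta> * (\<Prod>i\<in>UNIV. complex_of_real (t i) ^ \<beta> i))"
    if t: "\<And>i. 0 < t i" "\<And>i. t i \<le> 1" for t
  proof -
    define \<epsilon> where "\<epsilon> = Min (range t)"
    have \<epsilon>: "0 < \<epsilon>" "\<And>i. \<epsilon> \<le> t i" unfolding \<epsilon>_def using t by auto
    have \<epsilon>1: "\<epsilon> \<le> 1" using \<epsilon>(2) t(2) order_trans by blast
    let ?gap = "\<lambda>i v. complex_of_real (taylor_gap (1 - t i) R (v $ i))"
    define \<theta> where "\<theta> I v = complex_of_real (monexp (\<lambda>_. 0) t v) * (\<Prod>i\<in>I. 1 - ?gap i v)" for I v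
    have \<theta>: "\<theta> I \<in> expoly (\<lambda>_. \<epsilon>) \<and> f (synth \<mu> (\<theta> I)) = f (synth \<mu> (\<theta> {}))" if "finite I" for I
      using that
    proof (induction I rule: finite_induct)
      case empty
      have "(\<lambda>v. complex_of_real (monexp (\<lambda>_. 0) t v)) \<in> expoly (\<lambda>_. \<epsilon>)" by (rule expoly.monexp) (rule \<epsilon>)
      then show ?case by (simp add: \<theta>_def[abs_def])
    next
      case (insert i I)
      have g: "(\<lambda>v. ?gap i v * \<theta> I v) \<in> expoly (\<lambda>_. \<epsilon>)"
        by (intro expoly_mult' expoly_taylor_gap) (use insert t in auto)
      have eq: "\<theta> (insert i I) = (\<lambda>v. \<theta> I v + (-1) * (?gap i v * \<theta> I v))"
        using insert(1,2) by (simp add: \<theta>_def fun_eq_iff algebra_simps)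
      have "synth \<mu> (\<theta> (insert i I)) = (\<lambda>x. 1 * synth \<mu> (\<theta> I) x + (-1) * synth \<mu> (\<lambda>v. ?gap i v * \<theta> I v) x)"
        unfolding eq using synth_add[OF conjunct1[OF insert.IH] expoly.cmult[OF g] \<epsilon>(1) \<mu>, of "-1"]
        by (simp only: synth_cmult mult_1)
      then have "f (synth \<mu> (\<theta> (insert i I))) = 1 * f (synth \<mu> (\<theta> I)) + (-1) * f (synth \<mu> (\<lambda>v. ?gap i v * \<theta> I v))"
        using Hmu_linear_lincomb[OF lin synth_in_Hmu[OF conjunct1[OF insert.IH] \<epsilon>(1) \<mu>] synth_in_Hmu[OF g \<epsilon>(1) \<mu>]]
        by (simp only:)
      also have "f (synth \<mu> (\<lambda>v. ?gap i v * \<theta> I v)) = 0"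
        by (rule van[OF _ \<epsilon>(1) conjunct1[OF insert.IH]]) (use t in auto)
      finally have "f (synth \<mu> (\<theta> (insert i I))) = f (synth \<mu> (\<theta> {}))" using insert.IH by simp
      moreover have "\<theta> (insert i I) \<in> expoly (\<lambda>_. \<epsilon>)"
        unfolding eq by (intro expoly.add expoly.cmult g conjunct1[OF insert.IH])
      ultimately show ?case by blast
    qed
    have 1: "\<theta> UNIV v = (\<Sum>\<alpha>\<in>?A. (\<Prod>i\<in>UNIV. complex_of_real ((1 - t i) ^ \<alpha> i / fact (\<alpha> i))) * complex_of_real (monexp \<alpha> (\<lambda>_. 1) v))" for v
    proof -
      have "\<theta> UNIV v = complex_of_real (\<Prod>i\<in>UNIV. exp (- (t i * v $ i)) * (1 - taylor_gap (1 - t i) R (v $ i)))"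
        by (simp add: \<theta>_def monexp_def prod.distrib)
      also have "(\<lambda>i. exp (- (t i * v $ i)) * (1 - taylor_gap (1 - t i) R (v $ i))) =
          (\<lambda>i. \<Sum>j\<in>{..<R}. (1 - t i) ^ j / fact j * ((v $ i) ^ j * exp (- (1 * v $ i))))"
      proof
        fix i
        have "exp (- (t i * v $ i)) * (1 - taylor_gap (1 - t i) R (v $ i)) =
          (exp (- (t i * v $ i)) * exp (- ((1 - t i) * v $ i))) * (\<Sum>j<R. ((1 - t i) * v $ i) ^ j / fact j)"
          by (simp add: taylor_gap_def)
        \<comment> \<open>The rates add up to 1, so \<open>t\<close> survives only in the powers of
          \<open>1 - t i\<close>.\<close>
        also have "exp (- (t i * v $ i)) * exp (- ((1 - t i) * v $ i)) = exp (- (1 * v $ i))"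
          by (simp add: exp_add[symmetric] algebra_simps)
        finally show "exp (- (t i * v $ i)) * (1 - taylor_gap (1 - t i) R (v $ i)) =
          (\<Sum>j\<in>{..<R}. (1 - t i) ^ j / fact j * ((v $ i) ^ j * exp (- (1 * v $ i))))"
          by (simp add: sum_distrib_left power_mult_distrib mult_ac)
      qed
      also have "(\<Prod>i\<in>UNIV. \<Sum>j\<in>{..<R}. (1 - t i) ^ j / fact j * ((v $ i) ^ j * exp (- (1 * v $ i)))) =
        (\<Sum>\<alpha>\<in>?A. \<Prod>i\<in>UNIV. (1 - t i) ^ \<alpha> i / fact (\<alpha> i) * ((v $ i) ^ \<alpha> i * exp (- (1 * v $ i))))"
        by (rule prod_sum_PiE) auto
      also have "\<dots> = (\<Sum>\<alpha>\<in>?A. (\<Prod>i\<in>UNIV. (1 - t i) ^ \<alpha> i / fact (\<alpha> i)) * monexp \<alpha> (\<lambda>_. 1) v)"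
        unfolding monexp_def prod.distrib ..
      finally show ?thesis by simp
    qed
    have e1: "(\<lambda>v. complex_of_real (monexp \<alpha> (\<lambda>_. 1) v)) \<in> expoly (\<lambda>_. 1)" for \<alpha> by (rule expoly.monexp) simp
    have one: "(0::real) < 1" by simp
    have "synth \<mu> (\<theta> UNIV) = (\<lambda>x. \<Sum>\<alpha>\<in>?A. (\<Prod>i\<in>UNIV. complex_of_real ((1 - t i) ^ \<alpha> i / fact (\<alpha> i))) * synth \<mu> (\<lambda>v. complex_of_real (monexp \<alpha> (\<lambda>_. 1) v)) x)"
      unfolding 1[abs_def] synth_sum[OF finA expoly.cmult[OF e1] one \<mu>] synth_cmult ..
    then have "f (synth \<mu> (\<theta> UNIV)) = (\<Sum>\<alpha>\<in>?A. (\<Prod>i\<in>UNIV. complex_of_real ((1 - t i) ^ \<alpha> i / fact (\<alpha> i))) * \<Lambda> \<alpha>)"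
      unfolding \<Lambda>_def using Hmu_linear_sum[OF lin finA synth_in_Hmu[OF e1 one \<mu>]] by (simp only:)
    also have "\<dots> = (\<Sum>\<alpha>\<in>?A. \<Sum>\<beta>\<in>?A. ((\<Prod>i\<in>UNIV. of_nat (\<alpha> i choose \<beta> i) * (-1) ^ \<beta> i / fact (\<alpha> i)) * \<Lambda> \<alpha>) * (\<Prod>i\<in>UNIV. complex_of_real (t i) ^ \<beta> i))"
    proof (rule sum.cong[OF refl])
      fix \<alpha> assume \<alpha>: "\<alpha> \<in> ?A"
      have b: "complex_of_real ((1 - t i) ^ \<alpha> i / fact (\<alpha> i)) =
        (\<Sum>b\<in>{..<R}. of_nat (\<alpha> i choose b) * (-1) ^ b / fact (\<alpha> i) * complex_of_real (t i) ^ b)" for i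
      proof -
        have "complex_of_real (1 - t i) ^ \<alpha> i = (\<Sum>b\<le>\<alpha> i. of_nat (\<alpha> i choose b) * (- complex_of_real (t i)) ^ b)"
          using binomial_ring[of "- complex_of_real (t i)" 1 "\<alpha> i"] by simp
        also have "\<dots> = (\<Sum>b\<in>{..<R}. of_nat (\<alpha> i choose b) * (- complex_of_real (t i)) ^ b)"
          by (rule sum.mono_neutral_left) (use \<alpha> in \<open>auto simp: PiE_iff intro: le_less_trans\<close>)
        finally show ?thesis
          by (simp add: sum_divide_distrib power_minus[of "complex_of_real (t i)"] mult_ac)
      qed
      have "(\<Prod>i\<in>UNIV. complex_of_real ((1 - t i) ^ \<alpha> i / fact (\<alpha> i))) =
        (\<Sum>\<beta>\<in>?A. \<Prod>i\<in>UNIV. of_nat (\<alpha> i choose \<beta> i) * (-1) ^ \<beta> i / fact (\<alpha> i) * complex_of_real (t i) ^ \<beta> i)"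
        unfolding b by (rule prod_sum_PiE) auto
      also have "\<dots> = (\<Sum>\<beta>\<in>?A. (\<Prod>i\<in>UNIV. of_nat (\<alpha> i choose \<beta> i) * (-1) ^ \<beta> i / fact (\<alpha> i)) * (\<Prod>i\<in>UNIV. complex_of_real (t i) ^ \<beta> i))"
        by (simp only: prod.distrib)
      finally show "(\<Prod>i\<in>UNIV. complex_of_real ((1 - t i) ^ \<alpha> i / fact (\<alpha> i))) * \<Lambda> \<alpha> =
        (\<Sum>\<beta>\<in>?A. ((\<Prod>i\<in>UNIV. of_nat (\<alpha> i choose \<beta> i) * (-1) ^ \<beta> i / fact (\<alpha> i)) * \<Lambda> \<alpha>) * (\<Prod>i\<in>UNIV. complex_of_real (t i) ^ \<beta> i))"
        by (simp only: sum_distrib_left mult_ac)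
    qed
    also have "\<dots> = (\<Sum>\<beta>\<in>?A. \<Sum>\<alpha>\<in>?A. ((\<Prod>i\<in>UNIV. of_nat (\<alpha> i choose \<beta> i) * (-1) ^ \<beta> i / fact (\<alpha> i)) * \<Lambda> \<alpha>) * (\<Prod>i\<in>UNIV. complex_of_real (t i) ^ \<beta> i))"
      by (rule sum.swap)
    also have "\<dots> = (\<Sum>\<beta>\<in>?A. D \<beta> * (\<Prod>i\<in>UNIV. complex_of_real (t i) ^ \<beta> i))"
      unfolding D_def sum_distrib_right ..
    finally show ?thesis using \<theta>[of UNIV] by (simp add: \<theta>_def[abs_def])
  qed
  then show ?thesis by blast
qed

subsection \<open>Even moments\<close>

text \<open>Only the scaling in \<open>t\<close> and the nonvanishing of the constant matter, so
  \<open>I\<close> is not evaluated. It is the moment at \<open>t = 1\<close>, positive because the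
  integrand is positive on \<open>(0, 1)\<close>; the rest is the substitution
  \<open>x / sqrt t\<close>.\<close>

lemma gaussian_moment_pos:
  fixes s :: real
  assumes "0 \<le> s"
  shows "\<exists>I>0. \<forall>t>0. has_bochner_integral lborel (\<lambda>x::real. indicator {0<..} x * (x powr s * exp (- (x\<^sup>2 / t))))
    (I * t powr ((s + 1) / 2))"
proof -
  let ?f = "\<lambda>x::real. indicator {0<..} x * (x powr s * exp (- x\<^sup>2))"
  have int: "integrable lborel ?f"
  proof (rule Bochner_Integration.integrable_bound)
    have "has_bochner_integral lborel (\<lambda>v. indicator {0<..} v * (v powr s * exp (- (1 * v)))) (Gamma (s + 1) * 1 powr - (s + 1))"
      by (rule Gamma_has_bochner_integral) (use assms in auto)
    then show "integrable lborel (\<lambda>v. exp 1 * (indicator {0<..} v * (v powr s * exp (- (1 * v)))) :: real)"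
      by (intro integrable_mult_right) (auto simp: has_bochner_integral_iff)
    show "AE x in lborel. norm (?f x) \<le> norm (exp 1 * (indicator {0<..} x * (x powr s * exp (- (1 * x)))) :: real)"
    proof (intro AE_I2)
      fix x :: real
      have "- x\<^sup>2 \<le> 1 - x" using sum_squares_bound[of x 1] zero_le_power2[of "x - 1/2"] by (simp add: power2_eq_square algebra_simps)
      then have "exp (- x\<^sup>2) \<le> exp 1 * exp (- x)" by (simp add: exp_add[symmetric])
      then have "x powr s * exp (- x\<^sup>2) \<le> x powr s * (exp 1 * exp (- x))" by (rule mult_left_mono) simp
      then show "norm (?f x) \<le> norm (exp 1 * (indicator {0<..} x * (x powr s * exp (- (1 * x)))) :: real)"
        by (simp add: indicator_def abs_mult mult_ac)
    qed
  qed simp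
  define I where "I = integral\<^sup>L lborel ?f"
  have "I \<noteq> 0"
  proof
    assume "I = 0"
    then have "AE x in lborel. ?f x = 0"
      using integral_nonneg_eq_0_iff_AE[OF int] by (simp add: I_def)
    then have "AE x in lborel. x \<notin> {0<..<1::real}"
      by eventually_elim (auto simp: indicator_def)
    then have "emeasure lborel {0<..<1::real} = 0"
      using AE_iff_measurable[of "{0<..<1::real}" lborel "\<lambda>x. x \<notin> {0<..<1}"]
      by (simp only: space_lborel space_borel UNIV_I simp_thms not_not Collect_mem_eq sets_lborel) simp
    moreover have "emeasure lborel {0<..<1::real} = 1" by simp
    ultimately show False by simp
  qed
  moreover have "I \<ge> 0" unfolding I_def by (intro Bochner_Integration.integral_nonneg) simp
  ultimately have I: "I > 0" by simp
  have hb: "has_bochner_integral lborel ?f I" using int by (simp add: has_bochner_integral_iff I_def)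
  have "has_bochner_integral lborel (\<lambda>x. indicator {0<..} x * (x powr s * exp (- (x\<^sup>2 / t)))) (I * t powr ((s + 1) / 2))"
    if t: "0 < t" for t
  proof -
    let ?c = "1 / sqrt t"
    have c: "?c > 0" using t by simp
    have "has_bochner_integral lborel (\<lambda>x. ?f (0 + ?c * x)) (I /\<^sub>R \<bar>?c\<bar>)"
      using c hb by (subst lborel_has_bochner_integral_real_affine_iff[symmetric]) auto
    from has_bochner_integral_mult_right[OF this, of "t powr (s / 2)"]
    have "has_bochner_integral lborel (\<lambda>x. t powr (s / 2) * ?f (0 + ?c * x)) (t powr (s / 2) * (I /\<^sub>R \<bar>?c\<bar>))" .
    moreover have "t powr (s / 2) * ?f (0 + ?c * x) = indicator {0<..} x * (x powr s * exp (- (x\<^sup>2 / t)))" for x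
    proof (cases "x > 0")
      case True
      have "(x / sqrt t) powr s = x powr s / t powr (s / 2)"
        using True t by (simp add: powr_divide powr_half_sqrt[symmetric] powr_powr)
      then show ?thesis using True t by (simp add: power_divide)
    qed (use t in \<open>auto simp: indicator_def zero_less_divide_iff\<close>)
    moreover have "t powr (s / 2) * (I /\<^sub>R \<bar>?c\<bar>) = I * t powr ((s + 1) / 2)"
      using t by (simp add: add_divide_distrib powr_add powr_half_sqrt)
    ultimately show ?thesis by (simp only:)
  qed
  then show ?thesis using I by blast
qed

lemma inverse_square_integrable:
  "has_bochner_integral lborel (\<lambda>x. indicator {0<..} x * (1 / (1 + x\<^sup>2)) :: real) (pi / 2)"
proof (rule has_bochner_integral_nn_integral)
  have "(\<integral>\<^sup>+x. ennreal (1 / (1 + x\<^sup>2)) * indicator {0..} x \<partial>lborel) = ennreal (pi / 2 - arctan 0)"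
  proof (rule nn_integral_FTC_atLeast)
    show "(arctan has_real_derivative 1 / (1 + x\<^sup>2)) (at x)" for x
      using DERIV_arctan[of x] by (simp add: inverse_eq_divide)
    show "(arctan \<longlongrightarrow> pi / 2) at_top" by (rule tendsto_arctan_at_top)
  qed auto
  moreover have "(\<integral>\<^sup>+x. ennreal (indicator {0<..} x * (1 / (1 + x\<^sup>2))) \<partial>lborel) = (\<integral>\<^sup>+x. ennreal (1 / (1 + x\<^sup>2)) * indicator {0..} x \<partial>lborel)"
  proof (rule nn_integral_cong_AE)
    show "AE x in lborel. ennreal (indicator {0<..} x * (1 / (1 + x\<^sup>2))) = ennreal (1 / (1 + x\<^sup>2)) * indicator {0..} x"
      using AE_lborel_singleton[of "0::real"] by eventually_elim (auto simp: indicator_def)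
  qed
  ultimately show "(\<integral>\<^sup>+x. ennreal (indicator {0<..} x * (1 / (1 + x\<^sup>2))) \<partial>lborel) = ennreal (pi / 2)" by simp
qed (auto simp: indicator_def)

section \<open>Product weights and the moments of elements of \<open>Hmu\<close>\<close>

lemma prod_one_plus_le:
  fixes c :: "'n \<Rightarrow> real"
  assumes "finite A" "\<And>i. i \<in> A \<Longrightarrow> 0 \<le> c i"
  shows "(\<Prod>i\<in>A. 1 + c i) \<le> (1 + (\<Sum>i\<in>A. c i)) ^ card A"
proof -
  have "(\<Prod>i\<in>A. 1 + c i) \<le> (\<Prod>i\<in>A. 1 + (\<Sum>i\<in>A. c i))"
    by (rule prod_mono) (use assms member_le_sum[of _ A c] in auto)
  then show ?thesis by simp
qed

text \<open>Comparable with the radial weight of the seminorms up to a change of exponent, by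
  \<open>pw_le_norm\<close> and \<open>norm_le_pw\<close>, but a product over the coordinates, as
  needed for Fubini and for integration along a single axis.\<close>

definition pw :: "nat \<Rightarrow> real ^ 'n::finite \<Rightarrow> real" where
  "pw m x = (\<Prod>i\<in>UNIV. (1 + (x $ i)\<^sup>2) ^ m)"

lemma pw_pos: "0 < pw m x"
  unfolding pw_def by (intro prod_pos zero_less_power) (simp add: add_pos_nonneg)

lemma pw_le_norm: "pw m x \<le> (1 + (norm x)\<^sup>2) ^ (CARD('n) * m)" for x :: "real ^ 'n::finite"
proof -
  have "pw m x = (\<Prod>i\<in>UNIV. 1 + (x $ i)\<^sup>2) ^ m" by (simp add: pw_def prod_power_distrib)
  also have "\<dots> \<le> ((1 + (\<Sum>i\<in>UNIV. (x $ i)\<^sup>2)) ^ CARD('n)) ^ m"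
    by (intro power_mono prod_one_plus_le prod_nonneg) auto
  finally show ?thesis by (simp add: norm_power2_vec power_mult)
qed

lemma norm_le_pw: "(1 + (norm x)\<^sup>2) ^ m \<le> pw m x" for x :: "real ^ 'n::finite"
proof -
  have "1 + (\<Sum>i\<in>A. (x $ i)\<^sup>2) \<le> (\<Prod>i\<in>A. 1 + (x $ i)\<^sup>2)" if "finite A" for A :: "'n set"
    using that
  proof (induction rule: finite_induct)
    case (insert i A)
    have "1 + (\<Sum>i\<in>insert i A. (x $ i)\<^sup>2) \<le> (1 + (x $ i)\<^sup>2) * (1 + (\<Sum>i\<in>A. (x $ i)\<^sup>2))"
      using insert(1,2) by (simp add: algebra_simps sum_nonneg)
    also have "\<dots> \<le> (1 + (x $ i)\<^sup>2) * (\<Prod>i\<in>A. 1 + (x $ i)\<^sup>2)"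
      by (rule mult_left_mono[OF insert.IH]) simp
    finally show ?case using insert(1,2) by simp
  qed simp
  from this[of UNIV] have "1 + (norm x)\<^sup>2 \<le> (\<Prod>i\<in>UNIV. 1 + (x $ i)\<^sup>2)" by (simp add: norm_power2_vec)
  then have "(1 + (norm x)\<^sup>2) ^ m \<le> (\<Prod>i\<in>UNIV. 1 + (x $ i)\<^sup>2) ^ m" by (intro power_mono) auto
  then show ?thesis by (simp add: pw_def prod_power_distrib)
qed

definition even_moment :: "real ^ 'n::finite \<Rightarrow> 'n multi_index \<Rightarrow> 'n functional" where
  "even_moment \<mu> \<beta> \<phi> = (LINT x:orthant|lborel.
     complex_of_real (vpowr x (\<chi> i. \<mu> $ i + 1/2) * (\<Prod>i\<in>UNIV. ((x $ i)\<^sup>2) ^ \<beta> i)) * \<phi> x)"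

lemma vpowr_even_moment:
  assumes "x \<in> orthant"
  shows "vpowr x (\<chi> i. \<mu> $ i + 1/2) * (\<Prod>i\<in>UNIV. ((x $ i)\<^sup>2) ^ \<beta> i) * vpowr x (\<chi> i. \<mu> $ i + 1/2) =
    (\<Prod>i\<in>UNIV. (x $ i) powr (2 * \<mu> $ i + 1 + 2 * real (\<beta> i)))"
  unfolding vpowr_def prod.distrib[symmetric]
proof (rule prod.cong[OF refl])
  fix i
  have x: "0 < x $ i" using assms by (simp add: orthant_def)
  have "((x $ i)\<^sup>2) ^ \<beta> i = (x $ i) powr (2 * real (\<beta> i))"
    using powr_realpow[OF x, of "2 * \<beta> i"] by (simp add: power_mult)
  then show "x $ i powr (\<chi> i. \<mu> $ i + 1/2) $ i * ((x $ i)\<^sup>2) ^ \<beta> i * x $ i powr (\<chi> i. \<mu> $ i + 1/2) $ i =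
    x $ i powr (2 * \<mu> $ i + 1 + 2 * real (\<beta> i))"
    by (simp add: powr_add[symmetric] algebra_simps)
qed

lemma powr_le_one_plus_square:
  assumes "0 < x" "0 \<le> s" "s \<le> real m"
  shows "x powr s \<le> (1 + x\<^sup>2) ^ m"
proof -
  have "x powr s = (x\<^sup>2) powr (s / 2)"
    using assms by (simp add: powr_powr powr_numeral[symmetric] del: powr_numeral)
  also have "\<dots> \<le> (1 + x\<^sup>2) powr (s / 2)" using assms by (intro powr_mono2) auto
  also have "\<dots> \<le> (1 + x\<^sup>2) powr (real m)" using assms by (intro powr_mono) auto
  also have "\<dots> = (1 + x\<^sup>2) ^ m" by (rule powr_realpow) (simp add: add_pos_nonneg)
  finally show ?thesis .
qed

text \<open>In terms of the reduced function the integrand carries the power \<open>x^s\<close> with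
  \<open>s_i = 2 \<mu>_i + 1 + 2 \<beta>_i\<close>, nonnegative because
  \<open>\<mu>_i \<ge> -1/2\<close>. A weight therefore dominates it, even near the boundary of the
  orthant.\<close>

lemma even_moment_bound:
  fixes \<mu> :: "real ^ 'n::{finite,linorder}"
  assumes \<mu>: "\<And>i. -1/2 \<le> \<mu> $ i"
  shows "\<exists>m C. 0 \<le> C \<and> (\<forall>\<phi>\<in>Hmu \<mu>.
    set_integrable lborel orthant (\<lambda>x. complex_of_real (vpowr x (\<chi> i. \<mu> $ i + 1/2) * (\<Prod>i\<in>UNIV. ((x $ i)\<^sup>2) ^ \<beta> i)) * \<phi> x) \<and>
    (\<forall>B. (\<forall>x\<in>orthant. (1 + (norm x)\<^sup>2) ^ m * cmod (reduced \<mu> \<phi> x) \<le> B) \<longrightarrow> cmod (even_moment \<mu> \<beta> \<phi>) \<le> C * B))"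
proof -
  define s where "s i = 2 * \<mu> $ i + 1 + 2 * real (\<beta> i)" for i
  have s0: "0 \<le> s i" for i using \<mu>[of i] by (simp add: s_def)
  define m' where "m' = nat \<lceil>\<Sum>i\<in>UNIV. s i\<rceil>"
  have sm: "s i \<le> real m'" for i
    using member_le_sum[of i UNIV s] s0 unfolding m'_def by (simp add: order_trans[OF _ real_nat_ceiling_ge])
  \<comment> \<open>One power of the product weight beyond \<open>m'\<close> leaves the integrable
    majorant \<open>1 / pw 1 x\<close>; \<open>CARD('n)\<close> converts the product weight into the
    radial one.\<close>
  let ?m = "CARD('n) * Suc m'"
  let ?w = "\<lambda>x. vpowr x (\<chi> i. \<mu> $ i + 1/2) * (\<Prod>i\<in>UNIV. ((x $ i)\<^sup>2) ^ \<beta> i)"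
  let ?dom = "\<lambda>x :: (real, 'n) vec. \<Prod>i\<in>UNIV. indicator {0<..} (x $ i) * (1 / (1 + (x $ i)\<^sup>2))"
  have dom: "has_bochner_integral lborel ?dom (\<Prod>i\<in>(UNIV :: 'n set). pi / 2)"
    by (rule has_bochner_integral_prod_vec) (rule inverse_square_integrable)
  have dom_eq: "?dom x = indicator orthant x * (1 / pw 1 x)" for x
    unfolding indicator_orthant pw_def by (simp add: prod.distrib prod_dividef)
  have bound: "norm (indicator orthant x *\<^sub>R (complex_of_real (?w x) * \<phi> x)) \<le> B * ?dom x"
    if B: "\<And>x. x \<in> orthant \<Longrightarrow> (1 + (norm x)\<^sup>2) ^ ?m * cmod (reduced \<mu> \<phi> x) \<le> B" for \<phi> B x
  proof (cases "x \<in> orthant")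
    case True
    have "\<phi> x = complex_of_real (vpowr x (\<chi> i. \<mu> $ i + 1/2)) * reduced \<mu> \<phi> x" using reduced_cancel[OF True] by simp
    then have "complex_of_real (?w x) * \<phi> x = complex_of_real (\<Prod>i\<in>UNIV. (x $ i) powr s i) * reduced \<mu> \<phi> x"
      unfolding s_def vpowr_even_moment[OF True, symmetric] by simp
    then have "norm (complex_of_real (?w x) * \<phi> x) = (\<Prod>i\<in>UNIV. (x $ i) powr s i) * cmod (reduced \<mu> \<phi> x)"
      by (simp add: norm_mult abs_of_nonneg prod_nonneg del: of_real_prod)
    also have "\<dots> \<le> pw m' x * cmod (reduced \<mu> \<phi> x)"
      unfolding pw_def
      by (intro mult_right_mono prod_mono conjI powr_le_one_plus_square s0 sm) (use True in \<open>auto simp: orthant_def\<close>)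
    also have "pw m' x = pw (Suc m') x * (1 / pw 1 x)"
    proof -
      have "pw (Suc m') x = pw 1 x * pw m' x" by (simp add: pw_def prod.distrib)
      then show ?thesis using pw_pos[of 1 x] by simp
    qed
    also have "pw (Suc m') x * (1 / pw 1 x) * cmod (reduced \<mu> \<phi> x) = (pw (Suc m') x * cmod (reduced \<mu> \<phi> x)) * (1 / pw 1 x)" by simp
    also have "\<dots> \<le> B * (1 / pw 1 x)"
    proof (rule mult_right_mono)
      have "pw (Suc m') x * cmod (reduced \<mu> \<phi> x) \<le> (1 + (norm x)\<^sup>2) ^ ?m * cmod (reduced \<mu> \<phi> x)"
        by (intro mult_right_mono pw_le_norm) auto
      then show "pw (Suc m') x * cmod (reduced \<mu> \<phi> x) \<le> B" using B[OF True] by (rule order_trans)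
      show "0 \<le> 1 / pw 1 x" using pw_pos[of 1 x] by simp
    qed
    finally show ?thesis unfolding dom_eq using True by simp
  next
    case False
    then show ?thesis unfolding dom_eq by simp
  qed
  have int: "set_integrable lborel orthant (\<lambda>x. complex_of_real (?w x) * \<phi> x)" if \<phi>: "\<phi> \<in> Hmu \<mu>" for \<phi>
  proof -
    obtain B where B: "\<And>x. x \<in> orthant \<Longrightarrow> (1 + (norm x)\<^sup>2) ^ ?m * cmod (reduced \<mu> \<phi> x) \<le> B"
      using HmuD(3)[OF \<phi>, of ?m "[]"] by auto
    have "(\<lambda>x. indicator orthant x *\<^sub>R (complex_of_real (?w x) * \<phi> x)) \<in> borel_measurable borel"
    proof (rule borel_measurable_continuous_on_indicator)
      show "continuous_on orthant (\<lambda>x. complex_of_real (?w x) * \<phi> x)"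
        by (intro continuous_intros continuous_on_vpowr Cinf_on_continuous[OF HmuD(1)[OF \<phi>]])
    qed simp
    moreover have "integrable lborel (\<lambda>x. B * ?dom x)" using dom by (auto simp: has_bochner_integral_iff)
    ultimately show ?thesis unfolding set_integrable_def
      by (rule_tac Bochner_Integration.integrable_bound[where f="\<lambda>x. B * ?dom x"])
         (use bound[OF B] in \<open>auto intro!: AE_I2 order_trans[OF _ abs_ge_self] simp del: norm_scaleR norm_mult\<close>)
  qed
  have "cmod (even_moment \<mu> \<beta> \<phi>) \<le> (\<Prod>i\<in>(UNIV :: 'n set). pi / 2) * B"
    if \<phi>: "\<phi> \<in> Hmu \<mu>" and B: "\<And>x. x \<in> orthant \<Longrightarrow> (1 + (norm x)\<^sup>2) ^ ?m * cmod (reduced \<mu> \<phi> x) \<le> B" for \<phi> B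
  proof -
    have "cmod (even_moment \<mu> \<beta> \<phi>) \<le> (\<integral>x. B * ?dom x \<partial>lborel)"
      unfolding even_moment_def set_lebesgue_integral_def
    proof (rule Bochner_Integration.integral_norm_bound_integral)
      show "integrable lborel (\<lambda>x. indicat_real orthant x *\<^sub>R (complex_of_real (?w x) * \<phi> x))"
        using int[OF \<phi>] unfolding set_integrable_def .
      show "integrable lborel (\<lambda>x. B * ?dom x)" using dom by (auto simp: has_bochner_integral_iff)
    qed (rule bound[OF B])
    also have "\<dots> = (\<Prod>i\<in>(UNIV :: 'n set). pi / 2) * B"
      using has_bochner_integral_integral_eq[OF has_bochner_integral_mult_right[OF dom, of B]] by simp
    finally show ?thesis .
  qed
  then show ?thesis using int by (intro exI[of _ ?m] exI[of _ "\<Prod>i\<in>(UNIV :: 'n set). pi / 2"]) (auto intro!: prod_nonneg)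
qed

lemma Hmu_linear_even_moment:
  fixes \<mu> :: "real ^ 'n::{finite,linorder}"
  assumes \<mu>: "\<And>i. -1/2 \<le> \<mu> $ i"
  shows "Hmu_linear \<mu> (even_moment \<mu> \<beta>)"
proof -
  obtain m C where mC: "\<And>\<phi>. \<phi> \<in> Hmu \<mu> \<Longrightarrow> set_integrable lborel orthant (\<lambda>x. complex_of_real (vpowr x (\<chi> i. \<mu> $ i + 1/2) * (\<Prod>i\<in>UNIV. ((x $ i)\<^sup>2) ^ \<beta> i)) * \<phi> x)"
    using even_moment_bound[OF \<mu>, of \<beta>] by blast
  show ?thesis
    unfolding Hmu_linear_def
  proof (intro conjI ballI allI)
    fix \<phi> \<psi> assume "\<phi> \<in> Hmu \<mu>" "\<psi> \<in> Hmu \<mu>"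
    from set_integral_add(2)[OF mC[OF this(1)] mC[OF this(2)]]
    show "even_moment \<mu> \<beta> (\<lambda>x. \<phi> x + \<psi> x) = even_moment \<mu> \<beta> \<phi> + even_moment \<mu> \<beta> \<psi>"
      unfolding even_moment_def by (simp only: distrib_left)
  next
    fix c \<phi>
    show "even_moment \<mu> \<beta> (\<lambda>x. c * \<phi> x) = c * even_moment \<mu> \<beta> \<phi>"
      unfolding even_moment_def set_integral_mult_right[symmetric]
      by (simp only: mult.left_commute[of c])
  qed
qed

text \<open>The transform of the exponential contributes \<open>t_i^-(\<mu>_i + 1)\<close> and a
  Gaussian of width \<open>t_i\<close>, whose moment scales as
  \<open>t_i^(\<mu>_i + 1 + \<beta>_i)\<close>. Exactly \<open>t_i^\<beta>_i\<close>
  remains.\<close>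

lemma even_moment_synth:
  fixes \<mu> :: "real ^ 'n::{finite,linorder}"
  assumes \<mu>: "\<And>i. -1/2 \<le> \<mu> $ i"
  shows "\<exists>c. c \<noteq> 0 \<and> (\<forall>t. (\<forall>i. 0 < t i) \<longrightarrow>
    even_moment \<mu> \<beta> (synth \<mu> (\<lambda>v. complex_of_real (monexp (\<lambda>_. 0) t v))) = c * (\<Prod>i\<in>UNIV. complex_of_real (t i) ^ \<beta> i))"
proof -
  define s where "s i = 2 * \<mu> $ i + 1 + 2 * real (\<beta> i)" for i
  have s0: "0 \<le> s i" for i using \<mu>[of i] by (simp add: s_def)
  have "\<forall>i. \<exists>I>0. \<forall>t>0. has_bochner_integral lborel (\<lambda>x. indicator {0<..} x * (x powr s i * exp (- (x\<^sup>2 / t)))) (I * t powr ((s i + 1) / 2))"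
    using gaussian_moment_pos[OF s0] by blast
  from choice[OF this] obtain I where I: "\<And>i. 0 < I i"
    "\<And>i t. 0 < t \<Longrightarrow> has_bochner_integral lborel (\<lambda>x. indicator {0<..} x * (x powr s i * exp (- (x\<^sup>2 / t)))) (I i * t powr ((s i + 1) / 2))"
    by blast
  have "even_moment \<mu> \<beta> (synth \<mu> (\<lambda>v. complex_of_real (monexp (\<lambda>_. 0) t v))) = complex_of_real (\<Prod>i\<in>UNIV. I i) * (\<Prod>i\<in>UNIV. complex_of_real (t i) ^ \<beta> i)"
    if t: "\<And>i. 0 < t i" for t
  proof -
    let ?e = "\<lambda>i. t i powr - (\<mu> $ i + 1)"
    have 1: "has_bochner_integral lborel (\<lambda>x :: (real, 'n) vec. \<Prod>i\<in>UNIV. ?e i * (indicator {0<..} (x $ i) * ((x $ i) powr s i * exp (- ((x $ i)\<^sup>2 / t i)))))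
       (\<Prod>i\<in>UNIV. ?e i * (I i * t i powr ((s i + 1) / 2)))"
      by (intro has_bochner_integral_prod_vec[where f="\<lambda>i y. ?e i * (indicator {0<..} y * (y powr s i * exp (- (y\<^sup>2 / t i))))"]
          has_bochner_integral_mult_right I t)
    have "?e i * (I i * t i powr ((s i + 1) / 2)) = I i * t i ^ \<beta> i" for i
    proof -
      have "?e i * t i powr ((s i + 1) / 2) = t i powr (real (\<beta> i))"
        by (simp add: powr_add[symmetric] s_def field_simps)
      then show ?thesis using t[of i] by (simp add: powr_realpow)
    qed
    then have 2: "(\<Prod>i\<in>UNIV. ?e i * (I i * t i powr ((s i + 1) / 2))) = (\<Prod>i\<in>UNIV. I i) * (\<Prod>i\<in>UNIV. t i ^ \<beta> i)"
      by (simp only: prod.distrib)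
    have 3: "complex_of_real (\<Prod>i\<in>UNIV. ?e i * (indicator {0<..} (x $ i) * ((x $ i) powr s i * exp (- ((x $ i)\<^sup>2 / t i)))))
      = indicator orthant x *\<^sub>R (complex_of_real (vpowr x (\<chi> i. \<mu> $ i + 1/2) * (\<Prod>i\<in>UNIV. ((x $ i)\<^sup>2) ^ \<beta> i)) * synth \<mu> (\<lambda>v. complex_of_real (monexp (\<lambda>_. 0) t v)) x)" for x
    proof (cases "x \<in> orthant")
      case True
      have "synth \<mu> (\<lambda>v. complex_of_real (monexp (\<lambda>_. 0) t v)) x =
        complex_of_real (vpowr x (\<chi> i. \<mu> $ i + 1/2) * (\<Prod>i\<in>UNIV. ?e i * exp (- ((x $ i)\<^sup>2 / t i))))"
        using True hankel_monexp(2)[of \<mu> t "\<lambda>_. 0", OF \<mu> t] lag_0[OF t] by (simp add: synth_def)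
      then have "complex_of_real (vpowr x (\<chi> i. \<mu> $ i + 1/2) * (\<Prod>i\<in>UNIV. ((x $ i)\<^sup>2) ^ \<beta> i)) * synth \<mu> (\<lambda>v. complex_of_real (monexp (\<lambda>_. 0) t v)) x
        = complex_of_real ((\<Prod>i\<in>UNIV. (x $ i) powr s i) * (\<Prod>i\<in>UNIV. ?e i * exp (- ((x $ i)\<^sup>2 / t i))))"
        unfolding s_def vpowr_even_moment[OF True, symmetric] by simp
      moreover have "(\<Prod>i\<in>UNIV. ?e i * (indicator {0<..} (x $ i) * ((x $ i) powr s i * exp (- ((x $ i)\<^sup>2 / t i))))) =
        (\<Prod>i\<in>UNIV. (x $ i) powr s i) * (\<Prod>i\<in>UNIV. ?e i * exp (- ((x $ i)\<^sup>2 / t i)))"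
        using True unfolding prod.distrib[symmetric] by (intro prod.cong) (auto simp: orthant_def)
      ultimately show ?thesis using True by simp
    next
      case False
      then obtain i where "\<not> 0 < x $ i" by (auto simp: orthant_def)
      then have "(\<Prod>i\<in>UNIV. ?e i * (indicator {0<..} (x $ i) * ((x $ i) powr s i * exp (- ((x $ i)\<^sup>2 / t i))))) = 0"
        by (intro prod_zero bexI[of _ i]) (auto simp: indicator_def)
      then show ?thesis using False by simp
    qed
    from has_bochner_integral_of_real[OF 1, where 'a=complex] show ?thesis
      unfolding 3 2 even_moment_def set_lebesgue_integral_def by (simp add: has_bochner_integral_iff)
  qed
  moreover have "complex_of_real (\<Prod>i\<in>UNIV. I i) \<noteq> 0" using prod_pos[of UNIV I] I(1) by (metis less_irrefl of_real_eq_0_iff)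
  ultimately show ?thesis by blast
qed

lemma regular_functional_eq:
  fixes \<mu> :: "real ^ 'n::{finite,linorder}"
  assumes \<mu>: "\<And>i. -1/2 \<le> \<mu> $ i" and \<phi>: "\<phi> \<in> Hmu \<mu>"
  shows "regular_functional \<mu> (\<lambda>x. complex_of_real (vpowr x (\<chi> i. \<mu> $ i + 1/2)) *
      mpoly_eval M q (\<chi> i. complex_of_real ((x $ i)\<^sup>2))) \<phi> = (\<Sum>\<beta> | mi_abs \<beta> \<le> M. q \<beta> * even_moment \<mu> \<beta> \<phi>)"
proof -
  let ?w = "\<lambda>\<beta> x. complex_of_real (vpowr x (\<chi> i. \<mu> $ i + 1/2) * (\<Prod>i\<in>UNIV. ((x $ i)\<^sup>2) ^ \<beta> i)) * \<phi> x"
  have int: "set_integrable lborel orthant (?w \<beta>)" for \<beta>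
    using even_moment_bound[OF \<mu>, of \<beta>] \<phi> by blast
  have "complex_of_real (vpowr x (\<chi> i. \<mu> $ i + 1/2)) * mpoly_eval M q (\<chi> i. complex_of_real ((x $ i)\<^sup>2)) * \<phi> x
    = (\<Sum>\<beta> | mi_abs \<beta> \<le> M. q \<beta> * ?w \<beta> x)" for x
    by (simp add: mpoly_eval_def sum_distrib_left sum_distrib_right mult_ac)
  moreover have "(LINT x:orthant|lborel. (\<Sum>\<beta> | mi_abs \<beta> \<le> M. q \<beta> * ?w \<beta> x)) = (\<Sum>\<beta> | mi_abs \<beta> \<le> M. (LINT x:orthant|lborel. q \<beta> * ?w \<beta> x))"
    using int unfolding set_lebesgue_integral_def scaleR_sum_right
    by (intro Bochner_Integration.integral_sum) (simp add: set_integrable_mult_right[unfolded set_integrable_def] set_integrable_def)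
  ultimately show ?thesis using \<phi>
    unfolding regular_functional_def even_moment_def by (simp only: if_True set_integral_mult_right)
qed

lemma pw_mono: "m \<le> n \<Longrightarrow> pw m x \<le> pw n x"
  unfolding pw_def by (intro prod_mono conjI power_increasing) auto

lemma pw_add: "pw (m + n) x = pw m x * pw n x"
  by (simp add: pw_def power_add prod.distrib)

subsection \<open>Density of Gaussians\<close>

text \<open>The reduced functions of \<open>Hmu\<close>, described with product weights. The
  parameter \<open>\<mu>\<close> disappears, so the approximation can be done once for all; values
  off the orthant are left free.\<close>

definition rapid :: "'n::finite cfun \<Rightarrow> bool" where
  "rapid \<psi> \<longleftrightarrow> Cinf_on orthant \<psi> \<and> (\<forall>m l. \<exists>C. \<forall>x\<in>orthant. pw m x * cmod (T_list l \<psi> x) \<le> C)"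

lemma rapid_Cinf: "rapid \<psi> \<Longrightarrow> Cinf_on orthant \<psi>"
  by (simp add: rapid_def)

lemma rapid_bound:
  assumes "rapid \<psi>" obtains C where "0 < C" "\<And>x. x \<in> orthant \<Longrightarrow> pw m x * cmod (T_list l \<psi> x) \<le> C"
proof -
  obtain C where C: "\<And>x. x \<in> orthant \<Longrightarrow> pw m x * cmod (T_list l \<psi> x) \<le> C"
    using assms unfolding rapid_def by blast
  show ?thesis by (rule that[of "max 1 C"]) (use C in \<open>auto simp: le_max_iff_disj\<close>)
qed

lemma rapid_T_list: "rapid \<psi> \<Longrightarrow> rapid (T_list l \<psi>)"
  unfolding rapid_def
proof (intro conjI allI)
  fix m l'
  assume *: "Cinf_on orthant \<psi> \<and> (\<forall>m l. \<exists>C. \<forall>x\<in>orthant. pw m x * cmod (T_list l \<psi> x) \<le> C)"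
  then show "Cinf_on orthant (T_list l \<psi>)" by (blast intro: Cinf_on_T_list)
  show "\<exists>C. \<forall>x\<in>orthant. pw m x * cmod (T_list l' (T_list l \<psi>) x) \<le> C"
    using *[THEN conjunct2, rule_format, of m "l' @ l"] by simp
qed

lemma rapid_lincomb:
  assumes "rapid \<phi>" "rapid \<psi>"
  shows "rapid (\<lambda>x. a * \<phi> x + b * \<psi> x)"
  unfolding rapid_def
proof (intro conjI allI)
  show "Cinf_on orthant (\<lambda>x. a * \<phi> x + b * \<psi> x)"
    using assms by (intro Cinf_on_add Cinf_on_cmult rapid_Cinf) auto
  fix m l
  obtain C where C: "\<And>x. x \<in> orthant \<Longrightarrow> pw m x * cmod (T_list l \<phi> x) \<le> C" using rapid_bound[OF assms(1)] by metis
  obtain D where D: "\<And>x. x \<in> orthant \<Longrightarrow> pw m x * cmod (T_list l \<psi> x) \<le> D" using rapid_bound[OF assms(2)] by metis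
  have "pw m x * cmod (T_list l (\<lambda>x. a * \<phi> x + b * \<psi> x) x) \<le> cmod a * C + cmod b * D" if x: "x \<in> orthant" for x
  proof -
    have "cmod (T_list l (\<lambda>x. a * \<phi> x + b * \<psi> x) x) \<le> cmod a * cmod (T_list l \<phi> x) + cmod b * cmod (T_list l \<psi> x)"
      unfolding T_list_lincomb[OF rapid_Cinf[OF assms(1)] rapid_Cinf[OF assms(2)] x]
      using norm_triangle_ineq by (metis norm_mult)
    then have "pw m x * cmod (T_list l (\<lambda>x. a * \<phi> x + b * \<psi> x) x) \<le> pw m x * (cmod a * cmod (T_list l \<phi> x) + cmod b * cmod (T_list l \<psi> x))"
      using pw_pos[of m x] by (intro mult_left_mono) auto
    also have "\<dots> = cmod a * (pw m x * cmod (T_list l \<phi> x)) + cmod b * (pw m x * cmod (T_list l \<psi> x))"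
      by (simp add: algebra_simps)
    also have "\<dots> \<le> cmod a * C + cmod b * D" by (intro add_mono mult_left_mono C D x) auto
    finally show ?thesis .
  qed
  then show "\<exists>C. \<forall>x\<in>orthant. pw m x * cmod (T_list l (\<lambda>x. a * \<phi> x + b * \<psi> x) x) \<le> C" by blast
qed

section \<open>Recovering a function from its derivatives by integration from infinity\<close>

lemma partial_eq_T_op: "x \<in> orthant \<Longrightarrow> partial i g x = complex_of_real (x $ i) * T_op i g x"
  by (auto simp: T_op_def orthant_def less_imp_neq[symmetric])

lemma line_in_orthant: "x \<in> orthant \<Longrightarrow> 0 \<le> s \<Longrightarrow> x + s *\<^sub>R axis i 1 \<in> orthant"
  by (auto simp: orthant_def axis_def add_pos_nonneg)

lemma pw_split: "pw m x = (1 + (x $ i)\<^sup>2) ^ m * (\<Prod>j\<in>UNIV - {i}. (1 + (x $ j)\<^sup>2) ^ m)"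
  unfolding pw_def by (rule prod.remove) auto

text \<open>By integration of \<open>T\<^sub>i g\<close> along the ray \<open>x + s e\<^sub>i\<close>, \<open>s \<ge> 0\<close>, at the cost of one power of the weight.\<close>

lemma T_op_integrate:
  assumes g: "rapid g" and m: "1 \<le> m" and \<epsilon>: "0 \<le> \<epsilon>"
    and T: "\<And>y. y \<in> orthant \<Longrightarrow> pw (Suc m) y * cmod (T_op i g y) \<le> \<epsilon>" and x: "x \<in> orthant"
  shows "pw m x * cmod (g x) \<le> \<epsilon>"
proof -
  let ?y = "\<lambda>s. x + s *\<^sub>R axis i (1::real)"
  let ?r = "\<lambda>n. \<Prod>j\<in>UNIV - {i}. (1 + (x $ j)\<^sup>2) ^ n"
  define P where "P = inverse (?r (Suc m))"
  have rpos: "0 < ?r n" for n by (intro prod_pos zero_less_power) (simp add: add_pos_nonneg)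
  have P: "0 < P" unfolding P_def by (rule positive_imp_inverse_positive[OF rpos])
  have yi: "?y s $ i = x $ i + s" for s by (simp add: axis_def)
  have xi: "0 < x $ i" using x by (simp add: orthant_def)
  have pwy: "pw n (?y s) = (1 + (x $ i + s)\<^sup>2) ^ n * ?r n" for n s
  proof -
    have "(\<Prod>j\<in>UNIV - {i}. (1 + (?y s $ j)\<^sup>2) ^ n) = ?r n" by (rule prod.cong) (auto simp: axis_def)
    then show ?thesis unfolding pw_split[of n "?y s" i] yi by simp
  qed
  \<comment> \<open>\<open>G\<close> is an explicit primitive of the majorant \<open>G'\<close> of
    the derivative of \<open>g\<close> along the ray; \<open>P\<close> collects the weights of the
    fixed coordinates. As \<open>s\<close> grows, \<open>g\<close> tends to 0 and \<open>G\<close>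
    stays nonpositive, so \<open>- G 0\<close> bounds \<open>g x\<close>.\<close>
  define G where "G s = - (\<epsilon> * P / (2 * real m)) * inverse ((1 + (x $ i + s)\<^sup>2) ^ m)" for s
  define G' where "G' s = \<epsilon> * P * (x $ i + s) * inverse ((1 + (x $ i + s)\<^sup>2) ^ Suc m)" for s
  have pos: "0 < 1 + (x $ i + s)\<^sup>2" for s by (simp add: add_pos_nonneg)
  have Gd: "(G has_real_derivative G' s) (at s)" for s
  proof -
    let ?q = "1 + (x $ i + s)\<^sup>2"
    have q0: "?q \<noteq> 0" using pos[of s] by simp
    have d1: "((\<lambda>s. (1 + (x $ i + s)\<^sup>2) ^ m) has_real_derivative real m * ?q ^ (m - 1) * (2 * (x $ i + s))) (at s)"
      by (auto intro!: derivative_eq_intros)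
    have "((\<lambda>s. inverse ((1 + (x $ i + s)\<^sup>2) ^ m)) has_real_derivative
        - (inverse (?q ^ m) * (real m * ?q ^ (m - 1) * (2 * (x $ i + s))) * inverse (?q ^ m))) (at s)"
      by (rule DERIV_inverse'[OF d1]) (use q0 in simp)
    from DERIV_cmult[OF this, of "- (\<epsilon> * P / (2 * real m))"]
    have "(G has_real_derivative - (\<epsilon> * P / (2 * real m)) *
        - (inverse (?q ^ m) * (real m * ?q ^ (m - 1) * (2 * (x $ i + s))) * inverse (?q ^ m))) (at s)"
      unfolding G_def[abs_def] .
    moreover have "- (\<epsilon> * P / (2 * real m)) * - (inverse (?q ^ m) * (real m * ?q ^ (m - 1) * (2 * (x $ i + s))) * inverse (?q ^ m)) = G' s"
    proof -
      obtain k where k: "m = Suc k" using m by (cases m) auto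
      have "- (A / (2 * M)) * - (inverse (q * Q) * (M * Q * (2 * y)) * inverse (q * Q)) = A * y * inverse (q * (q * Q))"
        if "Q \<noteq> 0" "q \<noteq> 0" "M \<noteq> 0" for A M Q q y :: real
        using that by (simp add: field_simps)
      from this[of "?q ^ k" ?q "real m" "\<epsilon> * P" "x $ i + s"] show ?thesis
        using q0 m unfolding G'_def k by (simp add: mult_ac del: of_nat_Suc)
    qed
    ultimately show ?thesis by simp
  qed
  have gd: "((\<lambda>s. g (?y s)) has_vector_derivative partial i g (?y s)) (at s)" if "0 \<le> s" for s
    by (rule line_derivative[where U=orthant and g=g and g'="partial i g" and z=x])
       (use Cinf_on_has_partial[OF rapid_Cinf[OF g]] line_in_orthant[OF x that] in auto)
  have bnd: "norm (partial i g (?y s)) \<le> G' s" if s: "0 \<le> s" for s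
  proof -
    have y: "?y s \<in> orthant" by (rule line_in_orthant[OF x s])
    have "norm (partial i g (?y s)) = (x $ i + s) * cmod (T_op i g (?y s))"
      unfolding partial_eq_T_op[OF y] norm_mult norm_of_real yi using xi s by simp
    also have "\<dots> \<le> (x $ i + s) * (\<epsilon> / pw (Suc m) (?y s))"
      using T[OF y] pw_pos[of "Suc m" "?y s"] xi s by (intro mult_left_mono) (auto simp: field_simps)
    also have "\<dots> = G' s" unfolding pwy G'_def P_def by (simp add: divide_inverse mult_ac)
    finally show ?thesis .
  qed
  obtain C where C: "\<And>y. y \<in> orthant \<Longrightarrow> pw 1 y * cmod (T_list [] g y) \<le> C"
    using rapid_bound[OF g] by metis
  have le: "cmod (g x) \<le> - G 0 + C / S" if S: "0 < S" for S
  proof -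
    have "norm (g (?y S) - g (?y 0)) \<le> G S - G 0"
    proof (rule differentiable_bound_general[OF S, where f'="\<lambda>s. partial i g (?y s)" and \<phi>'=G'])
      show "continuous_on {0..S} (\<lambda>s. g (?y s))"
        by (rule continuous_at_imp_continuous_on) (auto intro!: has_vector_derivative_continuous gd)
      show "continuous_on {0..S} G"
        by (rule continuous_at_imp_continuous_on) (use Gd DERIV_isCont in blast)
    qed (use gd bnd Gd in \<open>auto simp: has_real_derivative_iff_has_vector_derivative\<close>)
    moreover have "G S \<le> 0" unfolding G_def using \<epsilon> P pos[of S] by (simp add: less_imp_le)
    moreover have "cmod (g (?y S)) \<le> C / S"
    proof -
      have y: "?y S \<in> orthant" using line_in_orthant[OF x] S by simp
      have "1 * S \<le> (1 + (x $ i + S)\<^sup>2) * 1"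
      proof -
        have "S \<le> 1 + S\<^sup>2" using sum_squares_bound[of S 1] S by (simp add: power2_eq_square algebra_simps)
        also have "S\<^sup>2 \<le> (x $ i + S)\<^sup>2" using xi S by (intro power_mono) auto
        finally show ?thesis by simp
      qed
      also have "\<dots> \<le> pw 1 (?y S)"
      proof -
        have "1 \<le> ?r 1" by (rule prod_ge_1) simp
        then show ?thesis unfolding pwy using pos[of S] by (intro mult_mono) auto
      qed
      finally have "S * cmod (g (?y S)) \<le> pw 1 (?y S) * cmod (g (?y S))" by (intro mult_right_mono) auto
      also have "\<dots> \<le> C" using C[OF y] by simp
      finally show ?thesis using S by (simp add: field_simps)
    qed
    moreover have "cmod (g x) \<le> norm (g (?y S) - g (?y 0)) + cmod (g (?y S))"
      using norm_triangle_ineq4[of "g (?y S)" "g (?y S) - g (?y 0)"] by simp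
    ultimately show ?thesis by linarith
  qed
  have "cmod (g x) \<le> - G 0"
  proof (rule tendsto_lowerbound)
    have "((\<lambda>S. - G 0 + C / S) \<longlongrightarrow> - G 0 + 0) at_top"
      by (intro tendsto_add tendsto_const tendsto_divide_0[OF tendsto_const] filterlim_at_top_imp_at_infinity filterlim_ident)
    then show "((\<lambda>S. - G 0 + C / S) \<longlongrightarrow> - G 0) at_top" by simp
    show "\<forall>\<^sub>F S in at_top. cmod (g x) \<le> - G 0 + C / S"
      using eventually_gt_at_top[of 0] by eventually_elim (rule le)
  qed simp
  also have "- G 0 \<le> \<epsilon> / pw m x"
  proof -
    have "P \<le> inverse (?r m)"
    proof -
      have "?r m \<le> ?r (Suc m)" by (rule prod_mono) (auto intro!: power_increasing simp del: power_Suc)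
      then show ?thesis unfolding P_def by (rule le_imp_inverse_le[OF _ rpos])
    qed
    moreover have "\<epsilon> / (2 * real m) \<le> \<epsilon> / 1" using m \<epsilon> by (intro divide_left_mono) auto
    ultimately have "\<epsilon> / (2 * real m) * P \<le> \<epsilon> * inverse (?r m)"
      using \<epsilon> P by (intro mult_mono) auto
    then have "\<epsilon> / (2 * real m) * P * inverse ((1 + (x $ i)\<^sup>2) ^ m) \<le> \<epsilon> * inverse (?r m) * inverse ((1 + (x $ i)\<^sup>2) ^ m)"
      by (intro mult_right_mono) auto
    moreover have "- G 0 = \<epsilon> / (2 * real m) * P * inverse ((1 + (x $ i)\<^sup>2) ^ m)" by (simp add: G_def)
    moreover have "\<epsilon> / pw m x = \<epsilon> * inverse (?r m) * inverse ((1 + (x $ i)\<^sup>2) ^ m)"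
      unfolding pw_split[of m x i] divide_inverse inverse_mult_distrib by (simp only: mult_ac)
    ultimately show ?thesis by (simp only:)
  qed
  finally show ?thesis using pw_pos[of m x] by (simp add: field_simps)
qed

lemma T_list_integrate:
  assumes g: "rapid g" and m: "1 \<le> m" and \<epsilon>: "0 \<le> \<epsilon>"
    and T: "\<And>y. y \<in> orthant \<Longrightarrow> pw (m + length l) y * cmod (T_list l g y) \<le> \<epsilon>" and x: "x \<in> orthant"
  shows "pw m x * cmod (g x) \<le> \<epsilon>"
  using T
proof (induction l)
  case (Cons i l)
  show ?case
  proof (rule Cons.IH)
    fix y :: "(real, 'a) vec" assume y: "y \<in> orthant"
    show "pw (m + length l) y * cmod (T_list l g y) \<le> \<epsilon>"
      by (rule T_op_integrate[where i=i, OF rapid_T_list[OF g] _ \<epsilon> _ y]) (use Cons.prems m in auto)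
  qed
qed (use x in simp)

section \<open>The span of Gaussians with integer rates\<close>

definition gauss :: "'n::finite multi_index \<Rightarrow> 'n cfun" where
  "gauss j x = complex_of_real (\<Prod>i\<in>UNIV. exp (- (real (j i) * (x $ i)\<^sup>2)))"

text \<open>In the coordinates \<open>w_i = exp (- x_i^2)\<close> these are the polynomials
  divisible by every \<open>w_i\<close>. Divisibility gives decay in each direction and makes the
  eigenvalues of the \<open>T_op i\<close> nonzero; integer rates make the span stable under
  multiplication by polynomials in \<open>w\<close>.\<close>

inductive_set gauss_span :: "'n::finite cfun set" where
  gauss: "(\<And>i. 1 \<le> j i) \<Longrightarrow> gauss j \<in> gauss_span"
| add: "\<eta> \<in> gauss_span \<Longrightarrow> \<eta>' \<in> gauss_span \<Longrightarrow> (\<lambda>x. \<eta> x + \<eta>' x) \<in> gauss_span"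
| cmult: "\<eta> \<in> gauss_span \<Longrightarrow> (\<lambda>x. c * \<eta> x) \<in> gauss_span"

lemma gauss_split: "gauss j x = complex_of_real (exp (- (real (j i) * (x $ i)\<^sup>2)) * (\<Prod>k\<in>UNIV - {i}. exp (- (real (j k) * (x $ k)\<^sup>2))))"
  unfolding gauss_def by (subst prod.remove[of _ i]) auto

lemma gauss_has_partial: "has_partial i (gauss j) (complex_of_real (- 2 * real (j i) * x $ i) * gauss j x) x"
proof -
  let ?R = "\<Prod>k\<in>UNIV - {i}. exp (- (real (j k) * (x $ k)\<^sup>2))"
  have split: "gauss j (x + s *\<^sub>R axis i 1) = complex_of_real (exp (- (real (j i) * (x $ i + s)\<^sup>2)) * ?R)" for s
  proof -
    have "(\<Prod>k\<in>UNIV - {i}. exp (- (real (j k) * ((x + s *\<^sub>R axis i 1) $ k)\<^sup>2))) = ?R"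
      by (rule prod.cong) (auto simp: axis_def)
    then show ?thesis unfolding gauss_split[of j _ i] by (simp add: axis_def)
  qed
  have "((\<lambda>s. exp (- (real (j i) * (x $ i + s)\<^sup>2)) * ?R) has_real_derivative
      (exp (- (real (j i) * (x $ i)\<^sup>2)) * (- (real (j i) * (2 * x $ i)))) * ?R) (at 0)"
    by (rule DERIV_cmult_right) (auto intro!: derivative_eq_intros)
  from has_vector_derivative_of_real[OF this, where 'a=complex] show ?thesis
    unfolding has_partial_def split gauss_split[of j x i] by (simp add: mult_ac)
qed

lemma Cinf_on_gauss: "open U \<Longrightarrow> Cinf_on U (gauss j)"
proof -
  assume U: "open U"
  have cont: "continuous_on U (gauss j)" unfolding gauss_def by (intro continuous_intros)
  have "Ck_on k U (gauss j)" for k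
  proof (induction k)
    case (Suc k)
    show ?case
    proof (rule Ck_on_SucI[OF U cont gauss_has_partial])
      fix i
      show "Ck_on k U (\<lambda>x. complex_of_real (- 2 * real (j i) * x $ i) * gauss j x)"
      proof (rule Ck_on_mult[OF U _ Suc])
        have "Cinf_on U (\<lambda>x. complex_of_real (- 2 * real (j i)) * complex_of_real (x $ i))"
          by (intro Cinf_on_cmult Cinf_on_coord U)
        then show "Ck_on k U (\<lambda>x. complex_of_real (- 2 * real (j i) * x $ i))" by (simp add: Cinf_on_def)
      qed
    qed
  qed (use cont in simp)
  then show ?thesis by (simp add: Cinf_on_def)
qed

lemma T_list_gauss:
  assumes "x \<in> orthant"
  shows "T_list l (gauss j) x = (\<Prod>i\<leftarrow>l. complex_of_real (- 2 * real (j i))) * gauss j x"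
  using assms
proof (induction l arbitrary: x)
  case (Cons i l)
  let ?c = "\<Prod>i\<leftarrow>l. complex_of_real (- 2 * real (j i))"
  have "T_list (i # l) (gauss j) x = T_op i (\<lambda>x. ?c * gauss j x) x"
    unfolding T_list_simps by (rule T_op_cong) (use Cons in auto)
  also have "\<dots> = complex_of_real (inverse (x $ i)) * (?c * (complex_of_real (- 2 * real (j i) * x $ i) * gauss j x))"
    by (rule T_op_has_partial[OF has_partial_cmult[OF gauss_has_partial]])
  also have "\<dots> = (complex_of_real (inverse (x $ i)) * complex_of_real (x $ i)) * (complex_of_real (- 2 * real (j i)) * ?c * gauss j x)"
    by (simp add: mult_ac)
  also have "complex_of_real (inverse (x $ i)) * complex_of_real (x $ i) = 1"
  proof -
    have "x $ i \<noteq> 0" using Cons.prems by (auto simp: orthant_def less_imp_neq[symmetric])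
    then show ?thesis by (simp add: of_real_mult[symmetric] del: of_real_inverse of_real_mult)
  qed
  finally show ?case by simp
qed simp

lemma pw_gauss_bounded: "\<exists>C>0. \<forall>x j. (\<forall>i. 1 \<le> j i) \<longrightarrow> pw m x * cmod (gauss j x) \<le> C"
proof -
  have "pw m x * cmod (gauss j x) \<le> (\<Prod>i\<in>(UNIV :: 'a set). fact m * exp 1)" if j: "\<And>i. 1 \<le> j i" for x :: "(real, 'a) vec" and j
  proof -
    have "pw m x * cmod (gauss j x) = (\<Prod>i\<in>UNIV. (1 + (x $ i)\<^sup>2) ^ m * exp (- (real (j i) * (x $ i)\<^sup>2)))"
      unfolding gauss_def norm_of_real pw_def by (simp add: prod.distrib abs_of_nonneg prod_nonneg)
    also have "\<dots> \<le> (\<Prod>i\<in>(UNIV :: 'a set). fact m * exp 1)"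
    proof (intro prod_mono conjI)
      fix i
      have "1 * (x $ i)\<^sup>2 \<le> real (j i) * (x $ i)\<^sup>2" using j[of i] by (intro mult_right_mono) auto
      then have "exp (- (real (j i) * (x $ i)\<^sup>2)) \<le> exp (- (1 * (1 + (x $ i)\<^sup>2))) * exp 1"
        by (simp add: exp_add[symmetric])
      then have "(1 + (x $ i)\<^sup>2) ^ m * exp (- (real (j i) * (x $ i)\<^sup>2)) \<le> (1 + (x $ i)\<^sup>2) ^ m * (exp (- (1 * (1 + (x $ i)\<^sup>2))) * exp 1)"
        by (intro mult_left_mono) auto
      also have "\<dots> = ((1 + (x $ i)\<^sup>2) ^ m * exp (- (1 * (1 + (x $ i)\<^sup>2)))) * exp 1" by simp
      also have "\<dots> \<le> (fact m / 1 ^ m) * exp 1"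
        by (intro mult_right_mono power_exp_bounded) auto
      finally show "(1 + (x $ i)\<^sup>2) ^ m * exp (- (real (j i) * (x $ i)\<^sup>2)) \<le> fact m * exp 1" by simp
    qed auto
    finally show ?thesis .
  qed
  moreover have "0 < (\<Prod>i\<in>(UNIV :: 'a set). fact m * exp 1 :: real)" by (intro prod_pos) auto
  ultimately show ?thesis by blast
qed

lemma rapid_gauss_span: "\<eta> \<in> gauss_span \<Longrightarrow> rapid \<eta>"
proof (induction rule: gauss_span.induct)
  case (gauss j)
  show ?case unfolding rapid_def
  proof (intro conjI allI)
    fix m l
    obtain C where C: "pw m x * cmod (gauss j x) \<le> C" for x using pw_gauss_bounded gauss by blast
    let ?c = "\<Prod>i\<leftarrow>l. complex_of_real (- 2 * real (j i))"
    have "pw m x * cmod (T_list l (gauss j) x) \<le> cmod ?c * C" if "x \<in> orthant" for x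
      using mult_left_mono[OF C[of x], of "cmod ?c"] unfolding T_list_gauss[OF that] norm_mult by (simp add: mult_ac)
    then show "\<exists>C. \<forall>x\<in>orthant. pw m x * cmod (T_list l (gauss j) x) \<le> C" by blast
  qed (rule Cinf_on_gauss, simp)
next
  case (add \<eta> \<eta>')
  then show ?case using rapid_lincomb[of \<eta> \<eta>' 1 1] by simp
next
  case (cmult \<eta> c)
  then show ?case using rapid_lincomb[of \<eta> \<eta> c 0] by simp
qed

text \<open>\<open>gauss j\<close> is an eigenfunction of \<open>T_op i\<close> with eigenvalue
  \<open>- 2 j_i\<close>, nonzero since \<open>j_i \<ge> 1\<close>. Hence every composition of these
  operators can be inverted inside the span.\<close>

lemma gauss_span_antiderivative:
  "\<eta> \<in> gauss_span \<Longrightarrow> \<exists>\<zeta>\<in>gauss_span. \<forall>x\<in>orthant. T_list l \<zeta> x = \<eta> x"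
proof (induction rule: gauss_span.induct)
  case (gauss j)
  let ?c = "\<Prod>i\<leftarrow>l. complex_of_real (- 2 * real (j i))"
  have "j i \<noteq> 0" for i using gauss[of i] by simp
  then have c: "?c \<noteq> 0" by (induction l) auto
  have "T_list l (\<lambda>x. inverse ?c * gauss j x) x = gauss j x" if "x \<in> orthant" for x
    using T_list_lincomb[OF Cinf_on_gauss[OF open_orthant] Cinf_on_gauss[OF open_orthant] that, of l "inverse ?c" j 0 j]
    unfolding T_list_gauss[OF that] using c by (simp add: mult.assoc[symmetric])
  then show ?case by (intro bexI[of _ "\<lambda>x. inverse ?c * gauss j x"]) (auto intro!: gauss_span.intros gauss)
next
  case (add \<eta> \<eta>')
  then obtain \<zeta> \<zeta>' where z: "\<zeta> \<in> gauss_span" "\<zeta>' \<in> gauss_span" "\<And>x. x \<in> orthant \<Longrightarrow> T_list l \<zeta> x = \<eta> x"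
    "\<And>x. x \<in> orthant \<Longrightarrow> T_list l \<zeta>' x = \<eta>' x" by blast
  have "T_list l (\<lambda>x. \<zeta> x + \<zeta>' x) x = \<eta> x + \<eta>' x" if "x \<in> orthant" for x
    using T_list_lincomb[OF rapid_Cinf[OF rapid_gauss_span[OF z(1)]] rapid_Cinf[OF rapid_gauss_span[OF z(2)]] that, of l 1 1] z that by simp
  then show ?case using gauss_span.add[OF z(1,2)] by blast
next
  case (cmult \<eta> c)
  then obtain \<zeta> where z: "\<zeta> \<in> gauss_span" "\<And>x. x \<in> orthant \<Longrightarrow> T_list l \<zeta> x = \<eta> x" by blast
  have "T_list l (\<lambda>x. c * \<zeta> x) x = c * \<eta> x" if "x \<in> orthant" for x
    using T_list_lincomb[OF rapid_Cinf[OF rapid_gauss_span[OF z(1)]] rapid_Cinf[OF rapid_gauss_span[OF z(1)]] that, of l c 0] z that by simp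
  then show ?case using gauss_span.cmult[OF z(1), of c] by blast
qed

definition wmap :: "real ^ 'n \<Rightarrow> real ^ 'n" where
  "wmap x = (\<chi> i. exp (- (x $ i)\<^sup>2))"

lemma gauss_span_mult_coord: "\<eta> \<in> gauss_span \<Longrightarrow> (\<lambda>x. complex_of_real (wmap x $ i) * \<eta> x) \<in> gauss_span"
proof (induction rule: gauss_span.induct)
  case (gauss j)
  have "complex_of_real (wmap x $ i) * gauss j x = gauss (j(i := Suc (j i))) x" for x
  proof -
    have "(\<Prod>k\<in>UNIV - {i}. exp (- (real ((j(i := Suc (j i))) k) * (x $ k)\<^sup>2))) = (\<Prod>k\<in>UNIV - {i}. exp (- (real (j k) * (x $ k)\<^sup>2)))"
      by (rule prod.cong) auto
    moreover have "wmap x $ i * exp (- (real (j i) * (x $ i)\<^sup>2)) = exp (- (real ((j(i := Suc (j i))) i) * (x $ i)\<^sup>2))"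
      by (simp add: wmap_def exp_add[symmetric] algebra_simps)
    ultimately show ?thesis unfolding gauss_split[of _ x i] of_real_mult[symmetric] mult.assoc[symmetric] by simp
  qed
  moreover have "gauss (j(i := Suc (j i))) \<in> gauss_span" by (rule gauss_span.gauss) (use gauss in auto)
  ultimately show ?case by simp
next
  case (add \<eta> \<eta>')
  from gauss_span.add[OF add.IH] show ?case by (simp add: distrib_left)
next
  case (cmult \<eta> c)
  from gauss_span.cmult[OF cmult.IH, of c] show ?case by (simp add: mult_ac)
qed

lemma gauss_span_zero: "(\<lambda>x. 0) \<in> gauss_span"
  using gauss_span.cmult[OF gauss_span.gauss[of "\<lambda>_. 1"], of 0] by simp

lemma gauss_span_sum: "finite A \<Longrightarrow> (\<And>a. a \<in> A \<Longrightarrow> \<eta> a \<in> gauss_span) \<Longrightarrow> (\<lambda>x. \<Sum>a\<in>A. \<eta> a x) \<in> gauss_span"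
  by (induction rule: finite_induct) (auto intro: gauss_span_zero gauss_span.add)

lemma gauss_span_mult_polynomial:
  fixes p :: "(real, 'n::finite) vec \<Rightarrow> real"
  assumes "real_polynomial_function p" "\<eta> \<in> gauss_span"
  shows "(\<lambda>x. complex_of_real (p (wmap x)) * \<eta> x) \<in> gauss_span"
  using assms
proof (induction arbitrary: \<eta> rule: real_polynomial_function.induct)
  case (linear p)
  interpret bounded_linear p by fact
  have "p w = (\<Sum>i\<in>UNIV. w $ i * p (axis i 1))" for w
  proof -
    have "w = (\<Sum>i\<in>UNIV. (w $ i) *\<^sub>R axis i 1)"
      by (simp add: vec_eq_iff axis_def if_distrib cong: if_cong)
    then have "p w = p (\<Sum>i\<in>UNIV. (w $ i) *\<^sub>R axis i 1)" by simp
    then show ?thesis by (simp add: sum scaleR)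
  qed
  note p = this
  have "complex_of_real (p (wmap x)) * \<eta> x = (\<Sum>i\<in>UNIV. complex_of_real (p (axis i 1)) * (complex_of_real (wmap x $ i) * \<eta> x))" for x
    by (simp only: p[of "wmap x"] of_real_sum of_real_mult sum_distrib_left mult_ac)
  moreover have "(\<lambda>x. \<Sum>i\<in>UNIV. complex_of_real (p (axis i 1)) * (complex_of_real (wmap x $ i) * \<eta> x)) \<in> gauss_span"
    by (rule gauss_span_sum[OF finite]) (rule gauss_span.cmult[OF gauss_span_mult_coord[OF linear.prems]])
  ultimately show ?case by (simp only:)
next
  case (const c)
  then show ?case by (rule gauss_span.cmult)
next
  case (add p q)
  from gauss_span.add[OF add.IH(1)[OF add.prems] add.IH(2)[OF add.prems]] show ?case
    by (simp add: distrib_right)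
next
  case (mult p q)
  from mult.IH(1)[OF mult.IH(2)[OF mult.prems]] show ?case by (simp add: mult_ac)
qed

section \<open>Compactification of the orthant to a cube\<close>

definition cubes :: "(real ^ 'n) set" where
  "cubes = {z. \<forall>i. 0 < z $ i \<and> z $ i < 1}"

text \<open>An algebraic coordinate, in which derivatives stay bounded: the derivative in
  \<open>z_i\<close> is \<open>- (1 + x_i^2)^2 / 2\<close> times \<open>T_op i\<close>, and a
  rapidly decreasing function can afford this weight.\<close>

definition zmap :: "real ^ 'n \<Rightarrow> real ^ 'n" where
  "zmap x = (\<chi> i. 1 / (1 + (x $ i)\<^sup>2))"

definition zinv :: "real ^ 'n \<Rightarrow> real ^ 'n" where
  "zinv z = (\<chi> i. sqrt (1 / z $ i - 1))"

lemma zmap_in: "x \<in> orthant \<Longrightarrow> zmap x \<in> cubes"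
  by (auto simp: zmap_def cubes_def orthant_def add_pos_pos less_imp_neq[symmetric] divide_less_eq intro!: divide_pos_pos add_pos_nonneg)

lemma zinv_zmap: "x \<in> orthant \<Longrightarrow> zinv (zmap x) = x"
  by (auto simp: zmap_def zinv_def orthant_def vec_eq_iff less_imp_le)

lemma rapid_lipschitz_coord:
  fixes D :: "'n::finite cfun"
  assumes D: "rapid D" and L: "\<And>y. y \<in> orthant \<Longrightarrow> pw 2 y * cmod (T_op i D y) \<le> L"
    and z: "z \<in> cubes" and ab: "0 < a" "a < b" "b < 1"
  shows "cmod (D (zinv (\<chi> j. if j = i then b else z $ j)) - D (zinv (\<chi> j. if j = i then a else z $ j))) \<le> L * (b - a)"
proof -
  let ?u = "\<lambda>s. (\<chi> j. if j = i then s else z $ j)"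
  define X0 where "X0 = (\<chi> j. if j = i then 0 else sqrt (1 / z $ j - 1))"
  define r where "r s = sqrt (1 / s - 1)" for s :: real
  have path: "zinv (?u s) = X0 + r s *\<^sub>R axis i 1" for s
    by (auto simp: vec_eq_iff zinv_def X0_def r_def axis_def)
  have inO: "X0 + r s *\<^sub>R axis i 1 \<in> orthant" if "0 < s" "s < 1" for s
    using that z by (auto simp: orthant_def X0_def r_def axis_def cubes_def)
  have L0: "0 \<le> L" 
  proof -
    have "0 \<le> pw 2 (X0 + r a *\<^sub>R axis i 1) * cmod (T_op i D (X0 + r a *\<^sub>R axis i 1))"
      using pw_pos[of 2 "X0 + r a *\<^sub>R axis i 1"] by simp
    also have "\<dots> \<le> L" by (rule L[OF inO]) (use ab in auto)
    finally show ?thesis .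
  qed
  let ?f = "\<lambda>s. D (X0 + r s *\<^sub>R axis i 1)"
  let ?r' = "\<lambda>s. - (1 / s\<^sup>2) / (2 * r s)"
  have deriv: "(?f has_vector_derivative ?r' s *\<^sub>R partial i D (X0 + r s *\<^sub>R axis i 1)) (at s)" if s: "0 < s" "s < 1" for s
  proof -
    have p: "1 / s - 1 > 0" using s by simp
    have "(r has_real_derivative ?r' s) (at s)"
      unfolding r_def using p s by (auto intro!: derivative_eq_intros simp: power2_eq_square field_simps)
    then have 1: "(r has_vector_derivative ?r' s) (at s)" by (simp add: has_real_derivative_iff_has_vector_derivative)
    have 2: "((\<lambda>t. D (X0 + t *\<^sub>R axis i 1)) has_vector_derivative partial i D (X0 + r s *\<^sub>R axis i 1)) (at (r s))"
      by (rule line_derivative[where U=orthant and g=D and g'="partial i D" and z=X0])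
         (use Cinf_on_has_partial[OF rapid_Cinf[OF D]] inO[OF s] in auto)
    from vector_diff_chain_at[OF 1 2] show ?thesis by (simp add: o_def)
  qed
  have bnd: "norm (?r' s *\<^sub>R partial i D (X0 + r s *\<^sub>R axis i 1)) \<le> L" if s: "0 < s" "s < 1" for s
  proof -
    let ?y = "X0 + r s *\<^sub>R axis i 1"
    have y: "?y \<in> orthant" by (rule inO[OF s])
    have yi: "?y $ i = r s" by (simp add: X0_def axis_def)
    have p: "1 / s - 1 > 0" using s by simp
    have r: "0 < r s" "1 + (r s)\<^sup>2 = 1 / s" using p by (simp_all add: r_def)
    have "norm (?r' s *\<^sub>R partial i D ?y) = (1 / s\<^sup>2) / (2 * r s) * (r s * cmod (T_op i D ?y))"
      unfolding partial_eq_T_op[OF y] yi using r by (simp add: norm_mult)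
    also have "\<dots> = (1 / s)\<^sup>2 / 2 * cmod (T_op i D ?y)"
      using r by (simp add: power_divide)
    also have "\<dots> \<le> pw 2 ?y * cmod (T_op i D ?y)"
    proof (rule mult_right_mono)
      have "1 \<le> (\<Prod>j\<in>UNIV - {i}. (1 + (?y $ j)\<^sup>2) ^ 2)" by (rule prod_ge_1) (simp add: one_le_power)
      then have "(1 + (?y $ i)\<^sup>2) ^ 2 * 1 \<le> pw 2 ?y" unfolding pw_split[of 2 ?y i] by (intro mult_left_mono) auto
      then show "(1 / s)\<^sup>2 / 2 \<le> pw 2 ?y" unfolding yi r(2) using zero_le_power2[of "1/s"] by linarith
    qed simp
    also have "\<dots> \<le> L" by (rule L[OF y])
    finally show ?thesis .
  qed
  have "norm (?f b - ?f a) \<le> L * b - L * a"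
  proof (rule differentiable_bound_general[OF ab(2), where \<phi>'="\<lambda>_. L" and f'="\<lambda>s. ?r' s *\<^sub>R partial i D (X0 + r s *\<^sub>R axis i 1)"])
    show "continuous_on {a..b} ?f"
      by (rule continuous_at_imp_continuous_on) (use ab in \<open>auto intro!: has_vector_derivative_continuous deriv\<close>)
    show "continuous_on {a..b} (\<lambda>s. L * s)" by (intro continuous_intros)
    show "((\<lambda>s. L * s) has_vector_derivative L) (at s)" for s
      unfolding has_real_derivative_iff_has_vector_derivative[symmetric] by (auto intro!: derivative_eq_intros)
  qed (use ab deriv bnd in auto)
  then show ?thesis unfolding path by (simp add: right_diff_distrib)
qed

text \<open>Changing the coordinates one at a time turns the bounds in single coordinates into a
  Lipschitz bound on the open cube. Uniform continuity then provides the extension to the closed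
  cube.\<close>

lemma rapid_compactify:
  fixes D :: "'n::finite cfun"
  assumes D: "rapid D"
  shows "\<exists>g. continuous_on (closure cubes) g \<and> (\<forall>x\<in>orthant. g (zmap x) = D x)"
proof -
  have "\<forall>i. \<exists>L. \<forall>y\<in>orthant. pw 2 y * cmod (T_op i D y) \<le> L"
    using rapid_bound[OF D, of 2 "[_]"] by (metis T_list_simps(1,2))
  then obtain L0 where L0: "\<And>i y. y \<in> orthant \<Longrightarrow> pw 2 y * cmod (T_op i D y) \<le> L0 i" by metis
  define L where "L = (\<Sum>i\<in>UNIV. \<bar>L0 i\<bar>)"
  have L: "pw 2 y * cmod (T_op i D y) \<le> L" if "y \<in> orthant" for y i
    using L0[OF that, of i] member_le_sum[of i UNIV "\<lambda>i. \<bar>L0 i\<bar>"] by (simp add: L_def)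
  have Lpos: "0 \<le> L" by (simp add: L_def sum_nonneg)
  have one: "cmod (D (zinv (\<chi> j. if j = i then b else z $ j)) - D (zinv (\<chi> j. if j = i then a else z $ j))) \<le> L * \<bar>b - a\<bar>"
    if "z \<in> cubes" "0 < a" "a < 1" "0 < b" "b < 1" for z a b i
  proof (cases a b rule: linorder_cases)
    case less
    then show ?thesis using rapid_lipschitz_coord[OF D L that(1,2) less that(5), of i] by simp
  next
    case equal
    then show ?thesis by (simp only: cancel_comm_monoid_add_class.diff_cancel norm_zero abs_zero mult_zero_right order_refl)
  next
    case greater
    then show ?thesis using rapid_lipschitz_coord[OF D L that(1,4) greater that(3), of i] by (simp add: norm_minus_commute)
  qed
  have mix: "cmod (D (zinv (\<chi> j. if j \<in> A then z' $ j else z $ j)) - D (zinv z)) \<le> L * (\<Sum>i\<in>A. \<bar>z' $ i - z $ i\<bar>)"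
    if z: "z \<in> cubes" "z' \<in> cubes" and A: "finite A" for z z' A
    using A
  proof (induction rule: finite_induct)
    case empty
    then show ?case by simp
  next
    case (insert i A)
    define w where "w = (\<chi> j. if j \<in> A then z' $ j else z $ j)"
    have w: "w \<in> cubes" using z by (auto simp: w_def cubes_def)
    have e: "(\<chi> j. if j \<in> insert i A then z' $ j else z $ j) = (\<chi> j. if j = i then z' $ i else w $ j)"
      "w = (\<chi> j. if j = i then z $ i else w $ j)"
      using insert(2) by (auto simp: vec_eq_iff w_def)
    have "cmod (D (zinv (\<chi> j. if j = i then z' $ i else w $ j)) - D (zinv (\<chi> j. if j = i then z $ i else w $ j))) \<le> L * \<bar>z' $ i - z $ i\<bar>"
      by (rule one[OF w]) (use z in \<open>auto simp: cubes_def\<close>)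
    then have "cmod (D (zinv (\<chi> j. if j \<in> insert i A then z' $ j else z $ j)) - D (zinv w)) \<le> L * \<bar>z' $ i - z $ i\<bar>"
      unfolding e(1) using e(2) by simp
    moreover have "cmod (D (zinv w) - D (zinv z)) \<le> L * (\<Sum>i\<in>A. \<bar>z' $ i - z $ i\<bar>)"
      unfolding w_def by (rule insert.IH)
    ultimately have "cmod (D (zinv (\<chi> j. if j \<in> insert i A then z' $ j else z $ j)) - D (zinv z)) \<le> L * \<bar>z' $ i - z $ i\<bar> + L * (\<Sum>i\<in>A. \<bar>z' $ i - z $ i\<bar>)"
      by (rule norm_diff_triangle_le)
    then show ?case using insert(1,2) by (simp add: distrib_left)
  qed
  have "(L * CARD('n))-lipschitz_on cubes (\<lambda>z. D (zinv z))"
  proof (rule lipschitz_onI)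
    fix z z' :: "real ^ 'n" assume z: "z \<in> cubes" "z' \<in> cubes"
    have "dist (D (zinv z)) (D (zinv z')) = cmod (D (zinv (\<chi> j. if j \<in> UNIV then z' $ j else z $ j)) - D (zinv z))"
      by (simp add: dist_norm norm_minus_commute)
    also have "\<dots> \<le> L * (\<Sum>i\<in>UNIV. \<bar>z' $ i - z $ i\<bar>)" by (rule mix[OF z]) simp
    also have "(\<Sum>i\<in>UNIV. \<bar>z' $ i - z $ i\<bar>) \<le> (\<Sum>i\<in>(UNIV :: 'n set). dist z z')"
      by (rule sum_mono) (use component_le_norm_cart[of "z' - z"] in \<open>simp add: dist_norm norm_minus_commute\<close>)
    finally show "dist (D (zinv z)) (D (zinv z')) \<le> L * CARD('n) * dist z z'"
      using Lpos by (simp add: mult_left_mono mult.assoc)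
  qed (use Lpos in simp)
  then have "uniformly_continuous_on cubes (\<lambda>z. D (zinv z))" by (rule lipschitz_on_uniformly_continuous)
  then obtain g where g: "uniformly_continuous_on (closure cubes) g" "\<And>z. z \<in> cubes \<Longrightarrow> D (zinv z) = g z"
    using uniformly_continuous_on_extension_on_closure by metis
  have "g (zmap x) = D x" if "x \<in> orthant" for x
    using g(2)[OF zmap_in[OF that]] unfolding zinv_zmap[OF that] ..
  then show ?thesis using uniformly_continuous_imp_continuous[OF g(1)] by blast
qed

text \<open>\<open>1 / (1 + x\<^sup>2)\<close> as a function of \<open>w = exp (- x\<^sup>2)\<close>, continued by \<open>0\<close> to \<open>w = 0\<close>.\<close>

definition zofw :: "real \<Rightarrow> real" where
  "zofw w = (if w \<le> 0 then 0 else 1 / (1 - ln w))"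

lemma zofw_continuous: "continuous_on {0..1} zofw"
  unfolding continuous_on_eq_continuous_within
proof
  fix w :: real assume w: "w \<in> {0..1}"
  show "continuous (at w within {0..1}) zofw"
  proof (cases "w = 0")
    case True
    show ?thesis
      unfolding continuous_within_eps_delta
    proof (intro allI impI)
      fix e :: real assume e: "0 < e"
      show "\<exists>d>0. \<forall>w'\<in>{0..1}. dist w' w < d \<longrightarrow> dist (zofw w') (zofw w) < e"
      \<comment> \<open>Below \<open>exp (- (1 / e))\<close> the denominator
        \<open>1 - ln w'\<close> exceeds \<open>1 / e\<close>.\<close>
      proof (intro exI[of _ "exp (- (1 / e))"] conjI ballI impI)
        fix w' :: real assume w': "w' \<in> {0..1}" "dist w' w < exp (- (1 / e))"
        show "dist (zofw w') (zofw w) < e"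
        proof (cases "w' = 0")
          case False
          then have p: "0 < w'" "w' < exp (- (1 / e))" using w' True by auto
          then have "ln w' < - (1 / e)" using ln_less_cancel_iff[of w' "exp (- (1 / e))"] by simp
          then have "1 / e < 1 - ln w'" using e by linarith
          moreover have "0 < 1 / e" using e by simp
          moreover from calculation have q: "0 < 1 - ln w'" by linarith
          ultimately have "1 / (1 - ln w') < 1 / (1 / e)"
            by (intro divide_strict_left_mono mult_pos_pos) simp_all
          then have "1 / (1 - ln w') < e" by simp
          then show ?thesis using p True q by (simp add: zofw_def dist_real_def)
        qed (use e True in simp)
      qed simp
    qed
  next
    case False
    then have w: "0 < w" "w \<le> 1" using w by auto
    have "isCont (\<lambda>w. 1 / (1 - ln w)) w"
    proof -
      have "1 - ln w \<noteq> 0" using ln_le_zero_iff[of w] w by linarith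
      then show ?thesis using w by (intro continuous_intros) auto
    qed
    moreover have ev: "\<forall>\<^sub>F w' in nhds w. 1 / (1 - ln w') = zofw w'"
      using eventually_nhds_in_open[of "{0<..}" w] w by (auto simp: zofw_def elim!: eventually_mono)
    ultimately have "isCont zofw w" by (simp only: isCont_cong[OF ev])
    then show ?thesis by (rule continuous_at_imp_continuous_at_within)
  qed
qed

lemma closure_cubes: "closure cubes = {z :: real ^ 'n::finite. \<forall>i. 0 \<le> z $ i \<and> z $ i \<le> 1}" (is "_ = ?B")
proof -
  let ?a = "0 :: real ^ 'n" and ?b = "(\<chi> i. 1) :: real ^ 'n"
  have b: "cubes = box ?a ?b" by (auto simp: cubes_def mem_box_cart)
  have "(\<chi> i. 1/2) \<in> box ?a ?b" by (simp add: mem_box_cart)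
  then have "box ?a ?b \<noteq> {}" by blast
  then have "closure cubes = cbox ?a ?b" unfolding b by (rule closure_box)
  then show ?thesis by (auto simp: mem_box_cart)
qed

text \<open>Gaussians are polynomials in \<open>w\<close>, not in \<open>z\<close>. The function
  need not be Lipschitz in \<open>w\<close>, but \<open>z\<close> depends continuously on
  \<open>w\<close> up to the boundary, and continuity is all that Stone--Weierstrass asks
  for.\<close>

lemma rapid_compactify_exp:
  fixes D :: "'n::finite cfun"
  assumes D: "rapid D"
  shows "\<exists>E. continuous_on (closure cubes) E \<and> (\<forall>x\<in>orthant. E (wmap x) = D x)"
proof -
  obtain g where g: "continuous_on (closure cubes) g" "\<And>x. x \<in> orthant \<Longrightarrow> g (zmap x) = D x"
    using rapid_compactify[OF D] by blast
  have "continuous_on (closure cubes) (\<lambda>w :: real ^ 'n. \<chi> i. zofw (w $ i))"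
    by (intro continuous_on_vec_lambda continuous_on_compose2[OF zofw_continuous] continuous_intros) (auto simp: closure_cubes)
  moreover have "(\<lambda>w :: real ^ 'n. \<chi> i. zofw (w $ i)) ` closure cubes \<subseteq> closure cubes"
  proof -
    have "0 \<le> zofw w \<and> zofw w \<le> 1" if "0 \<le> w" "w \<le> 1" for w
    proof (cases "w = 0")
      case False
      then have "ln w \<le> 0" using that by simp
      then have "1 \<le> 1 - ln w" by simp
      then have "1 / (1 - ln w) \<le> 1 / 1" by (intro divide_left_mono) auto
      moreover have "0 \<le> 1 / (1 - ln w)" using \<open>1 \<le> 1 - ln w\<close> by simp
      ultimately show ?thesis using False that by (simp only: zofw_def) simp
    qed (simp add: zofw_def)
    then show ?thesis by (auto simp: closure_cubes)
  qed
  ultimately have "continuous_on (closure cubes) (\<lambda>w. g (\<chi> i. zofw (w $ i)))"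
    by (intro continuous_on_compose2[OF g(1)])
  moreover have "g (\<chi> i. zofw (wmap x $ i)) = D x" if "x \<in> orthant" for x
  proof -
    have "(\<chi> i. zofw (wmap x $ i)) = zmap x" by (simp add: vec_eq_iff wmap_def zofw_def zmap_def)
    then show ?thesis using g(2)[OF that] by simp
  qed
  ultimately show ?thesis by blast
qed

text \<open>For \<open>u\<close> up to \<open>1 / e\<close> the base stays below a constant less
  than 1 and a high power is small; beyond that the denominator alone suffices.\<close>

lemma cutoff_power:
  fixes e :: real
  assumes "0 < e"
  shows "\<exists>L. \<forall>u\<ge>0. (1 - exp (- u)) ^ L / (1 + u) \<le> e"
proof -
  define U where "U = 1 / e"
  have U: "0 < U" using assms by (simp add: U_def)
  define \<rho> where "\<rho> = 1 - exp (- U)"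
  have \<rho>: "0 \<le> \<rho>" "\<rho> < 1" using U by (auto simp: \<rho>_def)
  obtain L where L: "\<rho> ^ L < e" using real_arch_pow_inv[OF assms \<rho>(2)] by blast
  have "(1 - exp (- u)) ^ L / (1 + u) \<le> e" if u: "0 \<le> u" for u
  proof (cases "u \<le> U")
    case True
    have "(1 - exp (- u)) ^ L \<le> \<rho> ^ L" unfolding \<rho>_def using u True by (intro power_mono) auto
    then have "(1 - exp (- u)) ^ L \<le> e" using L by simp
    also have "\<dots> \<le> e * (1 + u)" using u assms by simp
    finally show ?thesis using u by (simp add: divide_le_eq)
  next
    case False
    have "(1 - exp (- u)) ^ L \<le> 1" using u by (intro power_le_one) auto
    also have "1 = e * U" using assms by (simp add: U_def)
    also have "\<dots> \<le> e * (1 + u)" using assms False by (intro mult_left_mono) auto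
    finally show ?thesis using u by (simp add: divide_le_eq)
  qed
  then show ?thesis by blast
qed

lemma one_minus_prod_le:
  fixes b :: "'n \<Rightarrow> real"
  assumes "finite A" "\<And>i. i \<in> A \<Longrightarrow> 0 \<le> b i \<and> b i \<le> 1"
  shows "0 \<le> 1 - (\<Prod>i\<in>A. 1 - b i)" "1 - (\<Prod>i\<in>A. 1 - b i) \<le> (\<Sum>i\<in>A. b i)"
proof -
  have "(\<Prod>i\<in>A. 1 - b i) \<le> 1" by (rule prod_le_1) (use assms(2) in force)
  then show "0 \<le> 1 - (\<Prod>i\<in>A. 1 - b i)" by simp
  show "1 - (\<Prod>i\<in>A. 1 - b i) \<le> (\<Sum>i\<in>A. b i)"
    using assms
  proof (induction rule: finite_induct)
    case (insert i A)
    have IH: "1 - (\<Prod>i\<in>A. 1 - b i) \<le> (\<Sum>i\<in>A. b i)" using insert by auto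
    have "0 \<le> (\<Prod>i\<in>A. 1 - b i)" "(\<Prod>i\<in>A. 1 - b i) \<le> 1"
      using insert by (auto intro!: prod_nonneg prod_le_1)
    then have "b i * (\<Prod>i\<in>A. 1 - b i) \<le> b i" using insert by (simp add: mult_left_le)
    then show ?case using IH insert(1,2) by (simp add: algebra_simps)
  qed simp
qed

lemma gauss_one: "gauss (\<lambda>_. 1) x = complex_of_real (\<Prod>i\<in>UNIV. wmap x $ i)"
  by (simp add: gauss_def wmap_def)

text \<open>The factor \<open>\<Prod>\<^sub>i (1 - (1 - w\<^sub>i)\<^sup>L)\<close>, \<open>w = wmap x\<close>, is close to \<open>1\<close> in the weighted norm and is divisible by
  \<open>\<Prod>\<^sub>i w\<^sub>i\<close>, which absorbs the weight in the Stone--Weierstrass approximation on the cube.\<close>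

lemma weighted_gauss_approximation:
  fixes D :: "'n::finite cfun"
  assumes D: "rapid D" and \<epsilon>: "0 < \<epsilon>"
  shows "\<exists>\<eta>\<in>gauss_span. \<forall>x\<in>orthant. pw m x * cmod (D x - \<eta> x) \<le> \<epsilon>"
proof -
  obtain E where E: "continuous_on (closure cubes) E" "\<And>x. x \<in> orthant \<Longrightarrow> E (wmap x) = D x"
    using rapid_compactify_exp[OF D] by blast
  obtain C where C: "0 < C" "\<And>x. x \<in> orthant \<Longrightarrow> pw (Suc m) x * cmod (D x) \<le> C"
    using rapid_bound[OF D, of "Suc m" "[]"] by auto
  obtain B where B: "0 < B" "\<And>x :: real ^ 'n. pw m x * cmod (gauss (\<lambda>_. 1) x) \<le> B"
    using pw_gauss_bounded[of m] by (metis order_refl)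
  define n where "n = real CARD('n)"
  have n: "0 < n" by (simp add: n_def)
  \<comment> \<open>The constant anticipates a sum over \<open>n\<close> coordinates, each term
    weighted with the bound \<open>C\<close>, and half of \<open>\<epsilon>\<close> as the
    target.\<close>
  obtain L where L: "\<And>u. 0 \<le> u \<Longrightarrow> (1 - exp (- u)) ^ L / (1 + u) \<le> \<epsilon> / (2 * n * C)"
    using cutoff_power[of "\<epsilon> / (2 * n * C)"] \<epsilon> n C(1) by auto
  \<comment> \<open>The quotient of the product of the \<open>1 - (1 - w_i)^L\<close> by the product
    of the \<open>w_i\<close>, written as geometric sums so that it is a polynomial, continuous up
    to \<open>w_i = 0\<close>.\<close>
  define \<kappa> where "\<kappa> w = (\<Prod>i\<in>UNIV. \<Sum>k<L. (1 - w $ i) ^ k)" for w :: "real ^ 'n"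
  have Fc: "continuous_on (closure cubes) (\<lambda>w. E w * complex_of_real (\<kappa> w))"
    unfolding \<kappa>_def by (intro continuous_intros E)
  have "compact (closure (cubes :: (real ^ 'n) set))"
  proof -
    have "bounded (cubes :: (real ^ 'n) set)"
    proof (rule bounded_subset[OF bounded_box])
      show "cubes \<subseteq> box (0 :: real ^ 'n) (\<chi> i. 1)" by (auto simp: cubes_def mem_box_cart)
    qed
    then show ?thesis by simp
  qed
  from Stone_Weierstrass_polynomial_function[OF this Fc, of "\<epsilon> / (2 * B)"] \<epsilon> B(1)
  obtain p where p: "polynomial_function p" "\<And>w. w \<in> closure cubes \<Longrightarrow> cmod (E w * complex_of_real (\<kappa> w) - p w) < \<epsilon> / (2 * B)"
    by auto
  have g1: "gauss (\<lambda>_. 1) \<in> gauss_span" by (rule gauss_span.gauss) simp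
  define \<eta> where "\<eta> x = p (wmap x) * gauss (\<lambda>_. 1) x" for x
  have "\<eta> \<in> gauss_span"
  proof -
    have "real_polynomial_function (Re \<circ> p)" "real_polynomial_function (Im \<circ> p)"
      using p(1) bounded_linear_Re bounded_linear_Im unfolding polynomial_function_def by blast+
    note r = this
    have "(\<lambda>x. complex_of_real ((Re \<circ> p) (wmap x)) * gauss (\<lambda>_. 1) x + \<i> * (complex_of_real ((Im \<circ> p) (wmap x)) * gauss (\<lambda>_. 1) x)) \<in> gauss_span"
      by (intro gauss_span.add gauss_span.cmult gauss_span_mult_polynomial r g1)
    moreover have "complex_of_real ((Re \<circ> p) w) * G + \<i> * (complex_of_real ((Im \<circ> p) w) * G) = p w * G" for w G
      using complex_eq[of "p w"] by (simp add: distrib_right[symmetric] mult.assoc[symmetric])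
    ultimately show ?thesis unfolding \<eta>_def[abs_def] by (simp only:)
  qed
  moreover have "pw m x * cmod (D x - \<eta> x) \<le> \<epsilon>" if x: "x \<in> orthant" for x
  proof -
    let ?w = "wmap x" and ?G = "gauss (\<lambda>_. 1) x"
    define b where "b i = (1 - ?w $ i) ^ L" for i
    have w01: "0 < ?w $ i" "?w $ i \<le> 1" for i by (simp_all add: wmap_def)
    have wc: "?w \<in> closure cubes" using w01 by (auto simp: closure_cubes less_imp_le)
    have b01: "0 \<le> b i \<and> b i \<le> 1" for i unfolding b_def using w01[of i] by (auto intro!: power_le_one)
    have \<chi>: "(\<Prod>i\<in>UNIV. ?w $ i) * \<kappa> ?w = (\<Prod>i\<in>UNIV. 1 - b i)"
      unfolding \<kappa>_def b_def prod.distrib[symmetric]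
      by (rule prod.cong) (simp_all add: one_diff_power_eq[of "1 - _", symmetric, simplified])
    have *: "D x * ?G * complex_of_real (\<kappa> ?w) = complex_of_real (\<Prod>i\<in>UNIV. 1 - b i) * D x"
      unfolding gauss_one \<chi>[symmetric] of_real_mult by (simp only: mult_ac)
    \<comment> \<open>The first part is the error of the cutoff. In the second, the Gaussian carries
      the weight while the bracket is the uniform error on the cube.\<close>
    have split: "D x - \<eta> x = complex_of_real (1 - (\<Prod>i\<in>UNIV. 1 - b i)) * D x + ?G * (E ?w * complex_of_real (\<kappa> ?w) - p ?w)"
    proof -
      have "d - P * G = (1 - c) * d + G * (d * k - P)" if "d * G * k = c * d" for d P G c k :: complex
      proof -
        have "(1 - c) * d + G * (d * k - P) = d - c * d + d * G * k - P * G" by (simp add: algebra_simps)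
        then show ?thesis unfolding that by simp
      qed
      from this[OF *] show ?thesis unfolding \<eta>_def E(2)[OF x] of_real_diff of_real_1 .
    qed
    have 1: "pw m x * cmod (complex_of_real (1 - (\<Prod>i\<in>UNIV. 1 - b i)) * D x) \<le> \<epsilon> / 2"
    proof -
      have "pw m x * cmod (complex_of_real (1 - (\<Prod>i\<in>UNIV. 1 - b i)) * D x) = (1 - (\<Prod>i\<in>UNIV. 1 - b i)) * (pw m x * cmod (D x))"
        unfolding norm_mult norm_of_real using one_minus_prod_le(1)[of UNIV b] b01 by simp
      also have "\<dots> \<le> (\<Sum>i\<in>UNIV. b i) * (pw m x * cmod (D x))"
        by (intro mult_right_mono one_minus_prod_le(2)) (use b01 pw_pos[of m x] in auto)
      also have "\<dots> = (\<Sum>i\<in>UNIV. b i * (pw m x * cmod (D x)))" by (rule sum_distrib_right)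
      also have "\<dots> \<le> (\<Sum>i\<in>(UNIV :: 'n set). \<epsilon> / (2 * n))"
      proof (rule sum_mono)
        fix i
        have pos: "0 < 1 + (x $ i)\<^sup>2" by (simp add: add_pos_nonneg)
        have "1 + (x $ i)\<^sup>2 \<le> pw 1 x"
        proof -
          have "1 \<le> (\<Prod>j\<in>UNIV - {i}. (1 + (x $ j)\<^sup>2) ^ 1)" by (rule prod_ge_1) simp
          then have "(1 + (x $ i)\<^sup>2) ^ 1 * 1 \<le> pw 1 x" unfolding pw_split[of 1 x i] by (intro mult_left_mono) auto
          then show ?thesis by simp
        qed
        then have "(1 + (x $ i)\<^sup>2) * (pw m x * cmod (D x)) \<le> pw 1 x * (pw m x * cmod (D x))"
          using pw_pos[of m x] by (intro mult_right_mono) auto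
        also have "\<dots> \<le> C" using C(2)[OF x] pw_add[of 1 m x] by (simp add: mult.assoc)
        finally have "pw m x * cmod (D x) \<le> C / (1 + (x $ i)\<^sup>2)" using pos by (simp add: field_simps)
        then have "b i * (pw m x * cmod (D x)) \<le> b i * (C / (1 + (x $ i)\<^sup>2))" using b01 by (intro mult_left_mono) auto
        also have "\<dots> = C * ((1 - exp (- (x $ i)\<^sup>2)) ^ L / (1 + (x $ i)\<^sup>2))" by (simp add: b_def wmap_def)
        also have "\<dots> \<le> C * (\<epsilon> / (2 * n * C))" using C(1) by (intro mult_left_mono L) auto
        also have "\<dots> = \<epsilon> / (2 * n)" using C(1) by simp
        finally show "b i * (pw m x * cmod (D x)) \<le> \<epsilon> / (2 * n)" .
      qed
      also have "\<dots> = \<epsilon> / 2" using n by (simp add: n_def)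
      finally show ?thesis .
    qed
    have 2: "pw m x * cmod (?G * (E ?w * complex_of_real (\<kappa> ?w) - p ?w)) \<le> \<epsilon> / 2"
    proof -
      have "pw m x * cmod (?G * (E ?w * complex_of_real (\<kappa> ?w) - p ?w)) = (pw m x * cmod ?G) * cmod (E ?w * complex_of_real (\<kappa> ?w) - p ?w)"
        by (simp add: norm_mult)
      also have "\<dots> \<le> B * (\<epsilon> / (2 * B))"
        by (intro mult_mono B(2) less_imp_le[OF p(2)[OF wc]]) (use B in auto)
      also have "\<dots> = \<epsilon> / 2" using B(1) by simp
      finally show ?thesis .
    qed
    have "pw m x * cmod (D x - \<eta> x) \<le> pw m x * (cmod (complex_of_real (1 - (\<Prod>i\<in>UNIV. 1 - b i)) * D x) + cmod (?G * (E ?w * complex_of_real (\<kappa> ?w) - p ?w)))"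
      unfolding split using pw_pos[of m x] by (intro mult_left_mono norm_triangle_ineq) auto
    then show ?thesis using 1 2 unfolding distrib_left by linarith
  qed
  ultimately show ?thesis by blast
qed

text \<open>Approximating a single top derivative controls all lower ones: take \<open>K\<close>
  operators of every index, approximate that derivative, take an antiderivative within the span, and
  integrate the difference back from infinity. Each integration costs one power of the weight,
  whence the surplus \<open>length top\<close>.\<close>

lemma gauss_dense:
  fixes \<psi> :: "'n::{finite,linorder} cfun"
  assumes \<psi>: "rapid \<psi>" and \<epsilon>: "0 < \<epsilon>" and m: "1 \<le> m"
  shows "\<exists>\<eta>\<in>gauss_span. \<forall>l. (\<forall>i. count (mset l) i \<le> K) \<longrightarrow> (\<forall>x\<in>orthant. pw m x * cmod (T_list l (\<lambda>x. \<psi> x - \<eta> x) x) \<le> \<epsilon>)"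
proof -
  define top where "top = mi_list (\<lambda>i::'n. K)"
  have top: "count (mset top) i = K" for i by (simp add: top_def count_mi_list)
  obtain \<eta>0 where \<eta>0: "\<eta>0 \<in> gauss_span" "\<And>x. x \<in> orthant \<Longrightarrow> pw (m + length top) x * cmod (T_list top \<psi> x - \<eta>0 x) \<le> \<epsilon>"
    using weighted_gauss_approximation[OF rapid_T_list[OF \<psi>] \<epsilon>] by blast
  obtain \<eta> where \<eta>: "\<eta> \<in> gauss_span" "\<And>x. x \<in> orthant \<Longrightarrow> T_list top \<eta> x = \<eta>0 x"
    using gauss_span_antiderivative[OF \<eta>0(1)] by blast
  let ?R = "\<lambda>x. \<psi> x - \<eta> x"
  have R: "rapid ?R" using rapid_lincomb[OF \<psi> rapid_gauss_span[OF \<eta>(1)], of 1 "-1"] by simp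
  have topR: "T_list top ?R x = T_list top \<psi> x - \<eta>0 x" if "x \<in> orthant" for x
    using T_list_lincomb[OF rapid_Cinf[OF \<psi>] rapid_Cinf[OF rapid_gauss_span[OF \<eta>(1)]] that, of top 1 "-1"] \<eta>(2)[OF that] by simp
  have "pw m x * cmod (T_list l ?R x) \<le> \<epsilon>" if l: "\<And>i. count (mset l) i \<le> K" and x: "x \<in> orthant" for l x
  proof -
    have "mset l \<subseteq># mset top" by (rule mset_subset_eqI) (simp add: l top)
    moreover obtain l' where "mset l' = mset top - mset l" using ex_mset by blast
    ultimately have l': "mset (l' @ l) = mset top" by simp
    have len: "length l' \<le> length top" using arg_cong[OF l', of size] by simp
    show ?thesis
    proof (rule T_list_integrate[OF rapid_T_list[OF R] m less_imp_le[OF \<epsilon>] _ x])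
      fix y :: "(real, 'n) vec" assume y: "y \<in> orthant"
      have "T_list l' (T_list l ?R) y = T_list top ?R y"
        using T_list_perm[OF rapid_Cinf[OF R] l' y] by simp
      then have "pw (m + length l') y * cmod (T_list l' (T_list l ?R) y) \<le> pw (m + length top) y * cmod (T_list top \<psi> y - \<eta>0 y)"
        unfolding topR[OF y] using len by (intro mult_mono pw_mono) (auto simp: less_imp_le[OF pw_pos])
      then show "pw (m + length l') y * cmod (T_list l' (T_list l ?R) y) \<le> \<epsilon>" using \<eta>0(2)[OF y] by linarith
    qed
  qed
  then show ?thesis using \<eta>(1) by blast
qed

subsection \<open>Solutions of \<open>L f = 0\<close>\<close>

lemma rapid_reduced:
  fixes \<phi> :: "'n::{finite,linorder} cfun"
  assumes "\<phi> \<in> Hmu \<mu>"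
  shows "rapid (reduced \<mu> \<phi>)"
  unfolding rapid_def
proof (intro conjI allI)
  show "Cinf_on orthant (reduced \<mu> \<phi>)" by (rule Cinf_on_reduced[OF HmuD(1)[OF assms]])
  fix m l
  obtain C where C: "\<And>x. x \<in> orthant \<Longrightarrow> (1 + (norm x)\<^sup>2) ^ (CARD('n) * m) * cmod (T_list l (reduced \<mu> \<phi>) x) \<le> C"
    using HmuD(3)[OF assms] by blast
  have "pw m x * cmod (T_list l (reduced \<mu> \<phi>) x) \<le> C" if "x \<in> orthant" for x
    using mult_right_mono[OF pw_le_norm[of m x], of "cmod (T_list l (reduced \<mu> \<phi>) x)"] C[OF that] by simp
  then show "\<exists>C. \<forall>x\<in>orthant. pw m x * cmod (T_list l (reduced \<mu> \<phi>) x) \<le> C" by blast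
qed

definition unreduced :: "(real, 'n::finite) vec \<Rightarrow> 'n cfun \<Rightarrow> 'n cfun" where
  "unreduced \<mu> \<eta> x = (if x \<in> orthant then complex_of_real (vpowr x (\<chi> i. \<mu> $ i + 1/2)) * \<eta> x else 0)"

lemma reduced_unreduced: "x \<in> orthant \<Longrightarrow> reduced \<mu> (unreduced \<mu> \<eta>) x = \<eta> x"
  using vpowr_pos[of x "\<chi> i. \<mu> $ i + 1/2"] unfolding reduced_def vpowr_reduced_eq vpowr_uminus
  by (simp add: unreduced_def)

lemma unreduced_in_Hmu:
  assumes "rapid \<eta>"
  shows "unreduced \<mu> \<eta> \<in> Hmu \<mu>"
proof (rule HmuI)
  show "Cinf_on orthant (unreduced \<mu> \<eta>)"
    by (rule Cinf_on_transform[OF Cinf_on_mult[OF _ Cinf_on_vpowr rapid_Cinf[OF assms]]]) (auto simp: unreduced_def)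
  show "unreduced \<mu> \<eta> x = 0" if "x \<notin> orthant" for x using that by (simp add: unreduced_def)
  fix m l
  obtain C where C: "\<And>x. x \<in> orthant \<Longrightarrow> pw m x * cmod (T_list l \<eta> x) \<le> C" using rapid_bound[OF assms] by metis
  have "(1 + (norm x)\<^sup>2) ^ m * cmod (T_list l (reduced \<mu> (unreduced \<mu> \<eta>)) x) \<le> C" if x: "x \<in> orthant" for x
  proof -
    have "T_list l (reduced \<mu> (unreduced \<mu> \<eta>)) x = T_list l \<eta> x"
      by (rule T_list_cong[OF reduced_unreduced x])
    then show ?thesis using mult_right_mono[OF norm_le_pw[of x m], of "cmod (T_list l \<eta> x)"] C[OF x] by simp
  qed
  then show "\<exists>C. \<forall>x\<in>orthant. (1 + (norm x)\<^sup>2) ^ m * cmod (T_list l (reduced \<mu> (unreduced \<mu> \<eta>)) x) \<le> C" by blast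
qed

text \<open>An integer rate \<open>j_i \<ge> 1\<close> corresponds to the parameter
  \<open>t_i = 1 / j_i\<close>, which lies in the range \<open>(0, 1]\<close> where the expansion in
  \<open>t\<close> is available.\<close>

lemma unreduced_gauss:
  fixes j :: "'n::{finite,linorder} multi_index"
  assumes \<mu>: "\<And>i. -1/2 \<le> \<mu> $ i" and j: "\<And>i. 1 \<le> j i"
  shows "\<exists>c. unreduced \<mu> (gauss j) = (\<lambda>x. c * synth \<mu> (\<lambda>v. complex_of_real (monexp (\<lambda>_. 0) (\<lambda>i. 1 / real (j i)) v)) x)"
proof -
  let ?t = "\<lambda>i. 1 / real (j i)"
  have t: "0 < ?t i" for i using j[of i] by simp
  define c where "c = (\<Prod>i\<in>UNIV. ?t i powr - (\<mu> $ i + 1))"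
  have c: "c > 0" unfolding c_def by (intro prod_pos) (use j in \<open>auto simp: less_eq_Suc_le\<close>)
  have "unreduced \<mu> (gauss j) x = complex_of_real (inverse c) * synth \<mu> (\<lambda>v. complex_of_real (monexp (\<lambda>_. 0) ?t v)) x" for x
  proof (cases "x \<in> orthant")
    case True
    have "hankel \<mu> (\<lambda>v. complex_of_real (monexp (\<lambda>_. 0) ?t v)) (vsq x) = complex_of_real c * gauss j x"
      unfolding hankel_monexp(2)[of \<mu> ?t "\<lambda>_. 0", OF \<mu> t] lag_0[OF t] gauss_def c_def
      by (simp add: prod.distrib mult.commute)
    then show ?thesis using True c by (simp add: unreduced_def synth_def)
  qed (simp add: unreduced_def synth_def)
  then show ?thesis by blast
qed

lemma annihilated_by_L_op:
  fixes \<mu> :: "(real, 'n::{finite,linorder}) vec" and a :: "'n multi_index \<Rightarrow> real"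
  assumes \<mu>: "\<And>i. - 1/2 \<le> \<mu> $ i"
    and nz: "\<And>x :: (real, 'n) vec. x \<noteq> 0 \<Longrightarrow> mpoly_eval N a x \<noteq> 0"
    and nonneg: "\<And>\<alpha>. mi_abs \<alpha> \<le> N \<Longrightarrow> 0 \<le> a \<alpha>"
    and f: "f \<in> Hmu_dual \<mu>" and L: "L_op \<mu> N a f = (\<lambda>\<phi>. 0)"
  shows "\<exists>(M :: nat) (q :: 'n multi_index \<Rightarrow> complex).
           f = regular_functional \<mu> (\<lambda>x. complex_of_real (vpowr x (\<chi> i. \<mu> $ i + 1/2)) *
                 mpoly_eval M q (\<chi> i. complex_of_real ((x $ i)\<^sup>2)))"
proof -
  have lin: "Hmu_linear \<mu> f" using f by (auto simp: Hmu_dual_def Hmu_linear_def)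
  have "\<forall>i. \<exists>R. \<forall>a'\<ge>0. \<forall>\<epsilon>>0. \<forall>g\<in>expoly (\<lambda>_. \<epsilon>). \<forall>R'\<ge>R.
    f (synth \<mu> (\<lambda>v. complex_of_real (taylor_gap a' R' (v $ i)) * g v)) = 0"
  proof
    fix i
    have "axis i 1 \<noteq> (0 :: (real, 'n) vec)" by (simp add: axis_eq_0_iff)
    from synth_vanish[OF \<mu> f L nonneg nz[OF this]]
    show "\<exists>R. \<forall>a'\<ge>0. \<forall>\<epsilon>>0. \<forall>g\<in>expoly (\<lambda>_. \<epsilon>). \<forall>R'\<ge>R.
      f (synth \<mu> (\<lambda>v. complex_of_real (taylor_gap a' R' (v $ i)) * g v)) = 0" by simp
  qed
  from choice[OF this] obtain R0 where R0: "\<And>i a' \<epsilon> g R'. 0 \<le> a' \<Longrightarrow> 0 < \<epsilon> \<Longrightarrow> g \<in> expoly (\<lambda>_. \<epsilon>) \<Longrightarrow> R0 i \<le> R' \<Longrightarrow>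
    f (synth \<mu> (\<lambda>v. complex_of_real (taylor_gap a' R' (v $ i)) * g v)) = 0" by blast
  \<comment> \<open>The sum serves as a common upper bound for the orders of all
    coordinates.\<close>
  define R where "R = (\<Sum>i\<in>UNIV. R0 i)"
  have R: "R0 i \<le> R" for i unfolding R_def by (rule member_le_sum) auto
  let ?A = "PiE (UNIV :: 'n set) (\<lambda>_. {..<R})"
  have finA: "finite ?A" by (intro finite_PiE) auto
  have "\<exists>D. \<forall>t. (\<forall>i. 0 < t i \<and> t i \<le> 1) \<longrightarrow> f (synth \<mu> (\<lambda>v. complex_of_real (monexp (\<lambda>_. 0) t v))) =
    (\<Sum>\<beta>\<in>?A. D \<beta> * (\<Prod>i\<in>UNIV. complex_of_real (t i) ^ \<beta> i))"
    by (rule synth_exp_polynomial[OF \<mu> lin]) (rule R0[OF _ _ _ R])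
  then obtain D where D: "\<And>t. (\<And>i. 0 < t i \<and> t i \<le> 1) \<Longrightarrow> f (synth \<mu> (\<lambda>v. complex_of_real (monexp (\<lambda>_. 0) t v))) =
    (\<Sum>\<beta>\<in>?A. D \<beta> * (\<Prod>i\<in>UNIV. complex_of_real (t i) ^ \<beta> i))"
    by blast
  have "\<forall>\<beta>. \<exists>c. c \<noteq> 0 \<and> (\<forall>t. (\<forall>i. 0 < t i) \<longrightarrow>
    even_moment \<mu> \<beta> (synth \<mu> (\<lambda>v. complex_of_real (monexp (\<lambda>_. 0) t v))) = c * (\<Prod>i\<in>UNIV. complex_of_real (t i) ^ \<beta> i))"
    using even_moment_synth[OF \<mu>] by blast
  from choice[OF this] obtain c where c: "\<And>\<beta>. c \<beta> \<noteq> 0" "\<And>\<beta> t. (\<And>i. 0 < t i) \<Longrightarrow>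
    even_moment \<mu> \<beta> (synth \<mu> (\<lambda>v. complex_of_real (monexp (\<lambda>_. 0) t v))) = c \<beta> * (\<Prod>i\<in>UNIV. complex_of_real (t i) ^ \<beta> i)"
    by blast
  \<comment> \<open>Dividing by \<open>c \<beta>\<close> normalises each moment to
    \<open>t^\<beta>\<close>, so \<open>G\<close> reproduces the polynomial with coefficients
    \<open>D \<beta>\<close> and agrees with \<open>f\<close> on the Gaussians.\<close>
  define G where "G \<phi> = (\<Sum>\<beta>\<in>?A. D \<beta> / c \<beta> * even_moment \<mu> \<beta> \<phi>)" for \<phi>
  have Glin: "Hmu_linear \<mu> G"
  proof -
    note m = Hmu_linear_even_moment[OF \<mu>, unfolded Hmu_linear_def]
    show ?thesis unfolding Hmu_linear_def G_def
      using m by (simp add: sum.distrib distrib_left sum_distrib_left mult.left_commute)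
  qed
  have Gsynth: "f (unreduced \<mu> \<eta>) = G (unreduced \<mu> \<eta>)" if "\<eta> \<in> gauss_span" for \<eta>
    using that
  proof (induction rule: gauss_span.induct)
    case (gauss j)
    let ?t = "\<lambda>i. 1 / real (j i)"
    have t: "0 < ?t i" "?t i \<le> 1" for i using gauss[of i] by auto
    let ?s = "synth \<mu> (\<lambda>v. complex_of_real (monexp (\<lambda>_. 0) ?t v))"
    obtain d where d: "unreduced \<mu> (gauss j) = (\<lambda>x. d * ?s x)" using unreduced_gauss[where j=j, OF \<mu> gauss] by blast
    have s: "?s \<in> Hmu \<mu>" by (rule synth_in_Hmu[OF expoly.monexp _ \<mu>, where \<tau>="?t"]) (use t in auto)
    have "f ?s = G ?s" unfolding G_def using D[of ?t] t c(1) c(2)[of ?t, OF t(1)] by simp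
    moreover have "f (\<lambda>x. d * ?s x) = d * f ?s" using lin s unfolding Hmu_linear_def by simp
    moreover have "G (\<lambda>x. d * ?s x) = d * G ?s" using Glin s unfolding Hmu_linear_def by simp
    ultimately show ?case unfolding d by simp
  next
    case (add \<eta> \<eta>')
    have "unreduced \<mu> (\<lambda>x. \<eta> x + \<eta>' x) = (\<lambda>x. unreduced \<mu> \<eta> x + unreduced \<mu> \<eta>' x)"
      by (auto simp: unreduced_def fun_eq_iff distrib_left)
    then show ?case
      using add.IH lin Glin unreduced_in_Hmu[OF rapid_gauss_span[OF add.hyps(1)]] unreduced_in_Hmu[OF rapid_gauss_span[OF add.hyps(2)]]
      unfolding Hmu_linear_def by simp
  next
    case (cmult \<eta> d)
    have "unreduced \<mu> (\<lambda>x. d * \<eta> x) = (\<lambda>x. d * unreduced \<mu> \<eta> x)"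
      by (auto simp: unreduced_def fun_eq_iff)
    then show ?case
      using cmult.IH lin Glin unreduced_in_Hmu[OF rapid_gauss_span[OF cmult.hyps(1)]]
      unfolding Hmu_linear_def by simp
  qed
  obtain F \<delta> where F: "finite F" "0 < \<delta>"
    "\<And>\<psi>. \<psi> \<in> Hmu \<mu> \<Longrightarrow> (\<forall>(m,k)\<in>F. gamma_seminorm \<mu> m k \<psi> \<le> ennreal \<delta>) \<Longrightarrow> cmod (f \<psi>) < 1"
    using Hmu_dual_bound[OF f] by blast
  have "\<forall>\<beta>. \<exists>m C. 0 \<le> C \<and> (\<forall>\<phi>\<in>Hmu \<mu>. \<forall>B. (\<forall>x\<in>orthant. (1 + (norm x)\<^sup>2) ^ m * cmod (reduced \<mu> \<phi> x) \<le> B) \<longrightarrow> cmod (even_moment \<mu> \<beta> \<phi>) \<le> C * B)"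
    using even_moment_bound[OF \<mu>] by meson
  then obtain mb Cb where b: "\<And>\<beta>. 0 \<le> Cb \<beta>"
    "\<And>\<beta> \<phi> B. \<phi> \<in> Hmu \<mu> \<Longrightarrow> (\<And>x. x \<in> orthant \<Longrightarrow> (1 + (norm x)\<^sup>2) ^ mb \<beta> * cmod (reduced \<mu> \<phi> x) \<le> B) \<Longrightarrow> cmod (even_moment \<mu> \<beta> \<phi>) \<le> Cb \<beta> * B"
    by metis
  \<comment> \<open>Bounds the multiplicity of every index in the seminorms that control
    \<open>f\<close>.\<close>
  define K where "K = (\<Sum>p\<in>F. \<Sum>i\<in>UNIV. snd p i)"
  have K: "k i \<le> K" if "(m, k) \<in> F" for m k i
  proof -
    have "k i \<le> (\<Sum>i\<in>UNIV. k i)" by (rule member_le_sum) auto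
    also have "\<dots> \<le> K" unfolding K_def using member_le_sum[of "(m,k)" F "\<lambda>p. \<Sum>i\<in>UNIV. snd p i"] that F(1) by simp
    finally show ?thesis .
  qed
  \<comment> \<open>Dominates the weights needed for \<open>f\<close> and for all moments; the
    successor provides the \<open>1 \<le> m\<close> required by \<open>gauss_dense\<close>.\<close>
  define mm where "mm = Suc ((\<Sum>p\<in>F. fst p) + (\<Sum>\<beta>\<in>?A. mb \<beta>))"
  have mm1: "m \<le> mm" if "(m, k) \<in> F" for m k
    using member_le_sum[of "(m,k)" F fst] that F(1) by (simp add: mm_def)
  have mm2: "mb \<beta> \<le> mm" if "\<beta> \<in> ?A" for \<beta>
    using member_le_sum[of \<beta> ?A mb] that finA by (simp add: mm_def)
  define C where "C = 1 / \<delta> + (\<Sum>\<beta>\<in>?A. cmod (D \<beta> / c \<beta>) * Cb \<beta>)"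
  have C: "0 < C" unfolding C_def using F(2) b(1) by (intro add_pos_nonneg sum_nonneg mult_nonneg_nonneg) auto
  \<comment> \<open>Subtract a Gaussian approximation of \<open>\<phi>\<close>: both functionals
    agree on it, and both are bounded on the small remainder.\<close>
  have close: "cmod (f \<phi> - G \<phi>) \<le> C * e" if \<phi>: "\<phi> \<in> Hmu \<mu>" and e: "0 < e" for \<phi> e
  proof -
    obtain \<eta> where \<eta>: "\<eta> \<in> gauss_span" and small: "\<And>l x. (\<And>i. count (mset l) i \<le> K) \<Longrightarrow> x \<in> orthant \<Longrightarrow>
      pw mm x * cmod (T_list l (\<lambda>x. reduced \<mu> \<phi> x - \<eta> x) x) \<le> e"
      using gauss_dense[OF rapid_reduced[OF \<phi>] e, of mm K] by (auto simp: mm_def)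
    have u: "unreduced \<mu> \<eta> \<in> Hmu \<mu>" by (rule unreduced_in_Hmu[OF rapid_gauss_span[OF \<eta>]])
    define \<psi> where "\<psi> = (\<lambda>x. 1 * \<phi> x + (-1) * unreduced \<mu> \<eta> x)"
    have \<psi>: "\<psi> \<in> Hmu \<mu>" unfolding \<psi>_def by (rule Hmu_lincomb[OF \<phi> u])
    have red: "reduced \<mu> \<psi> x = reduced \<mu> \<phi> x - \<eta> x" if "x \<in> orthant" for x
      unfolding \<psi>_def reduced_lincomb reduced_unreduced[OF that] by simp
    have T: "(1 + (norm x)\<^sup>2) ^ m * cmod (T_list l (reduced \<mu> \<psi>) x) \<le> e"
      if "m \<le> mm" "\<And>i. count (mset l) i \<le> K" "x \<in> orthant" for m l x
    proof -
      have eq: "T_list l (reduced \<mu> \<psi>) x = T_list l (\<lambda>x. reduced \<mu> \<phi> x - \<eta> x) x"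
        by (rule T_list_cong[OF red that(3)])
      have "(1 + (norm x)\<^sup>2) ^ m * cmod (T_list l (reduced \<mu> \<psi>) x) \<le> pw mm x * cmod (T_list l (\<lambda>x. reduced \<mu> \<phi> x - \<eta> x) x)"
        unfolding eq
        by (rule mult_right_mono[OF order_trans[OF norm_le_pw pw_mono[OF that(1)]]]) simp
      also have "\<dots> \<le> e" by (rule small[OF that(2,3)])
      finally show ?thesis .
    qed
    have 1: "cmod (f \<psi>) \<le> e / \<delta>"
    proof (rule Hmu_dual_scaled[OF lin F(2) _ \<psi> e])
      show "(1 + (norm x)\<^sup>2) ^ m * cmod (T_list (mi_list k) (reduced \<mu> \<psi>) x) \<le> e" if "(m, k) \<in> F" "x \<in> orthant" for m k x
        by (rule T[OF mm1[OF that(1)] _ that(2)]) (use K[OF that(1)] in \<open>simp add: count_mi_list\<close>)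
    qed (rule F(3))
    have 2: "cmod (G \<psi>) \<le> (\<Sum>\<beta>\<in>?A. cmod (D \<beta> / c \<beta>) * Cb \<beta>) * e"
    proof -
      have "cmod (G \<psi>) \<le> (\<Sum>\<beta>\<in>?A. cmod (D \<beta> / c \<beta>) * (Cb \<beta> * e))"
        unfolding G_def
      proof (rule sum_norm_le)
        fix \<beta> assume \<beta>: "\<beta> \<in> ?A"
        have "cmod (even_moment \<mu> \<beta> \<psi>) \<le> Cb \<beta> * e"
          by (rule b(2)[OF \<psi>]) (use T[OF mm2[OF \<beta>], of "[]"] in simp)
        then show "cmod (D \<beta> / c \<beta> * even_moment \<mu> \<beta> \<psi>) \<le> cmod (D \<beta> / c \<beta>) * (Cb \<beta> * e)"
          unfolding norm_mult by (rule mult_left_mono) simp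
      qed
      then show ?thesis by (simp add: sum_distrib_right mult.assoc)
    qed
    have "f \<phi> - G \<phi> = f \<psi> - G \<psi>"
      unfolding \<psi>_def Hmu_linear_lincomb[OF lin \<phi> u] Hmu_linear_lincomb[OF Glin \<phi> u] Gsynth[OF \<eta>] by simp
    then have "cmod (f \<phi> - G \<phi>) \<le> cmod (f \<psi>) + cmod (G \<psi>)" by (metis norm_triangle_ineq4)
    then show ?thesis using 1 2 by (simp add: C_def distrib_right)
  qed
  have fG: "f \<phi> = G \<phi>" if \<phi>: "\<phi> \<in> Hmu \<mu>" for \<phi>
  proof -
    have "cmod (f \<phi> - G \<phi>) \<le> 0 + e" if "0 < e" for e
      using close[OF \<phi>, of "e / C"] that C by simp
    then have "cmod (f \<phi> - G \<phi>) \<le> 0" by (rule field_le_epsilon)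
    then show ?thesis by simp
  qed
  define M where "M = CARD('n) * R"
  define q where "q \<beta> = (if \<beta> \<in> ?A then D \<beta> / c \<beta> else 0)" for \<beta>
  have sub: "?A \<subseteq> {\<beta>. mi_abs \<beta> \<le> M}"
  proof
    fix \<beta> assume "\<beta> \<in> ?A"
    then have "\<beta> i \<le> R" for i by (auto simp: PiE_iff less_imp_le)
    then have "(\<Sum>i\<in>UNIV. \<beta> i) \<le> (\<Sum>i\<in>(UNIV :: 'n set). R)" by (intro sum_mono)
    then show "\<beta> \<in> {\<beta>. mi_abs \<beta> \<le> M}" by (simp add: mi_abs_def M_def)
  qed
  have "f = regular_functional \<mu> (\<lambda>x. complex_of_real (vpowr x (\<chi> i. \<mu> $ i + 1/2)) * mpoly_eval M q (\<chi> i. complex_of_real ((x $ i)\<^sup>2)))"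
  proof
    fix \<phi>
    show "f \<phi> = regular_functional \<mu> (\<lambda>x. complex_of_real (vpowr x (\<chi> i. \<mu> $ i + 1/2)) * mpoly_eval M q (\<chi> i. complex_of_real ((x $ i)\<^sup>2))) \<phi>"
    proof (cases "\<phi> \<in> Hmu \<mu>")
      case True
      have "G \<phi> = (\<Sum>\<beta>\<in>?A. q \<beta> * even_moment \<mu> \<beta> \<phi>)" by (simp add: G_def q_def)
      also have "\<dots> = (\<Sum>\<beta> | mi_abs \<beta> \<le> M. q \<beta> * even_moment \<mu> \<beta> \<phi>)"
        by (rule sum.mono_neutral_left[OF finite_mi_abs_le sub]) (auto simp: q_def)
      finally show ?thesis using fG[OF True] regular_functional_eq[OF \<mu> True] by simp
    next
      case False
      then show ?thesis using f by (simp add: Hmu_dual_def regular_functional_def)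
    qed
  qed
  then show ?thesis by blast
qed

theorem theorem1p1:
  fixes \<mu> :: "(real, 'n::{finite,linorder}) vec"
    and N :: nat
    and a :: "'n multi_index \<Rightarrow> real"
    and f :: "'n functional"
  assumes "\<forall>i. - 1/2 \<le> \<mu> $ i"
    and "\<forall>x :: (real, 'n) vec. x \<noteq> 0 \<longrightarrow> mpoly_eval N a x \<noteq> 0"
    and "(\<forall>\<alpha>. mi_abs \<alpha> \<le> N \<longrightarrow> 0 \<le> a \<alpha>) \<or> (\<forall>\<alpha>. mi_abs \<alpha> \<le> N \<longrightarrow> a \<alpha> \<le> 0)"
    and "f \<in> Hmu_dual \<mu>"
    and "L_op \<mu> N a f = (\<lambda>\<phi>. 0)"
  shows "\<exists>(M :: nat) (q :: 'n multi_index \<Rightarrow> complex).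
           f = regular_functional \<mu> (\<lambda>x. complex_of_real (vpowr x (\<chi> i. \<mu> $ i + 1/2)) *
                 mpoly_eval M q (\<chi> i. complex_of_real ((x $ i)\<^sup>2)))"
  using assms(3)
proof
  assume "\<forall>\<alpha>. mi_abs \<alpha> \<le> N \<longrightarrow> 0 \<le> a \<alpha>"
  then show ?thesis by (intro annihilated_by_L_op[where N=N and a=a]) (use assms in auto)
next
  \<comment> \<open>Replacing \<open>a\<close> by \<open>- a\<close> reverses the sign of
    \<open>L\<close> and of the polynomial and preserves the remaining hypotheses.\<close>
  assume neg: "\<forall>\<alpha>. mi_abs \<alpha> \<le> N \<longrightarrow> a \<alpha> \<le> 0"
  have "mpoly_eval N (\<lambda>\<alpha>. - a \<alpha>) x = - mpoly_eval N a x" for x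
    by (simp add: mpoly_eval_def sum_negf)
  moreover have "L_op \<mu> N (\<lambda>\<alpha>. - a \<alpha>) f = (\<lambda>\<phi>. 0)"
  proof
    fix \<phi>
    have "L_op \<mu> N (\<lambda>\<alpha>. - a \<alpha>) f \<phi> = - L_op \<mu> N a f \<phi>" by (simp add: L_op_def sum_negf)
    then show "L_op \<mu> N (\<lambda>\<alpha>. - a \<alpha>) f \<phi> = 0" using assms(5) by simp
  qed
  ultimately show ?thesis
    using neg by (intro annihilated_by_L_op[where N=N and a="\<lambda>\<alpha>. - a \<alpha>"]) (use assms in auto)
qed

end
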